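(* Let $k$ be a field and let $H$ be a finite dimensional Hopf algebra over $k$. Any two lower composition series of $H$ are equivalent.
   Context: A Hopf subalgebra $K$ of a Hopf algebra $L$ is normal in $L$ if it is stable under both adjoint actions of $L$: $h_{(1)}a\mathcal S(h_{(2)})\in K$ and $\mathcal S(h_{(1)})ah_{(2)}\in K$ for all $a\in K$, $h\in L$; then, with $K^+=K\cap\ker\epsilon$, $L/LK^+$ is a quotient Hopf algebra of $L$. A lower subnormal series of $H$ is a series of Hopf subalgebras $k = H_{n} \subseteq H_{n-1}\subseteq \dots\subseteq H_1 \subseteq H_0 = H$ with $H_{i+1}$ normal in $H_i$ for all $i$. Its factors are the quotient Hopf algebras $H_i/H_iH_{i+1}^+$, $i = 0, \dots, n-1$. A lower composition series of $H$ is a strictly decreasing lower subnormal series such that $H_i$ is a maximal (proper) normal Hopf subalgebra of $H_{i-1}$ for all $i=1,\dots,n$, i.e. there is no normal Hopf subalgebra $L$ of $H_{i-1}$ with $H_i\subsetneq L\subsetneq H_{i-1}$. Two lower subnormal series $k = H_{n} \subseteq \dots\subseteq H_0 = H$ and $k = H'_{m} \subseteq\dots\subseteq H'_0 = H$ are equivalent if there exists a bijection $f: \{0, \dots, n-1\} \to \{0, \dots, m-1\}$ such that $H_{i}/H_{i}H_{i+1}^+ \cong H'_{f(i)}/H'_{f(i)}(H'_{f(i)+1})^+$ as Hopf algebras for all $i$. *)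

theory Defs
  imports
    "HOL-Algebra.Free_Abelian_Groups"
    "HOL-Algebra.Ideal_Product"
    "HOL-Algebra.Module"
    "HOL-Algebra.QuotRing"
    "HOL-Algebra.Subrings"
begin

section \<open>Tensor products of modules\<close>

text \<open>
  The tensor product of modules \<open>A\<close>, \<open>B\<close> over a commutative ring \<open>k\<close> is the quotient of the
  free abelian group on \<open>A \<times> B\<close> by the subgroup generated by the biadditivity relations and
  the relations \<open>(c a, b) = (a, c b)\<close> for scalars \<open>c\<close>.
\<close>

definition tensor_rels ::
  "('k, 'm) ring_scheme \<Rightarrow> ('k, 'a, 'p) module_scheme \<Rightarrow> ('k, 'b, 'q) module_scheme
    \<Rightarrow> (('a \<times> 'b) \<Rightarrow>\<^sub>0 int) set" where
  "tensor_rels k A B =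
     {frag_of (a \<oplus>\<^bsub>A\<^esub> a', b) - (frag_of (a, b) + frag_of (a', b)) | a a' b.
        a \<in> carrier A \<and> a' \<in> carrier A \<and> b \<in> carrier B} \<union>
     {frag_of (a, b \<oplus>\<^bsub>B\<^esub> b') - (frag_of (a, b) + frag_of (a, b')) | a b b'.
        a \<in> carrier A \<and> b \<in> carrier B \<and> b' \<in> carrier B} \<union>
     {frag_of (c \<odot>\<^bsub>A\<^esub> a, b) - frag_of (a, c \<odot>\<^bsub>B\<^esub> b) | c a b.
        c \<in> carrier k \<and> a \<in> carrier A \<and> b \<in> carrier B}"

definition tensor_null ::
  "('k, 'm) ring_scheme \<Rightarrow> ('k, 'a, 'p) module_scheme \<Rightarrow> ('k, 'b, 'q) module_scheme
    \<Rightarrow> (('a \<times> 'b) \<Rightarrow>\<^sub>0 int) set" where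
  "tensor_null k A B =
     generate (free_Abelian_group (carrier A \<times> carrier B)) (tensor_rels k A B)"

text \<open>The additive group of the tensor product, in the multiplicative notation of the library.\<close>

definition tensor_group ::
  "('k, 'm) ring_scheme \<Rightarrow> ('k, 'a, 'p) module_scheme \<Rightarrow> ('k, 'b, 'q) module_scheme
    \<Rightarrow> (('a \<times> 'b) \<Rightarrow>\<^sub>0 int) set monoid" where
  "tensor_group k A B =
     free_Abelian_group (carrier A \<times> carrier B) Mod tensor_null k A B"

definition pure_tensor ::
  "('k, 'm) ring_scheme \<Rightarrow> ('k, 'a, 'p) module_scheme \<Rightarrow> ('k, 'b, 'q) module_scheme
    \<Rightarrow> 'a \<Rightarrow> 'b \<Rightarrow> (('a \<times> 'b) \<Rightarrow>\<^sub>0 int) set" where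
  "pure_tensor k A B a b =
     tensor_null k A B #>\<^bsub>free_Abelian_group (carrier A \<times> carrier B)\<^esub> frag_of (a, b)"

text \<open>
  For a biadditive, \<open>k\<close>-balanced map \<open>\<beta>\<close> into an abelian group \<open>G\<close>, the map
  \<open>tensor_lift G \<beta>\<close> is the induced homomorphism on the tensor product: the homomorphism
  \<open>(a, b) \<mapsto> \<beta> a b\<close> from the free abelian group is constant on each coset, and its value there
  is taken.  Thus, if \<open>\<Delta>\<close> denotes a comultiplication, \<open>tensor_lift G \<beta> (\<Delta> h)\<close> is the Sweedler
  expression \<open>\<beta> h\<^sub>(\<^sub>1\<^sub>) h\<^sub>(\<^sub>2\<^sub>)\<close>.
\<close>

definition tensor_lift ::
  "('c, 'm) monoid_scheme \<Rightarrow> ('a \<Rightarrow> 'b \<Rightarrow> 'c) \<Rightarrow> (('a \<times> 'b) \<Rightarrow>\<^sub>0 int) set \<Rightarrow> 'c" where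
  "tensor_lift G \<beta> X =
     the_elem ((\<lambda>z. \<Otimes>\<^bsub>G\<^esub>p\<in>Poly_Mapping.keys z.
       \<beta> (fst p) (snd p) [^]\<^bsub>G\<^esub> Poly_Mapping.lookup z p) ` X)"

text \<open>\<open>f \<otimes> g\<close>, for linear maps \<open>f\<close>, \<open>g\<close> with codomains \<open>A\<close>, \<open>B\<close>.\<close>

definition tensor_map ::
  "('k, 'm) ring_scheme \<Rightarrow> ('k, 'a, 'p) module_scheme \<Rightarrow> ('k, 'b, 'q) module_scheme
    \<Rightarrow> ('c \<Rightarrow> 'a) \<Rightarrow> ('d \<Rightarrow> 'b) \<Rightarrow> (('c \<times> 'd) \<Rightarrow>\<^sub>0 int) set \<Rightarrow> (('a \<times> 'b) \<Rightarrow>\<^sub>0 int) set" where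
  "tensor_map k A B f g =
     tensor_lift (tensor_group k A B) (\<lambda>x y. pure_tensor k A B (f x) (g y))"

text \<open>
  The tensor product of two algebras, with
  \<open>(a \<otimes> b)(a' \<otimes> b') = aa' \<otimes> bb'\<close>.  The underlying module depends only on the modules \<open>A\<close>, \<open>B\<close>.
\<close>

definition tensor ::
  "('k, 'm) ring_scheme \<Rightarrow> ('k, 'a, 'p) module_scheme \<Rightarrow> ('k, 'b, 'q) module_scheme
    \<Rightarrow> ('k, (('a \<times> 'b) \<Rightarrow>\<^sub>0 int) set) module" where
  "tensor k A B =
     \<lparr>carrier = carrier (tensor_group k A B),
      mult = (\<lambda>X Y. tensor_lift (tensor_group k A B)
        (\<lambda>a b. tensor_lift (tensor_group k A B)
          (\<lambda>a' b'. pure_tensor k A B (a \<otimes>\<^bsub>A\<^esub> a') (b \<otimes>\<^bsub>B\<^esub> b')) Y) X),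
      one = pure_tensor k A B \<one>\<^bsub>A\<^esub> \<one>\<^bsub>B\<^esub>,
      zero = \<one>\<^bsub>tensor_group k A B\<^esub>,
      add = mult (tensor_group k A B),
      smult = (\<lambda>c. tensor_map k A B (\<lambda>a. c \<odot>\<^bsub>A\<^esub> a) (\<lambda>b. b))\<rparr>"

text \<open>The canonical isomorphism \<open>(A \<otimes> B) \<otimes> C \<rightarrow> A \<otimes> (B \<otimes> C)\<close>.\<close>

definition tensor_assoc ::
  "('k, 'm) ring_scheme \<Rightarrow> ('k, 'a, 'p) module_scheme \<Rightarrow> ('k, 'b, 'q) module_scheme
    \<Rightarrow> ('k, 'c, 'r) module_scheme
    \<Rightarrow> (((('a \<times> 'b) \<Rightarrow>\<^sub>0 int) set \<times> 'c) \<Rightarrow>\<^sub>0 int) set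
    \<Rightarrow> (('a \<times> (('b \<times> 'c) \<Rightarrow>\<^sub>0 int) set) \<Rightarrow>\<^sub>0 int) set" where
  "tensor_assoc k A B C =
     tensor_lift (tensor_group k A (tensor k B C))
       (\<lambda>X c. tensor_lift (tensor_group k A (tensor k B C))
         (\<lambda>a b. pure_tensor k A (tensor k B C) a (pure_tensor k B C b c)) X)"


section \<open>Hopf algebras\<close>

record ('k, 'a) hopf = "('k, 'a) module" +
  comult :: "'a \<Rightarrow> (('a \<times> 'a) \<Rightarrow>\<^sub>0 int) set"
  counit :: "'a \<Rightarrow> 'k"
  antipode :: "'a \<Rightarrow> 'a"

text \<open>
  The library locale \<open>algebra\<close> covers only commutative algebras, so it is not used here.
\<close>

locale hopf_algebra = module k H + R: field k + M: ring H
  for k :: "('k, 'm) ring_scheme" (structure) and H :: "('k, 'a) hopf" (structure) +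
  assumes smult_mult_left:
      "\<lbrakk>c \<in> carrier k; x \<in> carrier H; y \<in> carrier H\<rbrakk>
        \<Longrightarrow> (c \<odot>\<^bsub>H\<^esub> x) \<otimes>\<^bsub>H\<^esub> y = c \<odot>\<^bsub>H\<^esub> (x \<otimes>\<^bsub>H\<^esub> y)"
    and smult_mult_right:
      "\<lbrakk>c \<in> carrier k; x \<in> carrier H; y \<in> carrier H\<rbrakk>
        \<Longrightarrow> x \<otimes>\<^bsub>H\<^esub> (c \<odot>\<^bsub>H\<^esub> y) = c \<odot>\<^bsub>H\<^esub> (x \<otimes>\<^bsub>H\<^esub> y)"
    and comult_hom: "comult H \<in> ring_hom H (tensor k H H)"
    and comult_smult:
      "\<lbrakk>c \<in> carrier k; x \<in> carrier H\<rbrakk>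
        \<Longrightarrow> comult H (c \<odot>\<^bsub>H\<^esub> x) = c \<odot>\<^bsub>tensor k H H\<^esub> comult H x"
    and counit_hom: "counit H \<in> ring_hom H k"
    and counit_smult:
      "\<lbrakk>c \<in> carrier k; x \<in> carrier H\<rbrakk> \<Longrightarrow> counit H (c \<odot>\<^bsub>H\<^esub> x) = c \<otimes>\<^bsub>k\<^esub> counit H x"
    and coassoc:
      "x \<in> carrier H \<Longrightarrow>
        tensor_assoc k H H H
          (tensor_map k (tensor k H H) H (comult H) (\<lambda>y. y) (comult H x)) =
        tensor_map k H (tensor k H H) (\<lambda>y. y) (comult H) (comult H x)"
    and counit_left:
      "x \<in> carrier H \<Longrightarrow>
        tensor_lift (add_monoid H) (\<lambda>y z. counit H y \<odot>\<^bsub>H\<^esub> z) (comult H x) = x"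
    and counit_right:
      "x \<in> carrier H \<Longrightarrow>
        tensor_lift (add_monoid H) (\<lambda>y z. counit H z \<odot>\<^bsub>H\<^esub> y) (comult H x) = x"
    and antipode_closed: "x \<in> carrier H \<Longrightarrow> antipode H x \<in> carrier H"
    and antipode_add:
      "\<lbrakk>x \<in> carrier H; y \<in> carrier H\<rbrakk>
        \<Longrightarrow> antipode H (x \<oplus>\<^bsub>H\<^esub> y) = antipode H x \<oplus>\<^bsub>H\<^esub> antipode H y"
    and antipode_smult:
      "\<lbrakk>c \<in> carrier k; x \<in> carrier H\<rbrakk> \<Longrightarrow> antipode H (c \<odot>\<^bsub>H\<^esub> x) = c \<odot>\<^bsub>H\<^esub> antipode H x"
    and antipode_left:
      "x \<in> carrier H \<Longrightarrow>
        tensor_lift (add_monoid H) (\<lambda>y z. antipode H y \<otimes>\<^bsub>H\<^esub> z) (comult H x) =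
        counit H x \<odot>\<^bsub>H\<^esub> \<one>\<^bsub>H\<^esub>"
    and antipode_right:
      "x \<in> carrier H \<Longrightarrow>
        tensor_lift (add_monoid H) (\<lambda>y z. y \<otimes>\<^bsub>H\<^esub> antipode H z) (comult H x) =
        counit H x \<odot>\<^bsub>H\<^esub> \<one>\<^bsub>H\<^esub>"

definition finite_dimensional ::
  "('k, 'm) ring_scheme \<Rightarrow> ('k, 'a, 'p) module_scheme \<Rightarrow> bool" where
  "finite_dimensional k V \<longleftrightarrow>
     (\<exists>B. finite B \<and> B \<subseteq> carrier V \<and>
       (\<forall>x\<in>carrier V. \<exists>c \<in> B \<rightarrow> carrier k. x = (\<Oplus>\<^bsub>V\<^esub>b\<in>B. c b \<odot>\<^bsub>V\<^esub> b)))"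

definition hopf_iso ::
  "('k, 'm) ring_scheme \<Rightarrow> ('k, 'a) hopf \<Rightarrow> ('k, 'b) hopf \<Rightarrow> ('a \<Rightarrow> 'b) set" where
  "hopf_iso k A B =
     {\<phi>. \<phi> \<in> ring_hom A B \<and> bij_betw \<phi> (carrier A) (carrier B) \<and>
       (\<forall>c\<in>carrier k. \<forall>x\<in>carrier A. \<phi> (c \<odot>\<^bsub>A\<^esub> x) = c \<odot>\<^bsub>B\<^esub> \<phi> x) \<and>
       (\<forall>x\<in>carrier A. comult B (\<phi> x) = tensor_map k B B \<phi> \<phi> (comult A x)) \<and>
       (\<forall>x\<in>carrier A. counit B (\<phi> x) = counit A x) \<and>
       (\<forall>x\<in>carrier A. antipode B (\<phi> x) = \<phi> (antipode A x))}"

definition hopf_isomorphic ::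
  "('k, 'm) ring_scheme \<Rightarrow> ('k, 'a) hopf \<Rightarrow> ('k, 'b) hopf \<Rightarrow> bool" where
  "hopf_isomorphic k A B \<longleftrightarrow> hopf_iso k A B \<noteq> {}"


section \<open>Hopf subalgebras and quotients\<close>

text \<open>
  The condition \<open>\<Delta>(K) \<subseteq> K \<otimes> K\<close> refers to the subgroup of \<open>L \<otimes> L\<close> generated by the
  \<open>x \<otimes> y\<close> with \<open>x, y \<in> K\<close>, i.e. the image of \<open>K \<otimes> K\<close> in \<open>L \<otimes> L\<close>.
\<close>

definition hopf_subalgebra ::
  "('k, 'm) ring_scheme \<Rightarrow> ('k, 'a) hopf \<Rightarrow> 'a set \<Rightarrow> bool" where
  "hopf_subalgebra k L K \<longleftrightarrow>
     subring K L \<and> submodule K k L \<and>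
     (\<forall>x\<in>K. comult L x \<in>
       generate (tensor_group k L L) {pure_tensor k L L y z | y z. y \<in> K \<and> z \<in> K}) \<and>
     (\<forall>x\<in>K. antipode L x \<in> K)"

text \<open>
  A Hopf subalgebra \<open>K\<close> of \<open>L\<close> as a Hopf algebra in its own right.  As \<open>K \<otimes> K\<close> and \<open>L \<otimes> L\<close>
  consist of different cosets, the comultiplication is corestricted along the map
  \<open>K \<otimes> K \<rightarrow> L \<otimes> L\<close> induced by the inclusion, which is injective since \<open>k\<close> is a field.
\<close>

definition hopf_sub ::
  "('k, 'm) ring_scheme \<Rightarrow> ('k, 'a) hopf \<Rightarrow> 'a set \<Rightarrow> ('k, 'a) hopf" where
  "hopf_sub k L K =
     L\<lparr>carrier := K,
       comult := (\<lambda>x. THE X.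
         X \<in> carrier (tensor k (L\<lparr>carrier := K\<rparr>) (L\<lparr>carrier := K\<rparr>)) \<and>
         tensor_map k L L (\<lambda>y. y) (\<lambda>z. z) X = comult L x)\<rparr>"

definition normal_hopf_subalgebra ::
  "('k, 'm) ring_scheme \<Rightarrow> ('k, 'a) hopf \<Rightarrow> 'a set \<Rightarrow> bool" where
  "normal_hopf_subalgebra k L K \<longleftrightarrow>
     hopf_subalgebra k L K \<and>
     (\<forall>h\<in>carrier L. \<forall>a\<in>K.
       tensor_lift (add_monoid L) (\<lambda>x y. x \<otimes>\<^bsub>L\<^esub> a \<otimes>\<^bsub>L\<^esub> antipode L y) (comult L h) \<in> K \<and>
       tensor_lift (add_monoid L) (\<lambda>x y. antipode L x \<otimes>\<^bsub>L\<^esub> a \<otimes>\<^bsub>L\<^esub> y) (comult L h) \<in> K)"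

definition augmentation ::
  "('k, 'm) ring_scheme \<Rightarrow> ('k, 'a) hopf \<Rightarrow> 'a set \<Rightarrow> 'a set" where
  "augmentation k L K = {x \<in> K. counit L x = \<zero>\<^bsub>k\<^esub>}"

text \<open>
  The quotient Hopf algebra by a Hopf ideal \<open>I\<close>.  The operations of \<open>L\<close> descend to cosets,
  so each \<open>the_elem\<close> below is applied to a singleton.
\<close>

definition quotient_algebra :: "('k, 'a, 'p) module_scheme \<Rightarrow> 'a set \<Rightarrow> ('k, 'a set) module" where
  "quotient_algebra L I =
     \<lparr>carrier = carrier (L Quot I), mult = mult (L Quot I), one = \<one>\<^bsub>L Quot I\<^esub>,
      zero = \<zero>\<^bsub>L Quot I\<^esub>, add = add (L Quot I),
      smult = (\<lambda>c X. the_elem ((\<lambda>x. I +>\<^bsub>L\<^esub> (c \<odot>\<^bsub>L\<^esub> x)) ` X))\<rparr>"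

definition quotient_hopf ::
  "('k, 'm) ring_scheme \<Rightarrow> ('k, 'a) hopf \<Rightarrow> 'a set \<Rightarrow> ('k, 'a set) hopf" where
  "quotient_hopf k L I =
     module.extend (quotient_algebra L I)
       (hopf.fields
         (\<lambda>X. the_elem ((\<lambda>x.
            tensor_map k (quotient_algebra L I) (quotient_algebra L I)
              (\<lambda>y. I +>\<^bsub>L\<^esub> y) (\<lambda>z. I +>\<^bsub>L\<^esub> z) (comult L x)) ` X))
         (\<lambda>X. the_elem (counit L ` X))
         (\<lambda>X. the_elem ((\<lambda>x. I +>\<^bsub>L\<^esub> antipode L x) ` X)))"

text \<open>
  \<open>L / L K\<^sup>+\<close>; the library's \<open>\<cdot>\<close> denotes the set of finite sums of products.
\<close>

definition normal_quotient ::
  "('k, 'm) ring_scheme \<Rightarrow> ('k, 'a) hopf \<Rightarrow> 'a set \<Rightarrow> ('k, 'a set) hopf" where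
  "normal_quotient k L K = quotient_hopf k L (carrier L \<cdot>\<^bsub>L\<^esub> augmentation k L K)"

definition maximal_normal_hopf_subalgebra ::
  "('k, 'm) ring_scheme \<Rightarrow> ('k, 'a) hopf \<Rightarrow> 'a set \<Rightarrow> bool" where
  "maximal_normal_hopf_subalgebra k L K \<longleftrightarrow>
     normal_hopf_subalgebra k L K \<and> K \<subset> carrier L \<and>
     \<not> (\<exists>N. normal_hopf_subalgebra k L N \<and> K \<subset> N \<and> N \<subset> carrier L)"


section \<open>Lower subnormal series\<close>

text \<open>
  A series \<open>k = H\<^sub>n \<subseteq> \<dots> \<subseteq> H\<^sub>0 = H\<close> is given by its length \<open>n\<close> and a sequence of carriers, of
  which only the entries at indices \<open>0, \<dots>, n\<close> matter.
\<close>

definition lower_subnormal_series ::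
  "('k, 'm) ring_scheme \<Rightarrow> ('k, 'a) hopf \<Rightarrow> nat \<Rightarrow> (nat \<Rightarrow> 'a set) \<Rightarrow> bool" where
  "lower_subnormal_series k H n K \<longleftrightarrow>
     K 0 = carrier H \<and>
     K n = {c \<odot>\<^bsub>H\<^esub> \<one>\<^bsub>H\<^esub> | c. c \<in> carrier k} \<and>
     (\<forall>i\<le>n. hopf_subalgebra k H (K i)) \<and>
     (\<forall>i<n. K (Suc i) \<subseteq> K i \<and> normal_hopf_subalgebra k (hopf_sub k H (K i)) (K (Suc i)))"

definition lower_composition_series ::
  "('k, 'm) ring_scheme \<Rightarrow> ('k, 'a) hopf \<Rightarrow> nat \<Rightarrow> (nat \<Rightarrow> 'a set) \<Rightarrow> bool" where
  "lower_composition_series k H n K \<longleftrightarrow>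
     lower_subnormal_series k H n K \<and>
     (\<forall>i<n. K (Suc i) \<subset> K i \<and>
       maximal_normal_hopf_subalgebra k (hopf_sub k H (K i)) (K (Suc i)))"

definition series_factor ::
  "('k, 'm) ring_scheme \<Rightarrow> ('k, 'a) hopf \<Rightarrow> (nat \<Rightarrow> 'a set) \<Rightarrow> nat \<Rightarrow> ('k, 'a set) hopf" where
  "series_factor k H K i = normal_quotient k (hopf_sub k H (K i)) (K (Suc i))"

definition equivalent_series ::
  "('k, 'm) ring_scheme \<Rightarrow> ('k, 'a) hopf
    \<Rightarrow> nat \<Rightarrow> (nat \<Rightarrow> 'a set) \<Rightarrow> nat \<Rightarrow> (nat \<Rightarrow> 'a set) \<Rightarrow> bool" where
  "equivalent_series k H n K m K' \<longleftrightarrow>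
     (\<exists>f. bij_betw f {..<n} {..<m} \<and>
       (\<forall>i<n. hopf_isomorphic k (series_factor k H K i) (series_factor k H K' (f i))))"

end

theory Submission
  imports
    Defs
    "HOL-Combinatorics.Permutations"
begin

text \<open>
  As for groups, everything rests on the following: if \<open>A\<close> and \<open>B\<close> are distinct maximal normal
  Hopf subalgebras of \<open>D\<close>, then \<open>AB = D\<close>, the inclusion induces
  \<open>A / A (A \<inter> B)\<^sup>+ \<cong> D / D B\<^sup>+\<close>, and \<open>A \<inter> B\<close> is a maximal normal Hopf subalgebra of \<open>A\<close>.
  Injectivity and maximality replace a dimension count (the Nichols-Zoeller theorem) by two
  explicit maps, both given by trace formulas.  A Hopf subalgebra \<open>N\<close> is a direct summand of \<open>H\<close> as
  a right \<open>N\<close>-module, so the coinvariants of \<open>H \<rightarrow> H / N\<^sup>+H\<close> lie in \<open>N\<close>.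
  Dually, \<open>\<pi> : A \<rightarrow> D / D B\<^sup>+\<close> has a counital colinear section \<open>s\<close>.  For \<open>a \<in> A\<close> the element
  \<open>w a = s (\<pi> a\<^sub>1) S (a\<^sub>2)\<close> is coinvariant, hence in \<open>A \<inter> B\<close>, and \<open>s (\<pi> a) = w (a\<^sub>1) a\<^sub>2\<close> is
  congruent to \<open>a\<close> modulo \<open>(A \<inter> B)\<^sup>+A\<close>, so \<open>\<pi> a = 0\<close> forces \<open>a \<in> (A \<inter> B)\<^sup>+A\<close>.
\<close>

section \<open>Tensor products\<close>

text \<open>For groups both points are formal: the kernel of \<open>A -> D / B\<close> is
  \<open>A \<inter> B\<close>, and maximality follows from the modular law. Here the elements of
  \<open>AB\<close> are sums of products, so neither argument carries over. Averaging against an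
  integral of \<open>N\<close> would give a retraction only when the integral can be normalised,
  that is, for semisimple \<open>N\<close>. The trace formulas are normalised by themselves: the
  checks of \<open>p 1 = 1\<close> and of \<open>\<epsilon> (s y) = \<epsilon> y\<close> both come
  down to the trace of the rank-one map \<open>x \<mapsto> \<epsilon> x 1\<close>, which is
  \<open>\<epsilon> 1 = 1\<close> in every characteristic. Finite dimension provides these traces
  and the linear projections. The modular law is replaced as follows: a Hopf subalgebra
  \<open>N\<close> with \<open>A \<inter> B \<subseteq> N \<subseteq> A\<close> and
  \<open>NB = D\<close> satisfies \<open>A = N + N\<^sup>+ A\<close>, so that all of
  \<open>A\<close> is coinvariant for \<open>N\<close> and \<open>A = N\<close>. Congruences modulo
  \<open>D B\<^sup>+\<close> and coinvariance are tested throughout on linear and bilinear maps into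
  \<open>H\<close> that vanish on the ideal in question, which keeps every computation inside
  \<open>H\<close>.\<close>

definition frag_eval ::
  "('c, 'm) monoid_scheme \<Rightarrow> ('a \<Rightarrow> 'b \<Rightarrow> 'c) \<Rightarrow> (('a \<times> 'b) \<Rightarrow>\<^sub>0 int) \<Rightarrow> 'c" where
  "frag_eval G \<beta> z =
     (\<Otimes>\<^bsub>G\<^esub>p\<in>Poly_Mapping.keys z. \<beta> (fst p) (snd p) [^]\<^bsub>G\<^esub> Poly_Mapping.lookup z p)"

lemma tensor_lift_eq: "tensor_lift G \<beta> X = the_elem (frag_eval G \<beta> ` X)"
  by (simp add: tensor_lift_def frag_eval_def[abs_def])

context comm_group
begin

lemma frag_eval_superset:
  assumes "finite T" "Poly_Mapping.keys z \<subseteq> T" "\<And>a b. (a, b) \<in> T \<Longrightarrow> \<beta> a b \<in> carrier G"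
  shows "frag_eval G \<beta> z = (\<Otimes>p\<in>T. \<beta> (fst p) (snd p) [^] Poly_Mapping.lookup z p)"
  unfolding frag_eval_def
  by (rule finprod_mono_neutral_cong_left)
     (use assms in \<open>auto simp: in_keys_iff intro!: int_pow_closed\<close>)

lemma frag_eval_hom:
  assumes "\<And>a b. (a, b) \<in> S \<Longrightarrow> \<beta> a b \<in> carrier G"
  shows "frag_eval G \<beta> \<in> hom (free_Abelian_group S) G"
proof (rule homI)
  fix x assume "x \<in> carrier (free_Abelian_group S)"
  then show "frag_eval G \<beta> x \<in> carrier G"
    unfolding frag_eval_def by (auto intro!: finprod_closed int_pow_closed assms)
next
  fix x y assume "x \<in> carrier (free_Abelian_group S)" "y \<in> carrier (free_Abelian_group S)"
  then have xy: "Poly_Mapping.keys x \<subseteq> S" "Poly_Mapping.keys y \<subseteq> S" by auto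
  define T where "T = Poly_Mapping.keys x \<union> Poly_Mapping.keys y"
  have T: "finite T" "\<And>a b. (a, b) \<in> T \<Longrightarrow> \<beta> a b \<in> carrier G"
    using xy assms by (auto simp: T_def)
  have "frag_eval G \<beta> (x + y) =
      (\<Otimes>p\<in>T. \<beta> (fst p) (snd p) [^] Poly_Mapping.lookup (x + y) p)"
    by (rule frag_eval_superset) (use T keys_add[of x y] in \<open>auto simp: T_def\<close>)
  also have "\<dots> = (\<Otimes>p\<in>T. \<beta> (fst p) (snd p) [^] Poly_Mapping.lookup x p
                   \<otimes> \<beta> (fst p) (snd p) [^] Poly_Mapping.lookup y p)"
    by (rule finprod_cong') (use T in \<open>auto simp: Poly_Mapping.lookup_add int_pow_mult\<close>)
  also have "\<dots> = (\<Otimes>p\<in>T. \<beta> (fst p) (snd p) [^] Poly_Mapping.lookup x p)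
                 \<otimes> (\<Otimes>p\<in>T. \<beta> (fst p) (snd p) [^] Poly_Mapping.lookup y p)"
    by (rule finprod_multf) (use T in auto)
  also have "\<dots> = frag_eval G \<beta> x \<otimes> frag_eval G \<beta> y"
    by (subst (1 2) frag_eval_superset[of T]) (use T in \<open>auto simp: T_def\<close>)
  finally show "frag_eval G \<beta> (x \<otimes>\<^bsub>free_Abelian_group S\<^esub> y) = frag_eval G \<beta> x \<otimes> frag_eval G \<beta> y"
    by simp
qed

lemma frag_eval_frag_of:
  "\<beta> a b \<in> carrier G \<Longrightarrow> frag_eval G \<beta> (frag_of (a, b)) = \<beta> a b"
  by (subst frag_eval_superset[of "{(a, b)}"]) auto

end

text \<open>The universal property below rests on these closure conditions alone, so it applies to
  subspaces, tensor products and quotients that are given as bare records, before any module axiom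
  is known for them.\<close>

definition add_smult_closed :: "('k, 'm) ring_scheme \<Rightarrow> ('k, 'a, 'p) module_scheme \<Rightarrow> bool" where
  "add_smult_closed k A \<longleftrightarrow>
     (\<forall>x\<in>carrier A. \<forall>y\<in>carrier A. x \<oplus>\<^bsub>A\<^esub> y \<in> carrier A) \<and>
     (\<forall>c\<in>carrier k. \<forall>x\<in>carrier A. c \<odot>\<^bsub>A\<^esub> x \<in> carrier A)"

text \<open>The target carries only a group structure, so one notion covers maps into
  \<open>H\<close> and maps into another tensor product.\<close>

definition balanced ::
  "('c, 'n) monoid_scheme \<Rightarrow> ('k, 'm) ring_scheme \<Rightarrow> ('k, 'a, 'p) module_scheme
    \<Rightarrow> ('k, 'b, 'q) module_scheme \<Rightarrow> ('a \<Rightarrow> 'b \<Rightarrow> 'c) \<Rightarrow> bool" where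
  "balanced G k A B \<beta> \<longleftrightarrow>
     (\<forall>a\<in>carrier A. \<forall>b\<in>carrier B. \<beta> a b \<in> carrier G) \<and>
     (\<forall>a\<in>carrier A. \<forall>a'\<in>carrier A. \<forall>b\<in>carrier B. \<beta> (a \<oplus>\<^bsub>A\<^esub> a') b = \<beta> a b \<otimes>\<^bsub>G\<^esub> \<beta> a' b) \<and>
     (\<forall>a\<in>carrier A. \<forall>b\<in>carrier B. \<forall>b'\<in>carrier B. \<beta> a (b \<oplus>\<^bsub>B\<^esub> b') = \<beta> a b \<otimes>\<^bsub>G\<^esub> \<beta> a b') \<and>
     (\<forall>c\<in>carrier k. \<forall>a\<in>carrier A. \<forall>b\<in>carrier B. \<beta> (c \<odot>\<^bsub>A\<^esub> a) b = \<beta> a (c \<odot>\<^bsub>B\<^esub> b))"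

lemma balancedI:
  assumes "\<And>a b. a \<in> carrier A \<Longrightarrow> b \<in> carrier B \<Longrightarrow> \<beta> a b \<in> carrier G"
    "\<And>a a' b. a \<in> carrier A \<Longrightarrow> a' \<in> carrier A \<Longrightarrow> b \<in> carrier B \<Longrightarrow>
       \<beta> (a \<oplus>\<^bsub>A\<^esub> a') b = \<beta> a b \<otimes>\<^bsub>G\<^esub> \<beta> a' b"
    "\<And>a b b'. a \<in> carrier A \<Longrightarrow> b \<in> carrier B \<Longrightarrow> b' \<in> carrier B \<Longrightarrow>
       \<beta> a (b \<oplus>\<^bsub>B\<^esub> b') = \<beta> a b \<otimes>\<^bsub>G\<^esub> \<beta> a b'"
    "\<And>c a b. c \<in> carrier k \<Longrightarrow> a \<in> carrier A \<Longrightarrow> b \<in> carrier B \<Longrightarrow>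
       \<beta> (c \<odot>\<^bsub>A\<^esub> a) b = \<beta> a (c \<odot>\<^bsub>B\<^esub> b)"
  shows "balanced G k A B \<beta>"
  using assms by (simp add: balanced_def)

lemma balancedD:
  assumes "balanced G k A B \<beta>"
  shows "\<And>a b. a \<in> carrier A \<Longrightarrow> b \<in> carrier B \<Longrightarrow> \<beta> a b \<in> carrier G"
    "\<And>a a' b. a \<in> carrier A \<Longrightarrow> a' \<in> carrier A \<Longrightarrow> b \<in> carrier B \<Longrightarrow>
       \<beta> (a \<oplus>\<^bsub>A\<^esub> a') b = \<beta> a b \<otimes>\<^bsub>G\<^esub> \<beta> a' b"
    "\<And>a b b'. a \<in> carrier A \<Longrightarrow> b \<in> carrier B \<Longrightarrow> b' \<in> carrier B \<Longrightarrow>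
       \<beta> a (b \<oplus>\<^bsub>B\<^esub> b') = \<beta> a b \<otimes>\<^bsub>G\<^esub> \<beta> a b'"
    "\<And>c a b. c \<in> carrier k \<Longrightarrow> a \<in> carrier A \<Longrightarrow> b \<in> carrier B \<Longrightarrow>
       \<beta> (c \<odot>\<^bsub>A\<^esub> a) b = \<beta> a (c \<odot>\<^bsub>B\<^esub> b)"
  using assms by (simp_all add: balanced_def)

lemma frag_diff_closed:
  assumes "x \<in> carrier (free_Abelian_group S)" "y \<in> carrier (free_Abelian_group S)"
  shows "x - y \<in> carrier (free_Abelian_group S)"
  using assms keys_diff[of x y] by auto

lemma frag_add_closed:
  assumes "x \<in> carrier (free_Abelian_group S)" "y \<in> carrier (free_Abelian_group S)"
  shows "x + y \<in> carrier (free_Abelian_group S)"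
  using assms keys_add[of x y] by auto

lemma tensor_rels_subset:
  assumes "add_smult_closed k A" "add_smult_closed k B"
  shows "tensor_rels k A B \<subseteq> carrier (free_Abelian_group (carrier A \<times> carrier B))"
proof -
  show ?thesis
    using assms unfolding tensor_rels_def add_smult_closed_def
    by (auto simp: frag_diff_closed frag_add_closed simp del: carrier_free_Abelian_group_iff)
qed

lemma tensor_null_subgroup:
  assumes "add_smult_closed k A" "add_smult_closed k B"
  shows "subgroup (tensor_null k A B) (free_Abelian_group (carrier A \<times> carrier B))"
  unfolding tensor_null_def
  by (rule group.generate_is_subgroup) (use tensor_rels_subset[OF assms] in auto)

lemma comm_group_tensor_group:
  assumes "add_smult_closed k A" "add_smult_closed k B"
  shows "comm_group (tensor_group k A B)"
  unfolding tensor_group_def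
  by (rule comm_group.abelian_FactGroup[OF abelian_free_Abelian_group tensor_null_subgroup[OF assms]])

lemma tensor_proj_hom:
  assumes "add_smult_closed k A" "add_smult_closed k B"
  shows "(\<lambda>z. tensor_null k A B #>\<^bsub>free_Abelian_group (carrier A \<times> carrier B)\<^esub> z)
    \<in> hom (free_Abelian_group (carrier A \<times> carrier B)) (tensor_group k A B)"
  unfolding tensor_group_def
  by (rule normal.r_coset_hom_Mod)
     (rule comm_group.normal_iff_subgroup[OF abelian_free_Abelian_group, THEN iffD2,
       OF tensor_null_subgroup[OF assms]])

lemma pure_tensor_closed:
  assumes "a \<in> carrier A" "b \<in> carrier B"
  shows "pure_tensor k A B a b \<in> carrier (tensor_group k A B)"
  using assms unfolding pure_tensor_def tensor_group_def carrier_FactGroup by simp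

lemma tensor_eqI:
  assumes A: "add_smult_closed k A" and B: "add_smult_closed k B"
    and z: "z - z' \<in> tensor_rels k A B"
    and zz: "z \<in> carrier (free_Abelian_group (carrier A \<times> carrier B))"
      "z' \<in> carrier (free_Abelian_group (carrier A \<times> carrier B))"
  shows "tensor_null k A B #>\<^bsub>free_Abelian_group (carrier A \<times> carrier B)\<^esub> z =
    tensor_null k A B #>\<^bsub>free_Abelian_group (carrier A \<times> carrier B)\<^esub> z'"
proof -
  let ?F = "free_Abelian_group (carrier A \<times> carrier B)"
  have "z - z' \<in> tensor_null k A B"
    unfolding tensor_null_def using z by (rule generate.incl)
  then have "z \<in> tensor_null k A B #>\<^bsub>?F\<^esub> z'"
    unfolding r_coset_def by (auto intro!: bexI[of _ "z - z'"])
  then show ?thesis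
    using group.repr_independence[OF group_free_Abelian_group _ zz(2) tensor_null_subgroup[OF A B]]
    by simp
qed

lemma pure_tensor_balanced:
  assumes A: "add_smult_closed k A" and B: "add_smult_closed k B"
  shows "balanced (tensor_group k A B) k A B (pure_tensor k A B)"
proof (rule balancedI)
  let ?F = "free_Abelian_group (carrier A \<times> carrier B)"
  let ?N = "tensor_null k A B"
  have mult: "pure_tensor k A B a b \<otimes>\<^bsub>tensor_group k A B\<^esub> pure_tensor k A B a' b' =
      ?N #>\<^bsub>?F\<^esub> (frag_of (a, b) + frag_of (a', b'))"
    if "a \<in> carrier A" "b \<in> carrier B" "a' \<in> carrier A" "b' \<in> carrier B" for a b a' b'
    using hom_mult[OF tensor_proj_hom[OF A B], of "frag_of (a, b)" "frag_of (a', b')"] that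
    unfolding pure_tensor_def by simp
  have ad: "frag_of p + frag_of q \<in> carrier ?F" if "p \<in> carrier A \<times> carrier B" "q \<in> carrier A \<times> carrier B" for p q
    using that keys_add[of "frag_of p" "frag_of q"] by auto
  note cl = A[unfolded add_smult_closed_def] B[unfolded add_smult_closed_def]
  { fix a a' b assume h: "a \<in> carrier A" "a' \<in> carrier A" "b \<in> carrier B"
    show "pure_tensor k A B (a \<oplus>\<^bsub>A\<^esub> a') b =
      pure_tensor k A B a b \<otimes>\<^bsub>tensor_group k A B\<^esub> pure_tensor k A B a' b"
      unfolding mult[OF h(1,3,2,3)] unfolding pure_tensor_def
      by (rule tensor_eqI[OF A B]) (use h cl ad in \<open>auto simp: tensor_rels_def simp del: carrier_free_Abelian_group_iff\<close>) }
  { fix a b b' assume h: "a \<in> carrier A" "b \<in> carrier B" "b' \<in> carrier B"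
    show "pure_tensor k A B a (b \<oplus>\<^bsub>B\<^esub> b') =
      pure_tensor k A B a b \<otimes>\<^bsub>tensor_group k A B\<^esub> pure_tensor k A B a b'"
      unfolding mult[OF h(1,2,1,3)] unfolding pure_tensor_def
      by (rule tensor_eqI[OF A B]) (use h cl ad in \<open>auto simp: tensor_rels_def simp del: carrier_free_Abelian_group_iff\<close>) }
  { fix c a b assume h: "c \<in> carrier k" "a \<in> carrier A" "b \<in> carrier B"
    show "pure_tensor k A B (c \<odot>\<^bsub>A\<^esub> a) b = pure_tensor k A B a (c \<odot>\<^bsub>B\<^esub> b)"
      unfolding pure_tensor_def
      by (rule tensor_eqI[OF A B]) (use h cl ad in \<open>auto simp: tensor_rels_def simp del: carrier_free_Abelian_group_iff\<close>) }
qed (rule pure_tensor_closed)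

context comm_group
begin

lemma frag_eval_null:
  assumes A: "add_smult_closed k A" and B: "add_smult_closed k B"
    and \<beta>: "balanced G k A B \<beta>"
    and z: "z \<in> tensor_null k A B"
  shows "frag_eval G \<beta> z = \<one>"
proof -
  let ?F = "free_Abelian_group (carrier A \<times> carrier B)"
  note cl = A[unfolded add_smult_closed_def] B[unfolded add_smult_closed_def]
  have \<beta>c: "\<beta> a b \<in> carrier G" if "a \<in> carrier A" "b \<in> carrier B" for a b
    using balancedD(1)[OF \<beta>] that .
  have hom: "frag_eval G \<beta> \<in> hom ?F G"
    by (rule frag_eval_hom) (use \<beta>c in auto)
  then interpret h: group_hom ?F G "frag_eval G \<beta>"
    by (auto simp: group_hom_def group_hom_axioms_def)
  have diff: "frag_eval G \<beta> (x - y) = frag_eval G \<beta> x \<otimes> inv (frag_eval G \<beta> y)"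
    if "x \<in> carrier ?F" "y \<in> carrier ?F" for x y
    using h.hom_mult[of x "- y"] h.hom_inv[of y] that by simp
  have add: "frag_eval G \<beta> (x + y) = frag_eval G \<beta> x \<otimes> frag_eval G \<beta> y"
    if "x \<in> carrier ?F" "y \<in> carrier ?F" for x y
    using h.hom_mult[of x y] that by simp
  have ad: "frag_of p + frag_of q \<in> carrier ?F"
    if "p \<in> carrier A \<times> carrier B" "q \<in> carrier A \<times> carrier B" for p q
    using that keys_add[of "frag_of p" "frag_of q"] by auto
  have "tensor_rels k A B \<subseteq> kernel ?F G (frag_eval G \<beta>)"
  proof
    fix z assume z: "z \<in> tensor_rels k A B"
    have "frag_eval G \<beta> z = \<one>"
      using z cl unfolding tensor_rels_def
      by (auto simp: diff add ad frag_eval_frag_of \<beta>c balancedD(2,3,4)[OF \<beta>]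
          simp del: carrier_free_Abelian_group_iff)
    then show "z \<in> kernel ?F G (frag_eval G \<beta>)"
      using z tensor_rels_subset[OF A B] unfolding kernel_def by blast
  qed
  then have "tensor_null k A B \<subseteq> kernel ?F G (frag_eval G \<beta>)"
    unfolding tensor_null_def
    by (rule h.generate_subgroup_incl[OF _ h.subgroup_kernel])
  then show ?thesis using z by (auto simp: kernel_def)
qed

text \<open>The evaluation homomorphism kills the defining relations and hence the subgroup they
  generate. It is therefore constant on each coset, and \<open>the_elem\<close> is applied to a
  singleton.\<close>

lemma tensor_lift_coset:
  assumes A: "add_smult_closed k A" and B: "add_smult_closed k B"
    and \<beta>: "balanced G k A B \<beta>"
    and z: "z \<in> carrier (free_Abelian_group (carrier A \<times> carrier B))"
  shows "tensor_lift G \<beta> (tensor_null k A B #>\<^bsub>free_Abelian_group (carrier A \<times> carrier B)\<^esub> z)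
    = frag_eval G \<beta> z"
proof -
  let ?F = "free_Abelian_group (carrier A \<times> carrier B)"
  have hom: "frag_eval G \<beta> \<in> hom ?F G"
    by (rule frag_eval_hom) (use balancedD(1)[OF \<beta>] in auto)
  have sub: "tensor_null k A B \<subseteq> carrier ?F"
    using tensor_null_subgroup[OF A B] by (rule subgroup.subset)
  have ne: "tensor_null k A B \<noteq> {}"
    using subgroup.one_closed[OF tensor_null_subgroup[OF A B]] by auto
  have "frag_eval G \<beta> x = frag_eval G \<beta> z"
    if x: "x \<in> tensor_null k A B #>\<^bsub>?F\<^esub> z" for x
  proof -
    from x obtain n where n: "n \<in> tensor_null k A B" "x = n \<otimes>\<^bsub>?F\<^esub> z"
      by (auto simp: r_coset_def)
    then show ?thesis
      using hom_mult[OF hom, of n z] sub z frag_eval_null[OF A B \<beta> n(1)] hom_in_carrier[OF hom z]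
      by auto
  qed
  moreover have "tensor_null k A B #>\<^bsub>?F\<^esub> z \<noteq> {}"
    using ne by (auto simp: r_coset_def)
  ultimately have "frag_eval G \<beta> ` (tensor_null k A B #>\<^bsub>?F\<^esub> z) = {frag_eval G \<beta> z}"
    by auto
  then show ?thesis by (simp add: tensor_lift_eq)
qed

lemma tensor_lift_hom:
  assumes A: "add_smult_closed k A" and B: "add_smult_closed k B"
    and \<beta>: "balanced G k A B \<beta>"
  shows "tensor_lift G \<beta> \<in> hom (tensor_group k A B) G"
proof (rule homI)
  let ?F = "free_Abelian_group (carrier A \<times> carrier B)"
  let ?c = "\<lambda>z. tensor_null k A B #>\<^bsub>?F\<^esub> z"
  have hom: "frag_eval G \<beta> \<in> hom ?F G"
    by (rule frag_eval_hom) (use balancedD(1)[OF \<beta>] in auto)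
  note lc = tensor_lift_coset[OF A B \<beta>]
  have rep: "\<exists>z\<in>carrier ?F. X = ?c z" if "X \<in> carrier (tensor_group k A B)" for X
    using that unfolding tensor_group_def carrier_FactGroup by auto
  { fix X assume "X \<in> carrier (tensor_group k A B)"
    then show "tensor_lift G \<beta> X \<in> carrier G"
      using rep lc hom_in_carrier[OF hom] by metis }
  { fix X Y assume "X \<in> carrier (tensor_group k A B)" "Y \<in> carrier (tensor_group k A B)"
    then obtain x y where x: "x \<in> carrier ?F" "X = ?c x" and y: "y \<in> carrier ?F" "Y = ?c y"
      using rep by metis
    have xy: "x \<otimes>\<^bsub>?F\<^esub> y \<in> carrier ?F"
      by (rule monoid.m_closed[OF group.is_monoid[OF group_free_Abelian_group] x(1) y(1)])
    have "X \<otimes>\<^bsub>tensor_group k A B\<^esub> Y = ?c (x \<otimes>\<^bsub>?F\<^esub> y)"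
      using hom_mult[OF tensor_proj_hom[OF A B] x(1) y(1)] x y by simp
    then show "tensor_lift G \<beta> (X \<otimes>\<^bsub>tensor_group k A B\<^esub> Y) = tensor_lift G \<beta> X \<otimes> tensor_lift G \<beta> Y"
      using lc[OF xy] lc[OF x(1)] lc[OF y(1)] x y hom_mult[OF hom x(1) y(1)] by simp }
qed

lemma tensor_lift_pure:
  assumes A: "add_smult_closed k A" and B: "add_smult_closed k B"
    and \<beta>: "balanced G k A B \<beta>" and ab: "a \<in> carrier A" "b \<in> carrier B"
  shows "tensor_lift G \<beta> (pure_tensor k A B a b) = \<beta> a b"
  unfolding pure_tensor_def
  by (subst tensor_lift_coset[OF A B \<beta>])
     (use ab balancedD(1)[OF \<beta>] in \<open>auto simp: frag_eval_frag_of\<close>)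

end

text \<open>Every tensor is the class of an element of the free abelian group, so induction there
  descends to classes. The last case is a difference because that is the inductive step for free
  abelian groups.\<close>

lemma tensor_group_induct [consumes 3, case_names one pure diff]:
  assumes A: "add_smult_closed k A" and B: "add_smult_closed k B"
    and X: "X \<in> carrier (tensor_group k A B)"
    and one: "P \<one>\<^bsub>tensor_group k A B\<^esub>"
    and pure: "\<And>a b. a \<in> carrier A \<Longrightarrow> b \<in> carrier B \<Longrightarrow> P (pure_tensor k A B a b)"
    and diff: "\<And>X Y. X \<in> carrier (tensor_group k A B) \<Longrightarrow> Y \<in> carrier (tensor_group k A B) \<Longrightarrow>
      P X \<Longrightarrow> P Y \<Longrightarrow> P (X \<otimes>\<^bsub>tensor_group k A B\<^esub> inv\<^bsub>tensor_group k A B\<^esub> Y)"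
  shows "P X"
proof -
  let ?S = "carrier A \<times> carrier B"
  let ?F = "free_Abelian_group ?S"
  let ?c = "\<lambda>z. tensor_null k A B #>\<^bsub>?F\<^esub> z"
  interpret T: comm_group "tensor_group k A B" by (rule comm_group_tensor_group[OF A B])
  interpret h: group_hom ?F "tensor_group k A B" ?c
    using tensor_proj_hom[OF A B] by (auto simp: group_hom_def group_hom_axioms_def)
  obtain z where z: "z \<in> carrier ?F" "X = ?c z"
    using X unfolding tensor_group_def carrier_FactGroup by auto
  have "P (?c z)"
  proof (rule free_Abelian_group_induct[of z ?S])
    show "Poly_Mapping.keys z \<subseteq> ?S" using z by simp
    show "P (?c 0)" using h.hom_one one by simp
    show "P (?c (frag_of p))" if "p \<in> ?S" for p
      using pure[of "fst p" "snd p"] that by (auto simp: pure_tensor_def)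
    show "P (?c (x - y))" if "Poly_Mapping.keys x \<subseteq> ?S" "Poly_Mapping.keys y \<subseteq> ?S" "P (?c x)" "P (?c y)" for x y
      using h.hom_mult[of x "- y"] h.hom_inv[of y] that diff[of "?c x" "?c y"]
        h.hom_closed[of x] h.hom_closed[of y] by simp
  qed
  then show ?thesis using z by simp
qed

lemma tensor_hom_eqI:
  assumes A: "add_smult_closed k A" and B: "add_smult_closed k B" and G: "group G"
    and f: "f \<in> hom (tensor_group k A B) G" and g: "g \<in> hom (tensor_group k A B) G"
    and eq: "\<And>a b. a \<in> carrier A \<Longrightarrow> b \<in> carrier B \<Longrightarrow> f (pure_tensor k A B a b) = g (pure_tensor k A B a b)"
    and X: "X \<in> carrier (tensor_group k A B)"
  shows "f X = g X"
proof -
  interpret T: comm_group "tensor_group k A B" by (rule comm_group_tensor_group[OF A B])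
  interpret f: group_hom "tensor_group k A B" G f
    using G f T.is_group by (simp add: group_hom_def group_hom_axioms_def)
  interpret g: group_hom "tensor_group k A B" G g
    using G g T.is_group by (simp add: group_hom_def group_hom_axioms_def)
  from A B X show ?thesis by (induction rule: tensor_group_induct) (auto simp: eq)
qed

section \<open>Functoriality of the tensor product\<close>

definition klinear ::
  "('k, 'm) ring_scheme \<Rightarrow> ('k, 'a, 'p) module_scheme \<Rightarrow> ('k, 'b, 'q) module_scheme
    \<Rightarrow> ('a \<Rightarrow> 'b) \<Rightarrow> bool" where
  "klinear k A B f \<longleftrightarrow>
     (\<forall>x\<in>carrier A. f x \<in> carrier B) \<and>
     (\<forall>x\<in>carrier A. \<forall>y\<in>carrier A. f (x \<oplus>\<^bsub>A\<^esub> y) = f x \<oplus>\<^bsub>B\<^esub> f y) \<and>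
     (\<forall>c\<in>carrier k. \<forall>x\<in>carrier A. f (c \<odot>\<^bsub>A\<^esub> x) = c \<odot>\<^bsub>B\<^esub> f x)"

lemma tensor_map_balanced:
  assumes "add_smult_closed k C" "add_smult_closed k D"
    and "klinear k A C f" "klinear k B D g"
  shows "balanced (tensor_group k C D) k A B (\<lambda>x y. pure_tensor k C D (f x) (g y))"
  using pure_tensor_balanced[OF assms(1,2)] assms(3,4)
  unfolding balanced_def klinear_def by (intro conjI ballI) simp_all

lemma
  assumes "add_smult_closed k A" "add_smult_closed k B"
    and "add_smult_closed k C" "add_smult_closed k D"
    and "klinear k A C f" "klinear k B D g"
  shows tensor_map_hom: "tensor_map k C D f g \<in> hom (tensor_group k A B) (tensor_group k C D)"
    and tensor_map_pure: "\<And>a b. a \<in> carrier A \<Longrightarrow> b \<in> carrier B \<Longrightarrow>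
      tensor_map k C D f g (pure_tensor k A B a b) = pure_tensor k C D (f a) (g b)"
  using comm_group.tensor_lift_hom[OF comm_group_tensor_group[OF assms(3,4)] assms(1,2)
      tensor_map_balanced[OF assms(3-6)]]
    comm_group.tensor_lift_pure[OF comm_group_tensor_group[OF assms(3,4)] assms(1,2)
      tensor_map_balanced[OF assms(3-6)]]
  unfolding tensor_map_def by auto

text \<open>The composites enter as \<open>h\<close> and \<open>h'\<close>, which agree with them on
  the carriers only. A retraction after an inclusion can thus be treated as the literal identity
  map.\<close>

lemma tensor_map_comp:
  assumes "add_smult_closed k A" "add_smult_closed k B"
    and "add_smult_closed k C" "add_smult_closed k D"
    and "add_smult_closed k E" "add_smult_closed k F"
    and "klinear k A C f" "klinear k B D g" "klinear k C E f'" "klinear k D F g'"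
    and h: "klinear k A E h" "klinear k B F h'"
      "\<And>x. x \<in> carrier A \<Longrightarrow> h x = f' (f x)" "\<And>x. x \<in> carrier B \<Longrightarrow> h' x = g' (g x)"
    and X: "X \<in> carrier (tensor_group k A B)"
  shows "tensor_map k E F f' g' (tensor_map k C D f g X) = tensor_map k E F h h' X"
proof -
  note fg = assms(7)[unfolded klinear_def] assms(8)[unfolded klinear_def]
  have "(tensor_map k E F f' g' \<circ> tensor_map k C D f g) X = tensor_map k E F h h' X"
  proof (rule tensor_hom_eqI[OF assms(1,2) _ _ _ _ X])
    show "group (tensor_group k E F)"
      using comm_group_tensor_group[OF assms(5,6)] by (simp add: comm_group_def)
    show "tensor_map k E F f' g' \<circ> tensor_map k C D f g \<in> hom (tensor_group k A B) (tensor_group k E F)"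
      by (rule hom_compose tensor_map_hom assms)+
    show "tensor_map k E F h h' \<in> hom (tensor_group k A B) (tensor_group k E F)"
      by (rule tensor_map_hom assms)+
    show "(tensor_map k E F f' g' \<circ> tensor_map k C D f g) (pure_tensor k A B a b) =
        tensor_map k E F h h' (pure_tensor k A B a b)"
      if "a \<in> carrier A" "b \<in> carrier B" for a b
      using that tensor_map_pure[OF assms(1-4,7,8)] tensor_map_pure[OF assms(3-6,9,10)]
        tensor_map_pure[OF assms(1,2,5,6) h(1,2)] fg h(3,4) by simp
  qed
  then show ?thesis by simp
qed

lemma tensor_map_id:
  assumes A: "add_smult_closed k A" and B: "add_smult_closed k B"
    and X: "X \<in> carrier (tensor_group k A B)"
    and f: "\<And>x. x \<in> carrier A \<Longrightarrow> f x = x" "\<And>x. x \<in> carrier B \<Longrightarrow> g x = x"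
  shows "tensor_map k A B f g X = X"
proof -
  have kl: "klinear k A A f" "klinear k B B g"
    using A B f by (auto simp: klinear_def add_smult_closed_def)
  show ?thesis
    by (rule tensor_hom_eqI[OF A B _ tensor_map_hom[OF A B A B kl] _ _ X, of "\<lambda>X. X"])
       (use comm_group_tensor_group[OF A B] tensor_map_pure[OF A B A B kl] f
         in \<open>auto simp: comm_group_def hom_def\<close>)
qed

text \<open>A product along a list rather than over a set, because the same pure tensor may occur
  several times in a sum.\<close>

definition lprod :: "('c, 'm) monoid_scheme \<Rightarrow> ('b \<Rightarrow> 'c) \<Rightarrow> 'b list \<Rightarrow> 'c" where
  "lprod G F zs = foldr (\<lambda>z s. F z \<otimes>\<^bsub>G\<^esub> s) zs \<one>\<^bsub>G\<^esub>"

lemma lprod_simps [simp]: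
  "lprod G F [] = \<one>\<^bsub>G\<^esub>" "lprod G F (z # zs) = F z \<otimes>\<^bsub>G\<^esub> lprod G F zs"
  by (simp_all add: lprod_def)

lemma (in monoid) lprod_closed:
  "(\<And>z. z \<in> set zs \<Longrightarrow> F z \<in> carrier G) \<Longrightarrow> lprod G F zs \<in> carrier G"
  by (induction zs) auto

lemma lprod_cong:
  "(\<And>z. z \<in> set zs \<Longrightarrow> F z = F' z) \<Longrightarrow> lprod G F zs = lprod G F' zs"
  by (induction zs) auto

lemma (in monoid) lprod_append:
  "(\<And>z. z \<in> set zs \<union> set ws \<Longrightarrow> F z \<in> carrier G) \<Longrightarrow>
    lprod G F (zs @ ws) = lprod G F zs \<otimes> lprod G F ws"
  by (induction zs) (auto simp: m_assoc lprod_closed)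

lemma (in comm_monoid) lprod_mult:
  "(\<And>z. z \<in> set zs \<Longrightarrow> F z \<in> carrier G) \<Longrightarrow> (\<And>z. z \<in> set zs \<Longrightarrow> F' z \<in> carrier G) \<Longrightarrow>
    lprod G (\<lambda>z. F z \<otimes> F' z) zs = lprod G F zs \<otimes> lprod G F' zs"
  by (induction zs) (auto simp: m_ac lprod_closed)

lemma (in group_hom) hom_lprod:
  "(\<And>z. z \<in> set zs \<Longrightarrow> F z \<in> carrier G) \<Longrightarrow> h (lprod G F zs) = lprod H (\<lambda>z. h (F z)) zs"
  by (induction zs) (auto simp: G.lprod_closed)

lemma lprod_map: "lprod G F (map f zs) = lprod G (\<lambda>z. F (f z)) zs"
  by (induction zs) auto

text \<open>Additivity makes a pure tensor with first entry zero idempotent, hence trivial; an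
  inverse can then be absorbed into the first entry. This is what turns elements of a generated
  subgroup into plain sums.\<close>

lemma inv_pure_tensor:
  assumes A: "add_smult_closed k A" and B: "add_smult_closed k B" and ab: "abelian_group A"
    and x: "x \<in> carrier A" "y \<in> carrier B"
  shows "inv\<^bsub>tensor_group k A B\<^esub> pure_tensor k A B x y = pure_tensor k A B (\<ominus>\<^bsub>A\<^esub> x) y"
proof -
  interpret A: abelian_group A by (rule ab)
  interpret T: comm_group "tensor_group k A B" by (rule comm_group_tensor_group[OF A B])
  note add = balancedD(2)[OF pure_tensor_balanced[OF A B]]
  have "pure_tensor k A B \<zero>\<^bsub>A\<^esub> y \<otimes>\<^bsub>tensor_group k A B\<^esub> pure_tensor k A B \<zero>\<^bsub>A\<^esub> y = pure_tensor k A B \<zero>\<^bsub>A\<^esub> y"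
    using add[of "\<zero>\<^bsub>A\<^esub>" "\<zero>\<^bsub>A\<^esub>" y] x by simp
  then have zero: "pure_tensor k A B \<zero>\<^bsub>A\<^esub> y = \<one>\<^bsub>tensor_group k A B\<^esub>"
    using T.r_cancel_one[of "pure_tensor k A B \<zero>\<^bsub>A\<^esub> y" "pure_tensor k A B \<zero>\<^bsub>A\<^esub> y"]
      pure_tensor_closed[of "\<zero>\<^bsub>A\<^esub>" A y B k] x by simp
  have "pure_tensor k A B (\<ominus>\<^bsub>A\<^esub> x) y \<otimes>\<^bsub>tensor_group k A B\<^esub> pure_tensor k A B x y = \<one>\<^bsub>tensor_group k A B\<^esub>"
    using add[of "\<ominus>\<^bsub>A\<^esub> x" x y] x zero by (simp add: A.l_neg)
  then show ?thesis
    using x by (intro T.inv_equality) (auto simp: pure_tensor_closed)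
qed

text \<open>Group generation also allows inverses of generators. Since \<open>K\<close> is closed
  under negation, these are again pure tensors with entries in \<open>K\<close> and
  \<open>K'\<close>, so concatenation of lists suffices.\<close>

lemma tensor_generate_rep:
  assumes A: "add_smult_closed k A" and B: "add_smult_closed k B" and ab: "abelian_group A"
    and K: "K \<subseteq> carrier A" "K' \<subseteq> carrier B" "\<And>x. x \<in> K \<Longrightarrow> \<ominus>\<^bsub>A\<^esub> x \<in> K"
    and X: "X \<in> generate (tensor_group k A B) {pure_tensor k A B y z | y z. y \<in> K \<and> z \<in> K'}"
  shows "\<exists>zs. set zs \<subseteq> K \<times> K' \<and>
    X = lprod (tensor_group k A B) (\<lambda>(x, y). pure_tensor k A B x y) zs"
proof -
  interpret T: comm_group "tensor_group k A B" by (rule comm_group_tensor_group[OF A B])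
  let ?P = "\<lambda>(x, y). pure_tensor k A B x y"
  have cl: "?P z \<in> carrier (tensor_group k A B)" if "z \<in> K \<times> K'" for z
    using that K by (auto intro!: pure_tensor_closed)
  show ?thesis using X
  proof (induction rule: generate.induct)
    case one
    then show ?case by (intro exI[of _ "[]"]) auto
  next
    case (incl h)
    then obtain y z where yz: "h = pure_tensor k A B y z" "y \<in> K" "z \<in> K'" by auto
    have "h = lprod (tensor_group k A B) ?P [(y, z)]" using cl[of "(y, z)"] yz by simp
    then show ?case using yz by (intro exI[of _ "[(y, z)]"]) auto
  next
    case (inv h)
    then obtain y z where yz: "h = pure_tensor k A B y z" "y \<in> K" "z \<in> K'" by auto
    have "inv\<^bsub>tensor_group k A B\<^esub> h = pure_tensor k A B (\<ominus>\<^bsub>A\<^esub> y) z"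
      using inv_pure_tensor[OF A B ab] yz K by auto
    then show ?case using cl[of "(\<ominus>\<^bsub>A\<^esub> y, z)"] yz K(3)
      by (intro exI[of _ "[(\<ominus>\<^bsub>A\<^esub> y, z)]"]) auto
  next
    case (eng h1 h2)
    then obtain zs ws where "set zs \<subseteq> K \<times> K'" "h1 = lprod (tensor_group k A B) ?P zs"
      "set ws \<subseteq> K \<times> K'" "h2 = lprod (tensor_group k A B) ?P ws" by auto
    then show ?case using T.lprod_append[of zs ws ?P] cl
      by (intro exI[of _ "zs @ ws"]) auto
  qed
qed

lemma tensor_carrier_generate:
  assumes A: "add_smult_closed k A" and B: "add_smult_closed k B"
    and X: "X \<in> carrier (tensor_group k A B)"
  shows "X \<in> generate (tensor_group k A B) {pure_tensor k A B y z | y z. y \<in> carrier A \<and> z \<in> carrier B}"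
    (is "_ \<in> generate ?T ?S")
proof -
  interpret T: comm_group ?T by (rule comm_group_tensor_group[OF A B])
  have S: "?S \<subseteq> carrier ?T" by (auto intro: pure_tensor_closed)
  from A B X show ?thesis
  proof (induction rule: tensor_group_induct)
    case one then show ?case by (rule generate.one)
  next
    case (pure a b) then show ?case by (intro generate.incl) auto
  next
    case (diff X Y)
    then show ?case by (intro generate.eng T.generate_m_inv_closed[OF S]) auto
  qed
qed

lemma tensor_list_rep:
  assumes "add_smult_closed k A" "add_smult_closed k B" "abelian_group A"
    and "X \<in> carrier (tensor_group k A B)"
  shows "\<exists>zs. set zs \<subseteq> carrier A \<times> carrier B \<and>
    X = lprod (tensor_group k A B) (\<lambda>(x, y). pure_tensor k A B x y) zs"
  using tensor_generate_rep[OF assms(1-3) order_refl order_refl _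
      tensor_carrier_generate[OF assms(1,2,4)]] abelian_group.a_inv_closed[OF assms(3)] by blast

lemma (in comm_group) tensor_lift_lprod:
  assumes A: "add_smult_closed k A" and B: "add_smult_closed k B"
    and \<beta>: "balanced G k A B \<beta>" and zs: "set zs \<subseteq> carrier A \<times> carrier B"
  shows "tensor_lift G \<beta> (lprod (tensor_group k A B) (\<lambda>(x, y). pure_tensor k A B x y) zs) =
    lprod G (\<lambda>(x, y). \<beta> x y) zs"
proof -
  interpret T: comm_group "tensor_group k A B" by (rule comm_group_tensor_group[OF A B])
  interpret h: group_hom "tensor_group k A B" G "tensor_lift G \<beta>"
    using tensor_lift_hom[OF A B \<beta>] by (simp add: group_hom_def group_hom_axioms_def)
  show ?thesis
    by (subst h.hom_lprod)
       (use zs in \<open>auto intro!: lprod_cong pure_tensor_closed simp: tensor_lift_pure[OF A B \<beta>]\<close>)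
qed

lemma (in comm_group) tensor_lift_map:
  assumes A: "add_smult_closed k A" "add_smult_closed k B"
    and C: "add_smult_closed k C" "add_smult_closed k D"
    and fg: "klinear k A C f" "klinear k B D g"
    and \<beta>: "balanced G k C D \<beta>" and X: "X \<in> carrier (tensor_group k A B)"
  shows "tensor_lift G \<beta> (tensor_map k C D f g X) = tensor_lift G (\<lambda>x y. \<beta> (f x) (g y)) X"
proof -
  have b: "balanced G k A B (\<lambda>x y. \<beta> (f x) (g y))"
    using \<beta> fg unfolding balanced_def klinear_def by (intro conjI ballI) simp_all
  have "(tensor_lift G \<beta> \<circ> tensor_map k C D f g) X = tensor_lift G (\<lambda>x y. \<beta> (f x) (g y)) X"
    by (rule tensor_hom_eqI[OF A is_group Group.hom_compose[OF tensor_map_hom[OF A C fg]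
          tensor_lift_hom[OF C \<beta>]] tensor_lift_hom[OF A b] _ X])
       (use fg in \<open>auto simp: tensor_map_pure[OF A C fg] tensor_lift_pure[OF C \<beta>] tensor_lift_pure[OF A b] klinear_def\<close>)
  then show ?thesis by simp
qed

lemma tensor_map_lprod:
  assumes A: "add_smult_closed k A" "add_smult_closed k B"
    and C: "add_smult_closed k C" "add_smult_closed k D"
    and fg: "klinear k A C f" "klinear k B D g"
    and zs: "set zs \<subseteq> carrier A \<times> carrier B"
  shows "tensor_map k C D f g (lprod (tensor_group k A B) (\<lambda>(x, y). pure_tensor k A B x y) zs) =
    lprod (tensor_group k C D) (\<lambda>(x, y). pure_tensor k C D (f x) (g y)) zs"
  unfolding tensor_map_def
  by (rule comm_group.tensor_lift_lprod[OF comm_group_tensor_group[OF C] A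
        tensor_map_balanced[OF C fg] zs])

lemma tensor_simps:
  "carrier (tensor k A B) = carrier (tensor_group k A B)"
  "add (tensor k A B) = monoid.mult (tensor_group k A B)"
  "smult (tensor k A B) c = tensor_map k A B (\<lambda>a. c \<odot>\<^bsub>A\<^esub> a) (\<lambda>b. b)"
  "\<one>\<^bsub>tensor k A B\<^esub> = pure_tensor k A B \<one>\<^bsub>A\<^esub> \<one>\<^bsub>B\<^esub>"
  "\<zero>\<^bsub>tensor k A B\<^esub> = \<one>\<^bsub>tensor_group k A B\<^esub>"
  by (simp_all add: tensor_def)

section \<open>Sweedler calculus\<close>

context hopf_algebra
begin

abbreviation hmult (infixl "\<star>" 70) where "x \<star> y \<equiv> x \<otimes>\<^bsub>H\<^esub> y"
abbreviation hadd (infixl "\<boxplus>" 65) where "x \<boxplus> y \<equiv> x \<oplus>\<^bsub>H\<^esub> y"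
abbreviation hsmult (infixr "\<bullet>" 75) where "c \<bullet> x \<equiv> c \<odot>\<^bsub>H\<^esub> x"
abbreviation hone ("\<e>") where "\<e> \<equiv> \<one>\<^bsub>H\<^esub>"
abbreviation antip ("\<S>") where "\<S> \<equiv> antipode H"
abbreviation cou ("\<epsilon>") where "\<epsilon> \<equiv> counit H"

lemma add_smult_closed_H: "add_smult_closed k H"
  by (simp add: add_smult_closed_def)

lemma abelian_group_H: "abelian_group H" by (rule M.abelian_group_axioms)

lemma add_smult_closed_HH: "add_smult_closed k (tensor k H H)"
proof -
  interpret T: comm_group "tensor_group k H H"
    by (rule comm_group_tensor_group[OF add_smult_closed_H add_smult_closed_H])
  have kl: "klinear k H H (\<lambda>a. c \<bullet> a)" if "c \<in> carrier k" for c
    using that by (auto simp: klinear_def smult_r_distr smult_assoc1[symmetric] R.m_comm)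
  have "klinear k H H (\<lambda>a. a)" by (auto simp: klinear_def)
  then show ?thesis
    using hom_in_carrier[OF tensor_map_hom[OF add_smult_closed_H add_smult_closed_H
          add_smult_closed_H add_smult_closed_H kl]]
    by (auto simp: add_smult_closed_def tensor_simps)
qed

lemma comm_group_H: "comm_group (add_monoid H)"
  by (rule M.a_comm_group)

text \<open>An arbitrary choice of pure tensors with sum \<open>\<Delta> h\<close>; only values of
  balanced maps on it are independent of the choice. The empty list outside the carrier lets every
  leg lie in \<open>H\<close> without a condition on \<open>h\<close>.\<close>

definition comult_list :: "'a \<Rightarrow> ('a \<times> 'a) list" where
  "comult_list h = (if h \<in> carrier H then
     SOME zs. set zs \<subseteq> carrier H \<times> carrier H \<and>
       comult H h = lprod (tensor_group k H H) (\<lambda>(x, y). pure_tensor k H H x y) zs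
     else [])"

lemma comult_closed: "h \<in> carrier H \<Longrightarrow> comult H h \<in> carrier (tensor_group k H H)"
  using ring_hom_closed[OF comult_hom] by (simp add: tensor_simps)

lemma
  assumes "h \<in> carrier H"
  shows comult_list_subset: "set (comult_list h) \<subseteq> carrier H \<times> carrier H"
    and comult_list_eq: "comult H h = lprod (tensor_group k H H) (\<lambda>(x, y). pure_tensor k H H x y) (comult_list h)"
  using someI_ex[OF tensor_list_rep[OF add_smult_closed_H add_smult_closed_H abelian_group_H
        comult_closed[OF assms]]] assms
  by (simp_all add: comult_list_def)

lemma comult_list_mem:
  "(x, y) \<in> set (comult_list h) \<Longrightarrow> x \<in> carrier H \<and> y \<in> carrier H"
  using comult_list_subset[of h] by (cases "h \<in> carrier H") (auto simp: comult_list_def)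

lemma tensor_lift_comult:
  assumes "comm_group G" "balanced G k H H \<beta>" "h \<in> carrier H"
  shows "tensor_lift G \<beta> (comult H h) = lprod G (\<lambda>(x, y). \<beta> x y) (comult_list h)"
  by (subst comult_list_eq[OF assms(3)])
     (rule comm_group.tensor_lift_lprod[OF assms(1) add_smult_closed_H add_smult_closed_H assms(2)
       comult_list_subset[OF assms(3)]])

text \<open>The product of two tensors is a lift of a lift. The inner lift has to be evaluated as a
  sum first, because that evaluation shows that the outer integrand is balanced.\<close>

lemma tensor_mult_lprod:
  assumes zs: "set zs \<subseteq> carrier H \<times> carrier H" and ws: "set ws \<subseteq> carrier H \<times> carrier H"
  defines "T \<equiv> tensor_group k H H" and "P \<equiv> pure_tensor k H H"
  shows "monoid.mult (tensor k H H) (lprod T (\<lambda>(x, y). P x y) zs) (lprod T (\<lambda>(x, y). P x y) ws) =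
    lprod T (\<lambda>(a, b). lprod T (\<lambda>(a', b'). P (a \<star> a') (b \<star> b')) ws) zs"
proof -
  note HH = add_smult_closed_H add_smult_closed_H
  interpret T: comm_group T unfolding T_def by (rule comm_group_tensor_group[OF HH])
  have P: "balanced T k H H P" unfolding T_def P_def by (rule pure_tensor_balanced[OF HH])
  have P1: "balanced T k H H (\<lambda>a' b'. P (a \<star> a') (b \<star> b'))" if "a \<in> carrier H" "b \<in> carrier H" for a b
    using P that unfolding balanced_def by (auto simp: M.r_distr smult_mult_right)
  let ?Y = "lprod T (\<lambda>(x, y). P x y) ws"
  have in1: "tensor_lift T (\<lambda>a' b'. P (a \<star> a') (b \<star> b')) ?Y =
      lprod T (\<lambda>(a', b'). P (a \<star> a') (b \<star> b')) ws" if "a \<in> carrier H" "b \<in> carrier H" for a b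
    using T.tensor_lift_lprod[OF HH P1[OF that] ws] unfolding T_def P_def .
  have cl: "P (a \<star> a') (b \<star> b') \<in> carrier T"
    if "a \<in> carrier H" "b \<in> carrier H" "(a', b') \<in> set ws" for a b a' b'
    using balancedD(1)[OF P1] that ws by auto
  have P2: "balanced T k H H (\<lambda>a b. tensor_lift T (\<lambda>a' b'. P (a \<star> a') (b \<star> b')) ?Y)"
  proof (rule balancedI)
    show "tensor_lift T (\<lambda>a' b'. P (a \<star> a') (b \<star> b')) ?Y \<in> carrier T"
      if "a \<in> carrier H" "b \<in> carrier H" for a b
      using that cl by (auto simp: in1 intro!: T.lprod_closed)
    show "tensor_lift T (\<lambda>a' b'. P ((a \<boxplus> a2) \<star> a') (b \<star> b')) ?Y =
       tensor_lift T (\<lambda>a' b'. P (a \<star> a') (b \<star> b')) ?Y \<otimes>\<^bsub>T\<^esub>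
       tensor_lift T (\<lambda>a' b'. P (a2 \<star> a') (b \<star> b')) ?Y"
      if "a \<in> carrier H" "a2 \<in> carrier H" "b \<in> carrier H" for a a2 b
      unfolding in1[OF that(1,3)] in1[OF that(2,3)] in1[OF M.a_closed[OF that(1,2)] that(3)]
      by (subst T.lprod_mult[symmetric])
         (use that cl ws in \<open>auto intro!: lprod_cong simp: M.l_distr balancedD(2)[OF P] subset_iff\<close>)
    show "tensor_lift T (\<lambda>a' b'. P (a \<star> a') ((b \<boxplus> b2) \<star> b')) ?Y =
       tensor_lift T (\<lambda>a' b'. P (a \<star> a') (b \<star> b')) ?Y \<otimes>\<^bsub>T\<^esub>
       tensor_lift T (\<lambda>a' b'. P (a \<star> a') (b2 \<star> b')) ?Y"
      if "a \<in> carrier H" "b \<in> carrier H" "b2 \<in> carrier H" for a b b2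
      unfolding in1[OF that(1,2)] in1[OF that(1,3)] in1[OF that(1) M.a_closed[OF that(2,3)]]
      by (subst T.lprod_mult[symmetric])
         (use that cl ws in \<open>auto intro!: lprod_cong simp: M.l_distr balancedD(3)[OF P] subset_iff\<close>)
    show "tensor_lift T (\<lambda>a' b'. P ((c \<bullet> a) \<star> a') (b \<star> b')) ?Y =
       tensor_lift T (\<lambda>a' b'. P (a \<star> a') ((c \<bullet> b) \<star> b')) ?Y"
      if "c \<in> carrier k" "a \<in> carrier H" "b \<in> carrier H" for a b c
      unfolding in1[OF smult_closed[OF that(1,2)] that(3)] in1[OF that(2) smult_closed[OF that(1,3)]]
      by (rule lprod_cong)
         (use that cl ws in \<open>auto simp: smult_mult_left balancedD(4)[OF P] subset_iff\<close>)
  qed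
  have "monoid.mult (tensor k H H) (lprod T (\<lambda>(x, y). P x y) zs) ?Y =
      tensor_lift T (\<lambda>a b. tensor_lift T (\<lambda>a' b'. P (a \<star> a') (b \<star> b')) ?Y) (lprod T (\<lambda>(x, y). P x y) zs)"
    by (simp add: tensor_def T_def P_def)
  also have "\<dots> = lprod T (\<lambda>(a, b). tensor_lift T (\<lambda>a' b'. P (a \<star> a') (b \<star> b')) ?Y) zs"
    using T.tensor_lift_lprod[OF HH P2 zs] unfolding T_def P_def .
  also have "\<dots> = lprod T (\<lambda>(a, b). lprod T (\<lambda>(a', b'). P (a \<star> a') (b \<star> b')) ws) zs"
    by (rule lprod_cong) (use zs in1 in auto)
  finally show ?thesis .
qed

lemma tensor_lift_comult_mult:
  assumes G: "comm_group G" and \<beta>: "balanced G k H H \<beta>"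
    and gh: "g \<in> carrier H" "h \<in> carrier H"
  shows "tensor_lift G \<beta> (comult H (g \<star> h)) =
    lprod G (\<lambda>(a, b). lprod G (\<lambda>(a', b'). \<beta> (a \<star> a') (b \<star> b')) (comult_list h)) (comult_list g)"
proof -
  note HH = add_smult_closed_H add_smult_closed_H
  interpret G: comm_group G by (rule G)
  interpret T: comm_group "tensor_group k H H" by (rule comm_group_tensor_group[OF HH])
  interpret f: group_hom "tensor_group k H H" G "tensor_lift G \<beta>"
    using G.tensor_lift_hom[OF HH \<beta>] by (simp add: group_hom_def group_hom_axioms_def)
  note sg = comult_list_mem[of _ _ g] and sh = comult_list_mem[of _ _ h]
  have cl: "pure_tensor k H H (a \<star> a') (b \<star> b') \<in> carrier (tensor_group k H H)"
    if "(a, b) \<in> set (comult_list g)" "(a', b') \<in> set (comult_list h)" for a b a' b'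
    using sg[OF that(1)] sh[OF that(2)] by (intro pure_tensor_closed) auto
  have "comult H (g \<star> h) = monoid.mult (tensor k H H) (comult H g) (comult H h)"
    by (rule ring_hom_mult[OF comult_hom gh])
  also have "\<dots> = lprod (tensor_group k H H) (\<lambda>(a, b). lprod (tensor_group k H H)
      (\<lambda>(a', b'). pure_tensor k H H (a \<star> a') (b \<star> b')) (comult_list h)) (comult_list g)"
    unfolding comult_list_eq[OF gh(1)] comult_list_eq[OF gh(2)]
    by (rule tensor_mult_lprod) (use comult_list_subset gh in auto)
  finally have "tensor_lift G \<beta> (comult H (g \<star> h)) = lprod G (\<lambda>z. tensor_lift G \<beta>
      (case z of (a, b) \<Rightarrow> lprod (tensor_group k H H)
      (\<lambda>(a', b'). pure_tensor k H H (a \<star> a') (b \<star> b')) (comult_list h))) (comult_list g)"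
    using cl by (simp only:) (subst f.hom_lprod, auto intro!: T.lprod_closed)
  also have "\<dots> = lprod G (\<lambda>(a, b). lprod G (\<lambda>(a', b'). \<beta> (a \<star> a') (b \<star> b')) (comult_list h)) (comult_list g)"
  proof (rule lprod_cong, clarify)
    fix a b assume ab: "(a, b) \<in> set (comult_list g)"
    have "tensor_lift G \<beta> (lprod (tensor_group k H H)
        (\<lambda>(a', b'). pure_tensor k H H (a \<star> a') (b \<star> b')) (comult_list h)) =
      lprod G (\<lambda>z. tensor_lift G \<beta> (case z of (a', b') \<Rightarrow> pure_tensor k H H (a \<star> a') (b \<star> b'))) (comult_list h)"
      using cl ab by (intro f.hom_lprod) auto
    also have "\<dots> = lprod G (\<lambda>(a', b'). \<beta> (a \<star> a') (b \<star> b')) (comult_list h)"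
      by (rule lprod_cong)
         (use sg[OF ab] sh in \<open>auto intro!: G.tensor_lift_pure[OF HH \<beta>]\<close>)
    finally show "tensor_lift G \<beta> (lprod (tensor_group k H H)
        (\<lambda>(a', b'). pure_tensor k H H (a \<star> a') (b \<star> b')) (comult_list h)) =
      lprod G (\<lambda>(a', b'). \<beta> (a \<star> a') (b \<star> b')) (comult_list h)" .
  qed
  finally show ?thesis .
qed

lemma klinear_comult: "klinear k H (tensor k H H) (comult H)"
  using comult_closed ring_hom_add[OF comult_hom] comult_smult
  by (auto simp: klinear_def tensor_simps)

lemma klinear_id: "klinear k H H (\<lambda>x. x)"
  by (auto simp: klinear_def)

lemma klinear_smult: "c \<in> carrier k \<Longrightarrow> klinear k H H (\<lambda>x. c \<bullet> x)"
  by (auto simp: klinear_def smult_r_distr smult_assoc1[symmetric] R.m_comm)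

end

lemma balanced_swap:
  assumes "comm_group G" "add_smult_closed k A" "add_smult_closed k B"
    and 1: "\<And>x. x \<in> carrier C \<Longrightarrow> balanced G k A B (\<gamma> x)"
    and 2: "\<And>y z x x'. y \<in> carrier A \<Longrightarrow> z \<in> carrier B \<Longrightarrow> x \<in> carrier C \<Longrightarrow> x' \<in> carrier C \<Longrightarrow>
      \<gamma> (x \<oplus>\<^bsub>C\<^esub> x') y z = \<gamma> x y z \<otimes>\<^bsub>G\<^esub> \<gamma> x' y z"
    and X: "X \<in> carrier (tensor_group k A B)"
    and x: "x \<in> carrier C" "x' \<in> carrier C" "x \<oplus>\<^bsub>C\<^esub> x' \<in> carrier C"
  shows "tensor_lift G (\<gamma> (x \<oplus>\<^bsub>C\<^esub> x')) X = tensor_lift G (\<gamma> x) X \<otimes>\<^bsub>G\<^esub> tensor_lift G (\<gamma> x') X"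
proof -
  interpret G: comm_group G by fact
  have hom: "(\<lambda>X. tensor_lift G (\<gamma> x) X \<otimes>\<^bsub>G\<^esub> tensor_lift G (\<gamma> x') X) \<in> hom (tensor_group k A B) G"
    using G.tensor_lift_hom[OF assms(2,3) 1[OF x(1)]] G.tensor_lift_hom[OF assms(2,3) 1[OF x(2)]]
    by (auto simp: hom_def G.m_ac Pi_def)
  show ?thesis
    by (rule tensor_hom_eqI[OF assms(2,3) G.is_group G.tensor_lift_hom[OF assms(2,3) 1[OF x(3)]] hom _ X])
       (simp add: G.tensor_lift_pure[OF assms(2,3) 1] x 2)
qed

lemma (in comm_group) tensor_lift_cong:
  assumes A: "add_smult_closed k A" "add_smult_closed k B"
    and \<beta>: "balanced G k A B \<beta>" "balanced G k A B \<beta>'"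
    and eq: "\<And>x y. x \<in> carrier A \<Longrightarrow> y \<in> carrier B \<Longrightarrow> \<beta> x y = \<beta>' x y"
    and X: "X \<in> carrier (tensor_group k A B)"
  shows "tensor_lift G \<beta> X = tensor_lift G \<beta>' X"
  by (rule tensor_hom_eqI[OF A is_group tensor_lift_hom[OF A \<beta>(1)] tensor_lift_hom[OF A \<beta>(2)] _ X])
     (simp add: tensor_lift_pure[OF A \<beta>(1)] tensor_lift_pure[OF A \<beta>(2)] eq)

text \<open>A trilinear map becomes balanced in two variables once two of its arguments are
  tensored. Both orders of the variables occur in the coassociativity law: one for
  \<open>H \<otimes> (H \<otimes> H)\<close>, the other for the domain of
  \<open>tensor_assoc\<close>.\<close>

lemma (in comm_group) tensor_lift_balanced:
  assumes A: "add_smult_closed k A" "add_smult_closed k B" and C: "add_smult_closed k C"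
    and sA: "\<And>c. c \<in> carrier k \<Longrightarrow> klinear k A A (\<lambda>a. c \<odot>\<^bsub>A\<^esub> a)" and iB: "klinear k B B (\<lambda>b. b)"
    and 1: "\<And>x. x \<in> carrier C \<Longrightarrow> balanced G k A B (\<delta> x)"
    and 2: "\<And>x x' a b. x \<in> carrier C \<Longrightarrow> x' \<in> carrier C \<Longrightarrow> a \<in> carrier A \<Longrightarrow> b \<in> carrier B \<Longrightarrow>
      \<delta> (x \<oplus>\<^bsub>C\<^esub> x') a b = \<delta> x a b \<otimes> \<delta> x' a b"
    and 3: "\<And>c x a b. c \<in> carrier k \<Longrightarrow> x \<in> carrier C \<Longrightarrow> a \<in> carrier A \<Longrightarrow> b \<in> carrier B \<Longrightarrow>
      \<delta> (c \<odot>\<^bsub>C\<^esub> x) a b = \<delta> x (c \<odot>\<^bsub>A\<^esub> a) b"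
  shows "balanced G k C (tensor k A B) (\<lambda>x. tensor_lift G (\<delta> x))"
    and "balanced G k (tensor k A B) C (\<lambda>Z x. tensor_lift G (\<delta> x) Z)"
proof -
  note cl = C[unfolded add_smult_closed_def]
  have a: "tensor_lift G (\<delta> x) Z \<in> carrier G"
    if "x \<in> carrier C" "Z \<in> carrier (tensor_group k A B)" for x Z
    using hom_in_carrier[OF tensor_lift_hom[OF A 1]] that .
  have b: "tensor_lift G (\<delta> (x \<oplus>\<^bsub>C\<^esub> x')) Z = tensor_lift G (\<delta> x) Z \<otimes> tensor_lift G (\<delta> x') Z"
    if "x \<in> carrier C" "x' \<in> carrier C" "Z \<in> carrier (tensor_group k A B)" for x x' Z
    by (rule balanced_swap[OF comm_group_axioms A 1]) (use that cl 2 in auto)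
  have c: "tensor_lift G (\<delta> x) (Z \<otimes>\<^bsub>tensor_group k A B\<^esub> Z') = tensor_lift G (\<delta> x) Z \<otimes> tensor_lift G (\<delta> x) Z'"
    if "x \<in> carrier C" "Z \<in> carrier (tensor_group k A B)" "Z' \<in> carrier (tensor_group k A B)" for x Z Z'
    using hom_mult[OF tensor_lift_hom[OF A 1]] that .
  have d: "tensor_lift G (\<delta> (c \<odot>\<^bsub>C\<^esub> x)) Z =
      tensor_lift G (\<delta> x) (tensor_map k A B (\<lambda>a. c \<odot>\<^bsub>A\<^esub> a) (\<lambda>b. b) Z)"
    if "c \<in> carrier k" "x \<in> carrier C" "Z \<in> carrier (tensor_group k A B)" for c x Z
  proof -
    have "balanced G k A B (\<lambda>a b. \<delta> x (c \<odot>\<^bsub>A\<^esub> a) b)"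
      using 1[OF that(2)] sA[OF that(1)] iB unfolding balanced_def klinear_def
      by (intro conjI ballI) simp_all
    then show ?thesis
      unfolding tensor_lift_map[OF A A sA[OF that(1)] iB 1[OF that(2)] that(3)]
      by (intro tensor_lift_cong[OF A 1]) (use that cl 3 in auto)
  qed
  show "balanced G k C (tensor k A B) (\<lambda>x. tensor_lift G (\<delta> x))"
    "balanced G k (tensor k A B) C (\<lambda>Z x. tensor_lift G (\<delta> x) Z)"
    by (rule balancedI; simp add: tensor_simps a b c d)+
qed

section \<open>Calculus of Sweedler sums with values in \<open>H\<close>\<close>

context hopf_algebra
begin

abbreviation lsum :: "('c \<Rightarrow> 'a) \<Rightarrow> 'c list \<Rightarrow> 'a" where
  "lsum \<equiv> lprod (add_monoid H)"

text \<open>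
  The Sweedler sum \<open>\<beta> h\<^sub>(\<^sub>1\<^sub>) h\<^sub>(\<^sub>2\<^sub>)\<close>.  Evaluating it on a chosen list of pure tensors, rather
  than with \<open>tensor_lift\<close>, makes linearity in parameters and interchange of sums independent of
  the bilinearity of \<open>\<beta>\<close>.
\<close>

definition sw :: "('a \<Rightarrow> 'a \<Rightarrow> 'a) \<Rightarrow> 'a \<Rightarrow> 'a" where
  "sw \<beta> h = lsum (\<lambda>(x, y). \<beta> x y) (comult_list h)"

definition lin :: "('a \<Rightarrow> 'a) \<Rightarrow> bool" where
  "lin f \<longleftrightarrow> (\<forall>x\<in>carrier H. f x \<in> carrier H) \<and>
     (\<forall>x\<in>carrier H. \<forall>y\<in>carrier H. f (x \<boxplus> y) = f x \<boxplus> f y) \<and>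
     (\<forall>c\<in>carrier k. \<forall>x\<in>carrier H. f (c \<bullet> x) = c \<bullet> f x)"

definition lfun :: "('a \<Rightarrow> 'k) \<Rightarrow> bool" where
  "lfun f \<longleftrightarrow> (\<forall>x\<in>carrier H. f x \<in> carrier k) \<and>
     (\<forall>x\<in>carrier H. \<forall>y\<in>carrier H. f (x \<boxplus> y) = f x \<oplus>\<^bsub>k\<^esub> f y) \<and>
     (\<forall>c\<in>carrier k. \<forall>x\<in>carrier H. f (c \<bullet> x) = c \<otimes>\<^bsub>k\<^esub> f x)"

definition bil :: "('a \<Rightarrow> 'a \<Rightarrow> 'a) \<Rightarrow> bool" where
  "bil \<beta> \<longleftrightarrow> (\<forall>x\<in>carrier H. lin (\<beta> x)) \<and> (\<forall>y\<in>carrier H. lin (\<lambda>x. \<beta> x y))"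

lemma linI:
  assumes "\<And>x. x \<in> carrier H \<Longrightarrow> f x \<in> carrier H"
    "\<And>x y. x \<in> carrier H \<Longrightarrow> y \<in> carrier H \<Longrightarrow> f (x \<boxplus> y) = f x \<boxplus> f y"
    "\<And>c x. c \<in> carrier k \<Longrightarrow> x \<in> carrier H \<Longrightarrow> f (c \<bullet> x) = c \<bullet> f x"
  shows "lin f"
  using assms by (simp add: lin_def)

lemma lin_closed: "lin f \<Longrightarrow> x \<in> carrier H \<Longrightarrow> f x \<in> carrier H"
  and lin_add: "lin f \<Longrightarrow> x \<in> carrier H \<Longrightarrow> y \<in> carrier H \<Longrightarrow> f (x \<boxplus> y) = f x \<boxplus> f y"
  and lin_smult: "lin f \<Longrightarrow> c \<in> carrier k \<Longrightarrow> x \<in> carrier H \<Longrightarrow> f (c \<bullet> x) = c \<bullet> f x"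
  by (simp_all add: lin_def)

lemma lfun_closed: "lfun f \<Longrightarrow> x \<in> carrier H \<Longrightarrow> f x \<in> carrier k"
  and lfun_add: "lfun f \<Longrightarrow> x \<in> carrier H \<Longrightarrow> y \<in> carrier H \<Longrightarrow> f (x \<boxplus> y) = f x \<oplus>\<^bsub>k\<^esub> f y"
  and lfun_smult: "lfun f \<Longrightarrow> c \<in> carrier k \<Longrightarrow> x \<in> carrier H \<Longrightarrow> f (c \<bullet> x) = c \<otimes>\<^bsub>k\<^esub> f x"
  by (simp_all add: lfun_def)

lemma smult_zero_k: "x \<in> carrier H \<Longrightarrow> \<zero>\<^bsub>k\<^esub> \<bullet> x = \<zero>\<^bsub>H\<^esub>"
  using smult_l_distr[of "\<zero>\<^bsub>k\<^esub>" "\<zero>\<^bsub>k\<^esub>" x] by simp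

lemma smult_zero_H: "c \<in> carrier k \<Longrightarrow> c \<bullet> \<zero>\<^bsub>H\<^esub> = \<zero>\<^bsub>H\<^esub>"
  using smult_r_distr[of c "\<zero>\<^bsub>H\<^esub>" "\<zero>\<^bsub>H\<^esub>"] by simp

lemma smult_minus_one: "x \<in> carrier H \<Longrightarrow> (\<ominus>\<^bsub>k\<^esub> \<one>\<^bsub>k\<^esub>) \<bullet> x = \<ominus>\<^bsub>H\<^esub> x"
  using smult_l_distr[of "\<ominus>\<^bsub>k\<^esub> \<one>\<^bsub>k\<^esub>" "\<one>\<^bsub>k\<^esub>" x]
  by (simp add: smult_zero_k R.l_neg M.minus_equality)

lemma lin_zero: "lin f \<Longrightarrow> f \<zero>\<^bsub>H\<^esub> = \<zero>\<^bsub>H\<^esub>"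
  using lin_smult[of f "\<zero>\<^bsub>k\<^esub>" "\<zero>\<^bsub>H\<^esub>"] by (simp add: smult_zero_k lin_closed)

lemma lin_minus: "lin f \<Longrightarrow> x \<in> carrier H \<Longrightarrow> f (\<ominus>\<^bsub>H\<^esub> x) = \<ominus>\<^bsub>H\<^esub> f x"
  using lin_smult[of f "\<ominus>\<^bsub>k\<^esub> \<one>\<^bsub>k\<^esub>" x] by (simp add: smult_minus_one lin_closed)

lemma lin_diff: "lin f \<Longrightarrow> x \<in> carrier H \<Longrightarrow> y \<in> carrier H \<Longrightarrow> f (x \<ominus>\<^bsub>H\<^esub> y) = f x \<ominus>\<^bsub>H\<^esub> f y"
  by (simp add: M.minus_eq lin_add lin_minus)

lemma lfun_zero: "lfun f \<Longrightarrow> f \<zero>\<^bsub>H\<^esub> = \<zero>\<^bsub>k\<^esub>"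
  using lfun_smult[of f "\<zero>\<^bsub>k\<^esub>" "\<zero>\<^bsub>H\<^esub>"] by (simp add: smult_zero_k lfun_closed)

lemma bilI:
  assumes "\<And>x. x \<in> carrier H \<Longrightarrow> lin (\<beta> x)" "\<And>y. y \<in> carrier H \<Longrightarrow> lin (\<lambda>x. \<beta> x y)"
  shows "bil \<beta>"
  using assms by (simp add: bil_def)

lemma bil_lin1: "bil \<beta> \<Longrightarrow> x \<in> carrier H \<Longrightarrow> lin (\<beta> x)"
  and bil_lin2: "bil \<beta> \<Longrightarrow> y \<in> carrier H \<Longrightarrow> lin (\<lambda>x. \<beta> x y)"
  by (simp_all add: bil_def)

lemma bil_closed: "bil \<beta> \<Longrightarrow> x \<in> carrier H \<Longrightarrow> y \<in> carrier H \<Longrightarrow> \<beta> x y \<in> carrier H"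
  by (rule lin_closed[OF bil_lin1])

lemma bil_balanced: "bil \<beta> \<Longrightarrow> balanced (add_monoid H) k H H \<beta>"
  by (rule balancedI) (auto simp: bil_def lin_def)

lemma lsum_closed: "(\<And>z. z \<in> set zs \<Longrightarrow> F z \<in> carrier H) \<Longrightarrow> lsum F zs \<in> carrier H"
  using M.add.lprod_closed[of zs F] by simp

lemma lsum_add:
  "(\<And>z. z \<in> set zs \<Longrightarrow> F z \<in> carrier H) \<Longrightarrow> (\<And>z. z \<in> set zs \<Longrightarrow> F' z \<in> carrier H) \<Longrightarrow>
    lsum (\<lambda>z. F z \<boxplus> F' z) zs = lsum F zs \<boxplus> lsum F' zs"
  using M.add.lprod_mult[of zs F F'] by simp

lemma lin_lsum:
  "lin f \<Longrightarrow> (\<And>z. z \<in> set zs \<Longrightarrow> F z \<in> carrier H) \<Longrightarrow> f (lsum F zs) = lsum (\<lambda>z. f (F z)) zs"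
  by (induction zs) (simp_all add: lin_zero lin_add lsum_closed)

lemma lsum_zero: "(\<And>z. z \<in> set zs \<Longrightarrow> F z = \<zero>\<^bsub>H\<^esub>) \<Longrightarrow> lsum F zs = \<zero>\<^bsub>H\<^esub>"
  by (induction zs) simp_all

lemma lsum_swap:
  assumes "\<And>z w. z \<in> set zs \<Longrightarrow> w \<in> set ws \<Longrightarrow> F z w \<in> carrier H"
  shows "lsum (\<lambda>z. lsum (F z) ws) zs = lsum (\<lambda>w. lsum (\<lambda>z. F z w) zs) ws"
  using assms
proof (induction zs)
  case Nil then show ?case by (simp add: lsum_zero)
next
  case (Cons z zs)
  have "lsum (\<lambda>w. lsum (\<lambda>z. F z w) (z # zs)) ws = lsum (\<lambda>w. F z w \<boxplus> lsum (\<lambda>z. F z w) zs) ws"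
    by simp
  also have "\<dots> = lsum (F z) ws \<boxplus> lsum (\<lambda>w. lsum (\<lambda>z. F z w) zs) ws"
    by (rule lsum_add) (use Cons.prems in \<open>auto intro!: lsum_closed\<close>)
  finally show ?case using Cons by simp
qed

text \<open>As a congruence rule this gives every rewriting of an integrand the knowledge that both
  legs lie in \<open>H\<close>.\<close>

lemma sw_cong [cong]:
  assumes "h = h'" "\<And>x y. x \<in> carrier H \<Longrightarrow> y \<in> carrier H \<Longrightarrow> \<beta> x y = \<beta>' x y"
  shows "sw \<beta> h = sw \<beta>' h'"
  unfolding sw_def assms(1) by (rule lprod_cong) (use assms(2) comult_list_mem in auto)

lemma sw_closed [intro!]:
  assumes "\<And>x y. x \<in> carrier H \<Longrightarrow> y \<in> carrier H \<Longrightarrow> \<beta> x y \<in> carrier H"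
  shows "sw \<beta> h \<in> carrier H"
  unfolding sw_def by (rule lsum_closed) (use assms comult_list_mem in auto)

lemma lin_sw_apply:
  assumes "lin f" "\<And>x y. x \<in> carrier H \<Longrightarrow> y \<in> carrier H \<Longrightarrow> \<beta> x y \<in> carrier H"
  shows "f (sw \<beta> h) = sw (\<lambda>x y. f (\<beta> x y)) h"
  unfolding sw_def
  by (subst lin_lsum[OF assms(1)]) (use assms(2) comult_list_mem in \<open>auto intro!: lprod_cong\<close>)

lemma sw_swap:
  assumes "\<And>x y u v. x \<in> carrier H \<Longrightarrow> y \<in> carrier H \<Longrightarrow> u \<in> carrier H \<Longrightarrow> v \<in> carrier H \<Longrightarrow>
    F x y u v \<in> carrier H"
  shows "sw (\<lambda>x y. sw (F x y) h) g = sw (\<lambda>u v. sw (\<lambda>x y. F x y u v) g) h"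
  unfolding sw_def case_prod_unfold
  by (rule lsum_swap) (use assms comult_list_mem in \<open>auto simp: case_prod_unfold\<close>)

lemma sw_lsum_swap:
  assumes "\<And>x y z. x \<in> carrier H \<Longrightarrow> y \<in> carrier H \<Longrightarrow> z \<in> set zs \<Longrightarrow> F x y z \<in> carrier H"
  shows "sw (\<lambda>x y. lsum (F x y) zs) g = lsum (\<lambda>z. sw (\<lambda>x y. F x y z) g) zs"
  unfolding sw_def case_prod_unfold
  by (rule lsum_swap) (use assms comult_list_mem in auto)

lemma sw_eq_tensor_lift:
  "bil \<beta> \<Longrightarrow> h \<in> carrier H \<Longrightarrow> sw \<beta> h = tensor_lift (add_monoid H) \<beta> (comult H h)"
  unfolding sw_def by (subst tensor_lift_comult[OF comm_group_H bil_balanced]) auto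

lemma sw_add:
  assumes "bil \<beta>" "g \<in> carrier H" "h \<in> carrier H"
  shows "sw \<beta> (g \<boxplus> h) = sw \<beta> g \<boxplus> sw \<beta> h"
proof -
  note HH = add_smult_closed_H add_smult_closed_H
  show ?thesis
    using hom_mult[OF comm_group.tensor_lift_hom[OF comm_group_H HH bil_balanced[OF assms(1)]]
        comult_closed[OF assms(2)] comult_closed[OF assms(3)]]
      ring_hom_add[OF comult_hom assms(2,3)] assms
    by (simp add: sw_eq_tensor_lift tensor_simps)
qed

lemma lin_smult_lin: "c \<in> carrier k \<Longrightarrow> lin f \<Longrightarrow> lin (\<lambda>x. c \<bullet> f x)"
  by (rule linI) (simp_all add: lin_closed lin_add lin_smult smult_r_distr smult_assoc1[symmetric] R.m_comm)

lemma sw_smult: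
  assumes "bil \<beta>" "c \<in> carrier k" "h \<in> carrier H"
  shows "sw \<beta> (c \<bullet> h) = c \<bullet> sw \<beta> h"
proof -
  note HH = add_smult_closed_H add_smult_closed_H
  have lin: "lin (\<lambda>x. c \<bullet> x)" by (rule lin_smult_lin) (use assms in \<open>auto simp: lin_def\<close>)
  have b: "bil (\<lambda>x y. \<beta> (c \<bullet> x) y)"
    using assms by (intro bilI linI) (simp_all add: bil_closed lin_add[OF bil_lin1] lin_add[OF bil_lin2]
       lin_smult[OF bil_lin1] lin_smult[OF bil_lin2] smult_r_distr smult_assoc1[symmetric] R.m_comm)
  have "sw \<beta> (c \<bullet> h) = sw (\<lambda>x y. \<beta> (c \<bullet> x) y) h"
    using comm_group.tensor_lift_map[OF comm_group_H HH HH klinear_smult klinear_id bil_balanced comult_closed]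
      comult_smult assms b
    by (simp add: sw_eq_tensor_lift tensor_simps)
  also have "\<dots> = sw (\<lambda>x y. c \<bullet> \<beta> x y) h"
    using assms lin_smult[OF bil_lin2[OF assms(1)]] by simp
  also have "\<dots> = c \<bullet> sw \<beta> h"
    using lin_sw_apply[OF lin] assms by (simp add: bil_closed)
  finally show ?thesis .
qed

lemma sw_lin_apply: "bil \<beta> \<Longrightarrow> lin (sw \<beta>)"
  by (rule linI) (auto simp: sw_add sw_smult bil_closed)

lemma lin_id: "lin (\<lambda>x. x)"
  and lin_mult_left: "lin f \<Longrightarrow> a \<in> carrier H \<Longrightarrow> lin (\<lambda>x. f x \<star> a)"
  and lin_mult_right: "lin f \<Longrightarrow> a \<in> carrier H \<Longrightarrow> lin (\<lambda>x. a \<star> f x)"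
  and lin_antipode: "lin f \<Longrightarrow> lin (\<lambda>x. \<S> (f x))"
  and lin_counit: "lin f \<Longrightarrow> a \<in> carrier H \<Longrightarrow> lin (\<lambda>x. \<epsilon> (f x) \<bullet> a)"
  and lin_lfun: "lfun \<phi> \<Longrightarrow> lin f \<Longrightarrow> a \<in> carrier H \<Longrightarrow> lin (\<lambda>x. \<phi> (f x) \<bullet> a)"
  and lin_comp: "lin g \<Longrightarrow> lin f \<Longrightarrow> lin (\<lambda>x. g (f x))"
  using ring_hom_closed[OF counit_hom] ring_hom_add[OF counit_hom]
  by (auto simp: lin_def lfun_def M.l_distr M.r_distr smult_mult_left smult_mult_right
    antipode_closed antipode_add antipode_smult counit_smult smult_l_distr smult_assoc1)

lemma lfun_counit: "lfun \<epsilon>"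
  using ring_hom_closed[OF counit_hom] ring_hom_add[OF counit_hom] counit_smult
  by (simp add: lfun_def)

lemma lin_plus: "lin f \<Longrightarrow> lin g \<Longrightarrow> lin (\<lambda>x. f x \<boxplus> g x)"
  by (simp add: lin_def smult_r_distr M.a_ac)

lemma lin_lsum_param:
  assumes "\<And>z. z \<in> set zs \<Longrightarrow> lin (\<lambda>x. F z x)"
  shows "lin (\<lambda>x. lsum (\<lambda>z. F z x) zs)"
  using assms
proof (induction zs)
  case Nil then show ?case by (auto intro!: linI simp: smult_zero_H)
next
  case (Cons z zs)
  then show ?case using lin_plus[of "F z" "\<lambda>x. lsum (\<lambda>z. F z x) zs"] by simp
qed

lemma lin_sw_param:
  assumes "\<And>u v. u \<in> carrier H \<Longrightarrow> v \<in> carrier H \<Longrightarrow> lin (\<lambda>x. \<beta> u v x)"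
  shows "lin (\<lambda>x. sw (\<lambda>u v. \<beta> u v x) h)"
  unfolding sw_def case_prod_unfold
  by (rule lin_lsum_param) (use assms comult_list_mem in auto)

lemma lin_sw_arg:
  assumes "lin f" "\<And>u. u \<in> carrier H \<Longrightarrow> lin (\<beta> u)" "\<And>v. v \<in> carrier H \<Longrightarrow> lin (\<lambda>u. \<beta> u v)"
  shows "lin (\<lambda>x. sw \<beta> (f x))"
  by (rule lin_comp[OF sw_lin_apply[OF bilI] assms(1)]) (use assms in auto)

lemma sw_mult:
  assumes "bil \<beta>" "g \<in> carrier H" "h \<in> carrier H"
  shows "sw \<beta> (g \<star> h) = sw (\<lambda>x y. sw (\<lambda>u v. \<beta> (x \<star> u) (y \<star> v)) h) g"
  unfolding sw_eq_tensor_lift[OF assms(1) M.m_closed[OF assms(2,3)]]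
    tensor_lift_comult_mult[OF comm_group_H bil_balanced[OF assms(1)] assms(2,3)]
  by (simp add: sw_def)

lemma sw_one:
  assumes "bil \<beta>"
  shows "sw \<beta> \<e> = \<beta> \<e> \<e>"
proof -
  note HH = add_smult_closed_H add_smult_closed_H
  show ?thesis
    using ring_hom_one[OF comult_hom] comm_group.tensor_lift_pure[OF comm_group_H HH bil_balanced[OF assms]]
    by (simp add: sw_eq_tensor_lift[OF assms] tensor_simps)
qed

lemma sw_counit_left: "lin f \<Longrightarrow> h \<in> carrier H \<Longrightarrow> sw (\<lambda>x y. \<epsilon> x \<bullet> f y) h = f h"
proof -
  assume f: "lin f" and h: "h \<in> carrier H"
  have "bil (\<lambda>x y. \<epsilon> x \<bullet> y)"
    by (intro bilI lin_counit lin_smult_lin lin_id lfun_closed[OF lfun_counit])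
  then have "f (sw (\<lambda>x y. \<epsilon> x \<bullet> y) h) = f h"
    using counit_left[OF h] h by (simp add: sw_eq_tensor_lift)
  then show ?thesis
    using lin_sw_apply[OF f, of "\<lambda>x y. \<epsilon> x \<bullet> y"] f
    by (simp add: lfun_closed[OF lfun_counit] lin_smult)
qed

lemma sw_counit_right: "lin f \<Longrightarrow> h \<in> carrier H \<Longrightarrow> sw (\<lambda>x y. \<epsilon> y \<bullet> f x) h = f h"
proof -
  assume f: "lin f" and h: "h \<in> carrier H"
  have "bil (\<lambda>x y. \<epsilon> y \<bullet> x)"
    by (intro bilI lin_counit lin_smult_lin lin_id lfun_closed[OF lfun_counit])
  then have "f (sw (\<lambda>x y. \<epsilon> y \<bullet> x) h) = f h"
    using counit_right[OF h] h by (simp add: sw_eq_tensor_lift)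
  then show ?thesis
    using lin_sw_apply[OF f, of "\<lambda>x y. \<epsilon> y \<bullet> x"] f
    by (simp add: lfun_closed[OF lfun_counit] lin_smult)
qed

lemma sw_antipode_left: "lin f \<Longrightarrow> h \<in> carrier H \<Longrightarrow> sw (\<lambda>x y. f (\<S> x \<star> y)) h = \<epsilon> h \<bullet> f \<e>"
proof -
  assume f: "lin f" and h: "h \<in> carrier H"
  have "bil (\<lambda>x y. \<S> x \<star> y)"
    by (intro bilI lin_mult_left lin_mult_right lin_antipode lin_id antipode_closed)
  then have "f (sw (\<lambda>x y. \<S> x \<star> y) h) = f (\<epsilon> h \<bullet> \<e>)"
    using antipode_left[OF h] h by (simp add: sw_eq_tensor_lift)
  then show ?thesis
    using lin_sw_apply[OF f, of "\<lambda>x y. \<S> x \<star> y"] f h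
    by (simp add: lfun_closed[OF lfun_counit] lin_smult antipode_closed)
qed

lemma sw_antipode_right: "lin f \<Longrightarrow> h \<in> carrier H \<Longrightarrow> sw (\<lambda>x y. f (x \<star> \<S> y)) h = \<epsilon> h \<bullet> f \<e>"
proof -
  assume f: "lin f" and h: "h \<in> carrier H"
  have "bil (\<lambda>x y. x \<star> \<S> y)"
    by (intro bilI lin_mult_left lin_mult_right lin_antipode lin_id antipode_closed)
  then have "f (sw (\<lambda>x y. x \<star> \<S> y) h) = f (\<epsilon> h \<bullet> \<e>)"
    using antipode_right[OF h] h by (simp add: sw_eq_tensor_lift)
  then show ?thesis
    using lin_sw_apply[OF f, of "\<lambda>x y. x \<star> \<S> y"] f h
    by (simp add: lfun_closed[OF lfun_counit] lin_smult antipode_closed)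
qed

text \<open>A trilinear \<open>\<gamma>\<close> induces a homomorphism \<open>?\<Gamma>\<close> on
  \<open>H \<otimes> (H \<otimes> H)\<close>. Applied to the two sides of \<open>coassoc\<close> it
  evaluates to the two iterated sums; on the left the reassociation is evaluated through
  \<open>?P\<close>.\<close>

lemma sw_coassoc:
  assumes h: "h \<in> carrier H"
    and 1: "\<And>y z. y \<in> carrier H \<Longrightarrow> z \<in> carrier H \<Longrightarrow> lin (\<lambda>x. \<gamma> x y z)"
    and 2: "\<And>x z. x \<in> carrier H \<Longrightarrow> z \<in> carrier H \<Longrightarrow> lin (\<lambda>y. \<gamma> x y z)"
    and 3: "\<And>x y. x \<in> carrier H \<Longrightarrow> y \<in> carrier H \<Longrightarrow> lin (\<lambda>z. \<gamma> x y z)"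
  shows "sw (\<lambda>x z. sw (\<lambda>u v. \<gamma> u v z) x) h = sw (\<lambda>x y. sw (\<lambda>u v. \<gamma> x u v) y) h"
proof -
  let ?G = "add_monoid H" and ?HH = "tensor k H H"
  let ?T = "tensor_group k H ?HH"
  note HH = add_smult_closed_H add_smult_closed_H
  note H2 = add_smult_closed_H add_smult_closed_HH
  note H3 = add_smult_closed_HH add_smult_closed_H
  interpret HHg: comm_group "tensor_group k H H" by (rule comm_group_tensor_group[OF HH])
  interpret T: comm_group ?T by (rule comm_group_tensor_group[OF H2])
  have \<gamma>x: "bil (\<gamma> x)" if "x \<in> carrier H" for x
    using 2 3 that by (intro bilI) auto
  let ?\<Gamma> = "\<lambda>x Z. tensor_lift ?G (\<gamma> x) Z"
  have \<Gamma>: "balanced ?G k H ?HH ?\<Gamma>"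
    by (rule comm_group.tensor_lift_balanced[OF comm_group_H HH add_smult_closed_H klinear_smult klinear_id])
       (use 1 2 3 \<gamma>x in \<open>auto intro: bil_balanced simp: lin_add[OF 1] lin_smult[OF 1] lin_smult[OF 2]\<close>)
  note pb = pure_tensor_balanced[OF HH] and pT = pure_tensor_balanced[OF H2]
  have sm: "pure_tensor k H H (c \<bullet> b) z = c \<odot>\<^bsub>?HH\<^esub> pure_tensor k H H b z"
    if "c \<in> carrier k" "b \<in> carrier H" "z \<in> carrier H" for c b z
    using tensor_map_pure[OF HH HH klinear_smult klinear_id] that by (simp add: tensor_simps)
  have pc: "pure_tensor k H H b z \<in> carrier ?HH" if "b \<in> carrier H" "z \<in> carrier H" for b z
    using pure_tensor_closed[OF that] by (simp add: tensor_simps)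
  let ?\<delta> = "\<lambda>z a b. pure_tensor k H ?HH a (pure_tensor k H H b z)"
  have \<delta>: "balanced ?T k H H (?\<delta> z)" if z: "z \<in> carrier H" for z
  proof (rule balancedI)
    fix a b b' assume ab: "a \<in> carrier H" "b \<in> carrier H" "b' \<in> carrier H"
    have "pure_tensor k H H (b \<boxplus> b') z = pure_tensor k H H b z \<oplus>\<^bsub>?HH\<^esub> pure_tensor k H H b' z"
      using balancedD(2)[OF pb] ab z by (simp add: tensor_simps)
    then show "?\<delta> z a (b \<boxplus> b') = ?\<delta> z a b \<otimes>\<^bsub>?T\<^esub> ?\<delta> z a b'"
      using balancedD(3)[OF pT] ab z pc by simp
  qed (use z pc sm balancedD[OF pT] in \<open>simp_all\<close>)
  let ?P = "\<lambda>Z z. tensor_lift ?T (?\<delta> z) Z"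
  have P: "balanced ?T k ?HH H ?P"
  proof (rule T.tensor_lift_balanced[OF HH add_smult_closed_H klinear_smult klinear_id \<delta>])
    fix x x' a b assume ab: "x \<in> carrier H" "x' \<in> carrier H" "a \<in> carrier H" "b \<in> carrier H"
    have "pure_tensor k H H b (x \<boxplus> x') = pure_tensor k H H b x \<oplus>\<^bsub>?HH\<^esub> pure_tensor k H H b x'"
      using balancedD(3)[OF pb] ab by (simp add: tensor_simps)
    then show "?\<delta> (x \<boxplus> x') a b = ?\<delta> x a b \<otimes>\<^bsub>?T\<^esub> ?\<delta> x' a b"
      using balancedD(3)[OF pT] ab pc by simp
  next
    fix c x a b assume ab: "c \<in> carrier k" "x \<in> carrier H" "a \<in> carrier H" "b \<in> carrier H"
    have "pure_tensor k H H b (c \<bullet> x) = c \<odot>\<^bsub>?HH\<^esub> pure_tensor k H H b x"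
      using balancedD(4)[OF pb, symmetric] sm ab by simp
    then show "?\<delta> (c \<bullet> x) a b = ?\<delta> x (c \<bullet> a) b"
      using balancedD(4)[OF pT, symmetric] ab pc by simp
  qed
  have assoc: "tensor_assoc k H H H = tensor_lift ?T ?P"
    by (simp add: tensor_assoc_def)
  have memD: "x \<in> carrier H" "y \<in> carrier H" if "(x, y) \<in> set (comult_list g)" for x y g
    using comult_list_mem[OF that] by auto
  have L: "tensor_assoc k H H H (tensor_map k ?HH H (comult H) (\<lambda>y. y) (comult H h)) =
      lprod ?T (\<lambda>(x, z). ?P (comult H x) z) (comult_list h)"
    unfolding assoc
    by (subst T.tensor_lift_map[OF HH H3 klinear_comult klinear_id P comult_closed[OF h]])
       (rule tensor_lift_comult[OF T.comm_group_axioms _ h],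
        use P klinear_comult in \<open>auto simp: balanced_def klinear_def\<close>)
  interpret f: group_hom ?T ?G "tensor_lift ?G ?\<Gamma>"
    using comm_group.tensor_lift_hom[OF comm_group_H H2 \<Gamma>] by (simp add: group_hom_def group_hom_axioms_def)
  have Pl: "?P (comult H x) z = lprod ?T (\<lambda>(u, v). ?\<delta> z u v) (comult_list x)"
    if "x \<in> carrier H" "z \<in> carrier H" for x z
    by (rule tensor_lift_comult[OF T.comm_group_axioms \<delta> that(1)]) (rule that)
  have dc: "?\<delta> z u v \<in> carrier ?T" if "u \<in> carrier H" "v \<in> carrier H" "z \<in> carrier H" for u v z
    using balancedD(1)[OF \<delta>] that by auto
  have \<Gamma>\<delta>: "tensor_lift ?G ?\<Gamma> (?\<delta> z u v) = \<gamma> u v z"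
    if "u \<in> carrier H" "v \<in> carrier H" "z \<in> carrier H" for u v z
    using that pc by (simp add: comm_group.tensor_lift_pure[OF comm_group_H H2 \<Gamma>] comm_group.tensor_lift_pure[OF comm_group_H HH bil_balanced[OF \<gamma>x]])
  have "tensor_lift ?G ?\<Gamma> (tensor_assoc k H H H (tensor_map k ?HH H (comult H) (\<lambda>y. y) (comult H h))) =
      lsum (\<lambda>p. tensor_lift ?G ?\<Gamma> (case p of (x, z) \<Rightarrow> ?P (comult H x) z)) (comult_list h)"
    unfolding L
    by (rule f.hom_lprod) (use balancedD(1)[OF P] comult_closed memD in \<open>auto simp: tensor_simps\<close>)
  also have "\<dots> = sw (\<lambda>x z. sw (\<lambda>u v. \<gamma> u v z) x) h"
    unfolding sw_def
  proof (rule lprod_cong, clarify)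
    fix x z assume "(x, z) \<in> set (comult_list h)"
    then have xz: "x \<in> carrier H" "z \<in> carrier H" using memD by auto
    have "tensor_lift ?G ?\<Gamma> (lprod ?T (\<lambda>(u, v). ?\<delta> z u v) (comult_list x)) =
       lsum (\<lambda>p. tensor_lift ?G ?\<Gamma> (case p of (u, v) \<Rightarrow> ?\<delta> z u v)) (comult_list x)"
      by (rule f.hom_lprod) (use dc memD xz in auto)
    also have "\<dots> = lsum (\<lambda>(u, v). \<gamma> u v z) (comult_list x)"
      by (rule lprod_cong) (use \<Gamma>\<delta> memD xz in auto)
    finally show "tensor_lift ?G ?\<Gamma> (?P (comult H x) z) = lsum (\<lambda>(u, v). \<gamma> u v z) (comult_list x)"
      using Pl[OF xz] by simp
  qed
  finally have left: "tensor_lift ?G ?\<Gamma> (tensor_assoc k H H H (tensor_map k ?HH H (comult H) (\<lambda>y. y) (comult H h)))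
    = sw (\<lambda>x z. sw (\<lambda>u v. \<gamma> u v z) x) h" .
  have "tensor_lift ?G ?\<Gamma> (tensor_map k H ?HH (\<lambda>y. y) (comult H) (comult H h)) =
      lsum (\<lambda>(x, y). ?\<Gamma> x (comult H y)) (comult_list h)"
    by (subst comm_group.tensor_lift_map[OF comm_group_H HH H2 klinear_id klinear_comult \<Gamma> comult_closed[OF h]])
       (rule tensor_lift_comult[OF comm_group_H _ h],
        use \<Gamma> klinear_comult in \<open>auto simp: balanced_def klinear_def\<close>)
  also have "\<dots> = sw (\<lambda>x y. sw (\<lambda>u v. \<gamma> x u v) y) h"
    unfolding sw_def[of _ h]
    by (rule lprod_cong) (use memD \<gamma>x in \<open>auto simp: sw_eq_tensor_lift\<close>)
  finally show ?thesis using left coassoc[OF h] by simp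
qed

lemmas lin_intros = bilI lin_id lin_mult_left lin_mult_right lin_antipode lin_counit
  lin_smult_lin lin_sw_param lin_sw_arg lin_lsum_param

declare antipode_closed [simp] sw_closed [simp]

lemma counit_closed [simp]: "x \<in> carrier H \<Longrightarrow> \<epsilon> x \<in> carrier k"
  by (rule lfun_closed[OF lfun_counit])

lemma counit_mult: "x \<in> carrier H \<Longrightarrow> y \<in> carrier H \<Longrightarrow> \<epsilon> (x \<star> y) = \<epsilon> x \<otimes>\<^bsub>k\<^esub> \<epsilon> y"
  by (rule ring_hom_mult[OF counit_hom])

lemma counit_one: "\<epsilon> \<e> = \<one>\<^bsub>k\<^esub>"
  by (rule ring_hom_one[OF counit_hom])

section \<open>The antipode reverses products and coproducts\<close>

lemma antipode_one: "\<S> \<e> = \<e>"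
proof -
  have "sw (\<lambda>x y. \<S> x \<star> y) \<e> = \<S> \<e> \<star> \<e>"
    by (rule sw_one) (intro lin_intros; simp)
  then show ?thesis using sw_antipode_left[OF lin_id, of \<e>] by (simp add: counit_one)
qed

text \<open>Uniqueness of convolution inverses, written out: \<open>S(gh)\<close> and
  \<open>S(h) S(g)\<close> are both inverse to multiplication. The element \<open>T\<close> is
  \<open>S(g1 h1) g2 h2 S(h3) S(g3)\<close>; contracting the last four factors gives the left side,
  contracting \<open>S(g1 h1)\<close> against \<open>g2 h2\<close> gives the right side.\<close>

lemma antipode_mult:
  assumes g: "g \<in> carrier H" and h: "h \<in> carrier H"
  shows "\<S> (g \<star> h) = \<S> h \<star> \<S> g"
proof -
  define F where "F a b b' c d d' = \<S> (a \<star> c) \<star> (b \<star> ((d \<star> \<S> d') \<star> \<S> b'))" for a b b' c d d'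
  define T where "T = sw (\<lambda>a t. sw (\<lambda>b b'. sw (\<lambda>c s. sw (\<lambda>d d'. F a b b' c d d') s) h) t) g"
  have 1: "sw (\<lambda>d d'. F a b b' c d d') s = \<epsilon> s \<bullet> (\<S> (a \<star> c) \<star> (b \<star> \<S> b'))"
    if "a \<in> carrier H" "b \<in> carrier H" "b' \<in> carrier H" "c \<in> carrier H" "s \<in> carrier H" for a b b' c s
    using that sw_antipode_right[of "\<lambda>z. \<S> (a \<star> c) \<star> (b \<star> (z \<star> \<S> b'))" s]
    by (simp add: F_def lin_intros)
  have 2: "sw (\<lambda>c s. \<epsilon> s \<bullet> (\<S> (a \<star> c) \<star> (b \<star> \<S> b'))) h = \<S> (a \<star> h) \<star> (b \<star> \<S> b')"
    if "a \<in> carrier H" "b \<in> carrier H" "b' \<in> carrier H" for a b b'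
    using that h by (intro sw_counit_right[of "\<lambda>c. \<S> (a \<star> c) \<star> (b \<star> \<S> b')"]) (simp_all add: lin_intros)
  have 3: "sw (\<lambda>b b'. \<S> (a \<star> h) \<star> (b \<star> \<S> b')) t = \<epsilon> t \<bullet> \<S> (a \<star> h)"
    if "a \<in> carrier H" "t \<in> carrier H" for a t
    using that h sw_antipode_right[of "\<lambda>z. \<S> (a \<star> h) \<star> z" t] by (simp add: lin_intros)
  have "T = sw (\<lambda>a t. \<epsilon> t \<bullet> \<S> (a \<star> h)) g"
    unfolding T_def by (simp add: 1 2 3)
  also have "\<dots> = \<S> (g \<star> h)"
    using g h by (intro sw_counit_right[of "\<lambda>a. \<S> (a \<star> h)"]) (simp_all add: lin_intros)
  finally have left: "T = \<S> (g \<star> h)" .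
  have "T = sw (\<lambda>t b'. sw (\<lambda>a b. sw (\<lambda>c s. sw (\<lambda>d d'. F a b b' c d d') s) h) t) g"
    unfolding T_def F_def by (rule sw_coassoc[symmetric, OF g]) (simp; fail | (intro lin_intros; simp))+
  also have "\<dots> = sw (\<lambda>t b'. sw (\<lambda>a b. sw (\<lambda>s d'. sw (\<lambda>c d. F a b b' c d d') s) h) t) g"
    by (unfold F_def, rule sw_cong[OF refl], rule sw_cong[OF refl], rule sw_coassoc[symmetric, OF h]) (simp; fail | (intro lin_intros; simp))+
  also have "\<dots> = sw (\<lambda>t b'. sw (\<lambda>s d'. sw (\<lambda>a b. sw (\<lambda>c d. F a b b' c d d') s) t) h) g"
    by (rule sw_cong[OF refl], rule sw_swap) (simp add: F_def)
  also have "\<dots> = sw (\<lambda>t b'. sw (\<lambda>s d'. \<epsilon> t \<bullet> \<epsilon> s \<bullet> (\<S> d' \<star> \<S> b')) h) g"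
  proof (intro sw_cong refl)
    fix t b' s d' assume cl: "t \<in> carrier H" "b' \<in> carrier H" "s \<in> carrier H" "d' \<in> carrier H"
    have "sw (\<lambda>a b. sw (\<lambda>c d. F a b b' c d d') s) t =
        sw (\<lambda>a b. sw (\<lambda>c d. \<S> (a \<star> c) \<star> (b \<star> d) \<star> (\<S> d' \<star> \<S> b')) s) t"
      using cl by (simp add: F_def M.m_assoc)
    also have "\<dots> = sw (\<lambda>x y. \<S> x \<star> y \<star> (\<S> d' \<star> \<S> b')) (t \<star> s)"
      using cl by (intro sw_mult[symmetric]) (simp_all add: lin_intros)
    also have "\<dots> = \<epsilon> (t \<star> s) \<bullet> (\<S> d' \<star> \<S> b')"
      using cl sw_antipode_left[of "\<lambda>z. z \<star> (\<S> d' \<star> \<S> b')" "t \<star> s"] by (simp add: lin_intros)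
    finally show "sw (\<lambda>a b. sw (\<lambda>c d. F a b b' c d d') s) t = \<epsilon> t \<bullet> \<epsilon> s \<bullet> (\<S> d' \<star> \<S> b')"
      using cl by (simp add: counit_mult smult_assoc1)
  qed
  also have "\<dots> = sw (\<lambda>t b'. \<epsilon> t \<bullet> (\<S> h \<star> \<S> b')) g"
  proof (intro sw_cong refl)
    fix t b' assume cl: "t \<in> carrier H" "b' \<in> carrier H"
    have "sw (\<lambda>s d'. \<epsilon> s \<bullet> (\<epsilon> t \<bullet> (\<S> d' \<star> \<S> b'))) h = \<epsilon> t \<bullet> (\<S> h \<star> \<S> b')"
      by (rule sw_counit_left[OF _ h]) (use cl in \<open>simp add: lin_intros\<close>)
    then show "sw (\<lambda>s d'. \<epsilon> t \<bullet> \<epsilon> s \<bullet> (\<S> d' \<star> \<S> b')) h = \<epsilon> t \<bullet> (\<S> h \<star> \<S> b')"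
      using cl by (simp add: smult_assoc1[symmetric] R.m_comm)
  qed
  also have "\<dots> = \<S> h \<star> \<S> g"
    by (rule sw_counit_left[OF _ g]) (use h in \<open>simp add: lin_intros\<close>)
  finally show ?thesis using left by simp
qed

text \<open>Both \<open>\<Delta> (S h)\<close> and \<open>S(h2) \<otimes> S(h1)\<close> are
  convolution inverse to \<open>\<Delta>\<close>. The element \<open>Z\<close> is
  \<open>\<beta>\<close> evaluated on the threefold product of \<open>\<Delta> (S h1)\<close>,
  \<open>\<Delta> h2\<close> and \<open>S y \<otimes> S x\<close>, where \<open>x\<close>,
  \<open>y\<close> are the legs of \<open>h3\<close>; it is contracted once from the right and once
  from the left.\<close>

lemma sw_antipode:
  assumes \<beta>: "bil \<beta>" and h: "h \<in> carrier H"
  shows "sw \<beta> (\<S> h) = sw (\<lambda>x y. \<beta> (\<S> y) (\<S> x)) h"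
proof -
  note b1 = lin_comp[OF bil_lin1[OF \<beta>]] and b2 = lin_comp[OF bil_lin2[OF \<beta>]]
  note li = lin_intros b1 b2
  note [simp] = bil_closed[OF \<beta>]
  define K where "K p q b c x y = \<beta> (p \<star> (b \<star> \<S> y)) (q \<star> (c \<star> \<S> x))" for p q b c x y
  define Z where "Z = sw (\<lambda>a t. sw (\<lambda>p q. sw (\<lambda>m s. sw (\<lambda>b c. sw (\<lambda>x y.
      K p q b c x y) s) m) t) (\<S> a)) h"
  have 1: "sw (\<lambda>m s. sw (\<lambda>b c. sw (\<lambda>x y. K p q b c x y) s) m) t = \<epsilon> t \<bullet> \<beta> p q"
    if cl: "t \<in> carrier H" "p \<in> carrier H" "q \<in> carrier H" for t p q
  proof -
    have "sw (\<lambda>m s. sw (\<lambda>b c. sw (\<lambda>x y. K p q b c x y) s) m) t =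
        sw (\<lambda>b r. sw (\<lambda>c s. sw (\<lambda>x y. K p q b c x y) s) r) t"
      unfolding K_def by (rule sw_coassoc[OF cl(1)]) (use cl in \<open>(intro li; simp)+\<close>)
    also have "\<dots> = sw (\<lambda>b r. sw (\<lambda>c' y. sw (\<lambda>c x. K p q b c x y) c') r) t"
      unfolding K_def
      by (rule sw_cong[OF refl], rule sw_coassoc[symmetric]) (use cl in \<open>(simp; fail | (intro li; simp))+\<close>)
    also have "\<dots> = sw (\<lambda>b r. sw (\<lambda>c' y. \<epsilon> c' \<bullet> \<beta> (p \<star> (b \<star> \<S> y)) q) r) t"
    proof (intro sw_cong refl)
      fix b r c' y assume c2: "b \<in> carrier H" "r \<in> carrier H" "c' \<in> carrier H" "y \<in> carrier H"
      have "sw (\<lambda>c x. K p q b c x y) c' = \<epsilon> c' \<bullet> \<beta> (p \<star> (b \<star> \<S> y)) (q \<star> \<e>)"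
        unfolding K_def
        by (rule sw_antipode_right[of "\<lambda>z. \<beta> (p \<star> (b \<star> \<S> y)) (q \<star> z)"])
           (use c2 cl in \<open>simp_all add: li\<close>)
      then show "sw (\<lambda>c x. K p q b c x y) c' = \<epsilon> c' \<bullet> \<beta> (p \<star> (b \<star> \<S> y)) q" using cl by simp
    qed
    also have "\<dots> = sw (\<lambda>b r. \<beta> (p \<star> (b \<star> \<S> r)) q) t"
    proof (intro sw_cong refl)
      fix b r assume c2: "b \<in> carrier H" "r \<in> carrier H"
      show "sw (\<lambda>c' y. \<epsilon> c' \<bullet> \<beta> (p \<star> (b \<star> \<S> y)) q) r = \<beta> (p \<star> (b \<star> \<S> r)) q"
        by (rule sw_counit_left[of "\<lambda>y. \<beta> (p \<star> (b \<star> \<S> y)) q"]) (use c2 cl in \<open>simp_all add: li\<close>)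
    qed
    also have "\<dots> = \<epsilon> t \<bullet> \<beta> (p \<star> \<e>) q"
      by (rule sw_antipode_right[of "\<lambda>z. \<beta> (p \<star> z) q"]) (use cl in \<open>simp_all add: li\<close>)
    finally show ?thesis using cl by simp
  qed
  have "Z = sw (\<lambda>a t. sw (\<lambda>p q. \<epsilon> t \<bullet> \<beta> p q) (\<S> a)) h"
    unfolding Z_def by (intro sw_cong refl 1)
  also have "\<dots> = sw (\<lambda>a t. \<epsilon> t \<bullet> sw \<beta> (\<S> a)) h"
    by (intro sw_cong refl lin_sw_apply[symmetric]) (simp_all add: lin_intros)
  also have "\<dots> = sw \<beta> (\<S> h)"
    by (rule sw_counit_right[OF _ h]) (use \<beta> in \<open>simp add: li bil_lin1 bil_lin2\<close>)
  finally have left: "Z = sw \<beta> (\<S> h)" .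
  \<comment> \<open>\<open>B s\<close> keeps the third factor fixed, so that the first two factors
    merge into \<open>\<Delta> (S a \<star> m)\<close> by multiplicativity of the coproduct.\<close>
  define B where "B s u v = sw (\<lambda>x y. \<beta> (u \<star> \<S> y) (v \<star> \<S> x)) s" for s u v
  have B: "bil (B s)" if "s \<in> carrier H" for s
    unfolding B_def using that by (intro li; simp)
  have "Z = sw (\<lambda>a t. sw (\<lambda>p q. sw (\<lambda>m s. sw (\<lambda>b c. B s (p \<star> b) (q \<star> c)) m) t) (\<S> a)) h"
    unfolding Z_def K_def B_def by (simp add: M.m_assoc)
  also have "\<dots> = sw (\<lambda>a t. sw (\<lambda>m s. sw (\<lambda>p q. sw (\<lambda>b c. B s (p \<star> b) (q \<star> c)) m) (\<S> a)) t) h"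
    by (rule sw_cong[OF refl], rule sw_swap) (simp add: B_def)
  also have "\<dots> = sw (\<lambda>a t. sw (\<lambda>m s. sw (B s) (\<S> a \<star> m)) t) h"
    by (intro sw_cong refl sw_mult[symmetric] B) simp_all
  also have "\<dots> = sw (\<lambda>n s. sw (\<lambda>a m. sw (B s) (\<S> a \<star> m)) n) h"
    unfolding B_def by (rule sw_coassoc[symmetric, OF h]) (simp; fail | (intro li; simp))+
  also have "\<dots> = sw (\<lambda>n s. \<epsilon> n \<bullet> sw (B s) \<e>) h"
    by (intro sw_cong refl sw_antipode_left[of "sw (B _)"] sw_lin_apply B)
  also have "\<dots> = sw (\<lambda>n s. \<epsilon> n \<bullet> B s \<e> \<e>) h"
    by (intro sw_cong refl) (simp add: sw_one B)
  also have "\<dots> = B h \<e> \<e>"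
    unfolding B_def by (rule sw_counit_left[OF _ h]) (intro li; simp)
  also have "\<dots> = sw (\<lambda>x y. \<beta> (\<S> y) (\<S> x)) h"
    unfolding B_def by simp
  finally show ?thesis using left by simp
qed

end

section \<open>Linear algebra\<close>

context hopf_algebra
begin

abbreviation subsp :: "'a set \<Rightarrow> bool" where "subsp W \<equiv> submodule W k H"

lemma subsp_carrier: "subsp W \<Longrightarrow> x \<in> W \<Longrightarrow> x \<in> carrier H"
  and subsp_zero: "subsp W \<Longrightarrow> \<zero>\<^bsub>H\<^esub> \<in> W"
  and subsp_add: "subsp W \<Longrightarrow> x \<in> W \<Longrightarrow> y \<in> W \<Longrightarrow> x \<boxplus> y \<in> W"
  and subsp_smult: "subsp W \<Longrightarrow> c \<in> carrier k \<Longrightarrow> x \<in> W \<Longrightarrow> c \<bullet> x \<in> W"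
  and subsp_minus: "subsp W \<Longrightarrow> x \<in> W \<Longrightarrow> \<ominus>\<^bsub>H\<^esub> x \<in> W"
  using submoduleE[of W] subgroup.one_closed[OF submodule.axioms(1), of W k H] by auto

lemma subsp_diff: "subsp W \<Longrightarrow> x \<in> W \<Longrightarrow> y \<in> W \<Longrightarrow> x \<ominus>\<^bsub>H\<^esub> y \<in> W"
  by (simp add: M.minus_eq subsp_add subsp_minus)

lemma subspI:
  assumes "W \<subseteq> carrier H" "\<zero>\<^bsub>H\<^esub> \<in> W" "\<And>x y. x \<in> W \<Longrightarrow> y \<in> W \<Longrightarrow> x \<boxplus> y \<in> W"
    "\<And>c x. c \<in> carrier k \<Longrightarrow> x \<in> W \<Longrightarrow> c \<bullet> x \<in> W"
  shows "subsp W"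
proof (rule submoduleI[OF assms(1,2)])
  show "\<ominus>\<^bsub>H\<^esub> a \<in> W" if "a \<in> W" for a
    using assms(4)[of "\<ominus>\<^bsub>k\<^esub> \<one>\<^bsub>k\<^esub>" a] that assms(1) by (auto simp: smult_minus_one)
qed (use assms in auto)

lemma subsp_lsum: "subsp W \<Longrightarrow> (\<And>z. z \<in> set zs \<Longrightarrow> F z \<in> W) \<Longrightarrow> lsum F zs \<in> W"
  by (induction zs) (auto simp: subsp_zero subsp_add)

lemma subsp_zero_set: "subsp {\<zero>\<^bsub>H\<^esub>}"
  by (rule subspI) (auto simp: smult_zero_H)

lemma subsp_carrier_H: "subsp (carrier H)"
  by (rule carrier_is_submodule)

lemma subsp_vimage: "lin f \<Longrightarrow> subsp W \<Longrightarrow> subsp {x \<in> carrier H. f x \<in> W}"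
  by (rule subspI) (auto simp: lin_zero lin_add lin_smult subsp_zero subsp_add subsp_smult)

lemma subsp_inter: "subsp V \<Longrightarrow> subsp W \<Longrightarrow> subsp (V \<inter> W)"
  by (rule subspI) (auto simp: subsp_carrier subsp_zero subsp_add subsp_smult)

lemma subsp_plus:
  assumes "subsp V" "subsp W" shows "subsp {v \<boxplus> w | v w. v \<in> V \<and> w \<in> W}"
proof (rule subspI)
  note c = subsp_carrier[OF assms(1)] subsp_carrier[OF assms(2)]
  have plusI: "v \<boxplus> w \<in> {v \<boxplus> w | v w. v \<in> V \<and> w \<in> W}" if "v \<in> V" "w \<in> W" for v w
    using that by blast
  show "{v \<boxplus> w | v w. v \<in> V \<and> w \<in> W} \<subseteq> carrier H" using c by auto
  show "\<zero>\<^bsub>H\<^esub> \<in> {v \<boxplus> w | v w. v \<in> V \<and> w \<in> W}"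
    using plusI[OF subsp_zero[OF assms(1)] subsp_zero[OF assms(2)]] by simp
  fix x assume "x \<in> {v \<boxplus> w | v w. v \<in> V \<and> w \<in> W}"
  then obtain v w where x: "x = v \<boxplus> w" "v \<in> V" "w \<in> W" by auto
  show "c \<bullet> x \<in> {v \<boxplus> w | v w. v \<in> V \<and> w \<in> W}" if "c \<in> carrier k" for c
    using x that c plusI[of "c \<bullet> v" "c \<bullet> w"] subsp_smult[OF assms(1)] subsp_smult[OF assms(2)]
    by (simp add: smult_r_distr)
  fix y assume "y \<in> {v \<boxplus> w | v w. v \<in> V \<and> w \<in> W}"
  then obtain v' w' where y: "y = v' \<boxplus> w'" "v' \<in> V" "w' \<in> W" by auto
  have "x \<boxplus> y = (v \<boxplus> v') \<boxplus> (w \<boxplus> w')" using x y c by (simp add: M.a_ac)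
  then show "x \<boxplus> y \<in> {v \<boxplus> w | v w. v \<in> V \<and> w \<in> W}"
    using x(2,3) y(2,3) plusI[of "v \<boxplus> v'" "w \<boxplus> w'"] subsp_add[OF assms(1)] subsp_add[OF assms(2)]
    by simp
qed

text \<open>A subspace \<open>W\<close> maximal among those containing \<open>U\<close> and missing
  \<open>x\<close> is a complementary hyperplane: adjoining any other vector \<open>y\<close> brings
  \<open>x\<close> in, so \<open>y\<close> is congruent modulo \<open>W\<close> to exactly one
  multiple of \<open>x\<close>. That coefficient is \<open>f y\<close>.\<close>

lemma separating_functional:
  assumes U: "subsp U" and x: "x \<in> carrier H" "x \<notin> U"
  shows "\<exists>f. lfun f \<and> (\<forall>u\<in>U. f u = \<zero>\<^bsub>k\<^esub>) \<and> f x = \<one>\<^bsub>k\<^esub>"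
proof -
  let ?A = "{W. subsp W \<and> U \<subseteq> W \<and> x \<notin> W}"
  have "\<exists>M\<in>?A. \<forall>X\<in>?A. M \<subseteq> X \<longrightarrow> X = M"
  proof (rule subset_Zorn_nonempty)
    show "?A \<noteq> {}" using U x by auto
    fix C assume C: "C \<noteq> {}" "subset.chain ?A C"
    then have sub: "subsp W" "U \<subseteq> W" "x \<notin> W" if "W \<in> C" for W
      using that by (auto simp: subset.chain_def)
    have tot: "V \<subseteq> W \<or> W \<subseteq> V" if "V \<in> C" "W \<in> C" for V W
      using C that by (auto simp: subset.chain_def)
    have "subsp (\<Union>C)"
    proof (rule subspI)
      show "\<Union>C \<subseteq> carrier H" using sub(1) subsp_carrier by blast
      show "\<zero>\<^bsub>H\<^esub> \<in> \<Union>C" using C(1) sub(1) subsp_zero by blast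
      show "y \<boxplus> z \<in> \<Union>C" if yz: "y \<in> \<Union>C" "z \<in> \<Union>C" for y z
      proof -
        obtain V W where VW: "V \<in> C" "W \<in> C" "y \<in> V" "z \<in> W" using yz by auto
        show ?thesis using tot[OF VW(1,2)] VW subsp_add[OF sub(1)] by blast
      qed
      show "c \<bullet> y \<in> \<Union>C" if "c \<in> carrier k" "y \<in> \<Union>C" for c y
        using that subsp_smult[OF sub(1)] by blast
    qed
    moreover have "U \<subseteq> \<Union>C" using sub(2) C(1) by blast
    moreover have "x \<notin> \<Union>C" using sub(3) by blast
    ultimately show "\<Union>C \<in> ?A" by simp
  qed
  then obtain W where W: "subsp W" "U \<subseteq> W" "x \<notin> W"
    and max: "\<And>X. subsp X \<Longrightarrow> U \<subseteq> X \<Longrightarrow> x \<notin> X \<Longrightarrow> W \<subseteq> X \<Longrightarrow> X = W"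
    by auto
  note Wc = subsp_carrier[OF W(1)]
  have ex: "\<exists>c\<in>carrier k. y \<ominus>\<^bsub>H\<^esub> c \<bullet> x \<in> W" if y: "y \<in> carrier H" for y
  proof (cases "y \<in> W")
    case True
    then show ?thesis using x y by (intro bexI[of _ "\<zero>\<^bsub>k\<^esub>"]) (simp_all add: smult_zero_k M.minus_eq)
  next
    case False
    let ?L = "{d \<bullet> y | d. d \<in> carrier k}"
    let ?X = "{v \<boxplus> w | v w. v \<in> W \<and> w \<in> ?L}"
    have L: "subsp ?L"
    proof (rule subspI)
      show "\<zero>\<^bsub>H\<^esub> \<in> ?L" using smult_zero_k[OF y] by force
      show "u \<boxplus> v \<in> ?L" if uv: "u \<in> ?L" "v \<in> ?L" for u v
      proof -
        obtain d d' where "u = d \<bullet> y" "v = d' \<bullet> y" "d \<in> carrier k" "d' \<in> carrier k"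
          using uv by auto
        then show ?thesis using smult_l_distr[of d d' y] y by (auto intro!: exI[of _ "d \<oplus>\<^bsub>k\<^esub> d'"])
      qed
      show "c \<bullet> u \<in> ?L" if "c \<in> carrier k" "u \<in> ?L" for c u
        using that y by (auto simp: smult_assoc1[symmetric])
    qed (use y in auto)
    have X: "subsp ?X" by (rule subsp_plus[OF W(1) L])
    have WX: "W \<subseteq> ?X"
    proof
      fix w assume w: "w \<in> W"
      have "w = w \<boxplus> \<zero>\<^bsub>k\<^esub> \<bullet> y" using w Wc y by (simp add: smult_zero_k)
      then show "w \<in> ?X" using w by auto
    qed
    have "y = \<zero>\<^bsub>H\<^esub> \<boxplus> \<one>\<^bsub>k\<^esub> \<bullet> y" using y by simp
    then have "y \<in> ?X" using subsp_zero[OF W(1)] R.one_closed by blast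
    then have "x \<in> ?X" using max[OF X _ _ WX] W(2) WX False by blast
    then obtain w d where wd: "x = w \<boxplus> d \<bullet> y" "w \<in> W" "d \<in> carrier k" by auto
    have d: "d \<noteq> \<zero>\<^bsub>k\<^esub>" using wd W(3) Wc y by (auto simp: smult_zero_k)
    let ?d = "inv\<^bsub>k\<^esub> d"
    have dc: "?d \<in> carrier k" "?d \<otimes>\<^bsub>k\<^esub> d = \<one>\<^bsub>k\<^esub>"
      using d wd(3) by (auto simp: R.field_Units intro: R.Units_inv_closed R.Units_l_inv)
    have "?d \<bullet> x = ?d \<bullet> w \<boxplus> y"
      using wd dc y Wc by (simp add: smult_r_distr smult_assoc1[symmetric])
    then have "y \<ominus>\<^bsub>H\<^esub> ?d \<bullet> x = \<ominus>\<^bsub>H\<^esub> (?d \<bullet> w)"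
      using wd dc y Wc M.a_lcomm[of y "\<ominus>\<^bsub>H\<^esub> (?d \<bullet> w)" "\<ominus>\<^bsub>H\<^esub> y"]
      by (simp add: M.minus_eq M.minus_add M.r_neg)
    then have "y \<ominus>\<^bsub>H\<^esub> ?d \<bullet> x \<in> W"
      using wd(2) dc(1) subsp_minus[OF W(1) subsp_smult[OF W(1)]] by simp
    then show ?thesis using dc(1) by blast
  qed
  have uniq: "c = c'" if "c \<in> carrier k" "c' \<in> carrier k" "y \<in> carrier H"
    "y \<ominus>\<^bsub>H\<^esub> c \<bullet> x \<in> W" "y \<ominus>\<^bsub>H\<^esub> c' \<bullet> x \<in> W" for c c' y
  proof (rule ccontr)
    assume ne: "c \<noteq> c'"
    let ?e = "c \<ominus>\<^bsub>k\<^esub> c'"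
    have e: "?e \<in> carrier k" "?e \<noteq> \<zero>\<^bsub>k\<^esub>" using that ne by auto
    have "?e \<bullet> x = (y \<ominus>\<^bsub>H\<^esub> c' \<bullet> x) \<ominus>\<^bsub>H\<^esub> (y \<ominus>\<^bsub>H\<^esub> c \<bullet> x)"
    proof -
      have m: "(\<ominus>\<^bsub>k\<^esub> c') \<bullet> x = \<ominus>\<^bsub>H\<^esub> (c' \<bullet> x)"
        using that x smult_l_distr[of "\<ominus>\<^bsub>k\<^esub> c'" c' x]
        by (simp add: R.l_neg smult_zero_k M.minus_equality)
      have "(y \<ominus>\<^bsub>H\<^esub> c' \<bullet> x) \<ominus>\<^bsub>H\<^esub> (y \<ominus>\<^bsub>H\<^esub> c \<bullet> x) = (y \<ominus>\<^bsub>H\<^esub> y) \<boxplus> (c \<bullet> x \<ominus>\<^bsub>H\<^esub> c' \<bullet> x)"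
        using that x by (simp add: M.minus_eq M.minus_add M.a_ac)
      then show ?thesis using that x m by (simp add: R.minus_eq M.minus_eq smult_l_distr M.r_neg)
    qed
    then have ex: "?e \<bullet> x \<in> W" using subsp_diff[OF W(1) that(5,4)] by simp
    have "?e \<in> Units k" using e R.field_Units by simp
    then have i: "inv\<^bsub>k\<^esub> ?e \<otimes>\<^bsub>k\<^esub> ?e = \<one>\<^bsub>k\<^esub>" "inv\<^bsub>k\<^esub> ?e \<in> carrier k"
      by (rule R.Units_l_inv, rule R.Units_inv_closed)
    show False
      using subsp_smult[OF W(1) i(2) ex] W(3) smult_assoc1[OF i(2) e(1) x(1)] x(1) i(1) by simp
  qed
  define f where "f y = (THE c. c \<in> carrier k \<and> y \<ominus>\<^bsub>H\<^esub> c \<bullet> x \<in> W)" for y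
  have fI: "f y = c" if "c \<in> carrier k" "y \<in> carrier H" "y \<ominus>\<^bsub>H\<^esub> c \<bullet> x \<in> W" for c y
    unfolding f_def by (rule the_equality) (use that uniq in auto)
  have f: "f y \<in> carrier k" "y \<ominus>\<^bsub>H\<^esub> f y \<bullet> x \<in> W" if y: "y \<in> carrier H" for y
    using ex[OF y] fI[OF _ y] by auto
  have "lfun f"
    unfolding lfun_def
  proof (intro conjI ballI)
    show "f (y \<boxplus> z) = f y \<oplus>\<^bsub>k\<^esub> f z" if "y \<in> carrier H" "z \<in> carrier H" for y z
    proof (rule fI)
      have "y \<boxplus> z \<ominus>\<^bsub>H\<^esub> (f y \<oplus>\<^bsub>k\<^esub> f z) \<bullet> x = (y \<ominus>\<^bsub>H\<^esub> f y \<bullet> x) \<boxplus> (z \<ominus>\<^bsub>H\<^esub> f z \<bullet> x)"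
        using that f x by (simp add: smult_l_distr M.minus_eq M.minus_add M.a_ac)
      then show "y \<boxplus> z \<ominus>\<^bsub>H\<^esub> (f y \<oplus>\<^bsub>k\<^esub> f z) \<bullet> x \<in> W"
        using subsp_add[OF W(1) f(2) f(2)] that by simp
    qed (use that f in auto)
    show "f (c \<bullet> y) = c \<otimes>\<^bsub>k\<^esub> f y" if "c \<in> carrier k" "y \<in> carrier H" for c y
    proof (rule fI)
      have "lin (\<lambda>z. c \<bullet> z)" using that by (intro lin_smult_lin lin_id)
      then have "c \<bullet> y \<ominus>\<^bsub>H\<^esub> (c \<otimes>\<^bsub>k\<^esub> f y) \<bullet> x = c \<bullet> (y \<ominus>\<^bsub>H\<^esub> f y \<bullet> x)"
        using that f x lin_diff[of "\<lambda>z. c \<bullet> z" y "f y \<bullet> x"] by (simp add: smult_assoc1)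
      then show "c \<bullet> y \<ominus>\<^bsub>H\<^esub> (c \<otimes>\<^bsub>k\<^esub> f y) \<bullet> x \<in> W"
        using subsp_smult[OF W(1) that(1) f(2)] that by simp
    qed (use that f in auto)
  qed (use f in auto)
  moreover have "f u = \<zero>\<^bsub>k\<^esub>" if "u \<in> U" for u
    using that W(2) Wc x by (intro fI) (auto simp: smult_zero_k M.minus_eq)
  moreover have "f x = \<one>\<^bsub>k\<^esub>"
    using x subsp_zero[OF W(1)] by (intro fI) (auto simp: M.minus_eq M.r_neg)
  ultimately show ?thesis by auto
qed

text \<open>Dual bases of \<open>V / U\<close>, with the vectors lifted into a prescribed set
  \<open>E\<close> and the functionals extended to all of \<open>H\<close>. Only the expansion
  formula modulo \<open>U\<close> is demanded; it is exactly what evaluating and permuting traces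
  calls for.\<close>

definition dual_family :: "('a \<times> ('a \<Rightarrow> 'k)) list \<Rightarrow> 'a set \<Rightarrow> 'a set \<Rightarrow> 'a set \<Rightarrow> bool" where
  "dual_family es E U V \<longleftrightarrow>
     (\<forall>(e, f)\<in>set es. e \<in> E \<and> lfun f \<and> (\<forall>u\<in>U. f u = \<zero>\<^bsub>k\<^esub>)) \<and>
     (\<forall>x\<in>V. x \<ominus>\<^bsub>H\<^esub> lsum (\<lambda>(e, f). f x \<bullet> e) es \<in> U)"

lemma dual_familyD:
  assumes "dual_family es E U V"
  shows "\<And>e f. (e, f) \<in> set es \<Longrightarrow> e \<in> E" "\<And>e f. (e, f) \<in> set es \<Longrightarrow> lfun f"
    "\<And>e f u. (e, f) \<in> set es \<Longrightarrow> u \<in> U \<Longrightarrow> f u = \<zero>\<^bsub>k\<^esub>"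
    "\<And>x. x \<in> V \<Longrightarrow> x \<ominus>\<^bsub>H\<^esub> lsum (\<lambda>(e, f). f x \<bullet> e) es \<in> U"
  using assms by (auto simp: dual_family_def)

lemma dual_family_zero:
  assumes "dual_family es E U V" "E \<subseteq> carrier H" "u \<in> U"
  shows "lsum (\<lambda>(e, f). f u \<bullet> e) es = \<zero>\<^bsub>H\<^esub>"
proof (rule lsum_zero, clarify)
  fix e f assume ef: "(e, f) \<in> set es"
  then show "f u \<bullet> e = \<zero>\<^bsub>H\<^esub>"
    using dual_familyD(1)[OF assms(1) ef] dual_familyD(3)[OF assms(1) ef assms(3)] assms(2)
    by (auto simp: smult_zero_k)
qed

lemma lin_expansion:
  assumes "\<And>e f. (e, f) \<in> set es \<Longrightarrow> e \<in> carrier H" "\<And>e f. (e, f) \<in> set es \<Longrightarrow> lfun f"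
  shows "lin (\<lambda>x. lsum (\<lambda>(e, f). f x \<bullet> e) es)"
  using assms by (auto intro!: lin_lsum_param lin_lfun lin_id simp: split_beta)

lemma lin_minus_fun: "lin f \<Longrightarrow> lin g \<Longrightarrow> lin (\<lambda>x. f x \<ominus>\<^bsub>H\<^esub> g x)"
proof -
  assume f: "lin f" and g: "lin g"
  have "lin (\<lambda>x. f x \<boxplus> (\<ominus>\<^bsub>k\<^esub> \<one>\<^bsub>k\<^esub>) \<bullet> g x)"
    by (intro lin_plus lin_smult_lin f g) simp
  then show ?thesis
    using g by (simp add: lin_def M.minus_eq smult_minus_one)
qed

text \<open>An elimination step. If \<open>h\<close> is not yet expanded correctly modulo
  \<open>U\<close>, a functional \<open>\<phi>\<close> with \<open>\<phi> h = 1\<close> is taken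
  that vanishes on the whole subspace \<open>?W\<close> already treated. The old functionals are
  composed with \<open>?R\<close>, so that the new remainder is \<open>?P\<close> after
  \<open>?R\<close>: it is unchanged on \<open>?W\<close> and vanishes at \<open>h\<close>.\<close>

lemma dual_family_list:
  assumes U: "subsp U" and bs: "set bs \<subseteq> carrier H"
  shows "\<exists>es. dual_family es (carrier H) U (set bs)"
  using bs
proof (induction bs)
  case Nil
  show ?case by (rule exI[of _ "[]"]) (simp add: dual_family_def)
next
  case (Cons h bs)
  then obtain es where es: "dual_family es (carrier H) U (set bs)" by auto
  note D = dual_familyD[OF es]
  let ?P = "\<lambda>x. x \<ominus>\<^bsub>H\<^esub> lsum (\<lambda>(e, f). f x \<bullet> e) es"
  let ?W = "{x \<in> carrier H. ?P x \<in> U}"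
  have P: "lin ?P" using D(1,2) by (intro lin_minus_fun lin_id lin_expansion) auto
  have W: "subsp ?W" by (rule subsp_vimage[OF P U])
  have h: "h \<in> carrier H" using Cons.prems by simp
  have UW: "U \<subseteq> ?W"
  proof
    fix u assume u: "u \<in> U"
    have "lsum (\<lambda>(e, f). f u \<bullet> e) es = \<zero>\<^bsub>H\<^esub>"
      by (rule dual_family_zero[OF es order_refl u])
    then show "u \<in> ?W" using u subsp_carrier[OF U] by (simp add: M.minus_eq)
  qed
  show ?case
  proof (cases "h \<in> ?W")
    case True
    then have "dual_family es (carrier H) U (set (h # bs))"
      using es by (auto simp: dual_family_def)
    then show ?thesis by blast
  next
    case False
    obtain \<phi> where \<phi>: "lfun \<phi>" "\<And>u. u \<in> ?W \<Longrightarrow> \<phi> u = \<zero>\<^bsub>k\<^esub>" "\<phi> h = \<one>\<^bsub>k\<^esub>"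
      using separating_functional[OF W h False] by auto
    let ?R = "\<lambda>x. x \<ominus>\<^bsub>H\<^esub> \<phi> x \<bullet> h"
    have R: "lin ?R" using h \<phi>(1) by (intro lin_minus_fun lin_id lin_lfun)
    let ?es = "(h, \<phi>) # map (\<lambda>(e, f). (e, \<lambda>x. f (?R x))) es"
    have R0: "?R u = u" if "u \<in> ?W" for u
      using \<phi>(2)[OF that] that h by (simp add: smult_zero_k M.minus_eq)
    have lf: "lfun (\<lambda>x. f (?R x))" if "lfun f" for f
      using that R by (simp add: lfun_def lin_def)
    have sum: "lsum (\<lambda>(e, f). f x \<bullet> e) ?es = \<phi> x \<bullet> h \<boxplus> lsum (\<lambda>(e, f). f (?R x) \<bullet> e) es"
      for x by (simp add: lprod_map case_prod_unfold)
    have lc: "lsum (\<lambda>(e, f). f y \<bullet> e) es \<in> carrier H" if "y \<in> carrier H" for y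
      using lin_closed[OF lin_expansion] D(1,2) that by blast
    have "x \<ominus>\<^bsub>H\<^esub> lsum (\<lambda>(e, f). f x \<bullet> e) ?es \<in> U" if x: "x \<in> set (h # bs)" for x
    proof -
      have xc: "x \<in> carrier H" using x Cons.prems by auto
      have "x \<ominus>\<^bsub>H\<^esub> lsum (\<lambda>(e, f). f x \<bullet> e) ?es = ?P (?R x)"
        unfolding sum using xc h lc[OF lin_closed[OF R xc]] lfun_closed[OF \<phi>(1) xc]
        by (simp add: M.minus_eq M.minus_add M.a_ac)
      moreover have "?P (?R x) \<in> U"
      proof (cases "x = h")
        case True
        have "?R h = \<zero>\<^bsub>H\<^esub>" using h \<phi>(3) by (simp add: M.minus_eq M.r_neg)
        then show ?thesis using True lin_zero[OF P] subsp_zero[OF U] by simp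
      next
        case False
        then have "x \<in> ?W" using x D(4) xc by auto
        then show ?thesis using R0 by simp
      qed
      ultimately show ?thesis by simp
    qed
    moreover have "e \<in> carrier H \<and> lfun f \<and> (\<forall>u\<in>U. f u = \<zero>\<^bsub>k\<^esub>)" if ef: "(e, f) \<in> set ?es" for e f
    proof (cases "e = h \<and> f = \<phi>")
      case True
      then show ?thesis using h \<phi>(1) \<phi>(2)[OF subsetD[OF UW]] by blast
    next
      case False
      then obtain g where g: "(e, g) \<in> set es" "f = (\<lambda>x. g (?R x))" using ef by auto
      have "f u = \<zero>\<^bsub>k\<^esub>" if "u \<in> U" for u
        using D(3)[OF g(1) that] R0[OF subsetD[OF UW that]] g(2) by simp
      then show ?thesis using D(1)[OF g(1)] lf[OF D(2)[OF g(1)]] g(2) by blast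
    qed
    ultimately have "dual_family ?es (carrier H) U (set (h # bs))"
      unfolding dual_family_def by blast
    then show ?thesis by blast
  qed
qed

end

locale fd_hopf_algebra = hopf_algebra k H
  for k :: "('k, 'm) ring_scheme" (structure) and H :: "('k, 'a) hopf" (structure) +
  assumes fd: "finite_dimensional k H"
begin

text \<open>The vectors whose expansion is correct modulo \<open>U\<close> form a subspace, so a
  finite spanning set is enough.\<close>

lemma dual_family_carrier:
  assumes U: "subsp U"
  shows "\<exists>es. dual_family es (carrier H) U (carrier H)"
proof -
  obtain B where B: "finite B" "B \<subseteq> carrier H"
    "\<And>x. x \<in> carrier H \<Longrightarrow> \<exists>c \<in> B \<rightarrow> carrier k. x = (\<Oplus>\<^bsub>H\<^esub>b\<in>B. c b \<bullet> b)"
    using fd unfolding finite_dimensional_def by blast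
  obtain bs where bs: "set bs = B" using finite_list[OF B(1)] by auto
  obtain es where es: "dual_family es (carrier H) U (set bs)"
    using dual_family_list[OF U] bs B(2) by blast
  note D = dual_familyD[OF es]
  let ?W = "{x \<in> carrier H. x \<ominus>\<^bsub>H\<^esub> lsum (\<lambda>(e, f). f x \<bullet> e) es \<in> U}"
  have W: "subsp ?W"
    by (rule subsp_vimage[OF lin_minus_fun[OF lin_id lin_expansion] U]) (use D in auto)
  have BW: "b \<in> ?W" if "b \<in> B" for b using that D(4) bs B(2) by auto
  have "(\<Oplus>\<^bsub>H\<^esub>b\<in>A. c b \<bullet> b) \<in> ?W" if "c \<in> A \<rightarrow> carrier k" "A \<subseteq> B" for c A
    using finite_subset[OF that(2) B(1)] that
  proof (induction A)
    case empty then show ?case using subsp_zero[OF W] by simp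
  next
    case (insert b A)
    have c: "c \<in> A \<rightarrow> carrier k" "c b \<in> carrier k" and A: "A \<subseteq> B" "b \<in> B"
      using insert.prems by auto
    have cl: "(\<lambda>b. c b \<bullet> b) \<in> A \<rightarrow> carrier H" "c b \<bullet> b \<in> carrier H"
      using c A B(2) by auto
    have "(\<Oplus>\<^bsub>H\<^esub>b\<in>insert b A. c b \<bullet> b) = c b \<bullet> b \<boxplus> (\<Oplus>\<^bsub>H\<^esub>b\<in>A. c b \<bullet> b)"
      by (rule M.finsum_insert[OF insert.hyps cl])
    then show ?case
      using subsp_add[OF W subsp_smult[OF W c(2) BW[OF A(2)]] insert.IH[OF c(1) A(1)]] by simp
  qed
  then have "x \<in> ?W" if "x \<in> carrier H" for x
    using B(3)[OF that] by auto
  then have "dual_family es (carrier H) U (carrier H)"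
    using es by (auto simp: dual_family_def)
  then show ?thesis by blast
qed

text \<open>The remainder of the expansion modulo \<open>V\<close> always lies in \<open>V\<close>,
  and equals \<open>x\<close> for \<open>x\<close> in \<open>V\<close> because the functionals
  vanish there.\<close>

lemma linear_projection:
  assumes V: "subsp V"
  shows "\<exists>E. lin E \<and> (\<forall>x\<in>carrier H. E x \<in> V) \<and> (\<forall>x\<in>V. E x = x)"
proof -
  obtain es where es: "dual_family es (carrier H) V (carrier H)" using dual_family_carrier[OF V] ..
  note D = dual_familyD[OF es]
  let ?E = "\<lambda>x. x \<ominus>\<^bsub>H\<^esub> lsum (\<lambda>(e, f). f x \<bullet> e) es"
  have "lsum (\<lambda>(e, f). f x \<bullet> e) es = \<zero>\<^bsub>H\<^esub>" if "x \<in> V" for x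
    by (rule dual_family_zero[OF es order_refl that])
  then have "?E x = x" if "x \<in> V" for x
    using that subsp_carrier[OF V] by (simp add: M.minus_eq)
  moreover have "lin ?E" using D(1,2) by (intro lin_minus_fun lin_id lin_expansion) auto
  ultimately show ?thesis using D(4) by (intro exI[of _ ?E]) blast
qed

text \<open>Each vector of a dual family for \<open>U\<close> is projected into \<open>V\<close> and
  then replaced by a representative of its class in \<open>A\<close>; both changes affect the
  expansion of elements of \<open>V\<close> only by elements of \<open>U\<close>. This allows dual
  bases of \<open>D / D B\<^sup>+\<close> with vectors in a Hopf subalgebra that maps onto
  it.\<close>

lemma dual_family_exists:
  assumes U: "subsp U" and V: "subsp V" and UV: "U \<subseteq> V"
    and A: "A \<subseteq> carrier H" "\<And>x. x \<in> V \<Longrightarrow> \<exists>a\<in>A. x \<ominus>\<^bsub>H\<^esub> a \<in> U"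
  shows "\<exists>es. dual_family es A U V"
proof -
  obtain es where es: "dual_family es (carrier H) U (carrier H)" using dual_family_carrier[OF U] ..
  note D = dual_familyD[OF es]
  obtain E where E: "lin E" "\<And>x. x \<in> carrier H \<Longrightarrow> E x \<in> V" "\<And>x. x \<in> V \<Longrightarrow> E x = x"
    using linear_projection[OF V] by blast
  have "\<forall>x\<in>carrier H. \<exists>a\<in>A. E x \<ominus>\<^bsub>H\<^esub> a \<in> U" using E(2) A(2) by blast
  then obtain r where r: "\<And>x. x \<in> carrier H \<Longrightarrow> r x \<in> A" "\<And>x. x \<in> carrier H \<Longrightarrow> E x \<ominus>\<^bsub>H\<^esub> r x \<in> U"
    by metis
  let ?es = "map (\<lambda>(e, f). (r e, f)) es"
  have rc: "r x \<in> carrier H" if "x \<in> carrier H" for x using r(1)[OF that] A(1) by blast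
  have "x \<ominus>\<^bsub>H\<^esub> lsum (\<lambda>(e, f). f x \<bullet> e) ?es \<in> U" if x: "x \<in> V" for x
  proof -
    have xc: "x \<in> carrier H" by (rule subsp_carrier[OF V x])
    let ?s = "\<lambda>g. lsum (\<lambda>(e, f). f x \<bullet> g e) es"
    have fx: "e \<in> carrier H" "f x \<in> carrier k" if "(e, f) \<in> set es" for e f
      using D(1,2)[OF that] lfun_closed xc by auto
    have sc: "?s g \<in> carrier H" if "\<And>y. y \<in> carrier H \<Longrightarrow> g y \<in> carrier H" for g
      by (rule lsum_closed) (use fx that in auto)
    have "E (x \<ominus>\<^bsub>H\<^esub> ?s (\<lambda>e. e)) = x \<ominus>\<^bsub>H\<^esub> ?s E"
    proof -
      have "E (?s (\<lambda>e. e)) = ?s E"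
        by (subst lin_lsum[OF E(1)]) (use fx in \<open>auto intro!: lprod_cong simp: lin_smult[OF E(1)]\<close>)
      then show ?thesis using lin_diff[OF E(1) xc sc[of "\<lambda>e. e"]] E(3)[OF x] by simp
    qed
    moreover have "x \<ominus>\<^bsub>H\<^esub> ?s (\<lambda>e. e) \<in> U" by (rule D(4)[OF xc])
    ultimately have 1: "x \<ominus>\<^bsub>H\<^esub> ?s E \<in> U" using E(3) UV by auto
    have 2: "?s (\<lambda>e. E e \<ominus>\<^bsub>H\<^esub> r e) \<in> U"
      by (rule subsp_lsum[OF U]) (use fx r in \<open>auto intro!: subsp_smult[OF U]\<close>)
    have "?s E = ?s r \<boxplus> ?s (\<lambda>e. E e \<ominus>\<^bsub>H\<^esub> r e)"
    proof -
      have "?s r \<boxplus> ?s (\<lambda>e. E e \<ominus>\<^bsub>H\<^esub> r e) =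
          lsum (\<lambda>z. (case z of (e, f) \<Rightarrow> f x \<bullet> r e) \<boxplus> (case z of (e, f) \<Rightarrow> f x \<bullet> (E e \<ominus>\<^bsub>H\<^esub> r e))) es"
        by (rule lsum_add[symmetric]) (use fx rc lin_closed[OF E(1)] in auto)
      also have "\<dots> = ?s E"
      proof (rule lprod_cong, clarsimp)
        fix e f assume ef: "(e, f) \<in> set es"
        have "r e \<boxplus> (E e \<ominus>\<^bsub>H\<^esub> r e) = E e"
          using fx[OF ef] rc lin_closed[OF E(1)] by (simp add: M.minus_eq M.a_lcomm M.r_neg)
        then show "f x \<bullet> r e \<boxplus> f x \<bullet> (E e \<ominus>\<^bsub>H\<^esub> r e) = f x \<bullet> E e"
          using fx[OF ef] rc lin_closed[OF E(1)] by (simp add: smult_r_distr[symmetric])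
      qed
      finally show ?thesis by simp
    qed
    moreover have sr: "?s r \<in> carrier H" by (rule sc) (rule rc)
    ultimately have "x \<ominus>\<^bsub>H\<^esub> ?s r = (x \<ominus>\<^bsub>H\<^esub> ?s E) \<boxplus> ?s (\<lambda>e. E e \<ominus>\<^bsub>H\<^esub> r e)"
    proof -
      assume s: "?s E = ?s r \<boxplus> ?s (\<lambda>e. E e \<ominus>\<^bsub>H\<^esub> r e)"
      have d: "?s (\<lambda>e. E e \<ominus>\<^bsub>H\<^esub> r e) \<in> carrier H" using 2 subsp_carrier[OF U] by blast
      show ?thesis unfolding s using xc sr d
        by (simp add: M.minus_eq M.minus_add M.a_assoc M.l_neg)
    qed
    then have "x \<ominus>\<^bsub>H\<^esub> ?s r \<in> U" using subsp_add[OF U 1 2] by simp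
    then show ?thesis by (simp add: lprod_map case_prod_unfold)
  qed
  then have "dual_family ?es A U V"
    using D r(1) unfolding dual_family_def by auto
  then show ?thesis by blast
qed

end

section \<open>Hopf subalgebras\<close>

context hopf_algebra
begin

abbreviation hs :: "'a set \<Rightarrow> bool" where "hs K \<equiv> hopf_subalgebra k H K"

lemma hs_subsp: "hs K \<Longrightarrow> subsp K"
  by (simp add: hopf_subalgebra_def)

lemma hs_carrier: "hs K \<Longrightarrow> x \<in> K \<Longrightarrow> x \<in> carrier H"
  using subsp_carrier[OF hs_subsp] .

lemma hs_mult: "hs K \<Longrightarrow> x \<in> K \<Longrightarrow> y \<in> K \<Longrightarrow> x \<star> y \<in> K"
  and hs_one: "hs K \<Longrightarrow> \<e> \<in> K"
  using subringE(3,6)[of K H] by (auto simp: hopf_subalgebra_def)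

lemma hs_antipode: "hs K \<Longrightarrow> x \<in> K \<Longrightarrow> \<S> x \<in> K"
  by (simp add: hopf_subalgebra_def)

lemma hs_add: "hs K \<Longrightarrow> x \<in> K \<Longrightarrow> y \<in> K \<Longrightarrow> x \<boxplus> y \<in> K"
  and hs_smult: "hs K \<Longrightarrow> c \<in> carrier k \<Longrightarrow> x \<in> K \<Longrightarrow> c \<bullet> x \<in> K"
  by (auto intro: subsp_add subsp_smult hs_subsp)

lemma hs_comult_list:
  assumes K: "hs K" and h: "h \<in> K"
  shows "\<exists>zs. set zs \<subseteq> K \<times> K \<and>
    comult H h = lprod (tensor_group k H H) (\<lambda>(x, y). pure_tensor k H H x y) zs"
proof (rule tensor_generate_rep[OF add_smult_closed_H add_smult_closed_H abelian_group_H])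
  show "comult H h \<in> generate (tensor_group k H H) {pure_tensor k H H y z |y z. y \<in> K \<and> z \<in> K}"
    using K h by (simp add: hopf_subalgebra_def)
qed (use subsp_minus[OF hs_subsp[OF K]] hs_carrier[OF K] in auto)

text \<open>The list fixed by \<open>comult_list\<close> has its legs in \<open>H\<close> only. For
  bilinear integrands it may be exchanged for a list with legs in \<open>K\<close>, whence the
  bilinearity assumptions of the next two facts.\<close>

lemma hs_sw_rep:
  assumes K: "hs K" and h: "h \<in> K"
  obtains zs where "set zs \<subseteq> K \<times> K" "\<And>\<beta>. bil \<beta> \<Longrightarrow> sw \<beta> h = lsum (\<lambda>(x, y). \<beta> x y) zs"
proof -
  obtain zs where zs: "set zs \<subseteq> K \<times> K"
    "comult H h = lprod (tensor_group k H H) (\<lambda>(x, y). pure_tensor k H H x y) zs"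
    using hs_comult_list[OF K h] by auto
  have "sw \<beta> h = lsum (\<lambda>(x, y). \<beta> x y) zs" if b: "bil \<beta>" for \<beta>
    unfolding sw_eq_tensor_lift[OF b hs_carrier[OF K h]] zs(2)
    by (rule comm_group.tensor_lift_lprod[OF comm_group_H add_smult_closed_H add_smult_closed_H
          bil_balanced[OF b]]) (use zs(1) hs_carrier[OF K] in auto)
  then show ?thesis using that zs(1) by blast
qed

lemma sw_sub_cong:
  assumes "hs K" "h \<in> K" "bil \<beta>" "bil \<beta>'" "\<And>x y. x \<in> K \<Longrightarrow> y \<in> K \<Longrightarrow> \<beta> x y = \<beta>' x y"
  shows "sw \<beta> h = sw \<beta>' h"
proof -
  obtain zs where zs: "set zs \<subseteq> K \<times> K" "\<And>\<beta>. bil \<beta> \<Longrightarrow> sw \<beta> h = lsum (\<lambda>(x, y). \<beta> x y) zs"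
    using hs_sw_rep[OF assms(1,2)] by blast
  show ?thesis
    unfolding zs(2)[OF assms(3)] zs(2)[OF assms(4)] by (rule lprod_cong) (use zs(1) assms(5) in auto)
qed

lemma sw_sub_mem:
  assumes "hs K" "h \<in> K" "bil \<beta>" "subsp W" "\<And>x y. x \<in> K \<Longrightarrow> y \<in> K \<Longrightarrow> \<beta> x y \<in> W"
  shows "sw \<beta> h \<in> W"
proof -
  obtain zs where zs: "set zs \<subseteq> K \<times> K" "\<And>\<beta>. bil \<beta> \<Longrightarrow> sw \<beta> h = lsum (\<lambda>(x, y). \<beta> x y) zs"
    using hs_sw_rep[OF assms(1,2)] by blast
  show ?thesis
    unfolding zs(2)[OF assms(3)] by (rule subsp_lsum[OF assms(4)]) (use zs(1) assms(5) in auto)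
qed

end

context fd_hopf_algebra
begin

text \<open>
  A Hopf subalgebra \<open>N\<close> is a direct summand of \<open>H\<close> as a right \<open>N\<close>-module.  The retraction is
  \<open>p a = \<Sum>\<^sub>i f\<^sub>i (S (g\<^sub>i\<^sub>1)) g\<^sub>i\<^sub>2\<close> with \<open>g\<^sub>i = E (a e\<^sub>i\<^sub>1) S (e\<^sub>i\<^sub>2)\<close>, where \<open>(e\<^sub>i, f\<^sub>i)\<close> are dual bases of \<open>N\<close>
  and \<open>E\<close> is a linear projection onto \<open>N\<close>; its linearity is the cyclicity of the trace.
\<close>

lemma hopf_subalgebra_retraction:
  assumes N: "hs N"
  shows "\<exists>p. lin p \<and> (\<forall>a\<in>carrier H. p a \<in> N) \<and> p \<e> = \<e> \<and>
    (\<forall>a\<in>carrier H. \<forall>c\<in>N. p (a \<star> c) = p a \<star> c)"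
proof -
  note Ns = hs_subsp[OF N] and Nc [simp] = hs_carrier[OF N]
  obtain E where E: "lin E" "\<And>x. x \<in> carrier H \<Longrightarrow> E x \<in> N" "\<And>x. x \<in> N \<Longrightarrow> E x = x"
    using linear_projection[OF Ns] by blast
  have Ec [simp]: "E x \<in> carrier H" if "x \<in> carrier H" for x using E(2) that by simp
  obtain es where es: "dual_family es N {\<zero>\<^bsub>H\<^esub>} N"
  proof -
    have "\<exists>es. dual_family es N {\<zero>\<^bsub>H\<^esub>} N"
      by (rule dual_family_exists[OF subsp_zero_set Ns])
         (use subsp_zero[OF Ns] in \<open>auto intro!: bexI simp: M.minus_eq M.r_neg\<close>)
    then show ?thesis using that by blast
  qed
  have eN: "fst z \<in> N" and lf: "lfun (snd z)" if "z \<in> set es" for z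
    using dual_familyD(1,2)[OF es, of "fst z" "snd z"] that by auto
  have ec [simp]: "fst z \<in> carrier H" if "z \<in> set es" for z using eN that by simp
  have fc [simp]: "snd z x \<in> carrier k" if "z \<in> set es" "x \<in> carrier H" for z x
    using lfun_closed[OF lf] that by simp
  have expand: "lsum (\<lambda>z. snd z x \<bullet> fst z) es = x" if x: "x \<in> N" for x
  proof -
    have c: "lsum (\<lambda>z. snd z x \<bullet> fst z) es \<in> carrier H" by (rule lsum_closed) (use x in auto)
    have "x \<ominus>\<^bsub>H\<^esub> lsum (\<lambda>z. snd z x \<bullet> fst z) es = \<zero>\<^bsub>H\<^esub>"
      using dual_familyD(4)[OF es x] by (simp add: case_prod_unfold)
    then show ?thesis using c M.r_right_minus_eq[OF Nc[OF x] c] by simp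
  qed
  note li = lin_intros lin_comp[OF E(1)]
  define G where "G a x = sw (\<lambda>s t. E (a \<star> s) \<star> \<S> t) x" for a x
  have G_lin1: "lin (\<lambda>a. G (g a) x)" if "x \<in> carrier H" "lin g" for x g
    unfolding G_def using that by (intro li; simp)
  have G_lin2: "lin (\<lambda>x. G a (g x))" if "a \<in> carrier H" "lin g" for a g
    unfolding G_def using that by (intro li; simp)
  note li = li G_lin1 G_lin2
  have Gc [simp]: "G a x \<in> carrier H" if "a \<in> carrier H" "x \<in> carrier H" for a x
    unfolding G_def using that by simp
  have GN: "G a x \<in> N" if "a \<in> carrier H" "x \<in> N" for a x
    unfolding G_def
    by (rule sw_sub_mem[OF N that(2) _ Ns])
       (use that in \<open>(intro li; simp) | simp add: hs_mult[OF N] hs_antipode[OF N] E(2)\<close>)+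
  \<comment> \<open>\<open>R z v g\<close> is \<open>f(S g1) g2 v\<close>. Summed over the dual
    basis with \<open>g = G a (fst z)\<close> it is the partial trace, over the first tensor factor,
    of \<open>x \<mapsto> S(G(a,x)_1) \<otimes> G(a,x)_2 v\<close>.\<close>
  define R where "R z v = sw (\<lambda>X Y. snd z (\<S> X) \<bullet> (Y \<star> v))" for z :: "'a \<times> ('a \<Rightarrow> 'k)" and v
  have R_lin: "lin (\<lambda>x. R z v (g x))" if "z \<in> set es" "v \<in> carrier H" "lin g" for z v g
    unfolding R_def using that by (intro li lin_lfun[OF lf]; simp)
  have R_lin2: "lin (\<lambda>v. R z v x)" if "z \<in> set es" "x \<in> carrier H" for z x
    unfolding R_def using that by (intro li lin_lfun[OF lf]; simp)
  have Rc [simp]: "R z v x \<in> carrier H" if "z \<in> set es" "v \<in> carrier H" for z v x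
    unfolding R_def using that by simp
  define p where "p a = lsum (\<lambda>z. R z \<e> (G a (fst z))) es" for a
  have p_lin: "lin p"
    unfolding p_def by (intro lin_lsum_param R_lin G_lin1 lin_id) simp_all
  have pN: "p a \<in> N" if a: "a \<in> carrier H" for a
    unfolding p_def
  proof (rule subsp_lsum[OF Ns])
    fix z assume z: "z \<in> set es"
    show "R z \<e> (G a (fst z)) \<in> N"
      unfolding R_def
      by (rule sw_sub_mem[OF N GN[OF a eN[OF z]] _ Ns])
         (use z in \<open>(intro li lin_lfun[OF lf]; simp) | simp add: subsp_smult[OF Ns]\<close>)+
  qed
  have p_one: "p \<e> = \<e>"
  proof -
    \<comment> \<open>Here the traced map has rank one, and its trace is \<open>\<epsilon>\<close>
      of the expansion of the unit, hence one: no integral has to be normalised.\<close>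
    have G1: "G \<e> x = \<epsilon> x \<bullet> \<e>" if x: "x \<in> N" for x
    proof -
      have "G \<e> x = sw (\<lambda>s t. s \<star> \<S> t) x"
        unfolding G_def
        by (rule sw_sub_cong[OF N x]) ((intro li; simp) | simp add: E(3))+
      then show ?thesis using sw_antipode_right[OF lin_id, of x] x by simp
    qed
    have "R z \<e> (G \<e> (fst z)) = \<epsilon> (snd z \<e> \<bullet> fst z) \<bullet> \<e>" if z: "z \<in> set es" for z
    proof -
      have b: "bil (\<lambda>X Y. snd z (\<S> X) \<bullet> (Y \<star> \<e>))"
        using z by (intro li lin_lfun[OF lf]; simp)
      have "R z \<e> (G \<e> (fst z)) = \<epsilon> (fst z) \<bullet> (snd z (\<S> \<e>) \<bullet> (\<e> \<star> \<e>))"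
        unfolding G1[OF eN[OF z]] R_def
          sw_smult[OF b counit_closed[OF ec[OF z]] M.one_closed] sw_one[OF b] ..
      then show ?thesis
        using z by (simp add: antipode_one counit_smult smult_assoc1[symmetric] R.m_comm)
    qed
    then have "p \<e> = lsum (\<lambda>z. \<epsilon> (snd z \<e> \<bullet> fst z) \<bullet> \<e>) es"
      unfolding p_def by (intro lprod_cong)
    also have "\<dots> = \<epsilon> (lsum (\<lambda>z. snd z \<e> \<bullet> fst z) es) \<bullet> \<e>"
      by (rule lin_lsum[symmetric, of "\<lambda>x. \<epsilon> x \<bullet> \<e>"]) (simp_all add: li)
    also have "\<dots> = \<e>" by (simp add: expand hs_one[OF N] counit_one)
    finally show ?thesis .
  qed
  \<comment> \<open>Written out, the right side is \<open>E(a c1 x1) S(x2) S(c2) c3\<close>, and the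
    last two factors contract.\<close>
  have G_mult: "G (a \<star> c) x = sw (\<lambda>c1 c2. G a (c1 \<star> x) \<star> c2) c"
    if a: "a \<in> carrier H" and c: "c \<in> carrier H" and x: "x \<in> carrier H" for a c x
  proof -
    define \<Phi> where "\<Phi> d1 z = sw (\<lambda>x1 x2. E (a \<star> (d1 \<star> x1)) \<star> (\<S> x2 \<star> z)) x" for d1 z
    have \<Phi>1: "lin (\<lambda>z. \<Phi> d1 (g z))" if "d1 \<in> carrier H" "lin g" for d1 g
      unfolding \<Phi>_def using that a by (intro li; simp)
    have \<Phi>2: "lin (\<lambda>d1. \<Phi> d1 z)" if "z \<in> carrier H" for z
      unfolding \<Phi>_def using that a by (intro li; simp)
    have "sw (\<lambda>c1 c2. G a (c1 \<star> x) \<star> c2) c = sw (\<lambda>c1 c2. sw (\<lambda>d1 d2. \<Phi> d1 (\<S> d2 \<star> c2)) c1) c"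
    proof (intro sw_cong refl)
      fix c1 c2 assume cc: "c1 \<in> carrier H" "c2 \<in> carrier H"
      have "G a (c1 \<star> x) \<star> c2 = sw (\<lambda>s t. E (a \<star> s) \<star> \<S> t \<star> c2) (c1 \<star> x)"
        unfolding G_def
        by (rule lin_sw_apply[of "\<lambda>z. z \<star> c2"]) (use cc a in \<open>simp_all add: li\<close>)
      also have "\<dots> = sw (\<lambda>d1 d2. sw (\<lambda>x1 x2. E (a \<star> (d1 \<star> x1)) \<star> \<S> (d2 \<star> x2) \<star> c2) x) c1"
        by (rule sw_mult) (use cc a x in \<open>simp_all add: li\<close>)
      also have "\<dots> = sw (\<lambda>d1 d2. \<Phi> d1 (\<S> d2 \<star> c2)) c1"
        unfolding \<Phi>_def using cc a by (simp add: antipode_mult M.m_assoc)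
      finally show "G a (c1 \<star> x) \<star> c2 = sw (\<lambda>d1 d2. \<Phi> d1 (\<S> d2 \<star> c2)) c1" .
    qed
    also have "\<dots> = sw (\<lambda>d1 r. sw (\<lambda>d2 c2. \<Phi> d1 (\<S> d2 \<star> c2)) r) c"
      by (rule sw_coassoc[OF c]) (simp; fail | (intro \<Phi>1 \<Phi>2 li; simp))+
    also have "\<dots> = sw (\<lambda>d1 r. \<epsilon> r \<bullet> \<Phi> d1 \<e>) c"
      by (intro sw_cong refl sw_antipode_left \<Phi>1 lin_id)
    also have "\<dots> = \<Phi> c \<e>"
      by (intro sw_counit_right \<Phi>2 c) simp
    also have "\<dots> = G (a \<star> c) x"
      unfolding \<Phi>_def G_def using a c by (simp add: M.m_assoc)
    finally show ?thesis by simp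
  qed
  \<comment> \<open>\<open>L a y u v\<close> traces
    \<open>x \<mapsto> S(u) S(G(a, y x)_1) \<otimes> G(a, y x)_2 v\<close>. Cyclicity of the trace
    carries \<open>S(u)\<close> around to the argument, where it becomes \<open>y S(u) x\<close>;
    this is \<open>cyc\<close>.\<close>
  define L where "L a y u v = lsum (\<lambda>z. sw (\<lambda>X Y. snd z (\<S> u \<star> \<S> X) \<bullet> (Y \<star> v)) (G a (y \<star> fst z))) es" for a y u v
  define L' where "L' a y v = lsum (\<lambda>z. R z v (G a (y \<star> fst z))) es" for a y v
  have cyc: "L a y u v = L' a (y \<star> \<S> u) v"
    if a: "a \<in> carrier H" and y: "y \<in> N" and u: "u \<in> N" and v: "v \<in> carrier H" for a y u v
  proof -
    have 1: "sw (\<lambda>X Y. snd z (\<S> u \<star> \<S> X) \<bullet> (Y \<star> v)) g = lsum (\<lambda>w. snd z (\<S> u \<star> fst w) \<bullet> R w v g) es"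
      if z: "z \<in> set es" and g: "g \<in> N" for z g
    proof -
      have "sw (\<lambda>X Y. snd z (\<S> u \<star> \<S> X) \<bullet> (Y \<star> v)) g =
          sw (\<lambda>X Y. lsum (\<lambda>w. snd w (\<S> X) \<bullet> (snd z (\<S> u \<star> fst w) \<bullet> (Y \<star> v))) es) g"
      proof (rule sw_sub_cong[OF N g])
        show "bil (\<lambda>X Y. snd z (\<S> u \<star> \<S> X) \<bullet> (Y \<star> v))"
          using z u v by (intro li lin_lfun[OF lf]; simp)
        show "bil (\<lambda>X Y. lsum (\<lambda>w. snd w (\<S> X) \<bullet> (snd z (\<S> u \<star> fst w) \<bullet> (Y \<star> v))) es)"
          using z u v by (intro li lin_lfun[OF lf]; simp)
        fix X Y assume X: "X \<in> N" and Y: "Y \<in> N"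
        have "lin (\<lambda>q. snd z (\<S> u \<star> q) \<bullet> (Y \<star> v))"
          using z u v Y by (intro li lin_lfun[OF lf]; simp)
        from lin_lsum[OF this, of es "\<lambda>w. snd w (\<S> X) \<bullet> fst w"]
        have "snd z (\<S> u \<star> \<S> X) \<bullet> (Y \<star> v) =
            lsum (\<lambda>w. snd z (\<S> u \<star> (snd w (\<S> X) \<bullet> fst w)) \<bullet> (Y \<star> v)) es"
          using X by (simp add: expand hs_antipode[OF N])
        also have "\<dots> = lsum (\<lambda>w. snd w (\<S> X) \<bullet> (snd z (\<S> u \<star> fst w) \<bullet> (Y \<star> v))) es"
          by (rule lprod_cong)
             (use z u v X Y in \<open>simp add: smult_mult_right lfun_smult[OF lf] smult_assoc1\<close>)
        finally show "snd z (\<S> u \<star> \<S> X) \<bullet> (Y \<star> v) =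
            lsum (\<lambda>w. snd w (\<S> X) \<bullet> (snd z (\<S> u \<star> fst w) \<bullet> (Y \<star> v))) es" .
      qed
      also have "\<dots> = lsum (\<lambda>w. sw (\<lambda>X Y. snd w (\<S> X) \<bullet> (snd z (\<S> u \<star> fst w) \<bullet> (Y \<star> v))) g) es"
        by (rule sw_lsum_swap) (use z u v in simp)
      also have "\<dots> = lsum (\<lambda>w. snd z (\<S> u \<star> fst w) \<bullet> R w v g) es"
      proof (rule lprod_cong)
        fix w assume w: "w \<in> set es"
        have "snd z (\<S> u \<star> fst w) \<bullet> R w v g = sw (\<lambda>X Y. snd z (\<S> u \<star> fst w) \<bullet> (snd w (\<S> X) \<bullet> (Y \<star> v))) g"
          unfolding R_def by (rule lin_sw_apply) (use z u v w in \<open>simp_all add: li\<close>)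
        then show "sw (\<lambda>X Y. snd w (\<S> X) \<bullet> (snd z (\<S> u \<star> fst w) \<bullet> (Y \<star> v))) g = snd z (\<S> u \<star> fst w) \<bullet> R w v g"
          using z u v w by (simp add: smult_assoc1[symmetric] R.m_comm)
      qed
      finally show ?thesis .
    qed
    have "L a y u v = lsum (\<lambda>z. lsum (\<lambda>w. snd z (\<S> u \<star> fst w) \<bullet> R w v (G a (y \<star> fst z))) es) es"
      unfolding L_def
      by (rule lprod_cong) (use a y eN in \<open>simp add: 1 GN hs_mult[OF N]\<close>)
    also have "\<dots> = lsum (\<lambda>w. lsum (\<lambda>z. snd z (\<S> u \<star> fst w) \<bullet> R w v (G a (y \<star> fst z))) es) es"
      by (rule lsum_swap) (use u v in simp)
    also have "\<dots> = lsum (\<lambda>w. R w v (G a (y \<star> (\<S> u \<star> fst w)))) es"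
    proof (rule lprod_cong)
      fix w assume w: "w \<in> set es"
      have l: "lin (\<lambda>x. R w v (G a (y \<star> x)))"
        using w v a y by (intro R_lin li; simp)
      have "R w v (G a (y \<star> lsum (\<lambda>z. snd z (\<S> u \<star> fst w) \<bullet> fst z) es)) =
          lsum (\<lambda>z. R w v (G a (y \<star> (snd z (\<S> u \<star> fst w) \<bullet> fst z)))) es"
        by (rule lin_lsum[OF l]) (use w u in simp)
      also have "\<dots> = lsum (\<lambda>z. snd z (\<S> u \<star> fst w) \<bullet> R w v (G a (y \<star> fst z))) es"
        by (rule lprod_cong) (use w u lin_smult[OF l] in simp)
      finally show "lsum (\<lambda>z. snd z (\<S> u \<star> fst w) \<bullet> R w v (G a (y \<star> fst z))) es =
          R w v (G a (y \<star> (\<S> u \<star> fst w)))"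
        using w u eN by (simp add: expand hs_mult[OF N] hs_antipode[OF N])
    qed
    also have "\<dots> = L' a (y \<star> \<S> u) v"
      unfolding L'_def by (rule lprod_cong) (use a y u in \<open>simp add: M.m_assoc\<close>)
    finally show ?thesis .
  qed
  have L_lin: "lin (\<lambda>y. L a y u v)" if "a \<in> carrier H" "u \<in> carrier H" "v \<in> carrier H" for a u v
    unfolding L_def using that by (intro li lin_lfun[OF lf]; simp)
  have L_lin2: "lin (\<lambda>u. L a y u v)" if "a \<in> carrier H" "y \<in> carrier H" "v \<in> carrier H" for a y v
    unfolding L_def using that by (intro li lin_lfun[OF lf]; simp)
  have L_lin3: "lin (\<lambda>v. L a y u v)" if "a \<in> carrier H" "u \<in> carrier H" "y \<in> carrier H" for a u y
    unfolding L_def using that by (intro li lin_lfun[OF lf]; simp)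
  have L'_lin: "lin (\<lambda>y. L' a (g y) v)" if "a \<in> carrier H" "v \<in> carrier H" "lin g" for a v g
    unfolding L'_def using that by (intro li R_lin; simp)
  have L'_lin2: "lin (\<lambda>v. L' a y v)" if "a \<in> carrier H" "y \<in> carrier H" for a y
    unfolding L'_def using that by (intro li R_lin2; simp)
  \<comment> \<open>By \<open>G_mult\<close> and the two reversal rules for the antipode,
    \<open>p (a c)\<close> is the sum of \<open>L a c1 c2 c3\<close>. Cyclicity turns this into
    \<open>L' a (c1 S(c2)) c3\<close>, which contracts to \<open>L' a 1 c = p a c\<close>.\<close>
  have p_mult: "p (a \<star> c) = p a \<star> c" if a: "a \<in> carrier H" and cN: "c \<in> N" for a c
  proof -
    have c: "c \<in> carrier H" using cN by simp
    have "p (a \<star> c) = lsum (\<lambda>z. sw (\<lambda>c1 c2. sw (\<lambda>u v.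
        sw (\<lambda>X Y. snd z (\<S> u \<star> \<S> X) \<bullet> (Y \<star> v)) (G a (c1 \<star> fst z))) c2) c) es"
      unfolding p_def
    proof (rule lprod_cong)
      fix z assume z: "z \<in> set es"
      have b: "bil (\<lambda>X Y. snd z (\<S> X) \<bullet> (Y \<star> \<e>))"
        using z by (intro li lin_lfun[OF lf]; simp)
      have "R z \<e> (G (a \<star> c) (fst z)) = sw (\<lambda>c1 c2. R z \<e> (G a (c1 \<star> fst z) \<star> c2)) c"
        unfolding G_mult[OF a c ec[OF z]]
        by (rule lin_sw_apply) (use z a in \<open>simp_all add: R_lin li\<close>)
      also have "\<dots> = sw (\<lambda>c1 c2. sw (\<lambda>u v.
        sw (\<lambda>X Y. snd z (\<S> u \<star> \<S> X) \<bullet> (Y \<star> v)) (G a (c1 \<star> fst z))) c2) c"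
      proof (intro sw_cong refl)
        fix c1 c2 assume cc: "c1 \<in> carrier H" "c2 \<in> carrier H"
        have "R z \<e> (G a (c1 \<star> fst z) \<star> c2) = sw (\<lambda>X Y. sw (\<lambda>u v.
            snd z (\<S> (X \<star> u)) \<bullet> (Y \<star> v \<star> \<e>)) c2) (G a (c1 \<star> fst z))"
          unfolding R_def by (rule sw_mult[OF b]) (use cc a z in simp_all)
        also have "\<dots> = sw (\<lambda>X Y. sw (\<lambda>u v. snd z (\<S> u \<star> \<S> X) \<bullet> (Y \<star> v)) c2) (G a (c1 \<star> fst z))"
          by (simp add: antipode_mult)
        also have "\<dots> = sw (\<lambda>u v. sw (\<lambda>X Y. snd z (\<S> u \<star> \<S> X) \<bullet> (Y \<star> v)) (G a (c1 \<star> fst z))) c2"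
          by (rule sw_swap) (use z in simp)
        finally show "R z \<e> (G a (c1 \<star> fst z) \<star> c2) = sw (\<lambda>u v.
          sw (\<lambda>X Y. snd z (\<S> u \<star> \<S> X) \<bullet> (Y \<star> v)) (G a (c1 \<star> fst z))) c2" .
      qed
      finally show "R z \<e> (G (a \<star> c) (fst z)) = sw (\<lambda>c1 c2. sw (\<lambda>u v.
        sw (\<lambda>X Y. snd z (\<S> u \<star> \<S> X) \<bullet> (Y \<star> v)) (G a (c1 \<star> fst z))) c2) c" .
    qed
    also have "\<dots> = sw (\<lambda>c1 c2. lsum (\<lambda>z. sw (\<lambda>u v.
        sw (\<lambda>X Y. snd z (\<S> u \<star> \<S> X) \<bullet> (Y \<star> v)) (G a (c1 \<star> fst z))) c2) es) c"
      by (rule sw_lsum_swap[symmetric]) simp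
    also have "\<dots> = sw (\<lambda>c1 c2. sw (\<lambda>u v. L a c1 u v) c2) c"
      unfolding L_def by (intro sw_cong refl sw_lsum_swap[symmetric]) simp
    also have "\<dots> = sw (\<lambda>c' v. sw (\<lambda>c1 u. L a c1 u v) c') c"
      by (rule sw_coassoc[symmetric, OF c]) (use a in \<open>simp_all add: L_lin L_lin2 L_lin3\<close>)
    also have "\<dots> = sw (\<lambda>c' v. sw (\<lambda>c1 u. L' a (c1 \<star> \<S> u) v) c') c"
    proof (rule sw_sub_cong[OF N cN])
      show "bil (\<lambda>c' v. sw (\<lambda>c1 u. L a c1 u v) c')"
        using a by (intro li L_lin L_lin2 L_lin3; simp)
      show "bil (\<lambda>c' v. sw (\<lambda>c1 u. L' a (c1 \<star> \<S> u) v) c')"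
        using a by (intro li L'_lin L'_lin2; simp)
      fix c' v assume cv: "c' \<in> N" "v \<in> N"
      show "sw (\<lambda>c1 u. L a c1 u v) c' = sw (\<lambda>c1 u. L' a (c1 \<star> \<S> u) v) c'"
        by (rule sw_sub_cong[OF N cv(1)])
           (use a cv in \<open>simp_all add: cyc bilI li L_lin L_lin2 L'_lin\<close>)
    qed
    also have "\<dots> = sw (\<lambda>c' v. \<epsilon> c' \<bullet> L' a \<e> v) c"
      by (intro sw_cong refl sw_antipode_right L'_lin a lin_id)
    also have "\<dots> = L' a \<e> c"
      by (intro sw_counit_left L'_lin2 c a) simp
    also have "\<dots> = lsum (\<lambda>z. R z \<e> (G a (fst z)) \<star> c) es"
      unfolding L'_def
    proof (rule lprod_cong)
      fix z assume z: "z \<in> set es"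
      have "R z \<e> (G a (fst z)) \<star> c = sw (\<lambda>X Y. (snd z (\<S> X) \<bullet> (Y \<star> \<e>)) \<star> c) (G a (fst z))"
        unfolding R_def
        by (rule lin_sw_apply[of "\<lambda>x. x \<star> c"]) (use z c in \<open>simp_all add: li\<close>)
      then show "R z c (G a (\<e> \<star> fst z)) = R z \<e> (G a (fst z)) \<star> c"
        unfolding R_def using z c by (simp add: smult_mult_left)
    qed
    also have "\<dots> = p a \<star> c"
      unfolding p_def
      by (rule lin_lsum[symmetric, of "\<lambda>x. x \<star> c"]) (use a c in \<open>simp_all add: li\<close>)
    finally show ?thesis .
  qed
  show ?thesis using p_lin pN p_one p_mult by blast
qed

text \<open>The hypothesis \<open>co\<close> says \<open>a\<^sub>1 \<otimes> \<pi> a\<^sub>2 = a \<otimes> \<pi> 1\<close> for the projection \<open>\<pi> : H \<rightarrow> H / N\<^sup>+H\<close>.\<close>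

lemma coinvariant_mem:
  assumes N: "hs N" and a: "a \<in> carrier H"
    and co: "\<And>\<beta>. bil \<beta> \<Longrightarrow> (\<And>h b x. h \<in> carrier H \<Longrightarrow> b \<in> N \<Longrightarrow> \<epsilon> b = \<zero>\<^bsub>k\<^esub> \<Longrightarrow> x \<in> carrier H \<Longrightarrow>
      \<beta> h (b \<star> x) = \<zero>\<^bsub>H\<^esub>) \<Longrightarrow> sw \<beta> a = \<beta> a \<e>"
  shows "a \<in> N"
proof -
  note Nc = hs_carrier[OF N]
  obtain p where p: "lin p" "\<And>a. a \<in> carrier H \<Longrightarrow> p a \<in> N" "p \<e> = \<e>"
    "\<And>a c. a \<in> carrier H \<Longrightarrow> c \<in> N \<Longrightarrow> p (a \<star> c) = p a \<star> c"
    using hopf_subalgebra_retraction[OF N] by blast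
  have pc [simp]: "p x \<in> carrier H" if "x \<in> carrier H" for x using p(2)[OF that] Nc by blast
  note li = lin_intros lin_comp[OF p(1)]
  \<comment> \<open>By right \<open>N\<close>-linearity of \<open>p\<close> this map factors through
    \<open>H / N\<^sup>+ H\<close> in its second argument. On \<open>\<Delta> a\<close> it gives
    \<open>p(a1 S(a2)) a3 = a\<close>, and on \<open>a \<otimes> 1\<close> it gives
    \<open>p a\<close>, so coinvariance forces \<open>a = p a\<close>.\<close>
  define \<beta> where "\<beta> h h' = sw (\<lambda>x y. p (h \<star> \<S> x) \<star> y) h'" for h h'
  have b: "bil \<beta>"
    unfolding \<beta>_def by (intro li; simp)
  have "sw \<beta> a = \<beta> a \<e>"
  proof (rule co[OF b])
    fix h b x assume h: "h \<in> carrier H" and b: "b \<in> N" "\<epsilon> b = \<zero>\<^bsub>k\<^esub>" and x: "x \<in> carrier H"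
    define f where "f z = sw (\<lambda>x1 x2. p (h \<star> \<S> x1) \<star> (z \<star> x2)) x" for z
    have f: "lin f" unfolding f_def using h by (intro li; simp)
    have "\<beta> h (b \<star> x) = sw (\<lambda>b1 b2. sw (\<lambda>x1 x2. p (h \<star> \<S> (b1 \<star> x1)) \<star> (b2 \<star> x2)) x) b"
      unfolding \<beta>_def by (rule sw_mult) (use h x Nc[OF b(1)] in \<open>simp_all add: li\<close>)
    also have "\<dots> = sw (\<lambda>b1 b2. f (\<S> b1 \<star> b2)) b"
    proof (rule sw_sub_cong[OF N b(1)])
      show "bil (\<lambda>b1 b2. sw (\<lambda>x1 x2. p (h \<star> \<S> (b1 \<star> x1)) \<star> (b2 \<star> x2)) x)"
        using h by (intro li; simp)
      show "bil (\<lambda>b1 b2. f (\<S> b1 \<star> b2))"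
        by (intro li lin_comp[OF f]; simp)
      show "sw (\<lambda>x1 x2. p (h \<star> \<S> (b1 \<star> x1)) \<star> (b2 \<star> x2)) x = f (\<S> b1 \<star> b2)"
        if "b1 \<in> N" "b2 \<in> N" for b1 b2
      proof -
        have "p (h \<star> \<S> (b1 \<star> x1)) \<star> (b2 \<star> x2) = p (h \<star> \<S> x1) \<star> (\<S> b1 \<star> b2 \<star> x2)"
          if "x1 \<in> carrier H" "x2 \<in> carrier H" for x1 x2
          using that \<open>b1 \<in> N\<close> \<open>b2 \<in> N\<close> Nc h p(4)[of "h \<star> \<S> x1" "\<S> b1"] hs_antipode[OF N]
          by (simp add: antipode_mult M.m_assoc)
        then show ?thesis unfolding f_def by simp
      qed
    qed
    also have "\<dots> = \<epsilon> b \<bullet> f \<e>" by (rule sw_antipode_left[OF f Nc[OF b(1)]])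
    also have "\<dots> = \<zero>\<^bsub>H\<^esub>" using b(2) lin_closed[OF f, of \<e>] by (simp add: smult_zero_k)
    finally show "\<beta> h (b \<star> x) = \<zero>\<^bsub>H\<^esub>" .
  qed
  moreover have "sw \<beta> a = a"
  proof -
    have "sw \<beta> a = sw (\<lambda>h' y. sw (\<lambda>h x. p (h \<star> \<S> x) \<star> y) h') a"
      unfolding \<beta>_def by (rule sw_coassoc[symmetric, OF a]) (simp; fail | (intro li; simp))+
    also have "\<dots> = sw (\<lambda>h' y. \<epsilon> h' \<bullet> (p \<e> \<star> y)) a"
      by (intro sw_cong refl sw_antipode_right[of "\<lambda>z. p z \<star> _"] li p(1))
    also have "\<dots> = p \<e> \<star> a" by (rule sw_counit_left[OF _ a]) (intro li; simp)
    finally show ?thesis using p(3) a by simp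
  qed
  moreover have "\<beta> a \<e> = p a"
  proof -
    have "\<beta> a \<e> = p (a \<star> \<S> \<e>) \<star> \<e>"
      unfolding \<beta>_def by (rule sw_one) (use a in \<open>intro li; simp\<close>)
    then show ?thesis using a by (simp add: antipode_one)
  qed
  ultimately show ?thesis using p(2)[OF a] by simp
qed

end

section \<open>Quotients by normal Hopf subalgebras\<close>

context hopf_algebra
begin

text \<open>Sweedler sums take values in \<open>H\<close>, so scalar identities are proved as
  identities between multiples of the unit; the counit recovers the scalars.\<close>

lemma scalar_eqD: "c \<in> carrier k \<Longrightarrow> d \<in> carrier k \<Longrightarrow> c \<bullet> \<e> = d \<bullet> \<e> \<Longrightarrow> c = d"
proof -
  assume c: "c \<in> carrier k" "d \<in> carrier k" and "c \<bullet> \<e> = d \<bullet> \<e>"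
  then have "\<epsilon> (c \<bullet> \<e>) = \<epsilon> (d \<bullet> \<e>)" by (simp only:)
  then show "c = d" by (simp only: counit_smult c M.one_closed counit_one R.r_one)
qed

lemma counit_antipode:
  assumes h: "h \<in> carrier H" shows "\<epsilon> (\<S> h) = \<epsilon> h"
proof -
  have l: "lin (\<lambda>z. \<epsilon> z \<bullet> \<e>)" by (intro lin_intros) simp
  have "sw (\<lambda>x y. \<epsilon> (\<S> x \<star> y) \<bullet> \<e>) h = \<epsilon> h \<bullet> (\<epsilon> \<e> \<bullet> \<e>)"
    by (rule sw_antipode_left[OF l h])
  moreover have "sw (\<lambda>x y. \<epsilon> (\<S> x \<star> y) \<bullet> \<e>) h = sw (\<lambda>x y. \<epsilon> y \<bullet> (\<epsilon> (\<S> x) \<bullet> \<e>)) h"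
    by (simp add: counit_mult smult_assoc1[symmetric] R.m_comm)
  moreover have "\<dots> = \<epsilon> (\<S> h) \<bullet> \<e>"
    by (rule sw_counit_right[OF _ h]) (intro lin_intros; simp)
  ultimately show ?thesis using h by (intro scalar_eqD) (simp_all add: counit_one)
qed

lemma sw_mem:
  assumes "subsp W" "\<And>x y. x \<in> carrier H \<Longrightarrow> y \<in> carrier H \<Longrightarrow> \<beta> x y \<in> W"
  shows "sw \<beta> h \<in> W"
  unfolding sw_def by (rule subsp_lsum[OF assms(1)]) (use assms(2) comult_list_mem in auto)

definition aug :: "'a set \<Rightarrow> 'a set" where
  "aug K = {x \<in> K. \<epsilon> x = \<zero>\<^bsub>k\<^esub>}"

lemma augI: "x \<in> K \<Longrightarrow> \<epsilon> x = \<zero>\<^bsub>k\<^esub> \<Longrightarrow> x \<in> aug K"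
  and augD: "x \<in> aug K \<Longrightarrow> x \<in> K" "x \<in> aug K \<Longrightarrow> \<epsilon> x = \<zero>\<^bsub>k\<^esub>"
  by (auto simp: aug_def)

lemma subsp_aug: "subsp K \<Longrightarrow> subsp (aug K)"
  by (rule subspI)
     (auto simp: aug_def subsp_carrier subsp_zero subsp_add subsp_smult lfun_zero[OF lfun_counit]
       lfun_add[OF lfun_counit] lfun_smult[OF lfun_counit])

lemma aug_diff: "hs K \<Longrightarrow> x \<in> K \<Longrightarrow> x \<ominus>\<^bsub>H\<^esub> \<epsilon> x \<bullet> \<e> \<in> aug K"
proof (rule augI)
  assume K: "hs K" and x: "x \<in> K"
  have xc: "x \<in> carrier H" by (rule hs_carrier[OF K x])
  show "x \<ominus>\<^bsub>H\<^esub> \<epsilon> x \<bullet> \<e> \<in> K"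
    by (intro subsp_diff[OF hs_subsp[OF K]] x hs_smult[OF K] hs_one[OF K] counit_closed xc)
  have "\<epsilon> ((x \<ominus>\<^bsub>H\<^esub> \<epsilon> x \<bullet> \<e>) \<boxplus> \<epsilon> x \<bullet> \<e>) = \<epsilon> x"
    using xc by (simp add: M.minus_eq M.a_assoc M.l_neg)
  then have "\<epsilon> (x \<ominus>\<^bsub>H\<^esub> \<epsilon> x \<bullet> \<e>) \<oplus>\<^bsub>k\<^esub> \<epsilon> x = \<epsilon> x"
    using xc by (simp add: lfun_add[OF lfun_counit] counit_smult counit_one)
  then show "\<epsilon> (x \<ominus>\<^bsub>H\<^esub> \<epsilon> x \<bullet> \<e>) = \<zero>\<^bsub>k\<^esub>"
    using xc R.add.r_cancel_one[of "\<epsilon> x" "\<epsilon> (x \<ominus>\<^bsub>H\<^esub> \<epsilon> x \<bullet> \<e>)"] by simp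
qed

abbreviation prd :: "'a set \<Rightarrow> 'a set \<Rightarrow> 'a set" where "prd X Y \<equiv> ideal_prod H X Y"

lemma subsp_prd:
  assumes "subsp X" "subsp Y" shows "subsp (prd X Y)"
proof (rule subspI)
  note X = subsp_carrier[OF assms(1)] and Y = subsp_carrier[OF assms(2)]
  show c: "prd X Y \<subseteq> carrier H"
  proof
    fix x assume "x \<in> prd X Y" then show "x \<in> carrier H"
      by (induction rule: ideal_prod.induct) (auto simp: X Y)
  qed
  have "\<zero>\<^bsub>H\<^esub> \<star> \<zero>\<^bsub>H\<^esub> \<in> prd X Y"
    by (intro ideal_prod.prod subsp_zero assms)
  then show "\<zero>\<^bsub>H\<^esub> \<in> prd X Y" by simp
  show "x \<boxplus> y \<in> prd X Y" if "x \<in> prd X Y" "y \<in> prd X Y" for x y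
    using that by (rule ideal_prod.sum)
  show "a \<bullet> x \<in> prd X Y" if "a \<in> carrier k" "x \<in> prd X Y" for a x
    using that(2)
  proof (induction rule: ideal_prod.induct)
    case (prod i j)
    have "a \<bullet> (i \<star> j) = (a \<bullet> i) \<star> j" using that(1) prod X Y by (simp add: smult_mult_left)
    then show ?case using prod that(1) subsp_smult[OF assms(1)] by (auto intro: ideal_prod.prod)
  next
    case (sum s1 s2)
    then show ?case using that(1) c by (simp add: smult_r_distr subset_iff ideal_prod.sum)
  qed
qed

lemma prd_subset:
  assumes "\<And>x y. x \<in> X \<Longrightarrow> y \<in> Y \<Longrightarrow> x \<star> y \<in> W" "subsp W"
  shows "prd X Y \<subseteq> W"
proof
  fix z assume "z \<in> prd X Y" then show "z \<in> W"
    by (induction rule: ideal_prod.induct) (auto simp: assms(1) subsp_add[OF assms(2)])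
qed

lemma prd_mono: "X \<subseteq> X' \<Longrightarrow> Y \<subseteq> Y' \<Longrightarrow> prd X Y \<subseteq> prd X' Y'"
proof
  fix z assume *: "X \<subseteq> X'" "Y \<subseteq> Y'" and "z \<in> prd X Y"
  from this(3) show "z \<in> prd X' Y'"
  proof (induction rule: ideal_prod.induct)
    case (prod i j) then show ?case using * by (intro ideal_prod.prod) auto
  next
    case (sum s1 s2) show ?case by (rule ideal_prod.sum[OF sum.IH])
  qed
qed

text \<open>Normality of \<open>B\<close> in \<open>D\<close> computed with the operations of
  \<open>H\<close>. The Hopf algebra \<open>D\<close> on its own has a different tensor square, so
  the translation is made only once, in \<open>normal_HS_iff\<close>.\<close>

definition nrm :: "'a set \<Rightarrow> 'a set \<Rightarrow> bool" where
  "nrm D B \<longleftrightarrow> hs D \<and> hs B \<and> B \<subseteq> D \<and>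
     (\<forall>h\<in>D. \<forall>a\<in>B. sw (\<lambda>x y. x \<star> a \<star> \<S> y) h \<in> B \<and> sw (\<lambda>x y. \<S> x \<star> a \<star> y) h \<in> B)"

lemma nrmD:
  assumes "nrm D B"
  shows "hs D" "hs B" "B \<subseteq> D"
    "\<And>h a. h \<in> D \<Longrightarrow> a \<in> B \<Longrightarrow> sw (\<lambda>x y. x \<star> a \<star> \<S> y) h \<in> B"
    "\<And>h a. h \<in> D \<Longrightarrow> a \<in> B \<Longrightarrow> sw (\<lambda>x y. \<S> x \<star> a \<star> y) h \<in> B"
  using assms by (auto simp: nrm_def)

definition hidl :: "'a set \<Rightarrow> 'a set \<Rightarrow> 'a set" where
  "hidl D K = prd D (aug K)"

lemma counit_adjoint:
  assumes h: "h \<in> carrier H" and a: "a \<in> carrier H" "\<epsilon> a = \<zero>\<^bsub>k\<^esub>"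
  shows "\<epsilon> (sw (\<lambda>x y. x \<star> a \<star> \<S> y) h) = \<zero>\<^bsub>k\<^esub>" "\<epsilon> (sw (\<lambda>x y. \<S> x \<star> a \<star> y) h) = \<zero>\<^bsub>k\<^esub>"
proof -
  have l: "lin (\<lambda>z. \<epsilon> z \<bullet> \<e>)" by (intro lin_intros) simp
  have z: "sw (\<lambda>x y. \<zero>\<^bsub>H\<^esub>) h = \<zero>\<^bsub>H\<^esub>" unfolding sw_def by (rule lsum_zero) auto
  have "\<epsilon> (sw (\<lambda>x y. x \<star> a \<star> \<S> y) h) \<bullet> \<e> = \<zero>\<^bsub>k\<^esub> \<bullet> \<e>"
    using a by (subst lin_sw_apply[OF l]) (simp_all add: counit_mult smult_zero_k z)
  then show "\<epsilon> (sw (\<lambda>x y. x \<star> a \<star> \<S> y) h) = \<zero>\<^bsub>k\<^esub>"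
    using a by (intro scalar_eqD) auto
  have "\<epsilon> (sw (\<lambda>x y. \<S> x \<star> a \<star> y) h) \<bullet> \<e> = \<zero>\<^bsub>k\<^esub> \<bullet> \<e>"
    using a by (subst lin_sw_apply[OF l]) (simp_all add: counit_mult smult_zero_k z)
  then show "\<epsilon> (sw (\<lambda>x y. \<S> x \<star> a \<star> y) h) = \<zero>\<^bsub>k\<^esub>"
    using a by (intro scalar_eqD) auto
qed

text \<open>The right side is \<open>d1 S(d2) b d3\<close>. Moving \<open>b\<close> past
  \<open>d\<close> thus costs only a replacement of \<open>b\<close> by its right adjoint
  translates, which remain in a normal Hopf subalgebra.\<close>

lemma mult_adjoint_right:
  assumes "d \<in> carrier H" "b \<in> carrier H"
  shows "b \<star> d = sw (\<lambda>x t. x \<star> sw (\<lambda>u v. \<S> u \<star> b \<star> v) t) d"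
proof -
  have "sw (\<lambda>x t. x \<star> sw (\<lambda>u v. \<S> u \<star> b \<star> v) t) d = sw (\<lambda>x t. sw (\<lambda>u v. (x \<star> \<S> u) \<star> (b \<star> v)) t) d"
  proof (rule sw_cong[OF refl])
    fix x t assume x: "x \<in> carrier H"
    have "x \<star> sw (\<lambda>u v. \<S> u \<star> b \<star> v) t = sw (\<lambda>u v. x \<star> (\<S> u \<star> b \<star> v)) t"
      by (rule lin_sw_apply) (use x assms in \<open>simp_all add: lin_intros\<close>)
    then show "x \<star> sw (\<lambda>u v. \<S> u \<star> b \<star> v) t = sw (\<lambda>u v. (x \<star> \<S> u) \<star> (b \<star> v)) t"
      using x assms by (simp add: M.m_assoc)
  qed
  also have "\<dots> = sw (\<lambda>r v. sw (\<lambda>x u. (x \<star> \<S> u) \<star> (b \<star> v)) r) d"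
    by (rule sw_coassoc[symmetric, OF assms(1)]) (use assms in \<open>simp_all add: lin_intros\<close>)
  also have "\<dots> = sw (\<lambda>r v. \<epsilon> r \<bullet> (\<e> \<star> (b \<star> v))) d"
    by (intro sw_cong refl sw_antipode_right[of "\<lambda>z. z \<star> (b \<star> _)"] lin_intros) (use assms in simp_all)
  also have "\<dots> = \<e> \<star> (b \<star> d)"
    by (rule sw_counit_left[OF _ assms(1)]) (use assms in \<open>simp add: lin_intros\<close>)
  finally show ?thesis using assms by simp
qed

text \<open>The mirror image, \<open>d1 b S(d2) d3\<close>, uses the left adjoint action.\<close>

lemma mult_adjoint_left:
  assumes "d \<in> carrier H" "b \<in> carrier H"
  shows "d \<star> b = sw (\<lambda>t y. sw (\<lambda>u v. u \<star> b \<star> \<S> v) t \<star> y) d"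
proof -
  have "sw (\<lambda>t y. sw (\<lambda>u v. u \<star> b \<star> \<S> v) t \<star> y) d = sw (\<lambda>t y. sw (\<lambda>u v. u \<star> b \<star> (\<S> v \<star> y)) t) d"
  proof (rule sw_cong[OF refl])
    fix t y assume y: "y \<in> carrier H"
    have "sw (\<lambda>u v. u \<star> b \<star> \<S> v) t \<star> y = sw (\<lambda>u v. u \<star> b \<star> \<S> v \<star> y) t"
      by (rule lin_sw_apply[of "\<lambda>z. z \<star> y"]) (use y assms in \<open>simp_all add: lin_intros\<close>)
    then show "sw (\<lambda>u v. u \<star> b \<star> \<S> v) t \<star> y = sw (\<lambda>u v. u \<star> b \<star> (\<S> v \<star> y)) t"
      using y assms by (simp add: M.m_assoc)
  qed
  also have "\<dots> = sw (\<lambda>u r. sw (\<lambda>v y. u \<star> b \<star> (\<S> v \<star> y)) r) d"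
    by (rule sw_coassoc[OF assms(1)]) (use assms in \<open>simp_all add: lin_intros\<close>)
  also have "\<dots> = sw (\<lambda>u r. \<epsilon> r \<bullet> (u \<star> b \<star> \<e>)) d"
    by (intro sw_cong refl sw_antipode_left[of "\<lambda>z. _ \<star> b \<star> z"] lin_intros) (use assms in simp_all)
  also have "\<dots> = d \<star> b \<star> \<e>"
    by (rule sw_counit_right[OF _ assms(1)]) (use assms in \<open>simp add: lin_intros\<close>)
  finally show ?thesis using assms by simp
qed

context
  fixes D B :: "'a set"
  assumes DB: "nrm D B"
begin

lemmas hsD = nrmD(1)[OF DB] and hsB = nrmD(2)[OF DB] and B_sub_D = nrmD(3)[OF DB]

lemma D_closed: "x \<in> D \<Longrightarrow> x \<in> carrier H" and B_closed: "x \<in> B \<Longrightarrow> x \<in> carrier H"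
  using hs_carrier hsD hsB by auto

lemma hidl_subsp: "subsp (hidl D B)"
  unfolding hidl_def by (intro subsp_prd subsp_aug hs_subsp hsD hsB)

lemma hidl_subset: "hidl D B \<subseteq> D"
  unfolding hidl_def
  by (rule prd_subset[OF _ hs_subsp[OF hsD]]) (use B_sub_D in \<open>auto intro: hs_mult[OF hsD] dest: augD(1)\<close>)

lemma hidl_closed: "x \<in> hidl D B \<Longrightarrow> x \<in> carrier H"
  using hidl_subset D_closed by blast

lemma hidl_mult_left:
  assumes "d \<in> D" "i \<in> hidl D B" shows "d \<star> i \<in> hidl D B"
  using assms(2) unfolding hidl_def
proof (induction rule: ideal_prod.induct)
  case (prod i j)
  have "d \<star> (i \<star> j) = (d \<star> i) \<star> j"
    using prod assms(1) D_closed B_closed augD(1) by (simp add: M.m_assoc)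
  then show ?case using prod assms(1) hs_mult[OF hsD] by (auto intro: ideal_prod.prod)
next
  case (sum s1 s2)
  then have "s1 \<in> carrier H" "s2 \<in> carrier H" using hidl_closed unfolding hidl_def by auto
  then show ?case using sum assms(1) D_closed by (simp add: M.r_distr ideal_prod.sum)
qed

lemma aug_mult_hidl:
  assumes "d \<in> D" "b \<in> aug B" shows "b \<star> d \<in> hidl D B"
proof -
  have b: "b \<in> B" "\<epsilon> b = \<zero>\<^bsub>k\<^esub>" using assms(2) augD by auto
  show ?thesis
    unfolding mult_adjoint_right[OF D_closed[OF assms(1)] B_closed[OF b(1)]]
  proof (rule sw_sub_mem[OF hsD assms(1) _ hidl_subsp])
    show "bil (\<lambda>x t. x \<star> sw (\<lambda>u v. \<S> u \<star> b \<star> v) t)"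
      using B_closed[OF b(1)] by (intro lin_intros; simp)
    show "x \<star> sw (\<lambda>u v. \<S> u \<star> b \<star> v) t \<in> hidl D B" if "x \<in> D" "t \<in> D" for x t
      unfolding hidl_def
      by (intro ideal_prod.prod that augI nrmD(5)[OF DB] b counit_adjoint D_closed B_closed)
  qed
qed

text \<open>Each inclusion uses stability under one of the two adjoint actions, and the translates
  keep counit zero. The equality makes the left ideal \<open>D B\<^sup>+\<close> two-sided in
  \<open>D\<close>.\<close>

lemma hidl_eq: "hidl D B = prd (aug B) D"
proof
  show "prd (aug B) D \<subseteq> hidl D B"
    by (rule prd_subset[OF _ hidl_subsp]) (rule aug_mult_hidl)
  have sub: "subsp (prd (aug B) D)" by (intro subsp_prd subsp_aug hs_subsp hsD hsB)
  show "hidl D B \<subseteq> prd (aug B) D"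
    unfolding hidl_def
  proof (rule prd_subset[OF _ sub])
    fix d b assume d: "d \<in> D" and "b \<in> aug B"
    then have b: "b \<in> B" "\<epsilon> b = \<zero>\<^bsub>k\<^esub>" using augD by auto
    show "d \<star> b \<in> prd (aug B) D"
      unfolding mult_adjoint_left[OF D_closed[OF d] B_closed[OF b(1)]]
    proof (rule sw_sub_mem[OF hsD d _ sub])
      show "bil (\<lambda>t y. sw (\<lambda>u v. u \<star> b \<star> \<S> v) t \<star> y)"
        using B_closed[OF b(1)] by (intro lin_intros; simp)
      show "sw (\<lambda>u v. u \<star> b \<star> \<S> v) t \<star> y \<in> prd (aug B) D" if "t \<in> D" "y \<in> D" for t y
        by (intro ideal_prod.prod that augI nrmD(4)[OF DB] b counit_adjoint D_closed B_closed)
    qed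
  qed
qed

lemma hidl_mult_right:
  assumes "d \<in> D" "i \<in> hidl D B" shows "i \<star> d \<in> hidl D B"
  using assms(2) unfolding hidl_eq
proof (induction rule: ideal_prod.induct)
  case (prod i j)
  have "(i \<star> j) \<star> d = i \<star> (j \<star> d)"
    using prod assms(1) D_closed B_closed augD(1) by (simp add: M.m_assoc)
  then show ?case using prod assms(1) hs_mult[OF hsD] by (auto intro: ideal_prod.prod)
next
  case (sum s1 s2)
  then have "s1 \<in> carrier H" "s2 \<in> carrier H" using hidl_closed unfolding hidl_eq by auto
  then show ?case using sum assms(1) D_closed by (simp add: M.l_distr ideal_prod.sum)
qed

lemma hidl_antipode:
  assumes "i \<in> hidl D B" shows "\<S> i \<in> hidl D B"
  using assms unfolding hidl_def
proof (induction rule: ideal_prod.induct)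
  case (prod d b)
  have "\<S> b \<in> aug B" using prod(2) hs_antipode[OF hsB] B_closed counit_antipode
    by (auto simp: aug_def)
  then have "\<S> b \<star> \<S> d \<in> hidl D B" using prod(1) by (intro aug_mult_hidl hs_antipode[OF hsD])
  then show ?case using prod D_closed B_closed augD(1)[OF prod(2)] by (simp add: antipode_mult hidl_def)
next
  case (sum s1 s2)
  then have "s1 \<in> carrier H" "s2 \<in> carrier H" using hidl_closed unfolding hidl_def by auto
  then show ?case using sum by (simp add: antipode_add ideal_prod.sum)
qed

lemma hidl_counit: "i \<in> hidl D B \<Longrightarrow> \<epsilon> i = \<zero>\<^bsub>k\<^esub>"
proof -
  have "prd D (aug B) \<subseteq> aug (carrier H)"
    by (rule prd_subset[OF _ subsp_aug[OF subsp_carrier_H]])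
       (auto simp: aug_def counit_mult D_closed B_closed)
  then show "i \<in> hidl D B \<Longrightarrow> \<epsilon> i = \<zero>\<^bsub>k\<^esub>" unfolding hidl_def using augD(2) by blast
qed

text \<open>The coideal property of \<open>I = D B\<^sup>+\<close>, in the form that a bilinear map
  vanishing on \<open>I \<times> D\<close> and \<open>D \<times> I\<close> kills
  \<open>\<Delta> I\<close>. In \<open>d1 b1 \<otimes> d2 b2\<close> the factor \<open>b1\<close>
  may be replaced by \<open>\<epsilon> b1\<close>, which leaves \<open>d1 \<otimes> d2 b\<close>
  with second leg in \<open>I\<close>.\<close>

lemma sw_hidl:
  assumes \<beta>: "bil \<beta>" and i: "i \<in> hidl D B"
    and 1: "\<And>x y. x \<in> hidl D B \<Longrightarrow> y \<in> D \<Longrightarrow> \<beta> x y = \<zero>\<^bsub>H\<^esub>"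
    and 2: "\<And>x y. x \<in> D \<Longrightarrow> y \<in> hidl D B \<Longrightarrow> \<beta> x y = \<zero>\<^bsub>H\<^esub>"
  shows "sw \<beta> i = \<zero>\<^bsub>H\<^esub>"
  using i unfolding hidl_def
proof (induction rule: ideal_prod.induct)
  case (prod d b)
  note dc = D_closed[OF prod(1)] and b = augD[OF prod(2)]
  note bc = B_closed[OF b(1)]
  note b1 = lin_comp[OF bil_lin1[OF \<beta>]] and b2 = lin_comp[OF bil_lin2[OF \<beta>]]
  note li = lin_intros b1 b2
  have "sw \<beta> (d \<star> b) = sw (\<lambda>x y. sw (\<lambda>u v. \<beta> (x \<star> u) (y \<star> v)) b) d"
    by (rule sw_mult[OF \<beta> dc bc])
  also have "\<dots> \<in> {\<zero>\<^bsub>H\<^esub>}"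
  proof (rule sw_sub_mem[OF hsD prod(1) _ subsp_zero_set])
    show "bil (\<lambda>x y. sw (\<lambda>u v. \<beta> (x \<star> u) (y \<star> v)) b)" by (intro li; simp)
    fix x y assume xy: "x \<in> D" "y \<in> D"
    note xyc = D_closed[OF xy(1)] D_closed[OF xy(2)]
    have "sw (\<lambda>u v. \<beta> (x \<star> u) (y \<star> v)) b = sw (\<lambda>u v. \<epsilon> u \<bullet> \<beta> x (y \<star> v)) b"
    proof (rule sw_sub_cong[OF hsB b(1)])
      show "bil (\<lambda>u v. \<beta> (x \<star> u) (y \<star> v))" "bil (\<lambda>u v. \<epsilon> u \<bullet> \<beta> x (y \<star> v))"
        using xyc bil_closed[OF \<beta>] by (intro li; simp)+
      fix u v assume uv: "u \<in> B" "v \<in> B"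
      note uvc = B_closed[OF uv(1)] B_closed[OF uv(2)]
      have "x \<star> (u \<ominus>\<^bsub>H\<^esub> \<epsilon> u \<bullet> \<e>) \<in> hidl D B"
        unfolding hidl_def by (intro ideal_prod.prod xy aug_diff hsB uv)
      then have z: "\<beta> (x \<star> (u \<ominus>\<^bsub>H\<^esub> \<epsilon> u \<bullet> \<e>)) (y \<star> v) = \<zero>\<^bsub>H\<^esub>"
        using xy uv B_sub_D by (intro 1 hs_mult[OF hsD]) auto
      have l: "lin (\<lambda>w. \<beta> (x \<star> w) (y \<star> v))" using xyc uvc by (intro li; simp)
      have "\<beta> (x \<star> u) (y \<star> v) \<ominus>\<^bsub>H\<^esub> \<beta> (x \<star> (\<epsilon> u \<bullet> \<e>)) (y \<star> v) = \<zero>\<^bsub>H\<^esub>"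
        using z lin_diff[OF l uvc(1), of "\<epsilon> u \<bullet> \<e>"] uvc by simp
      then have "\<beta> (x \<star> u) (y \<star> v) = \<beta> (x \<star> (\<epsilon> u \<bullet> \<e>)) (y \<star> v)"
        using xyc uvc bil_closed[OF \<beta>] by (subst (asm) M.r_right_minus_eq) auto
      then show "\<beta> (x \<star> u) (y \<star> v) = \<epsilon> u \<bullet> \<beta> x (y \<star> v)"
        using lin_smult[OF l, of "\<epsilon> u" \<e>] xyc uvc by simp
    qed
    also have "\<dots> = \<beta> x (y \<star> b)"
      by (rule sw_counit_left[OF _ bc]) (use xyc in \<open>intro li; simp\<close>)
    also have "\<dots> = \<zero>\<^bsub>H\<^esub>"
      by (rule 2[OF xy(1)]) (unfold hidl_def, intro ideal_prod.prod xy prod)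
    finally show "sw (\<lambda>u v. \<beta> (x \<star> u) (y \<star> v)) b \<in> {\<zero>\<^bsub>H\<^esub>}" by simp
  qed
  finally show ?case by simp
next
  case (sum s1 s2)
  then have "s1 \<in> carrier H" "s2 \<in> carrier H" using hidl_closed unfolding hidl_def by auto
  then show ?case using sum by (simp add: sw_add[OF \<beta>])
qed

end

end

lemma (in hopf_algebra) lfun_diff:
  assumes "lfun f" "x \<in> carrier H" "y \<in> carrier H"
  shows "f (x \<ominus>\<^bsub>H\<^esub> y) = f x \<ominus>\<^bsub>k\<^esub> f y"
proof -
  have "f (\<ominus>\<^bsub>H\<^esub> y) = \<ominus>\<^bsub>k\<^esub> f y"
    using lfun_smult[OF assms(1), of "\<ominus>\<^bsub>k\<^esub> \<one>\<^bsub>k\<^esub>" y] lfun_closed[OF assms(1,3)] assms(3)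
    by (simp add: smult_minus_one R.l_minus)
  then show ?thesis using lfun_add[OF assms(1,2), of "\<ominus>\<^bsub>H\<^esub> y"] assms(3)
    by (simp add: M.minus_eq R.minus_eq)
qed

lemma (in hopf_algebra) sw_plus:
  assumes "\<And>x y. x \<in> carrier H \<Longrightarrow> y \<in> carrier H \<Longrightarrow> \<beta> x y \<in> carrier H"
    "\<And>x y. x \<in> carrier H \<Longrightarrow> y \<in> carrier H \<Longrightarrow> \<beta>' x y \<in> carrier H"
  shows "sw (\<lambda>x y. \<beta> x y \<boxplus> \<beta>' x y) h = sw \<beta> h \<boxplus> sw \<beta>' h"
  unfolding sw_def case_prod_unfold
  by (rule lsum_add) (use assms comult_list_mem in auto)

context fd_hopf_algebra
begin

text \<open>
  The surjection \<open>\<pi> : A \<rightarrow> D / D B\<^sup>+\<close> has a right \<open>D / D B\<^sup>+\<close>-colinear, counital section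
  \<open>s\<close> (this is the construction of \<open>hopf_subalgebra_retraction\<close> in the dual).  Then
  \<open>w a = s (\<pi> a\<^sub>1) S (a\<^sub>2)\<close> is coinvariant, hence takes values in \<open>A \<inter> B\<close>, and
  \<open>s (\<pi> a) = w (a\<^sub>1) a\<^sub>2 \<equiv> a\<close> modulo \<open>(A \<inter> B)\<^sup>+ A\<close>.
\<close>

lemma inter_hidl_subset:
  assumes DB: "nrm D B" and A: "hs A" and AD: "A \<subseteq> D"
    and gen: "\<And>d. d \<in> D \<Longrightarrow> \<exists>a\<in>A. d \<ominus>\<^bsub>H\<^esub> a \<in> hidl D B"
    and a: "a \<in> A" "a \<in> hidl D B"
  shows "a \<in> prd (aug (A \<inter> B)) A"
proof -
  define I where "I = hidl D B"
  note hsD = nrmD(1)[OF DB] and hsB = nrmD(2)[OF DB]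
  note Dc [simp] = hs_carrier[OF hsD] and Ac [simp] = hs_carrier[OF A]
  note As = hs_subsp[OF A]
  have Is: "subsp I" unfolding I_def by (rule hidl_subsp[OF DB])
  have ID: "I \<subseteq> D" unfolding I_def by (rule hidl_subset[OF DB])
  note Ic = subsp_carrier[OF Is]
  have Il: "d \<star> i \<in> I" and Ir: "i \<star> d \<in> I" if "d \<in> D" "i \<in> I" for d i
    using that hidl_mult_left[OF DB] hidl_mult_right[OF DB] unfolding I_def by auto
  have IS: "\<S> i \<in> I" if "i \<in> I" for i using that hidl_antipode[OF DB] unfolding I_def by auto
  have I\<epsilon>: "\<epsilon> i = \<zero>\<^bsub>k\<^esub>" if "i \<in> I" for i using that hidl_counit[OF DB] unfolding I_def by auto
  have sw_I: "sw \<beta> i = \<zero>\<^bsub>H\<^esub>" if "bil \<beta>" "i \<in> I"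
    "\<And>x y. x \<in> I \<Longrightarrow> y \<in> D \<Longrightarrow> \<beta> x y = \<zero>\<^bsub>H\<^esub>" "\<And>x y. x \<in> D \<Longrightarrow> y \<in> I \<Longrightarrow> \<beta> x y = \<zero>\<^bsub>H\<^esub>" for \<beta> i
    using that sw_hidl[OF DB] unfolding I_def by blast
  have zeroI: "sw \<beta> h = \<zero>\<^bsub>H\<^esub>" if "hs K" "h \<in> K" "bil \<beta>" "\<And>x y. x \<in> K \<Longrightarrow> y \<in> K \<Longrightarrow> \<beta> x y = \<zero>\<^bsub>H\<^esub>" for \<beta> h K
    using sw_sub_mem[OF that(1-3) subsp_zero_set] that(4) by blast
  \<comment> \<open>Lifts of a basis of \<open>D / I\<close> that lie in \<open>A\<close>; they
    exist because \<open>A\<close> maps onto \<open>D / I\<close> by \<open>gen\<close>.\<close>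
  obtain es where es: "dual_family es A I D"
    using dual_family_exists[OF Is hs_subsp[OF hsD] ID _ gen[folded I_def]] Ac by blast
  have eA: "fst z \<in> A" and lf: "lfun (snd z)" and fI: "\<And>i. i \<in> I \<Longrightarrow> snd z i = \<zero>\<^bsub>k\<^esub>" if "z \<in> set es" for z
    using dual_familyD(1,2,3)[OF es, of "fst z" "snd z"] that by auto
  have eD: "fst z \<in> D" if "z \<in> set es" for z using eA that AD by blast
  have ec [simp]: "fst z \<in> carrier H" if "z \<in> set es" for z using eA that by simp
  have fc [simp]: "snd z x \<in> carrier k" if "z \<in> set es" "x \<in> carrier H" for z x
    using lfun_closed[OF lf] that by simp
  \<comment> \<open>A linear section of \<open>A -> D / I\<close>. It is not colinear in general,
    and the trace construction below corrects this.\<close>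
  define \<tau> where "\<tau> x = lsum (\<lambda>z. snd z x \<bullet> fst z) es" for x
  have \<tau>: "lin \<tau>" unfolding \<tau>_def by (intro lin_lsum_param lin_lfun[OF lf] lin_id) auto
  have \<tau>A: "\<tau> x \<in> A" if "x \<in> carrier H" for x
    unfolding \<tau>_def by (intro subsp_lsum[OF As] subsp_smult[OF As] eA fc that)
  have \<tau>c [simp]: "\<tau> x \<in> carrier H" if "x \<in> carrier H" for x using \<tau>A[OF that] by simp
  have \<tau>I: "\<tau> i = \<zero>\<^bsub>H\<^esub>" if "i \<in> I" for i
    unfolding \<tau>_def by (rule lsum_zero) (simp add: fI that smult_zero_k)
  have \<tau>D: "x \<ominus>\<^bsub>H\<^esub> \<tau> x \<in> I" if "x \<in> D" for x
    using dual_familyD(4)[OF es that] by (simp add: \<tau>_def case_prod_unfold)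
  \<comment> \<open>A linear map that vanishes on \<open>I\<close> sees its argument only modulo
    \<open>I\<close>, so the argument may be exchanged for its lift to \<open>A\<close>.\<close>
  have mod_I: "f x = f (\<tau> x)" if f: "lin f" and x: "x \<in> D" and z: "\<And>i. i \<in> I \<Longrightarrow> f i = \<zero>\<^bsub>H\<^esub>" for f x
  proof -
    have "f x \<ominus>\<^bsub>H\<^esub> f (\<tau> x) = \<zero>\<^bsub>H\<^esub>"
      using z[OF \<tau>D[OF x]] lin_diff[OF f Dc[OF x] \<tau>c[OF Dc[OF x]]] by simp
    then show ?thesis
      using M.r_right_minus_eq[OF lin_closed[OF f Dc[OF x]] lin_closed[OF f \<tau>c[OF Dc[OF x]]]] by simp
  qed
  note li = lin_intros lin_comp[OF \<tau>]
  \<comment> \<open>The counterpart of \<open>G\<close>: the legs of \<open>\<tau> w1\<close> are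
    fed to \<open>b\<close>, the second one multiplied by \<open>S(w2)\<close>. Modulo
    \<open>I\<close> the map \<open>\<tau>\<close> is the identity, so applying the counit to the
    first leg leaves \<open>w1 S(w2) = \<epsilon> w\<close>.\<close>
  define g where "g b w = sw (\<lambda>s t. sw (\<lambda>u v. b u (v \<star> \<S> t)) (\<tau> s)) w" for b w
  have bil_b2: "bil (\<lambda>u v. b u (v \<star> \<S> t))" if b: "bil b" and t: "t \<in> carrier H" for b t
    by (intro bilI lin_comp[OF bil_lin1[OF b]] bil_lin2[OF b] li) (use t in simp_all)
  have bil_b: "bil (\<lambda>s t. sw (\<lambda>u v. b u (v \<star> \<S> t)) (\<tau> s))" if b: "bil b" for b
  proof (rule bilI)
    show "lin (\<lambda>t. sw (\<lambda>u v. b u (v \<star> \<S> t)) (\<tau> s))" for s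
      by (intro lin_sw_param lin_comp[OF bil_lin1[OF b]] li) simp_all
    show "lin (\<lambda>s. sw (\<lambda>u v. b u (v \<star> \<S> t)) (\<tau> s))" if "t \<in> carrier H" for t
      by (rule lin_comp[OF sw_lin_apply[OF bil_b2[OF b that]] \<tau>])
  qed
  have g_lin: "lin (\<lambda>x. g b (q x))" if "bil b" "lin q" for b q
    unfolding g_def by (rule lin_comp[OF sw_lin_apply[OF bil_b[OF that(1)]] that(2)])
  have g_param: "lin (\<lambda>x. g (b x) w)" if "\<And>u v. u \<in> carrier H \<Longrightarrow> v \<in> carrier H \<Longrightarrow> lin (\<lambda>x. b x u v)" for b w
    unfolding g_def using that by (intro li; simp)
  have g_closed [simp]: "g b w \<in> carrier H"
    if "\<And>u v. u \<in> carrier H \<Longrightarrow> v \<in> carrier H \<Longrightarrow> b u v \<in> carrier H" for b w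
    unfolding g_def using that by simp
  have g_cong: "g b w = g b' w" if w: "w \<in> D" and b: "bil b" "bil b'"
    and eq: "\<And>u q. u \<in> A \<Longrightarrow> q \<in> D \<Longrightarrow> b u q = b' u q" for b b' w
    unfolding g_def
  proof (rule sw_sub_cong[OF hsD w bil_b[OF b(1)] bil_b[OF b(2)]])
    fix s t assume st: "s \<in> D" "t \<in> D"
    show "sw (\<lambda>u v. b u (v \<star> \<S> t)) (\<tau> s) = sw (\<lambda>u v. b' u (v \<star> \<S> t)) (\<tau> s)"
      by (rule sw_sub_cong[OF A \<tau>A bil_b2[OF b(1)] bil_b2[OF b(2)]])
         (use st eq AD in \<open>auto intro!: hs_mult[OF hsD] hs_antipode[OF hsD]\<close>)
  qed
  have g_I: "g b w = \<zero>\<^bsub>H\<^esub>" if w: "w \<in> I" and b: "bil b"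
    and z: "\<And>u i. u \<in> A \<Longrightarrow> i \<in> I \<Longrightarrow> b u i = \<zero>\<^bsub>H\<^esub>" for b w
    unfolding g_def
  proof (rule sw_I[OF bil_b[OF b] w])
    fix x y assume x: "x \<in> I" and y: "y \<in> D"
    have "lin (sw (\<lambda>u v. b u (v \<star> \<S> y)))" by (rule sw_lin_apply[OF bil_b2[OF b]]) (use y in simp)
    then show "sw (\<lambda>u v. b u (v \<star> \<S> y)) (\<tau> x) = \<zero>\<^bsub>H\<^esub>" using \<tau>I[OF x] lin_zero by simp
  next
    fix x y assume x: "x \<in> D" and y: "y \<in> I"
    show "sw (\<lambda>u v. b u (v \<star> \<S> y)) (\<tau> x) = \<zero>\<^bsub>H\<^esub>"
      by (rule zeroI[OF A \<tau>A bil_b2[OF b]]) (use x y AD in \<open>auto intro!: z Il IS Ic\<close>)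
  qed
  have bil_f: "bil (\<lambda>u v. snd z v \<bullet> u)" if "z \<in> set es" for z
    using that by (intro li lin_lfun[OF lf]; simp)
  \<comment> \<open>The trace over \<open>D / I\<close>: the functional of each dual pair is applied
    to the second leg, while its vector enters through \<open>S(e) y\<close>.\<close>
  define s where "s y = lsum (\<lambda>z. g (\<lambda>u v. snd z v \<bullet> u) (\<S> (fst z) \<star> y)) es" for y
  have s_lin: "lin s"
    unfolding s_def by (intro lin_lsum_param g_lin bil_f li) simp_all
  have sA: "s y \<in> A" if "y \<in> carrier H" for y
    unfolding s_def
  proof (rule subsp_lsum[OF As])
    fix z assume z: "z \<in> set es"
    show "g (\<lambda>u v. snd z v \<bullet> u) (\<S> (fst z) \<star> y) \<in> A"
      unfolding g_def
    proof (rule sw_mem[OF As])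
      fix s t assume "s \<in> carrier H" "t \<in> carrier H"
      then show "sw (\<lambda>u v. snd z (v \<star> \<S> t) \<bullet> u) (\<tau> s) \<in> A"
        using z by (intro sw_sub_mem[OF A \<tau>A bil_b2[OF bil_f] As] subsp_smult[OF As]) auto
    qed
  qed
  have sc [simp]: "s y \<in> carrier H" if "y \<in> carrier H" for y using sA[OF that] by simp
  have sI: "s i = \<zero>\<^bsub>H\<^esub>" if "i \<in> I" for i
    unfolding s_def
    by (rule lsum_zero, rule g_I)
       (use that in \<open>auto intro!: Il hs_antipode[OF hsD] eD bil_f simp: fI smult_zero_k\<close>)
  have s\<epsilon>: "\<epsilon> (s y) = \<epsilon> y" if y: "y \<in> D" for y
  proof (rule scalar_eqD)
    note yc = Dc[OF y]
    have l: "lin (\<lambda>x. \<epsilon> x \<bullet> \<e>)" by (intro li) simp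
    \<comment> \<open>After \<open>\<epsilon>\<close> the \<open>z\<close>-th term of
      \<open>s y\<close> is \<open>\<epsilon> y\<close> times \<open>\<epsilon>\<close> of the
      coefficient of the unit along the \<open>z\<close>-th vector. The sum is
      \<open>\<epsilon> y\<close> times the rank-one trace
      \<open>\<epsilon> (\<tau> 1) = 1\<close>.\<close>
    have g\<epsilon>: "\<epsilon> (g (\<lambda>u v. snd z v \<bullet> u) w) \<bullet> \<e> = \<epsilon> w \<bullet> (snd z \<e> \<bullet> \<e>)" if z: "z \<in> set es" and w: "w \<in> D" for z w
    proof -
      have "\<epsilon> (g (\<lambda>u v. snd z v \<bullet> u) w) \<bullet> \<e> = sw (\<lambda>s t. \<epsilon> (sw (\<lambda>u v. snd z (v \<star> \<S> t) \<bullet> u) (\<tau> s)) \<bullet> \<e>) w"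
        unfolding g_def by (rule lin_sw_apply[OF l]) (use z in simp)
      also have "\<dots> = sw (\<lambda>s t. snd z (\<tau> s \<star> \<S> t) \<bullet> \<e>) w"
      proof (rule sw_cong[OF refl])
        fix s t assume st: "s \<in> carrier H" "t \<in> carrier H"
        have "\<epsilon> (sw (\<lambda>u v. snd z (v \<star> \<S> t) \<bullet> u) (\<tau> s)) \<bullet> \<e> = sw (\<lambda>u v. \<epsilon> (snd z (v \<star> \<S> t) \<bullet> u) \<bullet> \<e>) (\<tau> s)"
          by (rule lin_sw_apply[OF l]) (use z st in simp)
        also have "\<dots> = sw (\<lambda>u v. \<epsilon> u \<bullet> (snd z (v \<star> \<S> t) \<bullet> \<e>)) (\<tau> s)"
          using z st by (simp add: counit_smult smult_assoc1[symmetric] R.m_comm)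
        also have "\<dots> = snd z (\<tau> s \<star> \<S> t) \<bullet> \<e>"
          by (rule sw_counit_left) (use z st in \<open>auto intro!: li lin_lfun[OF lf]\<close>)
        finally show "\<epsilon> (sw (\<lambda>u v. snd z (v \<star> \<S> t) \<bullet> u) (\<tau> s)) \<bullet> \<e> = snd z (\<tau> s \<star> \<S> t) \<bullet> \<e>" .
      qed
      also have "\<dots> = sw (\<lambda>s t. snd z (s \<star> \<S> t) \<bullet> \<e>) w"
      proof (rule sw_sub_cong[OF hsD w])
        show "bil (\<lambda>s t. snd z (\<tau> s \<star> \<S> t) \<bullet> \<e>)" "bil (\<lambda>s t. snd z (s \<star> \<S> t) \<bullet> \<e>)"
          using z by (intro li lin_lfun[OF lf]; simp)+
        show "snd z (\<tau> s \<star> \<S> t) \<bullet> \<e> = snd z (s \<star> \<S> t) \<bullet> \<e>" if st: "s \<in> D" "t \<in> D" for s t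
          by (rule mod_I[symmetric, OF _ st(1)])
             (use z st in \<open>auto intro!: li lin_lfun[OF lf] simp: fI Ir hs_antipode[OF hsD] smult_zero_k\<close>)
      qed
      also have "\<dots> = \<epsilon> w \<bullet> (snd z \<e> \<bullet> \<e>)"
        by (rule sw_antipode_right[of "\<lambda>x. snd z x \<bullet> \<e>"]) (use z w in \<open>auto intro!: li lin_lfun[OF lf]\<close>)
      finally show ?thesis .
    qed
    have "\<epsilon> (s y) \<bullet> \<e> = lsum (\<lambda>z. \<epsilon> (g (\<lambda>u v. snd z v \<bullet> u) (\<S> (fst z) \<star> y)) \<bullet> \<e>) es"
      unfolding s_def by (rule lin_lsum[OF l]) simp
    also have "\<dots> = lsum (\<lambda>z. \<epsilon> y \<bullet> (\<epsilon> (snd z \<e> \<bullet> fst z) \<bullet> \<e>)) es"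
    proof (rule lprod_cong)
      fix z assume z: "z \<in> set es"
      have "\<epsilon> (g (\<lambda>u v. snd z v \<bullet> u) (\<S> (fst z) \<star> y)) \<bullet> \<e> = \<epsilon> (\<S> (fst z) \<star> y) \<bullet> (snd z \<e> \<bullet> \<e>)"
        by (rule g\<epsilon>[OF z]) (intro hs_mult[OF hsD] hs_antipode[OF hsD] eD z y)
      then show "\<epsilon> (g (\<lambda>u v. snd z v \<bullet> u) (\<S> (fst z) \<star> y)) \<bullet> \<e> = \<epsilon> y \<bullet> (\<epsilon> (snd z \<e> \<bullet> fst z) \<bullet> \<e>)"
        using z yc by (simp add: counit_mult counit_antipode counit_smult smult_assoc1[symmetric] R.m_ac)
    qed
    also have "\<dots> = \<epsilon> y \<bullet> (\<epsilon> (\<tau> \<e>) \<bullet> \<e>)"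
      unfolding \<tau>_def
      by (rule lin_lsum[symmetric, of "\<lambda>x. \<epsilon> y \<bullet> (\<epsilon> x \<bullet> \<e>)"]) (use yc in \<open>auto intro!: li\<close>)
    also have "\<epsilon> (\<tau> \<e>) \<bullet> \<e> = \<epsilon> \<e> \<bullet> \<e>"
      by (rule mod_I[symmetric, OF l hs_one[OF hsD]]) (simp add: I\<epsilon> smult_zero_k)
    finally show "\<epsilon> (s y) \<bullet> \<e> = \<epsilon> y \<bullet> \<e>" by (simp add: counit_one)
  qed (use y in auto)
  \<comment> \<open>Right colinearity of \<open>s\<close> over \<open>D / I\<close>: the second leg
    matters only modulo \<open>I\<close>, which is why \<open>\<beta>\<close> is required to vanish
    on \<open>A \<times> I\<close>.\<close>
  have colin: "sw \<beta> (s y) = sw (\<lambda>y1 y2. \<beta> (s y1) y2) y"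
    if \<beta>: "bil \<beta>" and kill: "\<And>x i. x \<in> A \<Longrightarrow> i \<in> I \<Longrightarrow> \<beta> x i = \<zero>\<^bsub>H\<^esub>" and y: "y \<in> D" for \<beta> y
  proof -
    note yc = Dc[OF y]
    note b1 = lin_comp[OF bil_lin1[OF \<beta>]] and b2 = lin_comp[OF bil_lin2[OF \<beta>]]
    note li = li b1 b2
    note [simp] = bil_closed[OF \<beta>]
    \<comment> \<open>The form left after the coproduct of the second leg: its last part meets the
      functional, the first part times \<open>w2\<close> goes into \<open>\<beta>\<close>.\<close>
    define b where "b z w2 u q = sw (\<lambda>q1 q2. snd z q2 \<bullet> \<beta> u (q1 \<star> w2)) q" for z :: "'a \<times> ('a \<Rightarrow> 'k)" and w2 u q
    have b_closed [simp]: "b z w2 u q \<in> carrier H" if "z \<in> set es" "w2 \<in> carrier H" "u \<in> carrier H" for z w2 u q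
      unfolding b_def using that by simp
    have b_bil: "bil (b z w2)" if "z \<in> set es" "w2 \<in> carrier H" for z w2
      unfolding b_def using that by (intro li lin_lfun[OF lf]; simp)
    have b_w2: "lin (\<lambda>x. b z (f x) u q)" if "z \<in> set es" "u \<in> carrier H" "lin f" for z u q f
      unfolding b_def using that by (intro li; simp)
    have step: "sw \<beta> (g (\<lambda>u v. snd z v \<bullet> u) w) = sw (\<lambda>w1 w2. g (b z w2) w1) w"
      if z: "z \<in> set es" and w: "w \<in> carrier H" for z w
    proof -
      define \<Psi> where "\<Psi> s t1 x = sw (\<lambda>u v. sw (\<lambda>v1 v2. snd z (v2 \<star> \<S> t1) \<bullet> \<beta> u (v1 \<star> x)) v) (\<tau> s)" for s t1 x
      have \<Psi>1: "lin (\<lambda>s. \<Psi> s t x)" if "t \<in> carrier H" "x \<in> carrier H" for t x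
        unfolding \<Psi>_def using that z by (intro li lin_lfun[OF lf]; simp)
      have \<Psi>2: "lin (\<lambda>t. \<Psi> s t x)" if "s \<in> carrier H" "x \<in> carrier H" for s x
        unfolding \<Psi>_def using that z by (intro li lin_lfun[OF lf]; simp)
      have \<Psi>3: "lin (\<lambda>x. \<Psi> s t (f x))" if "s \<in> carrier H" "t \<in> carrier H" "lin f" for s t f
        unfolding \<Psi>_def using that z by (intro li lin_lfun[OF lf]; simp)
      have "sw \<beta> (g (\<lambda>u v. snd z v \<bullet> u) w) = sw (\<lambda>s t. sw \<beta> (sw (\<lambda>u v. snd z (v \<star> \<S> t) \<bullet> u) (\<tau> s))) w"
        unfolding g_def by (rule lin_sw_apply[OF sw_lin_apply[OF \<beta>]]) (use z in simp)
      also have "\<dots> = sw (\<lambda>s t. \<Psi> s t \<e>) w"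
      proof (rule sw_cong[OF refl])
        fix s t assume st: "s \<in> carrier H" "t \<in> carrier H"
        have "sw \<beta> (sw (\<lambda>u v. snd z (v \<star> \<S> t) \<bullet> u) (\<tau> s)) =
            sw (\<lambda>r v'. sw \<beta> (snd z (v' \<star> \<S> t) \<bullet> r)) (\<tau> s)"
          by (rule lin_sw_apply[OF sw_lin_apply[OF \<beta>]]) (use z st in simp)
        also have "\<dots> = sw (\<lambda>r v'. sw (\<lambda>u v. snd z (v' \<star> \<S> t) \<bullet> \<beta> u v) r) (\<tau> s)"
        proof (rule sw_cong[OF refl])
          fix r v' assume rv: "r \<in> carrier H" "v' \<in> carrier H"
          have "sw \<beta> (snd z (v' \<star> \<S> t) \<bullet> r) = snd z (v' \<star> \<S> t) \<bullet> sw \<beta> r"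
            by (rule sw_smult[OF \<beta>]) (use z st rv in simp_all)
          also have "\<dots> = sw (\<lambda>u v. snd z (v' \<star> \<S> t) \<bullet> \<beta> u v) r"
            by (rule lin_sw_apply) (use z st rv in \<open>auto intro!: li\<close>)
          finally show "sw \<beta> (snd z (v' \<star> \<S> t) \<bullet> r) = sw (\<lambda>u v. snd z (v' \<star> \<S> t) \<bullet> \<beta> u v) r" .
        qed
        also have "\<dots> = sw (\<lambda>u r. sw (\<lambda>v v'. snd z (v' \<star> \<S> t) \<bullet> \<beta> u v) r) (\<tau> s)"
          by (rule sw_coassoc) (use z st in \<open>auto intro!: li lin_lfun[OF lf]\<close>)
        also have "\<dots> = \<Psi> s t \<e>"
          unfolding \<Psi>_def by simp
        finally show "sw \<beta> (sw (\<lambda>u v. snd z (v \<star> \<S> t) \<bullet> u) (\<tau> s)) = \<Psi> s t \<e>" .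
      qed
      \<comment> \<open>A counit is inserted on the last leg of \<open>w\<close> and rewritten as
        \<open>S(t2) w2\<close>. The factor \<open>S(t2)\<close> then completes \<open>S(t1)\<close>
        to the coproduct of \<open>S(t)\<close>, and \<open>w2\<close> is the new right leg.\<close>
      also have "\<dots> = sw (\<lambda>s r. sw (\<lambda>t1 q. \<epsilon> q \<bullet> \<Psi> s t1 \<e>) r) w"
        by (intro sw_cong refl sw_counit_right[symmetric] \<Psi>2) simp_all
      also have "\<dots> = sw (\<lambda>s r. sw (\<lambda>t1 q. sw (\<lambda>t2 w2. \<Psi> s t1 (\<S> t2 \<star> w2)) q) r) w"
        by (intro sw_cong refl sw_antipode_left[symmetric] \<Psi>3 lin_id)
      also have "\<dots> = sw (\<lambda>s r. sw (\<lambda>t w2. sw (\<lambda>t1 t2. \<Psi> s t1 (\<S> t2 \<star> w2)) t) r) w"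
        by (intro sw_cong refl sw_coassoc[symmetric] \<Psi>2 \<Psi>3 li) simp_all
      also have "\<dots> = sw (\<lambda>w1 w2. sw (\<lambda>s t. sw (\<lambda>t1 t2. \<Psi> s t1 (\<S> t2 \<star> w2)) t) w1) w"
        by (rule sw_coassoc[symmetric, OF w])
           (use z in \<open>auto intro!: \<Psi>1 \<Psi>2 \<Psi>3 lin_sw_param lin_sw_arg li\<close>)
      also have "\<dots> = sw (\<lambda>w1 w2. g (b z w2) w1) w"
        unfolding g_def
      proof (rule sw_cong[OF refl], rule sw_cong[OF refl])
        fix w1 w2 s t assume cl: "w1 \<in> carrier H" "w2 \<in> carrier H" "s \<in> carrier H" "t \<in> carrier H"
        have "sw (\<lambda>u v. b z w2 u (v \<star> \<S> t)) (\<tau> s) =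
            sw (\<lambda>u v. sw (\<lambda>t1 t2. sw (\<lambda>v1 v2. snd z (v2 \<star> \<S> t1) \<bullet> \<beta> u (v1 \<star> (\<S> t2 \<star> w2))) v) t) (\<tau> s)"
        proof (rule sw_cong[OF refl])
          fix u v assume uv: "u \<in> carrier H" "v \<in> carrier H"
          have bq: "bil (\<lambda>q1 q2. snd z q2 \<bullet> \<beta> u (q1 \<star> w2))"
            using z cl uv by (intro li lin_lfun[OF lf]; simp)
          have bp: "bil (\<lambda>p1 p2. snd z (v2 \<star> p2) \<bullet> \<beta> u (v1 \<star> p1 \<star> w2))" if "v1 \<in> carrier H" "v2 \<in> carrier H" for v1 v2
            using z cl uv that by (intro li lin_lfun[OF lf]; simp)
          have "b z w2 u (v \<star> \<S> t) = sw (\<lambda>v1 v2. sw (\<lambda>p1 p2. snd z (v2 \<star> p2) \<bullet> \<beta> u (v1 \<star> p1 \<star> w2)) (\<S> t)) v"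
            unfolding b_def by (rule sw_mult[OF bq uv(2)]) (use cl in simp)
          also have "\<dots> = sw (\<lambda>v1 v2. sw (\<lambda>t1 t2. snd z (v2 \<star> \<S> t1) \<bullet> \<beta> u (v1 \<star> \<S> t2 \<star> w2)) t) v"
            by (intro sw_cong refl sw_antipode bp cl)
          also have "\<dots> = sw (\<lambda>v1 v2. sw (\<lambda>t1 t2. snd z (v2 \<star> \<S> t1) \<bullet> \<beta> u (v1 \<star> (\<S> t2 \<star> w2))) t) v"
            using cl by (simp add: M.m_assoc)
          also have "\<dots> = sw (\<lambda>t1 t2. sw (\<lambda>v1 v2. snd z (v2 \<star> \<S> t1) \<bullet> \<beta> u (v1 \<star> (\<S> t2 \<star> w2))) v) t"
            by (rule sw_swap) (use z cl uv in simp)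
          finally show "b z w2 u (v \<star> \<S> t) =
            sw (\<lambda>t1 t2. sw (\<lambda>v1 v2. snd z (v2 \<star> \<S> t1) \<bullet> \<beta> u (v1 \<star> (\<S> t2 \<star> w2))) v) t" .
        qed
        also have "\<dots> = sw (\<lambda>t1 t2. \<Psi> s t1 (\<S> t2 \<star> w2)) t"
          unfolding \<Psi>_def by (rule sw_swap) (use z cl in simp)
        finally show "sw (\<lambda>t1 t2. \<Psi> s t1 (\<S> t2 \<star> w2)) t = sw (\<lambda>u v. b z w2 u (v \<star> \<S> t)) (\<tau> s)" by simp
      qed
      finally show ?thesis .
    qed
    \<comment> \<open>With \<open>w = S(e) y\<close> the coproduct is
      \<open>S(e2) y1 \<otimes> S(e1) y2\<close>; \<open>X\<close> keeps \<open>e2\<close>,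
      \<open>y1\<close> and the right leg as separate linear arguments.\<close>
    define X where "X z e1 y1 w2 = g (b z w2) (\<S> e1 \<star> y1)" for z e1 y1 w2
    have X_lin1: "lin (\<lambda>e1. X z (f e1) y1 w2)" if "z \<in> set es" "y1 \<in> carrier H" "w2 \<in> carrier H" "lin f" for z y1 w2 f
      unfolding X_def using that by (intro g_lin b_bil li)
    have X_lin2: "lin (\<lambda>y1. X z e1 (f y1) w2)" if "z \<in> set es" "e1 \<in> carrier H" "w2 \<in> carrier H" "lin f" for z e1 w2 f
      unfolding X_def using that by (intro g_lin b_bil li) simp_all
    have X_lin3: "lin (\<lambda>x. X z e1 y1 (f x))" if "z \<in> set es" "lin f" for z e1 y1 f
      unfolding X_def using that by (intro g_param b_w2)
    have Xc [simp]: "X z e1 y1 w2 \<in> carrier H" if "z \<in> set es" "w2 \<in> carrier H" for z e1 y1 w2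
      unfolding X_def using that by simp
    have b_kill: "b z w2 u i = \<zero>\<^bsub>H\<^esub>" if "z \<in> set es" "w2 \<in> D" "u \<in> A" "i \<in> I" for z w2 u i
      unfolding b_def
    proof (rule sw_I[OF _ that(4)])
      show "bil (\<lambda>q1 q2. snd z q2 \<bullet> \<beta> u (q1 \<star> w2))"
        using that by (intro li lin_lfun[OF lf]; simp)
      show "snd z q2 \<bullet> \<beta> u (q1 \<star> w2) = \<zero>\<^bsub>H\<^esub>" if "q1 \<in> I" "q2 \<in> D" for q1 q2
        using that \<open>z \<in> set es\<close> kill[OF \<open>u \<in> A\<close> Ir[OF \<open>w2 \<in> D\<close> that(1)]] by (simp add: smult_zero_H)
      show "snd z q2 \<bullet> \<beta> u (q1 \<star> w2) = \<zero>\<^bsub>H\<^esub>" if "q1 \<in> D" "q2 \<in> I" for q1 q2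
        using that \<open>z \<in> set es\<close> \<open>w2 \<in> D\<close> \<open>u \<in> A\<close> by (simp add: fI smult_zero_k)
    qed
    have expand: "sw (\<lambda>w1 w2. g (b z w2) w1) (\<S> (fst z) \<star> y) =
        sw (\<lambda>z1 z2. sw (\<lambda>y1 y2. lsum (\<lambda>j. snd j z2 \<bullet> X z (fst j) y1 (\<S> z1 \<star> y2)) es) y) (fst z)"
      if z: "z \<in> set es" for z
    proof -
      have bl: "bil (\<lambda>w1 w2. g (b z w2) w1)"
        using z by (intro bilI g_param b_w2 lin_id g_lin b_bil)
      have bl2: "bil (\<lambda>x1 x2. g (b z (x2 \<star> y2)) (x1 \<star> y1))" if "y1 \<in> carrier H" "y2 \<in> carrier H" for y1 y2
        using z that by (intro bilI g_param b_w2 li g_lin b_bil) simp_all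
      have "sw (\<lambda>w1 w2. g (b z w2) w1) (\<S> (fst z) \<star> y) =
          sw (\<lambda>x1 x2. sw (\<lambda>y1 y2. g (b z (x2 \<star> y2)) (x1 \<star> y1)) y) (\<S> (fst z))"
        by (rule sw_mult[OF bl _ yc]) (use z in simp)
      also have "\<dots> = sw (\<lambda>y1 y2. sw (\<lambda>x1 x2. g (b z (x2 \<star> y2)) (x1 \<star> y1)) (\<S> (fst z))) y"
        by (rule sw_swap) (use z in simp)
      also have "\<dots> = sw (\<lambda>y1 y2. sw (\<lambda>z1 z2. X z z2 y1 (\<S> z1 \<star> y2)) (fst z)) y"
        unfolding X_def by (intro sw_cong refl sw_antipode bl2 ec z)
      also have "\<dots> = sw (\<lambda>z1 z2. sw (\<lambda>y1 y2. X z z2 y1 (\<S> z1 \<star> y2)) y) (fst z)"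
        by (rule sw_swap) (use z in simp)
      \<comment> \<open>\<open>X\<close> vanishes when its first leg argument lies in
        \<open>I\<close>, so \<open>z2\<close> may be expanded in the dual family. This creates a
        second index \<open>j\<close>, and the original index \<open>z\<close> can then be summed
        away.\<close>
      also have "\<dots> = sw (\<lambda>z1 z2. sw (\<lambda>y1 y2. X z (\<tau> z2) y1 (\<S> z1 \<star> y2)) y) (fst z)"
      proof (rule sw_sub_cong[OF hsD eD[OF z]])
        show "bil (\<lambda>z1 z2. sw (\<lambda>y1 y2. X z z2 y1 (\<S> z1 \<star> y2)) y)"
          using z by (intro bilI lin_sw_param X_lin1 X_lin3 li) simp_all
        show "bil (\<lambda>z1 z2. sw (\<lambda>y1 y2. X z (\<tau> z2) y1 (\<S> z1 \<star> y2)) y)"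
          using z by (intro bilI lin_sw_param X_lin1 X_lin3 li \<tau>) simp_all
        fix z1 z2 assume zz: "z1 \<in> D" "z2 \<in> D"
        show "sw (\<lambda>y1 y2. X z z2 y1 (\<S> z1 \<star> y2)) y = sw (\<lambda>y1 y2. X z (\<tau> z2) y1 (\<S> z1 \<star> y2)) y"
        proof (rule sw_sub_cong[OF hsD y])
          show "bil (\<lambda>y1 y2. X z z2 y1 (\<S> z1 \<star> y2))"
            using z zz by (intro bilI X_lin2 X_lin3 li) simp_all
          show "bil (\<lambda>y1 y2. X z (\<tau> z2) y1 (\<S> z1 \<star> y2))"
            using z zz by (intro bilI X_lin2 X_lin3 li) simp_all
          fix y1 y2 assume yy: "y1 \<in> D" "y2 \<in> D"
          have w2: "\<S> z1 \<star> y2 \<in> D" by (intro hs_mult[OF hsD] hs_antipode[OF hsD] zz yy)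
          show "X z z2 y1 (\<S> z1 \<star> y2) = X z (\<tau> z2) y1 (\<S> z1 \<star> y2)"
          proof (rule mod_I[OF _ zz(2)])
            show "lin (\<lambda>x. X z x y1 (\<S> z1 \<star> y2))"
              using z yy w2 by (intro X_lin1 lin_id) simp_all
            show "X z i y1 (\<S> z1 \<star> y2) = \<zero>\<^bsub>H\<^esub>" if "i \<in> I" for i
              unfolding X_def
              by (rule g_I[OF Ir[OF yy(1) IS[OF that]] b_bil[OF z Dc[OF w2]] b_kill[OF z w2]])
          qed
        qed
      qed
      also have "\<dots> = sw (\<lambda>z1 z2. sw (\<lambda>y1 y2. lsum (\<lambda>j. snd j z2 \<bullet> X z (fst j) y1 (\<S> z1 \<star> y2)) es) y) (fst z)"
      proof (intro sw_cong refl)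
        fix z1 z2 y1 y2 assume cl: "z1 \<in> carrier H" "z2 \<in> carrier H" "y1 \<in> carrier H" "y2 \<in> carrier H"
        have l: "lin (\<lambda>x. X z x y1 (\<S> z1 \<star> y2))"
          using z cl by (intro X_lin1 lin_id) simp_all
        have "X z (\<tau> z2) y1 (\<S> z1 \<star> y2) = lsum (\<lambda>j. X z (snd j z2 \<bullet> fst j) y1 (\<S> z1 \<star> y2)) es"
          unfolding \<tau>_def by (rule lin_lsum[OF l]) (use cl in simp)
        also have "\<dots> = lsum (\<lambda>j. snd j z2 \<bullet> X z (fst j) y1 (\<S> z1 \<star> y2)) es"
          by (rule lprod_cong) (use cl lin_smult[OF l] in simp)
        finally show "X z (\<tau> z2) y1 (\<S> z1 \<star> y2) = lsum (\<lambda>j. snd j z2 \<bullet> X z (fst j) y1 (\<S> z1 \<star> y2)) es" .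
      qed
      finally show ?thesis .
    qed
    \<comment> \<open>What remains of the form when the sum over \<open>z\<close> is carried inside
      \<open>g\<close>. The fact \<open>trace\<close> shows that it collapses to
      \<open>f_j(q) \<beta>(u, y2)\<close>, in which \<open>z\<close> no longer occurs.\<close>
    define Y where "Y j y2 u q = lsum (\<lambda>z. sw (\<lambda>z1 z2. snd j z2 \<bullet> b z (\<S> z1 \<star> y2) u q) (fst z)) es"
      for j :: "'a \<times> ('a \<Rightarrow> 'k)" and y2 u q
    have Y_bil: "bil (Y j y2)" if "j \<in> set es" "y2 \<in> carrier H" for j y2
      unfolding Y_def using that
      by (intro bilI lin_lsum_param lin_sw_param lin_smult_lin bil_lin1[OF b_bil] bil_lin2[OF b_bil]) simp_all
    have trace: "Y j y2 u q = snd j q \<bullet> \<beta> u y2"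
      if j: "j \<in> set es" and y2: "y2 \<in> D" and u: "u \<in> A" and q: "q \<in> D" for j y2 u q
    proof -
      have "Y j y2 u q = lsum (\<lambda>z. sw (\<lambda>q1 q2. sw (\<lambda>z1 z2. snd z q2 \<bullet> (snd j z2 \<bullet> \<beta> u (q1 \<star> (\<S> z1 \<star> y2)))) (fst z)) q) es"
        unfolding Y_def b_def
      proof (rule lprod_cong)
        fix z assume z: "z \<in> set es"
        have "sw (\<lambda>z1 z2. snd j z2 \<bullet> sw (\<lambda>q1 q2. snd z q2 \<bullet> \<beta> u (q1 \<star> (\<S> z1 \<star> y2))) q) (fst z) =
          sw (\<lambda>z1 z2. sw (\<lambda>q1 q2. snd z q2 \<bullet> (snd j z2 \<bullet> \<beta> u (q1 \<star> (\<S> z1 \<star> y2)))) q) (fst z)"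
        proof (rule sw_cong[OF refl])
          fix z1 z2 assume zz: "z1 \<in> carrier H" "z2 \<in> carrier H"
          have "snd j z2 \<bullet> sw (\<lambda>q1 q2. snd z q2 \<bullet> \<beta> u (q1 \<star> (\<S> z1 \<star> y2))) q =
              sw (\<lambda>q1 q2. snd j z2 \<bullet> (snd z q2 \<bullet> \<beta> u (q1 \<star> (\<S> z1 \<star> y2)))) q"
            by (rule lin_sw_apply) (use z j zz y2 u in \<open>auto intro!: li\<close>)
          then show "snd j z2 \<bullet> sw (\<lambda>q1 q2. snd z q2 \<bullet> \<beta> u (q1 \<star> (\<S> z1 \<star> y2))) q =
              sw (\<lambda>q1 q2. snd z q2 \<bullet> (snd j z2 \<bullet> \<beta> u (q1 \<star> (\<S> z1 \<star> y2)))) q"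
            using z j zz y2 u by (simp add: smult_assoc1[symmetric] R.m_comm)
        qed
        also have "\<dots> = sw (\<lambda>q1 q2. sw (\<lambda>z1 z2. snd z q2 \<bullet> (snd j z2 \<bullet> \<beta> u (q1 \<star> (\<S> z1 \<star> y2)))) (fst z)) q"
          by (rule sw_swap) (use z j y2 u in simp)
        finally show "sw (\<lambda>z1 z2. snd j z2 \<bullet> sw (\<lambda>q1 q2. snd z q2 \<bullet> \<beta> u (q1 \<star> (\<S> z1 \<star> y2))) q) (fst z) =
          sw (\<lambda>q1 q2. sw (\<lambda>z1 z2. snd z q2 \<bullet> (snd j z2 \<bullet> \<beta> u (q1 \<star> (\<S> z1 \<star> y2)))) (fst z)) q" .
      qed
      also have "\<dots> = sw (\<lambda>q1 q2. lsum (\<lambda>z. sw (\<lambda>z1 z2. snd z q2 \<bullet> (snd j z2 \<bullet> \<beta> u (q1 \<star> (\<S> z1 \<star> y2)))) (fst z)) es) q"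
        by (rule sw_lsum_swap[symmetric]) (use j y2 u in simp)
      \<comment> \<open>The sum over \<open>z\<close> is the expansion of \<open>q2\<close> modulo
        \<open>I\<close>. Removing it leaves \<open>f_j(q3) \<beta>(u, q1 S(q2) y2)\<close>, in
        which \<open>q1 S(q2)\<close> contracts.\<close>
      also have "\<dots> = sw (\<lambda>q1 q2. sw (\<lambda>z1 z2. snd j z2 \<bullet> \<beta> u (q1 \<star> (\<S> z1 \<star> y2))) q2) q"
      proof (rule sw_sub_cong[OF hsD q])
        show "bil (\<lambda>q1 q2. lsum (\<lambda>z. sw (\<lambda>z1 z2. snd z q2 \<bullet> (snd j z2 \<bullet> \<beta> u (q1 \<star> (\<S> z1 \<star> y2)))) (fst z)) es)"
          using j y2 u by (intro li lin_lfun[OF lf]; simp)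
        show "bil (\<lambda>q1 q2. sw (\<lambda>z1 z2. snd j z2 \<bullet> \<beta> u (q1 \<star> (\<S> z1 \<star> y2))) q2)"
          using j y2 u by (intro li lin_lfun[OF lf]; simp)
        fix q1 q2 assume qq: "q1 \<in> D" "q2 \<in> D"
        have bz: "bil (\<lambda>z1 z2. snd j z2 \<bullet> \<beta> u (q1 \<star> (\<S> z1 \<star> y2)))"
          using j y2 u qq by (intro li lin_lfun[OF lf]; simp)
        have l: "lin (sw (\<lambda>z1 z2. snd j z2 \<bullet> \<beta> u (q1 \<star> (\<S> z1 \<star> y2))))" by (rule sw_lin_apply[OF bz])
        have "sw (\<lambda>z1 z2. snd j z2 \<bullet> \<beta> u (q1 \<star> (\<S> z1 \<star> y2))) q2 =
            sw (\<lambda>z1 z2. snd j z2 \<bullet> \<beta> u (q1 \<star> (\<S> z1 \<star> y2))) (\<tau> q2)"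
        proof (rule mod_I[OF l qq(2)], rule sw_I[OF bz])
          show "snd j z2 \<bullet> \<beta> u (q1 \<star> (\<S> z1 \<star> y2)) = \<zero>\<^bsub>H\<^esub>" if "z1 \<in> I" "z2 \<in> D" for z1 z2
            using kill[OF u Il[OF qq(1) Ir[OF y2 IS[OF that(1)]]]] that j by (simp add: smult_zero_H)
          show "snd j z2 \<bullet> \<beta> u (q1 \<star> (\<S> z1 \<star> y2)) = \<zero>\<^bsub>H\<^esub>" if "z1 \<in> D" "z2 \<in> I" for z1 z2
            using that j u qq y2 by (simp add: fI smult_zero_k)
        qed
        also have "\<dots> = lsum (\<lambda>z. sw (\<lambda>z1 z2. snd j z2 \<bullet> \<beta> u (q1 \<star> (\<S> z1 \<star> y2))) (snd z q2 \<bullet> fst z)) es"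
          unfolding \<tau>_def by (rule lin_lsum[OF l]) (use qq in simp)
        also have "\<dots> = lsum (\<lambda>z. sw (\<lambda>z1 z2. snd z q2 \<bullet> (snd j z2 \<bullet> \<beta> u (q1 \<star> (\<S> z1 \<star> y2)))) (fst z)) es"
        proof (rule lprod_cong)
          fix z assume z: "z \<in> set es"
          have "sw (\<lambda>z1 z2. snd j z2 \<bullet> \<beta> u (q1 \<star> (\<S> z1 \<star> y2))) (snd z q2 \<bullet> fst z) =
              snd z q2 \<bullet> sw (\<lambda>z1 z2. snd j z2 \<bullet> \<beta> u (q1 \<star> (\<S> z1 \<star> y2))) (fst z)"
            by (rule sw_smult[OF bz]) (use z qq in simp_all)
          also have "\<dots> = sw (\<lambda>z1 z2. snd z q2 \<bullet> (snd j z2 \<bullet> \<beta> u (q1 \<star> (\<S> z1 \<star> y2)))) (fst z)"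
            by (rule lin_sw_apply) (use z j qq y2 u in \<open>auto intro!: li\<close>)
          finally show "sw (\<lambda>z1 z2. snd j z2 \<bullet> \<beta> u (q1 \<star> (\<S> z1 \<star> y2))) (snd z q2 \<bullet> fst z) =
            sw (\<lambda>z1 z2. snd z q2 \<bullet> (snd j z2 \<bullet> \<beta> u (q1 \<star> (\<S> z1 \<star> y2)))) (fst z)" .
        qed
        finally show "lsum (\<lambda>z. sw (\<lambda>z1 z2. snd z q2 \<bullet> (snd j z2 \<bullet> \<beta> u (q1 \<star> (\<S> z1 \<star> y2)))) (fst z)) es =
          sw (\<lambda>z1 z2. snd j z2 \<bullet> \<beta> u (q1 \<star> (\<S> z1 \<star> y2))) q2" by simp
      qed
      also have "\<dots> = sw (\<lambda>r z2. sw (\<lambda>q1 z1. snd j z2 \<bullet> \<beta> u (q1 \<star> (\<S> z1 \<star> y2))) r) q"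
        by (rule sw_coassoc[symmetric]) (use j y2 u q in \<open>auto intro!: li lin_lfun[OF lf]\<close>)
      also have "\<dots> = sw (\<lambda>r z2. sw (\<lambda>q1 z1. snd j z2 \<bullet> \<beta> u (q1 \<star> \<S> z1 \<star> y2)) r) q"
        using y2 by (simp add: M.m_assoc)
      also have "\<dots> = sw (\<lambda>r z2. \<epsilon> r \<bullet> (snd j z2 \<bullet> \<beta> u (\<e> \<star> y2))) q"
        by (intro sw_cong refl sw_antipode_right[of "\<lambda>x. snd j _ \<bullet> \<beta> u (x \<star> y2)"] li) (use j y2 u in simp_all)
      also have "\<dots> = snd j q \<bullet> \<beta> u (\<e> \<star> y2)"
        by (rule sw_counit_left) (use j y2 u q in \<open>auto intro!: li lin_lfun[OF lf]\<close>)
      finally show ?thesis using y2 by simp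
    qed
    have collect: "lsum (\<lambda>z. sw (\<lambda>z1 z2. snd j z2 \<bullet> X z (fst j) y1 (\<S> z1 \<star> y2)) (fst z)) es =
        g (Y j y2) (\<S> (fst j) \<star> y1)" if j: "j \<in> set es" and yy: "y1 \<in> carrier H" "y2 \<in> carrier H" for j y1 y2
    proof -
      let ?w = "\<S> (fst j) \<star> y1"
      have "g (Y j y2) ?w = sw (\<lambda>s t. lsum (\<lambda>z. sw (\<lambda>u v. sw (\<lambda>z1 z2. snd j z2 \<bullet> b z (\<S> z1 \<star> y2) u (v \<star> \<S> t)) (fst z)) (\<tau> s)) es) ?w"
        unfolding g_def Y_def by (rule sw_cong[OF refl], rule sw_lsum_swap) (use j yy in simp)
      also have "\<dots> = lsum (\<lambda>z. sw (\<lambda>s t. sw (\<lambda>u v. sw (\<lambda>z1 z2. snd j z2 \<bullet> b z (\<S> z1 \<star> y2) u (v \<star> \<S> t)) (fst z)) (\<tau> s)) ?w) es"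
        by (rule sw_lsum_swap) (use j yy in simp)
      also have "\<dots> = lsum (\<lambda>z. sw (\<lambda>z1 z2. snd j z2 \<bullet> X z (fst j) y1 (\<S> z1 \<star> y2)) (fst z)) es"
      proof (rule lprod_cong)
        fix z assume z: "z \<in> set es"
        have "sw (\<lambda>s t. sw (\<lambda>u v. sw (\<lambda>z1 z2. snd j z2 \<bullet> b z (\<S> z1 \<star> y2) u (v \<star> \<S> t)) (fst z)) (\<tau> s)) ?w =
            sw (\<lambda>s t. sw (\<lambda>z1 z2. sw (\<lambda>u v. snd j z2 \<bullet> b z (\<S> z1 \<star> y2) u (v \<star> \<S> t)) (\<tau> s)) (fst z)) ?w"
          by (rule sw_cong[OF refl], rule sw_swap) (use z j yy in simp)
        also have "\<dots> = sw (\<lambda>z1 z2. sw (\<lambda>s t. sw (\<lambda>u v. snd j z2 \<bullet> b z (\<S> z1 \<star> y2) u (v \<star> \<S> t)) (\<tau> s)) ?w) (fst z)"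
          by (rule sw_swap) (use z j yy in simp)
        also have "\<dots> = sw (\<lambda>z1 z2. snd j z2 \<bullet> X z (fst j) y1 (\<S> z1 \<star> y2)) (fst z)"
        proof (rule sw_cong[OF refl])
          fix z1 z2 assume zz: "z1 \<in> carrier H" "z2 \<in> carrier H"
          have l: "lin (\<lambda>x. snd j z2 \<bullet> x)" using j zz by (intro li) simp
          show "sw (\<lambda>s t. sw (\<lambda>u v. snd j z2 \<bullet> b z (\<S> z1 \<star> y2) u (v \<star> \<S> t)) (\<tau> s)) ?w =
              snd j z2 \<bullet> X z (fst j) y1 (\<S> z1 \<star> y2)"
            unfolding X_def g_def using z j zz yy by (simp add: lin_sw_apply[OF l])
        qed
        finally show "sw (\<lambda>s t. sw (\<lambda>u v. sw (\<lambda>z1 z2. snd j z2 \<bullet> b z (\<S> z1 \<star> y2) u (v \<star> \<S> t)) (fst z)) (\<tau> s)) ?w =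
          sw (\<lambda>z1 z2. snd j z2 \<bullet> X z (fst j) y1 (\<S> z1 \<star> y2)) (fst z)" .
      qed
      finally show ?thesis by simp
    qed
    have "sw \<beta> (s y) = lsum (\<lambda>z. sw \<beta> (g (\<lambda>u v. snd z v \<bullet> u) (\<S> (fst z) \<star> y))) es"
      unfolding s_def by (rule lin_lsum[OF sw_lin_apply[OF \<beta>]]) simp
    also have "\<dots> = lsum (\<lambda>z. sw (\<lambda>z1 z2. sw (\<lambda>y1 y2. lsum (\<lambda>j. snd j z2 \<bullet> X z (fst j) y1 (\<S> z1 \<star> y2)) es) y) (fst z)) es"
      by (rule lprod_cong) (use yc in \<open>simp add: step expand\<close>)
    also have "\<dots> = lsum (\<lambda>z. sw (\<lambda>y1 y2. lsum (\<lambda>j. sw (\<lambda>z1 z2. snd j z2 \<bullet> X z (fst j) y1 (\<S> z1 \<star> y2)) (fst z)) es) y) es"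
    proof (rule lprod_cong)
      fix z assume z: "z \<in> set es"
      have "sw (\<lambda>z1 z2. sw (\<lambda>y1 y2. lsum (\<lambda>j. snd j z2 \<bullet> X z (fst j) y1 (\<S> z1 \<star> y2)) es) y) (fst z) =
          sw (\<lambda>y1 y2. sw (\<lambda>z1 z2. lsum (\<lambda>j. snd j z2 \<bullet> X z (fst j) y1 (\<S> z1 \<star> y2)) es) (fst z)) y"
        by (rule sw_swap) (use z in \<open>simp add: lsum_closed\<close>)
      also have "\<dots> = sw (\<lambda>y1 y2. lsum (\<lambda>j. sw (\<lambda>z1 z2. snd j z2 \<bullet> X z (fst j) y1 (\<S> z1 \<star> y2)) (fst z)) es) y"
        by (rule sw_cong[OF refl], rule sw_lsum_swap) (use z in simp)
      finally show "sw (\<lambda>z1 z2. sw (\<lambda>y1 y2. lsum (\<lambda>j. snd j z2 \<bullet> X z (fst j) y1 (\<S> z1 \<star> y2)) es) y) (fst z) =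
          sw (\<lambda>y1 y2. lsum (\<lambda>j. sw (\<lambda>z1 z2. snd j z2 \<bullet> X z (fst j) y1 (\<S> z1 \<star> y2)) (fst z)) es) y" .
    qed
    also have "\<dots> = sw (\<lambda>y1 y2. lsum (\<lambda>z. lsum (\<lambda>j. sw (\<lambda>z1 z2. snd j z2 \<bullet> X z (fst j) y1 (\<S> z1 \<star> y2)) (fst z)) es) es) y"
      by (rule sw_lsum_swap[symmetric]) (simp add: lsum_closed)
    also have "\<dots> = sw (\<lambda>y1 y2. lsum (\<lambda>j. g (Y j y2) (\<S> (fst j) \<star> y1)) es) y"
    proof (rule sw_cong[OF refl])
      fix y1 y2 assume yy: "y1 \<in> carrier H" "y2 \<in> carrier H"
      have "lsum (\<lambda>z. lsum (\<lambda>j. sw (\<lambda>z1 z2. snd j z2 \<bullet> X z (fst j) y1 (\<S> z1 \<star> y2)) (fst z)) es) es =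
          lsum (\<lambda>j. lsum (\<lambda>z. sw (\<lambda>z1 z2. snd j z2 \<bullet> X z (fst j) y1 (\<S> z1 \<star> y2)) (fst z)) es) es"
        by (rule lsum_swap) (use yy in simp)
      also have "\<dots> = lsum (\<lambda>j. g (Y j y2) (\<S> (fst j) \<star> y1)) es"
        by (rule lprod_cong) (rule collect[OF _ yy])
      finally show "lsum (\<lambda>z. lsum (\<lambda>j. sw (\<lambda>z1 z2. snd j z2 \<bullet> X z (fst j) y1 (\<S> z1 \<star> y2)) (fst z)) es) es =
          lsum (\<lambda>j. g (Y j y2) (\<S> (fst j) \<star> y1)) es" .
    qed
    \<comment> \<open>The collapsed form is the one defining \<open>s\<close>, followed by
      \<open>\<beta>\<close> with fixed right argument \<open>y2\<close>; linearity reassembles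
      \<open>\<beta> (s y1) y2\<close>.\<close>
    also have "\<dots> = sw (\<lambda>y1 y2. \<beta> (s y1) y2) y"
    proof (rule sw_sub_cong[OF hsD y])
      show "bil (\<lambda>y1 y2. lsum (\<lambda>j. g (Y j y2) (\<S> (fst j) \<star> y1)) es)"
      proof (intro bilI lin_lsum_param g_lin Y_bil li)
        fix x z assume "x \<in> carrier H" "z \<in> set es"
        then show "lin (\<lambda>y2. g (Y z y2) (\<S> (fst z) \<star> x))"
          unfolding Y_def by (intro g_param lin_lsum_param lin_sw_param lin_smult_lin b_w2 li) simp_all
      qed (simp_all add: bil_lin1[OF Y_bil] bil_lin2[OF Y_bil])
      show "bil (\<lambda>y1 y2. \<beta> (s y1) y2)" by (intro bilI b1 b2 s_lin lin_id) simp_all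
      fix y1 y2 assume yy: "y1 \<in> D" "y2 \<in> D"
      have l: "lin (\<lambda>x. \<beta> x y2)" using yy by (intro b2 lin_id) simp
      have "\<beta> (s y1) y2 = lsum (\<lambda>j. \<beta> (g (\<lambda>u v. snd j v \<bullet> u) (\<S> (fst j) \<star> y1)) y2) es"
        unfolding s_def by (rule lin_lsum[OF l]) simp
      also have "\<dots> = lsum (\<lambda>j. g (Y j y2) (\<S> (fst j) \<star> y1)) es"
      proof (rule lprod_cong)
        fix j assume j: "j \<in> set es"
        have wD: "\<S> (fst j) \<star> y1 \<in> D" by (intro hs_mult[OF hsD] hs_antipode[OF hsD] eD j yy)
        have "\<beta> (g (\<lambda>u v. snd j v \<bullet> u) (\<S> (fst j) \<star> y1)) y2 = g (\<lambda>u v. \<beta> (snd j v \<bullet> u) y2) (\<S> (fst j) \<star> y1)"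
          unfolding g_def using j yy by (simp add: lin_sw_apply[OF l])
        also have "\<dots> = g (Y j y2) (\<S> (fst j) \<star> y1)"
        proof (rule g_cong[OF wD _ Y_bil[OF j Dc[OF yy(2)]]])
          have "bil (\<lambda>u v. snd j v \<bullet> \<beta> u y2)" using j yy by (intro li lin_lfun[OF lf]; simp)
          then show "bil (\<lambda>u v. \<beta> (snd j v \<bullet> u) y2)"
            using j by (simp add: bil_def lin_def lin_smult[OF l])
          show "\<beta> (snd j q \<bullet> u) y2 = Y j y2 u q" if "u \<in> A" "q \<in> D" for u q
            using trace[OF j yy(2) that] lin_smult[OF l] j that by simp
        qed
        finally show "\<beta> (g (\<lambda>u v. snd j v \<bullet> u) (\<S> (fst j) \<star> y1)) y2 = g (Y j y2) (\<S> (fst j) \<star> y1)" .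
      qed
      finally show "lsum (\<lambda>j. g (Y j y2) (\<S> (fst j) \<star> y1)) es = \<beta> (s y1) y2" by simp
    qed
    finally show ?thesis .
  qed
  note li = li lin_comp[OF s_lin]
  \<comment> \<open>The convolution of \<open>s\<close> with the antipode. It measures how far
    \<open>s\<close> is from the inclusion of \<open>A\<close>, and \<open>sw_w\<close> recovers
    \<open>s\<close> from it.\<close>
  define w where "w x = sw (\<lambda>u v. s u \<star> \<S> v) x" for x
  have w_lin: "lin w" unfolding w_def by (intro li; simp)
  have wc [simp]: "w x \<in> carrier H" if "x \<in> carrier H" for x using lin_closed[OF w_lin that] .
  have wA: "w x \<in> A" if "x \<in> A" for x
    unfolding w_def
    by (rule sw_sub_mem[OF A that _ As])
       ((intro li; simp) | auto intro!: hs_mult[OF A] hs_antipode[OF A] sA)+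
  have wB: "w x \<in> B" if x: "x \<in> A" for x
  proof (rule coinvariant_mem[OF hsB])
    show "w x \<in> carrier H" using x by simp
    fix \<beta> assume \<beta>: "bil \<beta>" and kill: "\<And>h b x. h \<in> carrier H \<Longrightarrow> b \<in> B \<Longrightarrow> \<epsilon> b = \<zero>\<^bsub>k\<^esub> \<Longrightarrow> x \<in> carrier H \<Longrightarrow>
      \<beta> h (b \<star> x) = \<zero>\<^bsub>H\<^esub>"
    note b1 = lin_comp[OF bil_lin1[OF \<beta>]] and b2 = lin_comp[OF bil_lin2[OF \<beta>]]
    note li = li b1 b2
    note [simp] = bil_closed[OF \<beta>]
    have killI: "\<beta> h i = \<zero>\<^bsub>H\<^esub>" if h: "h \<in> carrier H" and i: "i \<in> I" for h i
    proof -
      have "prd (aug B) D \<subseteq> {i \<in> carrier H. \<beta> h i \<in> {\<zero>\<^bsub>H\<^esub>}}"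
        by (rule prd_subset[OF _ subsp_vimage[OF bil_lin1[OF \<beta> h] subsp_zero_set]])
           (use h kill hs_carrier[OF hsB] in \<open>auto simp: aug_def\<close>)
      then show ?thesis using i unfolding I_def hidl_eq[OF DB] by blast
    qed
    \<comment> \<open>Colinearity of \<open>s\<close> and the reversal rule for \<open>S\<close>
      turn the coproduct of \<open>w x\<close> into \<open>s(x1) S(x4) \<otimes> x2 S(x3)\<close>.
      The second leg contracts to the unit, which is coinvariance.\<close>
    define U where "U x1 x2 y1 y2 = \<beta> (s x1 \<star> \<S> y2) (x2 \<star> \<S> y1)" for x1 x2 y1 y2
    have "sw \<beta> (w x) = sw (\<lambda>u v. sw \<beta> (s u \<star> \<S> v)) x"
      unfolding w_def by (rule lin_sw_apply[OF sw_lin_apply[OF \<beta>]]) simp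
    also have "\<dots> = sw (\<lambda>u v. sw (\<lambda>x1 x2. sw (\<lambda>y1 y2. U x1 x2 y1 y2) v) u) x"
    proof (rule sw_sub_cong[OF A x])
      show "bil (\<lambda>u v. sw \<beta> (s u \<star> \<S> v))"
        by (intro li bil_lin1[OF \<beta>] bil_lin2[OF \<beta>]; simp)
      show "bil (\<lambda>u v. sw (\<lambda>x1 x2. sw (\<lambda>y1 y2. U x1 x2 y1 y2) v) u)"
        unfolding U_def by (intro li; simp)
      fix u v assume uv: "u \<in> A" "v \<in> A"
      have uD: "u \<in> D" using uv AD by blast
      have bp: "bil (\<lambda>p1 p2. \<beta> (q1 \<star> p1) (q2 \<star> p2))" if "q1 \<in> carrier H" "q2 \<in> carrier H" for q1 q2
        using that by (intro li; simp)
      have "sw \<beta> (s u \<star> \<S> v) = sw (\<lambda>q1 q2. sw (\<lambda>p1 p2. \<beta> (q1 \<star> p1) (q2 \<star> p2)) (\<S> v)) (s u)"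
        by (rule sw_mult[OF \<beta>]) (use uv in simp_all)
      also have "\<dots> = sw (\<lambda>q1 q2. sw (\<lambda>y1 y2. \<beta> (q1 \<star> \<S> y2) (q2 \<star> \<S> y1)) v) (s u)"
        by (rule sw_cong[OF refl], rule sw_antipode[OF bp Ac[OF uv(2)]])
      also have "\<dots> = sw (\<lambda>x1 x2. sw (\<lambda>y1 y2. \<beta> (s x1 \<star> \<S> y2) (x2 \<star> \<S> y1)) v) u"
      proof (rule colin[OF _ _ uD])
        show "bil (\<lambda>q1 q2. sw (\<lambda>y1 y2. \<beta> (q1 \<star> \<S> y2) (q2 \<star> \<S> y1)) v)" by (intro li; simp)
        fix h i assume h: "h \<in> A" and i: "i \<in> I"
        show "sw (\<lambda>y1 y2. \<beta> (h \<star> \<S> y2) (i \<star> \<S> y1)) v = \<zero>\<^bsub>H\<^esub>"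
        proof (rule zeroI[OF A uv(2)])
          show "bil (\<lambda>y1 y2. \<beta> (h \<star> \<S> y2) (i \<star> \<S> y1))" using h Ic[OF i] by (intro li; simp)
          show "\<beta> (h \<star> \<S> y2) (i \<star> \<S> y1) = \<zero>\<^bsub>H\<^esub>" if "y1 \<in> A" "y2 \<in> A" for y1 y2
            using that h i AD by (intro killI Ir hs_antipode[OF hsD]) auto
        qed
      qed
      finally show "sw \<beta> (s u \<star> \<S> v) = sw (\<lambda>x1 x2. sw (\<lambda>y1 y2. U x1 x2 y1 y2) v) u"
        unfolding U_def .
    qed
    also have "\<dots> = sw (\<lambda>x1 r. sw (\<lambda>x2 v. sw (\<lambda>y1 y2. U x1 x2 y1 y2) v) r) x"
      unfolding U_def by (rule sw_coassoc) (use x in \<open>(simp; fail | (intro li; simp))+\<close>)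
    also have "\<dots> = sw (\<lambda>x1 r. sw (\<lambda>m y2. sw (\<lambda>x2 y1. U x1 x2 y1 y2) m) r) x"
      unfolding U_def by (rule sw_cong[OF refl], rule sw_coassoc[symmetric]) (simp; fail | (intro li; simp))+
    also have "\<dots> = sw (\<lambda>x1 r. sw (\<lambda>m y2. \<epsilon> m \<bullet> \<beta> (s x1 \<star> \<S> y2) \<e>) r) x"
      unfolding U_def
      by (intro sw_cong refl sw_antipode_right[of "\<lambda>z. \<beta> (s _ \<star> \<S> _) z"] bil_lin1[OF \<beta>]) simp_all
    also have "\<dots> = sw (\<lambda>x1 r. \<beta> (s x1 \<star> \<S> r) \<e>) x"
      by (intro sw_cong refl sw_counit_left[of "\<lambda>y2. \<beta> (s _ \<star> \<S> y2) \<e>"]) (simp; fail | (intro li; simp))+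
    also have "\<dots> = \<beta> (w x) \<e>"
      unfolding w_def by (rule lin_sw_apply[symmetric, of "\<lambda>z. \<beta> z \<e>"]) (simp_all add: bil_lin2[OF \<beta>])
    finally show "sw \<beta> (w x) = \<beta> (w x) \<e>" .
  qed
  have w\<epsilon>: "\<epsilon> (w x) = \<epsilon> x" if x: "x \<in> A" for x
  proof (rule scalar_eqD)
    have l: "lin (\<lambda>x. \<epsilon> x \<bullet> \<e>)" by (intro li) simp
    have "\<epsilon> (w x) \<bullet> \<e> = sw (\<lambda>u v. \<epsilon> (s u \<star> \<S> v) \<bullet> \<e>) x"
      unfolding w_def by (rule lin_sw_apply[OF l]) simp
    also have "\<dots> = sw (\<lambda>u v. \<epsilon> u \<bullet> (\<epsilon> v \<bullet> \<e>)) x"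
      by (rule sw_sub_cong[OF A x])
         ((intro li lin_smult_lin l; simp)
          | use AD in \<open>auto simp: counit_mult counit_antipode s\<epsilon> smult_assoc1 subset_iff\<close>)+
    also have "\<dots> = \<epsilon> x \<bullet> \<e>"
      by (rule sw_counit_left[OF l]) (use x in simp)
    finally show "\<epsilon> (w x) \<bullet> \<e> = \<epsilon> x \<bullet> \<e>" .
  qed (use x in auto)
  have sw_w: "sw (\<lambda>u v. w u \<star> v) x = s x" if x: "x \<in> carrier H" for x
  proof -
    have "sw (\<lambda>r v. w r \<star> v) x = sw (\<lambda>r v. sw (\<lambda>t u. s t \<star> (\<S> u \<star> v)) r) x"
    proof (rule sw_cong[OF refl])
      fix r v assume rv: "r \<in> carrier H" "v \<in> carrier H"
      have "w r \<star> v = sw (\<lambda>t u. s t \<star> \<S> u \<star> v) r"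
        unfolding w_def by (rule lin_sw_apply[of "\<lambda>z. z \<star> v"]) (use rv in \<open>auto intro!: li\<close>)
      then show "w r \<star> v = sw (\<lambda>t u. s t \<star> (\<S> u \<star> v)) r" using rv by (simp add: M.m_assoc)
    qed
    also have "\<dots> = sw (\<lambda>t r. sw (\<lambda>u v. s t \<star> (\<S> u \<star> v)) r) x"
      by (rule sw_coassoc[OF x]) (simp; fail | (intro li; simp))+
    also have "\<dots> = sw (\<lambda>t r. \<epsilon> r \<bullet> (s t \<star> \<e>)) x"
      by (intro sw_cong refl sw_antipode_left[of "\<lambda>z. s _ \<star> z"] li) simp_all
    also have "\<dots> = s x \<star> \<e>"
      by (rule sw_counit_right[OF _ x]) (intro li; simp)
    finally show ?thesis using x by simp
  qed
  have ac: "a \<in> carrier H" using a(1) by simp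
  have "s a = \<zero>\<^bsub>H\<^esub>" using sI a(2) by (simp add: I_def)
  \<comment> \<open>The first summand is \<open>s a\<close>, which vanishes since \<open>a\<close>
    lies in \<open>I\<close>. In the second, the left factor \<open>\<epsilon> u 1 - w u\<close>
    lies in \<open>A \<inter> B\<close> and has counit zero.\<close>
  have split: "sw (\<lambda>u v. \<epsilon> u \<bullet> v) a = sw (\<lambda>u v. w u \<star> v) a \<boxplus> sw (\<lambda>u v. (\<epsilon> u \<bullet> \<e> \<ominus>\<^bsub>H\<^esub> w u) \<star> v) a"
  proof -
    have "sw (\<lambda>u v. \<epsilon> u \<bullet> v) a = sw (\<lambda>u v. w u \<star> v \<boxplus> (\<epsilon> u \<bullet> \<e> \<ominus>\<^bsub>H\<^esub> w u) \<star> v) a"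
    proof (rule sw_cong[OF refl])
      fix u v assume uv: "u \<in> carrier H" "v \<in> carrier H"
      have "w u \<boxplus> (\<epsilon> u \<bullet> \<e> \<ominus>\<^bsub>H\<^esub> w u) = \<epsilon> u \<bullet> \<e>"
        using uv M.a_lcomm[of "w u" "\<epsilon> u \<bullet> \<e>" "\<ominus>\<^bsub>H\<^esub> w u"] by (simp add: M.minus_eq M.r_neg)
      then show "\<epsilon> u \<bullet> v = w u \<star> v \<boxplus> (\<epsilon> u \<bullet> \<e> \<ominus>\<^bsub>H\<^esub> w u) \<star> v"
        using uv by (simp add: M.l_distr[symmetric] smult_mult_left)
    qed
    also have "\<dots> = sw (\<lambda>u v. w u \<star> v) a \<boxplus> sw (\<lambda>u v. (\<epsilon> u \<bullet> \<e> \<ominus>\<^bsub>H\<^esub> w u) \<star> v) a"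
      by (rule sw_plus) simp_all
    finally show ?thesis .
  qed
  have "a = sw (\<lambda>u v. \<epsilon> u \<bullet> v) a"
    by (rule sw_counit_left[OF lin_id ac, symmetric])
  also have "\<dots> = sw (\<lambda>u v. (\<epsilon> u \<bullet> \<e> \<ominus>\<^bsub>H\<^esub> w u) \<star> v) a"
    unfolding split sw_w[OF ac] \<open>s a = \<zero>\<^bsub>H\<^esub>\<close> by (rule M.l_zero) (simp add: ac)
  also have "\<dots> \<in> prd (aug (A \<inter> B)) A"
  proof (rule sw_sub_mem[OF A a(1)])
    show "bil (\<lambda>u v. (\<epsilon> u \<bullet> \<e> \<ominus>\<^bsub>H\<^esub> w u) \<star> v)"
      by (intro li lin_minus_fun w_lin; simp)
    show "subsp (prd (aug (A \<inter> B)) A)"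
      by (intro subsp_prd subsp_aug subsp_inter hs_subsp A hsB)
    fix u v assume uv: "u \<in> A" "v \<in> A"
    have uc: "u \<in> carrier H" by (rule Ac[OF uv(1)])
    have m: "\<epsilon> u \<bullet> \<e> \<ominus>\<^bsub>H\<^esub> w u \<in> A \<inter> B"
      by (intro IntI subsp_diff[OF As] subsp_diff[OF hs_subsp[OF hsB]] hs_smult[OF A] hs_smult[OF hsB]
          hs_one[OF A] hs_one[OF hsB] wA wB uv counit_closed uc)
    have "\<epsilon> (\<epsilon> u \<bullet> \<e> \<ominus>\<^bsub>H\<^esub> w u) = \<epsilon> (\<epsilon> u \<bullet> \<e>) \<ominus>\<^bsub>k\<^esub> \<epsilon> (w u)"
      by (rule lfun_diff[OF lfun_counit]) (use uc in simp_all)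
    also have "\<dots> = \<zero>\<^bsub>k\<^esub>"
      using uc uv(1) by (simp add: counit_smult counit_one w\<epsilon> R.minus_eq R.r_neg)
    finally have "\<epsilon> (\<epsilon> u \<bullet> \<e> \<ominus>\<^bsub>H\<^esub> w u) = \<zero>\<^bsub>k\<^esub>" .
    then show "(\<epsilon> u \<bullet> \<e> \<ominus>\<^bsub>H\<^esub> w u) \<star> v \<in> prd (aug (A \<inter> B)) A"
      by (intro ideal_prod.prod augI m uv)
  qed
  finally show ?thesis .
qed

end

section \<open>Products and intersections of Hopf subalgebras\<close>

context hopf_algebra
begin

lemma prd_incl_left: "\<e> \<in> Y \<Longrightarrow> X \<subseteq> carrier H \<Longrightarrow> X \<subseteq> prd X Y"
  using ideal_prod.prod[of _ X \<e> Y H] by (metis M.r_one subset_iff)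

lemma prd_incl_right: "\<e> \<in> X \<Longrightarrow> Y \<subseteq> carrier H \<Longrightarrow> Y \<subseteq> prd X Y"
  using ideal_prod.prod[of \<e> X _ Y H] by (metis M.l_one subset_iff)

text \<open>Here \<open>b n = n1 (S(n2) b n3)\<close>, and the bracket lies in \<open>B\<close> by
  normality. Hence products with a normal factor are subalgebras although \<open>N\<close> itself
  need not be normal in \<open>D\<close>.\<close>

lemma prd_swap:
  assumes DB: "nrm D B" and N: "hs N" "N \<subseteq> D"
  shows "prd B N \<subseteq> prd N B"
proof (rule prd_subset)
  have Bs: "hs B" by (rule nrmD(2)[OF DB])
  show s: "subsp (prd N B)" by (intro subsp_prd hs_subsp N Bs)
  fix b n assume b: "b \<in> B" and n: "n \<in> N"
  note bc = hs_carrier[OF Bs b] and nc = hs_carrier[OF N(1) n]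
  show "b \<star> n \<in> prd N B"
    unfolding mult_adjoint_right[OF nc bc]
    by (rule sw_sub_mem[OF N(1) n _ s])
       ((use bc in \<open>intro lin_intros; simp\<close>) | (use N(2) b in \<open>auto intro!: ideal_prod.prod nrmD(5)[OF DB]\<close>))+
qed

section \<open>Adjoint actions on products\<close>

definition adj_l :: "'a \<Rightarrow> 'a \<Rightarrow> 'a" where "adj_l h p = sw (\<lambda>x y. x \<star> p \<star> \<S> y) h"
definition adj_r :: "'a \<Rightarrow> 'a \<Rightarrow> 'a" where "adj_r h p = sw (\<lambda>x y. \<S> x \<star> p \<star> y) h"

lemma adj_lin1: "p \<in> carrier H \<Longrightarrow> lin f \<Longrightarrow> lin (\<lambda>h. adj_l (f h) p)" "p \<in> carrier H \<Longrightarrow> lin f \<Longrightarrow> lin (\<lambda>h. adj_r (f h) p)"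
  unfolding adj_l_def adj_r_def by (intro lin_intros; simp)+

lemma adj_lin2: "h \<in> carrier H \<Longrightarrow> lin f \<Longrightarrow> lin (\<lambda>p. adj_l h (f p))" "h \<in> carrier H \<Longrightarrow> lin f \<Longrightarrow> lin (\<lambda>p. adj_r h (f p))"
  unfolding adj_l_def adj_r_def by (intro lin_intros; simp)+

lemma adj_closed [simp]: "p \<in> carrier H \<Longrightarrow> adj_l h p \<in> carrier H" "p \<in> carrier H \<Longrightarrow> adj_r h p \<in> carrier H"
  unfolding adj_l_def adj_r_def by simp_all

lemma adj_l_mult:
  assumes "g \<in> carrier H" "h \<in> carrier H" "p \<in> carrier H"
  shows "adj_l (g \<star> h) p = adj_l g (adj_l h p)"
proof -
  have "adj_l (g \<star> h) p = sw (\<lambda>x y. sw (\<lambda>u v. (x \<star> u) \<star> p \<star> \<S> (y \<star> v)) h) g"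
    unfolding adj_l_def by (rule sw_mult) (use assms in \<open>simp_all add: lin_intros\<close>)
  also have "\<dots> = sw (\<lambda>x y. x \<star> adj_l h p \<star> \<S> y) g"
  proof (rule sw_cong[OF refl])
    fix x y assume xy: "x \<in> carrier H" "y \<in> carrier H"
    have "x \<star> adj_l h p \<star> \<S> y = sw (\<lambda>u v. x \<star> (u \<star> p \<star> \<S> v) \<star> \<S> y) h"
      unfolding adj_l_def by (rule lin_sw_apply[of "\<lambda>z. x \<star> z \<star> \<S> y"]) (use xy assms in \<open>simp_all add: lin_intros\<close>)
    then show "sw (\<lambda>u v. (x \<star> u) \<star> p \<star> \<S> (y \<star> v)) h = x \<star> adj_l h p \<star> \<S> y"
      using xy assms by (simp add: antipode_mult M.m_assoc)
  qed
  finally show ?thesis unfolding adj_l_def .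
qed

lemma adj_r_mult:
  assumes "g \<in> carrier H" "h \<in> carrier H" "p \<in> carrier H"
  shows "adj_r (g \<star> h) p = adj_r h (adj_r g p)"
proof -
  have "adj_r (g \<star> h) p = sw (\<lambda>x y. sw (\<lambda>u v. \<S> (x \<star> u) \<star> p \<star> (y \<star> v)) h) g"
    unfolding adj_r_def by (rule sw_mult) (use assms in \<open>simp_all add: lin_intros\<close>)
  also have "\<dots> = sw (\<lambda>u v. sw (\<lambda>x y. \<S> (x \<star> u) \<star> p \<star> (y \<star> v)) g) h"
    by (rule sw_swap) (use assms in simp)
  also have "\<dots> = sw (\<lambda>u v. \<S> u \<star> adj_r g p \<star> v) h"
  proof (rule sw_cong[OF refl])
    fix u v assume xy: "u \<in> carrier H" "v \<in> carrier H"
    have "\<S> u \<star> adj_r g p \<star> v = sw (\<lambda>x y. \<S> u \<star> (\<S> x \<star> p \<star> y) \<star> v) g"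
      unfolding adj_r_def by (rule lin_sw_apply[of "\<lambda>z. \<S> u \<star> z \<star> v"]) (use xy assms in \<open>simp_all add: lin_intros\<close>)
    then show "sw (\<lambda>x y. \<S> (x \<star> u) \<star> p \<star> (y \<star> v)) g = \<S> u \<star> adj_r g p \<star> v"
      using xy assms by (simp add: antipode_mult M.m_assoc)
  qed
  finally show ?thesis unfolding adj_r_def .
qed

text \<open>
  The four-leg contraction \<open>h\<^sub>1 \<otimes> \<sigma> (h\<^sub>2, h\<^sub>3) \<otimes> h\<^sub>4 = h\<^sub>1 \<otimes> 1 \<otimes> h\<^sub>2\<close> underlying both adjoint actions.
\<close>

lemma sw_contract:
  assumes h: "h \<in> carrier H"
    and K: "\<And>v z. v \<in> carrier H \<Longrightarrow> z \<in> carrier H \<Longrightarrow> lin (\<lambda>x. K x z v)"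
      "\<And>x v. x \<in> carrier H \<Longrightarrow> v \<in> carrier H \<Longrightarrow> lin (\<lambda>z. K x z v)"
      "\<And>x z. x \<in> carrier H \<Longrightarrow> z \<in> carrier H \<Longrightarrow> lin (\<lambda>v. K x z v)"
    and \<sigma>: "bil \<sigma>" "\<And>m f. lin f \<Longrightarrow> m \<in> carrier H \<Longrightarrow> sw (\<lambda>y u. f (\<sigma> y u)) m = \<epsilon> m \<bullet> f \<e>"
  shows "sw (\<lambda>t r. sw (\<lambda>x y. sw (\<lambda>u v. K x (\<sigma> y u) v) r) t) h = sw (\<lambda>x v. K x \<e> v) h"
proof -
  note [simp] = bil_closed[OF \<sigma>(1)]
  have Kc [simp]: "K x z v \<in> carrier H" if "x \<in> carrier H" "z \<in> carrier H" "v \<in> carrier H" for x z v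
    using lin_closed[OF K(1)] that by blast
  note K2 = lin_comp[OF K(2)] and s1 = lin_comp[OF bil_lin1[OF \<sigma>(1)]] and s2 = lin_comp[OF bil_lin2[OF \<sigma>(1)]]
  have "sw (\<lambda>t r. sw (\<lambda>x y. sw (\<lambda>u v. K x (\<sigma> y u) v) r) t) h =
      sw (\<lambda>x r'. sw (\<lambda>y r. sw (\<lambda>u v. K x (\<sigma> y u) v) r) r') h"
    by (rule sw_coassoc[OF h])
       (intro lin_sw_param lin_sw_arg K2 K s1 s2 lin_id; simp)+
  also have "\<dots> = sw (\<lambda>x r'. sw (\<lambda>m v. sw (\<lambda>y u. K x (\<sigma> y u) v) m) r') h"
    by (rule sw_cong[OF refl], rule sw_coassoc[symmetric]) (simp; fail | (intro K2 K s1 s2 lin_id; simp))+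
  also have "\<dots> = sw (\<lambda>x r'. sw (\<lambda>m v. \<epsilon> m \<bullet> K x \<e> v) r') h"
    by (rule sw_cong[OF refl], rule sw_cong[OF refl], rule \<sigma>(2)[OF K(2)])
  also have "\<dots> = sw (\<lambda>x v. K x \<e> v) h"
    by (rule sw_cong[OF refl], rule sw_counit_left[OF K(3)]) simp_all
  finally show ?thesis .
qed

text \<open>The adjoint action makes \<open>H\<close> a module algebra: on the right side the inner
  factor \<open>S(h2) h3\<close> between \<open>p\<close> and \<open>q\<close> contracts.\<close>

lemma adj_l_prod:
  assumes h: "h \<in> carrier H" and p: "p \<in> carrier H" "q \<in> carrier H"
  shows "adj_l h (p \<star> q) = sw (\<lambda>t r. adj_l t p \<star> adj_l r q) h"
proof -
  have "sw (\<lambda>t r. adj_l t p \<star> adj_l r q) h =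
      sw (\<lambda>t r. sw (\<lambda>x y. sw (\<lambda>u v. x \<star> p \<star> (\<S> y \<star> u) \<star> q \<star> \<S> v) r) t) h"
  proof (rule sw_cong[OF refl])
    fix t r assume "t \<in> carrier H" "r \<in> carrier H"
    have "adj_l t p \<star> adj_l r q = sw (\<lambda>x y. x \<star> p \<star> \<S> y \<star> adj_l r q) t"
      unfolding adj_l_def[of t] by (rule lin_sw_apply[of "\<lambda>z. z \<star> adj_l r q"]) (use p in \<open>simp_all add: lin_intros\<close>)
    also have "\<dots> = sw (\<lambda>x y. sw (\<lambda>u v. x \<star> p \<star> \<S> y \<star> (u \<star> q \<star> \<S> v)) r) t"
      unfolding adj_l_def by (rule sw_cong[OF refl], rule lin_sw_apply) (use p in \<open>simp_all add: lin_intros\<close>)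
    finally show "adj_l t p \<star> adj_l r q = sw (\<lambda>x y. sw (\<lambda>u v. x \<star> p \<star> (\<S> y \<star> u) \<star> q \<star> \<S> v) r) t"
      using p by (simp add: M.m_assoc)
  qed
  also have "\<dots> = sw (\<lambda>x v. x \<star> p \<star> \<e> \<star> q \<star> \<S> v) h"
    by (rule sw_contract[OF h, where \<sigma> = "\<lambda>y u. \<S> y \<star> u"])
       (use p in \<open>simp_all add: lin_intros sw_antipode_left\<close>)
  finally show ?thesis unfolding adj_l_def using p by (simp add: M.m_assoc)
qed

lemma adj_r_prod:
  assumes h: "h \<in> carrier H" and p: "p \<in> carrier H" "q \<in> carrier H"
  shows "adj_r h (p \<star> q) = sw (\<lambda>t r. adj_r t p \<star> adj_r r q) h"
proof -
  have "sw (\<lambda>t r. adj_r t p \<star> adj_r r q) h =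
      sw (\<lambda>t r. sw (\<lambda>x y. sw (\<lambda>u v. \<S> x \<star> p \<star> (y \<star> \<S> u) \<star> q \<star> v) r) t) h"
  proof (rule sw_cong[OF refl])
    fix t r assume "t \<in> carrier H" "r \<in> carrier H"
    have "adj_r t p \<star> adj_r r q = sw (\<lambda>x y. \<S> x \<star> p \<star> y \<star> adj_r r q) t"
      unfolding adj_r_def[of t] by (rule lin_sw_apply[of "\<lambda>z. z \<star> adj_r r q"]) (use p in \<open>simp_all add: lin_intros\<close>)
    also have "\<dots> = sw (\<lambda>x y. sw (\<lambda>u v. \<S> x \<star> p \<star> y \<star> (\<S> u \<star> q \<star> v)) r) t"
      unfolding adj_r_def by (rule sw_cong[OF refl], rule lin_sw_apply) (use p in \<open>simp_all add: lin_intros\<close>)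
    finally show "adj_r t p \<star> adj_r r q = sw (\<lambda>x y. sw (\<lambda>u v. \<S> x \<star> p \<star> (y \<star> \<S> u) \<star> q \<star> v) r) t"
      using p by (simp add: M.m_assoc)
  qed
  also have "\<dots> = sw (\<lambda>x v. \<S> x \<star> p \<star> \<e> \<star> q \<star> v) h"
    by (rule sw_contract[OF h, where \<sigma> = "\<lambda>y u. y \<star> \<S> u"])
       (use p in \<open>simp_all add: lin_intros sw_antipode_right\<close>)
  finally show ?thesis unfolding adj_r_def using p by (simp add: M.m_assoc)
qed

section \<open>Stable subspaces\<close>

definition stable :: "'a set \<Rightarrow> 'a set \<Rightarrow> bool" where
  "stable D P \<longleftrightarrow> (\<forall>h\<in>D. \<forall>p\<in>P. adj_l h p \<in> P \<and> adj_r h p \<in> P)"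

lemma nrm_iff: "nrm D B \<longleftrightarrow> hs D \<and> hs B \<and> B \<subseteq> D \<and> stable D B"
  by (simp add: nrm_def stable_def adj_l_def adj_r_def)

lemma stable_prd:
  assumes D: "hs D" and XY: "subsp X" "subsp Y" and st: "stable D X" "stable D Y"
  shows "stable D (prd X Y)"
  unfolding stable_def
proof (intro ballI conjI)
  fix h p assume h: "h \<in> D" and p: "p \<in> prd X Y"
  note hc = hs_carrier[OF D h] and Xc = subsp_carrier[OF XY(1)] and Yc = subsp_carrier[OF XY(2)]
  note s = subsp_prd[OF XY]
  have l: "lin (adj_l h)" "lin (adj_r h)" using adj_lin2[OF hc lin_id] by simp_all
  have "prd X Y \<subseteq> {p \<in> carrier H. adj_l h p \<in> prd X Y}"
  proof (rule prd_subset[OF _ subsp_vimage[OF l(1) s]], clarify, intro conjI)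
    fix x y assume xy: "x \<in> X" "y \<in> Y"
    show "x \<star> y \<in> carrier H" using xy Xc Yc by simp
    show "adj_l h (x \<star> y) \<in> prd X Y"
      unfolding adj_l_prod[OF hc Xc[OF xy(1)] Yc[OF xy(2)]]
      by (rule sw_sub_mem[OF D h _ s])
         ((use xy Xc Yc in \<open>intro bilI lin_intros adj_lin1; simp\<close>)
          | (use xy st in \<open>auto intro!: ideal_prod.prod simp: stable_def\<close>))+
  qed
  then show "adj_l h p \<in> prd X Y" using p by blast
  have "prd X Y \<subseteq> {p \<in> carrier H. adj_r h p \<in> prd X Y}"
  proof (rule prd_subset[OF _ subsp_vimage[OF l(2) s]], clarify, intro conjI)
    fix x y assume xy: "x \<in> X" "y \<in> Y"
    show "x \<star> y \<in> carrier H" using xy Xc Yc by simp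
    show "adj_r h (x \<star> y) \<in> prd X Y"
      unfolding adj_r_prod[OF hc Xc[OF xy(1)] Yc[OF xy(2)]]
      by (rule sw_sub_mem[OF D h _ s])
         ((use xy Xc Yc in \<open>intro bilI lin_intros adj_lin1; simp\<close>)
          | (use xy st in \<open>auto intro!: ideal_prod.prod simp: stable_def\<close>))+
  qed
  then show "adj_r h p \<in> prd X Y" using p by blast
qed

lemma stable_self:
  assumes B: "hs B" and P: "subsp P" "\<And>b p. b \<in> B \<Longrightarrow> p \<in> P \<Longrightarrow> b \<star> p \<in> P" "\<And>b p. b \<in> B \<Longrightarrow> p \<in> P \<Longrightarrow> p \<star> b \<in> P"
  shows "stable B P"
  unfolding stable_def
proof (intro ballI conjI)
  fix h p assume h: "h \<in> B" and p: "p \<in> P"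
  note pc = subsp_carrier[OF P(1) p]
  show "adj_l h p \<in> P"
    unfolding adj_l_def
  proof (rule sw_sub_mem[OF B h _ P(1)])
    show "bil (\<lambda>x y. x \<star> p \<star> \<S> y)" using pc by (intro lin_intros; simp)
  qed (intro P(2,3) p hs_antipode[OF B])
  show "adj_r h p \<in> P"
    unfolding adj_r_def
  proof (rule sw_sub_mem[OF B h _ P(1)])
    show "bil (\<lambda>x y. \<S> x \<star> p \<star> y)" using pc by (intro lin_intros; simp)
  qed (intro P(2,3) p hs_antipode[OF B])
qed

text \<open>An element \<open>xy\<close> acts as a composite of the actions of \<open>x\<close> and
  \<open>y\<close>, and the elements that map a fixed \<open>p\<close> into \<open>P\<close> form a
  subspace; so stability passes from the products to their sums.\<close>

lemma stable_prd_left: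
  assumes st: "stable X P" "stable Y P" and XY: "subsp X" "subsp Y" and P: "subsp P"
  shows "stable (prd X Y) P"
  unfolding stable_def
proof (intro ballI)
  fix h p assume h: "h \<in> prd X Y" and p: "p \<in> P"
  note pc = subsp_carrier[OF P p] and Xc = subsp_carrier[OF XY(1)] and Yc = subsp_carrier[OF XY(2)]
  have "subsp ({h \<in> carrier H. adj_l h p \<in> P} \<inter> {h \<in> carrier H. adj_r h p \<in> P})"
    by (intro subsp_inter subsp_vimage adj_lin1 lin_id pc P)
  then have "prd X Y \<subseteq> {h \<in> carrier H. adj_l h p \<in> P} \<inter> {h \<in> carrier H. adj_r h p \<in> P}"
  proof (rule prd_subset[rotated])
    fix x y assume xy: "x \<in> X" "y \<in> Y"
    show "x \<star> y \<in> {h \<in> carrier H. adj_l h p \<in> P} \<inter> {h \<in> carrier H. adj_r h p \<in> P}"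
      using xy st p Xc Yc pc by (simp add: adj_l_mult adj_r_mult stable_def)
  qed
  then show "adj_l h p \<in> P \<and> adj_r h p \<in> P" using h by blast
qed

end

section \<open>A criterion for Hopf subalgebras\<close>

context fd_hopf_algebra
begin

lemma dual_basis:
  obtains es where "\<And>z. z \<in> set es \<Longrightarrow> fst z \<in> carrier H" "\<And>z. z \<in> set es \<Longrightarrow> lfun (snd z)"
    "\<And>x. x \<in> carrier H \<Longrightarrow> lsum (\<lambda>z. snd z x \<bullet> fst z) es = x"
proof -
  obtain es where es: "dual_family es (carrier H) {\<zero>\<^bsub>H\<^esub>} (carrier H)"
    using dual_family_carrier[OF subsp_zero_set] ..
  have 1: "fst z \<in> carrier H" and 2: "lfun (snd z)" if "z \<in> set es" for z
    using dual_familyD(1,2)[OF es, of "fst z" "snd z"] that by auto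
  have "lsum (\<lambda>z. snd z x \<bullet> fst z) es = x" if x: "x \<in> carrier H" for x
  proof -
    have c: "lsum (\<lambda>z. snd z x \<bullet> fst z) es \<in> carrier H"
      by (rule lsum_closed) (use x 1 lfun_closed[OF 2] in auto)
    have "x \<ominus>\<^bsub>H\<^esub> lsum (\<lambda>z. snd z x \<bullet> fst z) es = \<zero>\<^bsub>H\<^esub>"
      using dual_familyD(4)[OF es x] by (simp add: case_prod_unfold)
    then show ?thesis using M.r_right_minus_eq[OF x c] by simp
  qed
  then show ?thesis using that 1 2 by blast
qed

text \<open>Let \<open>E\<close> project onto \<open>K\<close>. Expanding one leg of
  \<open>\<Delta> h\<close> in a dual basis writes the other leg as slices, which lie in
  \<open>K\<close> and are fixed by \<open>E\<close>. Hence \<open>E \<otimes> id\<close> and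
  \<open>id \<otimes> E\<close> both fix \<open>\<Delta> h\<close>, and so does
  \<open>E \<otimes> E\<close>, whose values are sums of tensors over \<open>K\<close>.\<close>

lemma comult_mem_generate:
  assumes K: "subsp K" and h: "h \<in> carrier H"
    and r: "\<And>f. lfun f \<Longrightarrow> sw (\<lambda>x y. f y \<bullet> x) h \<in> K"
    and l: "\<And>f. lfun f \<Longrightarrow> sw (\<lambda>x y. f x \<bullet> y) h \<in> K"
  shows "comult H h \<in> generate (tensor_group k H H) {pure_tensor k H H y z | y z. y \<in> K \<and> z \<in> K}"
proof -
  let ?T = "tensor_group k H H" and ?P = "pure_tensor k H H"
  note HH = add_smult_closed_H add_smult_closed_H
  interpret T: comm_group ?T by (rule comm_group_tensor_group[OF HH])
  obtain es where es: "\<And>z. z \<in> set es \<Longrightarrow> fst z \<in> carrier H" "\<And>z. z \<in> set es \<Longrightarrow> lfun (snd z)"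
    "\<And>x. x \<in> carrier H \<Longrightarrow> lsum (\<lambda>z. snd z x \<bullet> fst z) es = x"
    using dual_basis by blast
  obtain E where E: "lin E" "\<And>x. x \<in> carrier H \<Longrightarrow> E x \<in> K" "\<And>x. x \<in> K \<Longrightarrow> E x = x"
    using linear_projection[OF K] by blast
  have kE: "klinear k H H E" using E(1) by (simp add: klinear_def lin_def)
  note Kc = subsp_carrier[OF K]
  note P = pure_tensor_balanced[OF HH]
  have fc: "snd z x \<in> carrier k" if "z \<in> set es" "x \<in> carrier H" for z x
    using lfun_closed[OF es(2)] that by simp
  have P_hom1: "(\<lambda>x. ?P x y) \<in> hom (add_monoid H) ?T" if "y \<in> carrier H" for y
    using that by (auto intro!: homI simp: balancedD[OF P])
  have P_hom2: "(\<lambda>y. ?P x y) \<in> hom (add_monoid H) ?T" if "x \<in> carrier H" for x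
    using that by (auto intro!: homI simp: balancedD[OF P])
  have P_sum1: "?P (lsum F zs) y = lprod ?T (\<lambda>z. ?P (F z) y) zs"
    if "y \<in> carrier H" "\<And>z. z \<in> set zs \<Longrightarrow> F z \<in> carrier H" for y F and zs :: "'z list"
  proof -
    interpret f: group_hom "add_monoid H" ?T "\<lambda>x. ?P x y"
      using P_hom1[OF that(1)] M.add.is_group by (simp add: group_hom_def group_hom_axioms_def)
    show ?thesis by (rule f.hom_lprod) (use that(2) in simp)
  qed
  have P_sum2: "?P x (lsum F zs) = lprod ?T (\<lambda>z. ?P x (F z)) zs"
    if "x \<in> carrier H" "\<And>z. z \<in> set zs \<Longrightarrow> F z \<in> carrier H" for x F and zs :: "'z list"
  proof -
    interpret f: group_hom "add_monoid H" ?T "\<lambda>y. ?P x y"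
      using P_hom2[OF that(1)] M.add.is_group by (simp add: group_hom_def group_hom_axioms_def)
    show ?thesis by (rule f.hom_lprod) (use that(2) in simp)
  qed
  have lprod_swap: "lprod ?T (\<lambda>p. lprod ?T (F p) ws) zs = lprod ?T (\<lambda>w. lprod ?T (\<lambda>p. F p w) zs) ws"
    if "\<And>p w. p \<in> set zs \<Longrightarrow> w \<in> set ws \<Longrightarrow> F p w \<in> carrier ?T" for F and zs :: "'y list" and ws :: "'z list"
    using that
  proof (induction zs)
    case Nil
    have "lprod ?T (\<lambda>w. \<one>\<^bsub>?T\<^esub>) ws = \<one>\<^bsub>?T\<^esub>" by (induction ws) auto
    then show ?case by simp
  next
    case (Cons p zs)
    have "lprod ?T (\<lambda>w. F p w \<otimes>\<^bsub>?T\<^esub> lprod ?T (\<lambda>p. F p w) zs) ws =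
        lprod ?T (F p) ws \<otimes>\<^bsub>?T\<^esub> lprod ?T (\<lambda>w. lprod ?T (\<lambda>p. F p w) zs) ws"
      by (rule T.lprod_mult) (use Cons.prems in \<open>auto intro!: T.lprod_closed\<close>)
    then show ?case using Cons by simp
  qed
  let ?L = "comult_list h"
  have mem: "fst p \<in> carrier H" "snd p \<in> carrier H" if "p \<in> set ?L" for p
    using comult_list_mem[of "fst p" "snd p" h] that by auto
  have hL: "comult H h = lprod ?T (\<lambda>p. ?P (fst p) (snd p)) ?L"
    using comult_list_eq[OF h] by (simp add: case_prod_unfold)
  have right: "comult H h = lprod ?T (\<lambda>z. ?P (sw (\<lambda>x y. snd z y \<bullet> x) h) (fst z)) es"
  proof -
    have "comult H h = lprod ?T (\<lambda>p. lprod ?T (\<lambda>z. ?P (snd z (snd p) \<bullet> fst p) (fst z)) es) ?L"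
      unfolding hL
    proof (rule lprod_cong)
      fix p assume p: "p \<in> set ?L"
      have "?P (fst p) (lsum (\<lambda>z. snd z (snd p) \<bullet> fst z) es) =
          lprod ?T (\<lambda>z. ?P (fst p) (snd z (snd p) \<bullet> fst z)) es"
        by (rule P_sum2) (use mem[OF p] es fc in auto)
      also have "\<dots> = lprod ?T (\<lambda>z. ?P (snd z (snd p) \<bullet> fst p) (fst z)) es"
        by (rule lprod_cong) (use mem[OF p] es fc in \<open>auto simp: balancedD(4)[OF P]\<close>)
      finally show "?P (fst p) (snd p) = lprod ?T (\<lambda>z. ?P (snd z (snd p) \<bullet> fst p) (fst z)) es"
        using es(3)[OF mem(2)[OF p]] by simp
    qed
    also have "\<dots> = lprod ?T (\<lambda>z. lprod ?T (\<lambda>p. ?P (snd z (snd p) \<bullet> fst p) (fst z)) ?L) es"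
      by (rule lprod_swap) (use mem es fc in \<open>auto intro!: pure_tensor_closed\<close>)
    also have "\<dots> = lprod ?T (\<lambda>z. ?P (sw (\<lambda>x y. snd z y \<bullet> x) h) (fst z)) es"
      unfolding sw_def case_prod_unfold
      by (rule lprod_cong, rule P_sum1[symmetric]) (use mem es fc in auto)
    finally show ?thesis .
  qed
  have left: "comult H h = lprod ?T (\<lambda>z. ?P (fst z) (sw (\<lambda>x y. snd z x \<bullet> y) h)) es"
  proof -
    have "comult H h = lprod ?T (\<lambda>p. lprod ?T (\<lambda>z. ?P (fst z) (snd z (fst p) \<bullet> snd p)) es) ?L"
      unfolding hL
    proof (rule lprod_cong)
      fix p assume p: "p \<in> set ?L"
      have "?P (lsum (\<lambda>z. snd z (fst p) \<bullet> fst z) es) (snd p) =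
          lprod ?T (\<lambda>z. ?P (snd z (fst p) \<bullet> fst z) (snd p)) es"
        by (rule P_sum1) (use mem[OF p] es fc in auto)
      also have "\<dots> = lprod ?T (\<lambda>z. ?P (fst z) (snd z (fst p) \<bullet> snd p)) es"
        by (rule lprod_cong) (use mem[OF p] es fc in \<open>auto simp: balancedD(4)[OF P]\<close>)
      finally show "?P (fst p) (snd p) = lprod ?T (\<lambda>z. ?P (fst z) (snd z (fst p) \<bullet> snd p)) es"
        using es(3)[OF mem(1)[OF p]] by simp
    qed
    also have "\<dots> = lprod ?T (\<lambda>z. lprod ?T (\<lambda>p. ?P (fst z) (snd z (fst p) \<bullet> snd p)) ?L) es"
      by (rule lprod_swap) (use mem es fc in \<open>auto intro!: pure_tensor_closed\<close>)
    also have "\<dots> = lprod ?T (\<lambda>z. ?P (fst z) (sw (\<lambda>x y. snd z x \<bullet> y) h)) es"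
      unfolding sw_def case_prod_unfold
      by (rule lprod_cong, rule P_sum2[symmetric]) (use mem es fc in auto)
    finally show ?thesis .
  qed
  have map_list: "tensor_map k H H f g (lprod ?T (\<lambda>z. ?P (a z) (b z)) zs) = lprod ?T (\<lambda>z. ?P (f (a z)) (g (b z))) zs"
    if "klinear k H H f" "klinear k H H g" "\<And>z. z \<in> set zs \<Longrightarrow> a z \<in> carrier H \<and> b z \<in> carrier H"
    for f g a b and zs :: "'z list"
    using tensor_map_lprod[OF HH HH that(1,2), of "map (\<lambda>z. (a z, b z)) zs"] that(3)
    by (auto simp: lprod_map)
  have E1: "tensor_map k H H E (\<lambda>y. y) (comult H h) = comult H h"
    unfolding right
    by (subst map_list[OF kE klinear_id]) (use es r Kc in \<open>auto intro!: lprod_cong simp: E(3)\<close>)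
  have E2: "tensor_map k H H (\<lambda>x. x) E (comult H h) = comult H h"
    unfolding left
    by (subst map_list[OF klinear_id kE]) (use es l Kc in \<open>auto intro!: lprod_cong simp: E(3)\<close>)
  have "comult H h = tensor_map k H H E (\<lambda>y. y) (tensor_map k H H (\<lambda>x. x) E (comult H h))"
    using E1 E2 by simp
  also have "\<dots> = tensor_map k H H E E (comult H h)"
    by (rule tensor_map_comp[OF HH HH HH klinear_id kE kE klinear_id kE kE _ _ comult_closed[OF h]]) auto
  also have "\<dots> = lprod ?T (\<lambda>p. ?P (E (fst p)) (E (snd p))) ?L"
    unfolding hL by (rule map_list[OF kE kE]) (use mem in auto)
  also have "\<dots> \<in> generate ?T {?P y z | y z. y \<in> K \<and> z \<in> K}"
  proof -
    have "lprod ?T (\<lambda>p. ?P (E (fst p)) (E (snd p))) zs \<in> generate ?T {?P y z | y z. y \<in> K \<and> z \<in> K}"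
      if "set zs \<subseteq> carrier H \<times> carrier H" for zs
      using that
    proof (induction zs)
      case Nil then show ?case by (simp add: generate.one)
    next
      case (Cons p zs)
      have "?P (E (fst p)) (E (snd p)) \<in> generate ?T {?P y z | y z. y \<in> K \<and> z \<in> K}"
      proof (rule generate.incl)
        have "E (fst p) \<in> K" "E (snd p) \<in> K" using Cons.prems E(2) by auto
        then show "?P (E (fst p)) (E (snd p)) \<in> {?P y z | y z. y \<in> K \<and> z \<in> K}" by blast
      qed
      then show ?case using Cons by (simp add: generate.eng)
    qed
    then show ?thesis using comult_list_subset[OF h] by blast
  qed
  finally show ?thesis .
qed

text \<open>Closure under slices by functionals replaces
  \<open>\<Delta>(K) \<subseteq> K \<otimes> K\<close>. In this form the condition passes at once to
  intersections, for which the tensor form would need \<open>(A \<otimes> A) \<inter> (B \<otimes>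
  B) = (A \<inter> B) \<otimes> (A \<inter> B)\<close>.\<close>

lemma hsI:
  assumes K: "subsp K" and one: "\<e> \<in> K" and mult: "\<And>x y. x \<in> K \<Longrightarrow> y \<in> K \<Longrightarrow> x \<star> y \<in> K"
    and S: "\<And>x. x \<in> K \<Longrightarrow> \<S> x \<in> K"
    and r: "\<And>f h. lfun f \<Longrightarrow> h \<in> K \<Longrightarrow> sw (\<lambda>x y. f y \<bullet> x) h \<in> K"
    and l: "\<And>f h. lfun f \<Longrightarrow> h \<in> K \<Longrightarrow> sw (\<lambda>x y. f x \<bullet> y) h \<in> K"
  shows "hs K"
proof -
  have "subring K H"
    by (rule M.subringI) (use subsp_carrier[OF K] subsp_minus[OF K] subsp_add[OF K] one mult in auto)
  then show ?thesis
    unfolding hopf_subalgebra_def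
    using K S comult_mem_generate[OF K subsp_carrier[OF K]] r l by blast
qed

lemma hs_trans:
  assumes "hs K" "lfun f" "h \<in> K"
  shows "sw (\<lambda>x y. f y \<bullet> x) h \<in> K" "sw (\<lambda>x y. f x \<bullet> y) h \<in> K"
proof -
  note c = lfun_closed[OF assms(2)] hs_carrier[OF assms(1)]
  have b: "bil (\<lambda>x y. f y \<bullet> x)" "bil (\<lambda>x y. f x \<bullet> y)"
    by (intro lin_intros lin_lfun[OF assms(2)]; simp add: c)+
  show "sw (\<lambda>x y. f y \<bullet> x) h \<in> K" "sw (\<lambda>x y. f x \<bullet> y) h \<in> K"
    by (rule sw_sub_mem[OF assms(1,3) b(1) hs_subsp[OF assms(1)]], simp add: hs_smult[OF assms(1)] c,
        rule sw_sub_mem[OF assms(1,3) b(2) hs_subsp[OF assms(1)]], simp add: hs_smult[OF assms(1)] c)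
qed

lemma hs_inter:
  assumes A: "hs A" and B: "hs B" shows "hs (A \<inter> B)"
  by (rule hsI)
     (use hs_trans[OF A] hs_trans[OF B] hs_mult[OF A] hs_mult[OF B] hs_one[OF A] hs_one[OF B]
        hs_antipode[OF A] hs_antipode[OF B] subsp_inter[OF hs_subsp[OF A] hs_subsp[OF B]] in auto)

lemma hs_prd:
  assumes A: "hs A" and B: "hs B" and BA: "prd B A \<subseteq> prd A B"
  shows "hs (prd A B)"
proof -
  note As = hs_subsp[OF A] and Bs = hs_subsp[OF B]
  note Ps = subsp_prd[OF As Bs]
  note Pc = subsp_carrier[OF Ps] and Ac = hs_carrier[OF A] and Bc = hs_carrier[OF B]
  have AP: "a \<star> p \<in> prd A B" if a: "a \<in> A" and p: "p \<in> prd A B" for a p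
  proof -
    have "prd A B \<subseteq> {p \<in> carrier H. a \<star> p \<in> prd A B}"
    proof (rule prd_subset[OF _ subsp_vimage[OF lin_mult_right[OF lin_id Ac[OF a]] Ps]])
      fix x y assume xy: "x \<in> A" "y \<in> B"
      have "a \<star> (x \<star> y) = (a \<star> x) \<star> y" using xy a Ac Bc by (simp add: M.m_assoc)
      then show "x \<star> y \<in> {p \<in> carrier H. a \<star> p \<in> prd A B}"
        using xy a Ac Bc hs_mult[OF A] by (auto intro: ideal_prod.prod)
    qed
    then show ?thesis using p by blast
  qed
  have PB: "p \<star> b \<in> prd A B" if b: "b \<in> B" and p: "p \<in> prd A B" for b p
  proof -
    have "prd A B \<subseteq> {p \<in> carrier H. p \<star> b \<in> prd A B}"
    proof (rule prd_subset[OF _ subsp_vimage[OF lin_mult_left[OF lin_id Bc[OF b]] Ps]])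
      fix x y assume xy: "x \<in> A" "y \<in> B"
      have "(x \<star> y) \<star> b = x \<star> (y \<star> b)" using xy b Ac Bc by (simp add: M.m_assoc)
      then show "x \<star> y \<in> {p \<in> carrier H. p \<star> b \<in> prd A B}"
        using xy b Ac Bc hs_mult[OF B] by (auto intro: ideal_prod.prod)
    qed
    then show ?thesis using p by blast
  qed
  have PA: "p \<star> a \<in> prd A B" if a: "a \<in> A" and p: "p \<in> prd A B" for a p
  proof -
    have "prd A B \<subseteq> {p \<in> carrier H. p \<star> a \<in> prd A B}"
    proof (rule prd_subset[OF _ subsp_vimage[OF lin_mult_left[OF lin_id Ac[OF a]] Ps]])
      fix x y assume xy: "x \<in> A" "y \<in> B"
      have "(x \<star> y) \<star> a = x \<star> (y \<star> a)" using xy a Ac Bc by (simp add: M.m_assoc)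
      moreover have "y \<star> a \<in> prd A B" using BA ideal_prod.prod[OF xy(2) a] by blast
      ultimately show "x \<star> y \<in> {p \<in> carrier H. p \<star> a \<in> prd A B}"
        using xy a Ac Bc AP by auto
    qed
    then show ?thesis using p by blast
  qed
  show ?thesis
  proof (rule hsI[OF Ps])
    show "\<e> \<in> prd A B" using ideal_prod.prod[OF hs_one[OF A] hs_one[OF B], of H] by simp
    show "x \<star> y \<in> prd A B" if x: "x \<in> prd A B" and y: "y \<in> prd A B" for x y
    proof -
      have "prd A B \<subseteq> {p \<in> carrier H. x \<star> p \<in> prd A B}"
      proof (rule prd_subset[OF _ subsp_vimage[OF lin_mult_right[OF lin_id Pc[OF x]] Ps]])
        fix a b assume ab: "a \<in> A" "b \<in> B"
        have "x \<star> (a \<star> b) = (x \<star> a) \<star> b" using ab Ac Bc Pc[OF x] by (simp add: M.m_assoc)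
        then show "a \<star> b \<in> {p \<in> carrier H. x \<star> p \<in> prd A B}"
          using ab Ac Bc PB[OF ab(2) PA[OF ab(1) x]] by auto
      qed
      then show ?thesis using y by blast
    qed
    have Sl: "lin \<S>" by (intro lin_antipode lin_id)
    have "prd A B \<subseteq> {p \<in> carrier H. \<S> p \<in> prd A B}"
    proof (rule prd_subset[OF _ subsp_vimage[OF Sl Ps]])
      fix a b assume ab: "a \<in> A" "b \<in> B"
      have "\<S> b \<star> \<S> a \<in> prd B A" by (intro ideal_prod.prod hs_antipode[OF A] hs_antipode[OF B] ab)
      then show "a \<star> b \<in> {p \<in> carrier H. \<S> p \<in> prd A B}"
        using ab Ac Bc BA by (auto simp: antipode_mult)
    qed
    then show "\<S> x \<in> prd A B" if "x \<in> prd A B" for x using that by blast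
    \<comment> \<open>The coproduct of \<open>ab\<close> has legs \<open>a1 b1\<close> and
      \<open>a2 b2\<close>, both again products of an element of \<open>A\<close> and one of
      \<open>B\<close>. The two slice conditions are instances.\<close>
    have gen: "sw \<beta> h \<in> prd A B"
      if \<beta>: "bil \<beta>" and mem: "\<And>a b a' b'. a \<in> A \<Longrightarrow> b \<in> B \<Longrightarrow> a' \<in> A \<Longrightarrow> b' \<in> B \<Longrightarrow> \<beta> (a \<star> b) (a' \<star> b') \<in> prd A B"
        and h: "h \<in> prd A B" for \<beta> h
    proof -
      note b1 = lin_comp[OF bil_lin1[OF \<beta>]] and b2 = lin_comp[OF bil_lin2[OF \<beta>]]
      have "prd A B \<subseteq> {h \<in> carrier H. sw \<beta> h \<in> prd A B}"
      proof (rule prd_subset[OF _ subsp_vimage[OF sw_lin_apply[OF \<beta>] Ps]])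
        fix a b assume ab: "a \<in> A" "b \<in> B"
        have "sw (\<lambda>x y. sw (\<lambda>u v. \<beta> (x \<star> u) (y \<star> v)) b) a \<in> prd A B"
        proof (rule sw_sub_mem[OF A ab(1) _ Ps])
          show "bil (\<lambda>x y. sw (\<lambda>u v. \<beta> (x \<star> u) (y \<star> v)) b)"
            by (intro lin_intros b1 b2; simp)
          show "sw (\<lambda>u v. \<beta> (x \<star> u) (y \<star> v)) b \<in> prd A B" if "x \<in> A" "y \<in> A" for x y
            by (rule sw_sub_mem[OF B ab(2) _ Ps])
               ((use that Ac in \<open>intro lin_intros b1 b2; simp\<close>) | (use that in \<open>auto intro!: mem\<close>))+
        qed
        then show "a \<star> b \<in> {h \<in> carrier H. sw \<beta> h \<in> prd A B}"
          using ab Ac Bc sw_mult[OF \<beta> Ac[OF ab(1)] Bc[OF ab(2)]] by auto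
      qed
      then show ?thesis using h by blast
    qed
    show "sw (\<lambda>x y. f y \<bullet> x) h \<in> prd A B" "sw (\<lambda>x y. f x \<bullet> y) h \<in> prd A B"
      if f: "lfun f" and h: "h \<in> prd A B" for f h
    proof -
      note c = lfun_closed[OF f] Ac Bc
      have b: "bil (\<lambda>x y. f y \<bullet> x)" "bil (\<lambda>x y. f x \<bullet> y)"
        by (intro lin_intros lin_lfun[OF f]; simp add: c)+
      show "sw (\<lambda>x y. f y \<bullet> x) h \<in> prd A B"
        by (rule gen[OF b(1) _ h]) (intro subsp_smult[OF Ps] ideal_prod.prod c M.m_closed)
      show "sw (\<lambda>x y. f x \<bullet> y) h \<in> prd A B"
        by (rule gen[OF b(2) _ h]) (intro subsp_smult[OF Ps] ideal_prod.prod c M.m_closed)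
    qed
  qed
qed

section \<open>Normality of intersections and products\<close>

lemma nrm_restrict: "nrm D C \<Longrightarrow> hs A \<Longrightarrow> C \<subseteq> A \<Longrightarrow> A \<subseteq> D \<Longrightarrow> nrm A C"
  by (auto simp: nrm_def)

lemma nrm_inter: "nrm D A \<Longrightarrow> nrm D B \<Longrightarrow> nrm D (A \<inter> B)"
  using hs_inter by (auto simp: nrm_def)

lemma nrm_prd:
  assumes "nrm D A" "nrm D B" shows "nrm D (prd A B)"
proof -
  note A = nrmD[OF assms(1)] and B = nrmD[OF assms(2)]
  have "stable D (prd A B)"
    using assms by (intro stable_prd hs_subsp A(1,2) B(2)) (auto simp: nrm_iff)
  moreover have "hs (prd A B)" by (intro hs_prd A(2) B(2) prd_swap[OF assms(2) A(2,3)])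
  moreover have "prd A B \<subseteq> D"
    by (rule prd_subset[OF _ hs_subsp[OF A(1)]]) (use A(3) B(3) in \<open>auto intro: hs_mult[OF A(1)]\<close>)
  ultimately show ?thesis using A(1) by (simp add: nrm_iff)
qed

text \<open>Although \<open>N\<close> is normal only in \<open>A\<close>, the product
  \<open>NB\<close> is stable under \<open>A\<close>, being a product of \<open>A\<close>-stable
  subspaces, and under \<open>B\<close>, because it is an algebra containing \<open>B\<close>. Since
  \<open>D = AB\<close>, it is stable under \<open>D\<close>.\<close>

lemma nrm_prd_sub:
  assumes DA: "nrm D A" and DB: "nrm D B" and AN: "nrm A N" and D: "D = prd A B"
  shows "nrm D (prd N B)"
proof -
  note A = nrmD[OF DA] and B = nrmD[OF DB] and N = nrmD[OF AN]
  have ND: "N \<subseteq> D" using N(3) A(3) by blast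
  have hP: "hs (prd N B)" by (intro hs_prd N(2) B(2) prd_swap[OF DB N(2) ND])
  have BP: "B \<subseteq> prd N B" by (rule prd_incl_right[OF hs_one[OF N(2)]]) (use hs_carrier[OF B(2)] in auto)
  have "stable A (prd N B)"
    using AN nrm_iff[of D B] DB A(3) by (intro stable_prd A(2) hs_subsp N(2) B(2)) (auto simp: nrm_iff stable_def)
  moreover have "stable B (prd N B)"
    by (rule stable_self[OF B(2) hs_subsp[OF hP]]) (use BP in \<open>auto intro: hs_mult[OF hP]\<close>)
  ultimately have "stable D (prd N B)"
    unfolding D by (intro stable_prd_left hs_subsp A(2) B(2) hP)
  moreover have "prd N B \<subseteq> D"
    by (rule prd_subset[OF _ hs_subsp[OF A(1)]]) (use ND B(3) in \<open>auto intro: hs_mult[OF A(1)]\<close>)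
  ultimately show ?thesis using A(1) hP by (simp add: nrm_iff)
qed

section \<open>The map from \<open>A\<close> to \<open>D / D B\<^sup>+\<close>\<close>

lemma mod_hidl_rep:
  assumes DB: "nrm D B" and N: "hs N" "N \<subseteq> D" and D: "D \<subseteq> prd N B" and d: "d \<in> D"
  shows "\<exists>n\<in>N. d \<ominus>\<^bsub>H\<^esub> n \<in> hidl D B"
proof -
  note B = nrmD[OF DB] and I = hidl_subsp[OF DB]
  have "prd N B \<subseteq> {n \<boxplus> i | n i. n \<in> N \<and> i \<in> hidl D B}"
  proof (rule prd_subset[OF _ subsp_plus[OF hs_subsp[OF N(1)] I]])
    fix n b assume nb: "n \<in> N" "b \<in> B"
    note c = hs_carrier[OF N(1) nb(1)] hs_carrier[OF B(2) nb(2)]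
    \<comment> \<open>Splitting \<open>b\<close> into \<open>\<epsilon> b 1\<close> and an element
      of \<open>B\<^sup>+\<close> shows \<open>n b\<close> congruent to a multiple of
      \<open>n\<close>.\<close>
    have "n \<star> b = \<epsilon> b \<bullet> n \<boxplus> n \<star> (b \<ominus>\<^bsub>H\<^esub> \<epsilon> b \<bullet> \<e>)"
    proof -
      have "\<epsilon> b \<bullet> n = n \<star> (\<epsilon> b \<bullet> \<e>)" using c by (simp add: smult_mult_right)
      moreover have "\<epsilon> b \<bullet> \<e> \<boxplus> (b \<ominus>\<^bsub>H\<^esub> \<epsilon> b \<bullet> \<e>) = b"
        using c M.a_lcomm[of "\<epsilon> b \<bullet> \<e>" b "\<ominus>\<^bsub>H\<^esub> (\<epsilon> b \<bullet> \<e>)"] by (simp add: M.minus_eq M.r_neg)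
      ultimately show ?thesis using c by (simp add: M.r_distr[symmetric])
    qed
    moreover have "n \<star> (b \<ominus>\<^bsub>H\<^esub> \<epsilon> b \<bullet> \<e>) \<in> hidl D B"
      unfolding hidl_def using N(2) nb by (intro ideal_prod.prod aug_diff B(2)) auto
    moreover have "\<epsilon> b \<bullet> n \<in> N" using c nb by (intro hs_smult[OF N(1)]) auto
    ultimately show "n \<star> b \<in> {n \<boxplus> i | n i. n \<in> N \<and> i \<in> hidl D B}" by blast
  qed
  then obtain n i where ni: "d = n \<boxplus> i" "n \<in> N" "i \<in> hidl D B" using d D by blast
  have "d \<ominus>\<^bsub>H\<^esub> n = i"
    using ni hs_carrier[OF N(1)] subsp_carrier[OF I] M.a_lcomm[of n i "\<ominus>\<^bsub>H\<^esub> n"]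
    by (simp add: M.minus_eq M.a_assoc M.r_neg)
  then show ?thesis using ni by blast
qed

lemma hidl_mono: "A \<subseteq> D \<Longrightarrow> C \<subseteq> B \<Longrightarrow> hidl A C \<subseteq> hidl D B"
  unfolding hidl_def by (intro prd_mono) (auto simp: aug_def)

text \<open>Injectivity of \<open>A / A (A \<inter> B)\<^sup>+ -> D / D B\<^sup>+\<close>. The hard
  inclusion comes from the colinear section and lands in \<open>(A \<inter> B)\<^sup>+ A\<close>;
  normality of \<open>A \<inter> B\<close> in \<open>A\<close> makes the two sides of the ideal
  agree.\<close>

lemma inter_hidl:
  assumes DB: "nrm D B" and A: "hs A" "A \<subseteq> D" and D: "D \<subseteq> prd A B" and C: "nrm A (A \<inter> B)"
  shows "A \<inter> hidl D B = hidl A (A \<inter> B)"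
proof
  show "A \<inter> hidl D B \<subseteq> hidl A (A \<inter> B)"
    unfolding hidl_eq[OF C]
    using inter_hidl_subset[OF DB A mod_hidl_rep[OF DB A D]] by blast
  show "hidl A (A \<inter> B) \<subseteq> A \<inter> hidl D B"
    using hidl_subset[OF C] hidl_mono[OF A(2), of "A \<inter> B" B] by blast
qed

text \<open>If \<open>A = N + N\<^sup>+A\<close> then every element of \<open>A\<close> is coinvariant for \<open>N\<close>.\<close>

lemma hs_eq_of_prd_eq:
  assumes DB: "nrm D B" and A: "hs A" "A \<subseteq> D" and C: "nrm A (A \<inter> B)"
    and N: "hs N" "A \<inter> B \<subseteq> N" "N \<subseteq> A" and D: "D \<subseteq> prd N B"
  shows "A \<subseteq> N"
proof
  fix a assume a: "a \<in> A"
  have ND: "N \<subseteq> D" using N(3) A(2) by blast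
  have DA: "D \<subseteq> prd A B" using D prd_mono[OF N(3) order_refl] by blast
  \<comment> \<open>From \<open>D = NB\<close> an element of \<open>A\<close> is congruent to some
    \<open>n\<close> modulo \<open>D B\<^sup>+\<close>. The difference lies in \<open>A\<close>,
    hence in \<open>(A \<inter> B)\<^sup>+ A\<close>, which is contained in
    \<open>N\<^sup>+ A\<close>.\<close>
  have rep: "\<exists>n\<in>N. x \<ominus>\<^bsub>H\<^esub> n \<in> prd (aug N) A" if x: "x \<in> A" for x
  proof -
    obtain n where n: "n \<in> N" "x \<ominus>\<^bsub>H\<^esub> n \<in> hidl D B"
      using mod_hidl_rep[OF DB N(1) ND D] x A(2) by blast
    have "x \<ominus>\<^bsub>H\<^esub> n \<in> A" using x n(1) N(3) by (intro subsp_diff[OF hs_subsp[OF A(1)]]) auto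
    then have "x \<ominus>\<^bsub>H\<^esub> n \<in> prd (aug (A \<inter> B)) A"
      using n(2) inter_hidl[OF DB A DA C] hidl_eq[OF C] by blast
    moreover have "prd (aug (A \<inter> B)) A \<subseteq> prd (aug N) A"
      by (rule prd_mono) (use N(2) in \<open>auto simp: aug_def\<close>)
    ultimately show ?thesis using n(1) by blast
  qed
  show "a \<in> N"
  proof (rule coinvariant_mem[OF N(1) hs_carrier[OF A(1) a]])
    fix \<beta> assume \<beta>: "bil \<beta>" and kill: "\<And>h b x. h \<in> carrier H \<Longrightarrow> b \<in> N \<Longrightarrow> \<epsilon> b = \<zero>\<^bsub>k\<^esub> \<Longrightarrow> x \<in> carrier H \<Longrightarrow>
      \<beta> h (b \<star> x) = \<zero>\<^bsub>H\<^esub>"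
    \<comment> \<open>For such \<open>\<beta>\<close> every \<open>x\<close> in \<open>A\<close>
      acts on the right as \<open>\<epsilon> x 1\<close>, because \<open>x - n\<close> lies in
      \<open>N\<^sup>+ A\<close> and \<open>n - \<epsilon> n 1\<close> in \<open>N\<^sup>+\<close>.
      The counit axiom then gives coinvariance.\<close>
    have eq: "\<beta> h x = \<epsilon> x \<bullet> \<beta> h \<e>" if h: "h \<in> carrier H" and x: "x \<in> A" for h x
    proof -
      obtain n where n: "n \<in> N" "x \<ominus>\<^bsub>H\<^esub> n \<in> prd (aug N) A" using rep[OF x] by blast
      note l = bil_lin1[OF \<beta> h] and xc = hs_carrier[OF A(1) x] and nc = hs_carrier[OF N(1) n(1)]
      have l0: "lin (\<lambda>y. \<epsilon> y \<bullet> \<beta> h \<e>)" by (intro lin_intros) (use l in \<open>auto intro: lin_closed\<close>)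
      have l2: "lin (\<lambda>y. \<beta> h y \<ominus>\<^bsub>H\<^esub> \<epsilon> y \<bullet> \<beta> h \<e>)" by (rule lin_minus_fun[OF l l0])
      have bc: "\<beta> h y \<in> carrier H" if "y \<in> carrier H" for y by (rule lin_closed[OF l that])
      have "prd (aug N) A \<subseteq> {y \<in> carrier H. \<beta> h y \<ominus>\<^bsub>H\<^esub> \<epsilon> y \<bullet> \<beta> h \<e> \<in> {\<zero>\<^bsub>H\<^esub>}}"
        by (rule prd_subset[OF _ subsp_vimage[OF l2 subsp_zero_set]])
           (use h kill hs_carrier[OF N(1)] hs_carrier[OF A(1)] bc in
            \<open>auto simp: aug_def counit_mult smult_zero_k M.minus_eq\<close>)
      then have 1: "\<beta> h (x \<ominus>\<^bsub>H\<^esub> n) \<ominus>\<^bsub>H\<^esub> \<epsilon> (x \<ominus>\<^bsub>H\<^esub> n) \<bullet> \<beta> h \<e> = \<zero>\<^bsub>H\<^esub>" using n(2) by blast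
      have "\<beta> h ((n \<ominus>\<^bsub>H\<^esub> \<epsilon> n \<bullet> \<e>) \<star> \<e>) = \<zero>\<^bsub>H\<^esub>"
        using aug_diff[OF N(1) n(1)] by (intro kill h) (auto simp: aug_def)
      then have "\<beta> h (n \<ominus>\<^bsub>H\<^esub> \<epsilon> n \<bullet> \<e>) = \<zero>\<^bsub>H\<^esub>" using nc by simp
      then have 2: "\<beta> h n \<ominus>\<^bsub>H\<^esub> \<epsilon> n \<bullet> \<beta> h \<e> = \<zero>\<^bsub>H\<^esub>"
        using lin_diff[OF l nc, of "\<epsilon> n \<bullet> \<e>"] lin_smult[OF l, of "\<epsilon> n" \<e>] nc by simp
      have "x = (x \<ominus>\<^bsub>H\<^esub> n) \<boxplus> n" using xc nc by (simp add: M.minus_eq M.a_assoc M.l_neg)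
      then have "\<beta> h x \<ominus>\<^bsub>H\<^esub> \<epsilon> x \<bullet> \<beta> h \<e> = \<zero>\<^bsub>H\<^esub>"
        using lin_add[OF l2, of "x \<ominus>\<^bsub>H\<^esub> n" n] 1 2 xc nc by simp
      then show ?thesis using bc xc by (subst (asm) M.r_right_minus_eq) auto
    qed
    have "sw \<beta> a = sw (\<lambda>x y. \<epsilon> y \<bullet> \<beta> x \<e>) a"
      by (rule sw_sub_cong[OF A(1) a \<beta>])
         (use eq hs_carrier[OF A(1)] bil_closed[OF \<beta>] in \<open>auto intro!: lin_intros bil_lin2[OF \<beta>]\<close>)
    also have "\<dots> = \<beta> a \<e>"
      by (rule sw_counit_right[OF bil_lin2[OF \<beta>]]) (use a hs_carrier[OF A(1)] in auto)
    finally show "sw \<beta> a = \<beta> a \<e>" .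
  qed
qed

section \<open>Maximal normal Hopf subalgebras\<close>

definition maxn :: "'a set \<Rightarrow> 'a set \<Rightarrow> bool" where
  "maxn D B \<longleftrightarrow> nrm D B \<and> B \<subset> D \<and> \<not> (\<exists>N. nrm D N \<and> B \<subset> N \<and> N \<subset> D)"

text \<open>The product is normal and contains both factors. It cannot equal \<open>A\<close>, since
  then \<open>A\<close> would lie strictly between \<open>B\<close> and \<open>D\<close>; maximality
  of \<open>A\<close> leaves only \<open>D\<close>.\<close>

lemma maxn_prd:
  assumes A: "maxn D A" and B: "maxn D B" and ne: "A \<noteq> B"
  shows "prd A B = D"
proof -
  have nA: "nrm D A" "A \<subset> D" and nB: "nrm D B" "B \<subset> D" using A B by (auto simp: maxn_def)
  note hA = nrmD(2)[OF nA(1)] and hB = nrmD(2)[OF nB(1)]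
  have n: "nrm D (prd A B)" by (rule nrm_prd[OF nA(1) nB(1)])
  have AP: "A \<subseteq> prd A B" by (rule prd_incl_left[OF hs_one[OF hB]]) (use hs_carrier[OF hA] in auto)
  have BP: "B \<subseteq> prd A B" by (rule prd_incl_right[OF hs_one[OF hA]]) (use hs_carrier[OF hB] in auto)
  have "prd A B \<noteq> A"
  proof
    assume "prd A B = A"
    then have "B \<subset> A" using BP ne by blast
    then show False using B nA unfolding maxn_def by blast
  qed
  then have "A \<subset> prd A B" using AP by blast
  then have "\<not> prd A B \<subset> D" using A n unfolding maxn_def by blast
  then show ?thesis using nrmD(3)[OF n] by blast
qed

text \<open>An intermediate \<open>N\<close> gives a normal \<open>NB\<close> between
  \<open>B\<close> and \<open>D\<close>. It differs from \<open>B\<close> because \<open>N\<close>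
  is not contained in \<open>B\<close>, so it equals \<open>D\<close>; then
  \<open>hs_eq_of_prd_eq\<close> forces \<open>N = A\<close>.\<close>

lemma maxn_inter:
  assumes A: "maxn D A" and B: "maxn D B" and ne: "A \<noteq> B"
  shows "maxn A (A \<inter> B)"
proof -
  have nA: "nrm D A" "A \<subset> D" and nB: "nrm D B" "B \<subset> D" using A B by (auto simp: maxn_def)
  note hA = nrmD(2)[OF nA(1)] and hB = nrmD(2)[OF nB(1)]
  note D = maxn_prd[OF A B ne]
  have C: "nrm A (A \<inter> B)"
    by (rule nrm_restrict[OF nrm_inter[OF nA(1) nB(1)] hA]) (use nA in auto)
  have "A \<inter> B \<noteq> A"
  proof
    assume "A \<inter> B = A"
    then have "A \<subset> B" using ne by blast
    then show False using A nB unfolding maxn_def by blast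
  qed
  moreover have "\<not> (\<exists>N. nrm A N \<and> A \<inter> B \<subset> N \<and> N \<subset> A)"
  proof
    assume "\<exists>N. nrm A N \<and> A \<inter> B \<subset> N \<and> N \<subset> A"
    then obtain N where N: "nrm A N" "A \<inter> B \<subset> N" "N \<subset> A" by blast
    note hN = nrmD(2)[OF N(1)]
    have n: "nrm D (prd N B)" by (rule nrm_prd_sub[OF nA(1) nB(1) N(1) D[symmetric]])
    have NP: "N \<subseteq> prd N B" by (rule prd_incl_left[OF hs_one[OF hB]]) (use hs_carrier[OF hN] in auto)
    have BP: "B \<subseteq> prd N B" by (rule prd_incl_right[OF hs_one[OF hN]]) (use hs_carrier[OF hB] in auto)
    have "prd N B \<noteq> B" using NP N(2,3) by blast
    then have "B \<subset> prd N B" using BP by blast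
    then have "\<not> prd N B \<subset> D" using B n unfolding maxn_def by blast
    then have "D \<subseteq> prd N B" using nrmD(3)[OF n] by blast
    then have "A \<subseteq> N"
      using N(2,3) nA(2) by (intro hs_eq_of_prd_eq[OF nB(1) hA _ C hN]) auto
    then show False using N(3) by blast
  qed
  ultimately show ?thesis using C unfolding maxn_def by blast
qed

end

section \<open>Hopf subalgebras as Hopf algebras\<close>

text \<open>The tensor product sees only carrier, addition and scalar action. Records that differ in
  multiplication or comultiplication may therefore be exchanged inside it.\<close>

lemma tensor_group_cong:
  assumes "carrier A = carrier A'" "add A = add A'" "smult A = smult A'"
    "carrier B = carrier B'" "add B = add B'" "smult B = smult B'"
  shows "tensor_group k A B = tensor_group k A' B'" "pure_tensor k A B = pure_tensor k A' B'"
    "tensor_map k A B = tensor_map k A' B'"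
proof -
  have "tensor_rels k A B = tensor_rels k A' B'" by (simp add: tensor_rels_def assms)
  then have n: "tensor_null k A B = tensor_null k A' B'" by (simp add: tensor_null_def assms)
  show g: "tensor_group k A B = tensor_group k A' B'" by (simp add: tensor_group_def n assms)
  show p: "pure_tensor k A B = pure_tensor k A' B'" by (simp add: pure_tensor_def fun_eq_iff n assms)
  show "tensor_map k A B = tensor_map k A' B'" by (simp add: tensor_map_def fun_eq_iff g p)
qed

lemma lprod_cong_monoid:
  "monoid.mult G = monoid.mult G' \<Longrightarrow> one G = one G' \<Longrightarrow> lprod G F zs = lprod G' F zs"
  by (induction zs) auto

lemma ideal_prod_cong:
  assumes "monoid.mult R = monoid.mult S" "add R = add S" shows "ideal_prod R I J = ideal_prod S I J"
proof -
  have "ideal_prod R I J \<subseteq> ideal_prod S I J" if "monoid.mult R = monoid.mult S" "add R = add S" for R S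
  proof
    fix x assume "x \<in> ideal_prod R I J" then show "x \<in> ideal_prod S I J"
    proof (induction rule: ideal_prod.induct)
      case (prod i j) then show ?case using ideal_prod.prod[of i I j J S] that by simp
    next
      case (sum s1 s2) then show ?case using ideal_prod.sum[of s1 S I J s2] that by simp
    qed
  qed
  from this[OF assms] this[OF assms[symmetric]] show ?thesis by auto
qed

context fd_hopf_algebra
begin

abbreviation HS :: "'a set \<Rightarrow> ('k, 'a) hopf" where "HS A \<equiv> hopf_sub k H A"
text \<open>The record over which \<open>hopf_sub\<close> states its comultiplication: only the
  carrier of \<open>H\<close> has been changed.\<close>

abbreviation HC :: "'a set \<Rightarrow> ('k, 'a) hopf" where "HC A \<equiv> H\<lparr>carrier := A\<rparr>"

lemma HS_simps [simp]:
  "carrier (HS A) = A" "monoid.mult (HS A) = monoid.mult H" "one (HS A) = one H" "zero (HS A) = zero H"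
  "add (HS A) = add H" "smult (HS A) = smult H" "counit (HS A) = counit H" "antipode (HS A) = antipode H"
  by (simp_all add: hopf_sub_def)

lemma HS_tensor:
  "tensor_group k (HC A) (HC A) = tensor_group k (HS A) (HS A)"
  "pure_tensor k (HC A) (HC A) = pure_tensor k (HS A) (HS A)"
  "carrier (tensor k (HC A) (HC A)) = carrier (tensor_group k (HS A) (HS A))"
  using tensor_group_cong[of "HC A" "HS A" "HC A" "HS A" k] by (simp_all add: tensor_simps)

lemma HS_closed: "subsp A \<Longrightarrow> add_smult_closed k (HS A)"
  by (simp add: add_smult_closed_def subsp_add subsp_smult)

lemma comm_group_HS:
  assumes A: "subsp A" shows "comm_group (add_monoid (HS A))"
proof -
  have "comm_group ((add_monoid H)\<lparr>carrier := A\<rparr>)"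
    using M.a_comm_group A
    by (intro group.group_comm_groupI subgroup.subgroup_is_group M.add.is_group)
       (auto simp: submodule_def M.a_comm subsp_carrier)
  then show ?thesis by simp
qed

lemma klinear_incl: "subsp A \<Longrightarrow> klinear k (HS A) H (\<lambda>x. x)"
  by (auto simp: klinear_def subsp_carrier)

text \<open>The retraction \<open>E \<otimes> E\<close> shows that \<open>A \<otimes> A \<rightarrow> H \<otimes> H\<close> is injective.\<close>

lemma tensor_incl_inj:
  assumes A: "subsp A" and X: "X \<in> carrier (tensor_group k (HS A) (HS A))" "Y \<in> carrier (tensor_group k (HS A) (HS A))"
    and eq: "tensor_map k H H (\<lambda>y. y) (\<lambda>z. z) X = tensor_map k H H (\<lambda>y. y) (\<lambda>z. z) Y"
  shows "X = Y"
proof -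
  obtain E where E: "lin E" "\<And>x. x \<in> carrier H \<Longrightarrow> E x \<in> A" "\<And>x. x \<in> A \<Longrightarrow> E x = x"
    using linear_projection[OF A] by blast
  have kE: "klinear k H (HS A) E" using E by (simp add: klinear_def lin_def)
  note cA = HS_closed[OF A] and cH = add_smult_closed_H and i = klinear_incl[OF A]
  have kid: "klinear k (HS A) (HS A) (\<lambda>x. x)" using A by (auto simp: klinear_def subsp_add subsp_smult)
  have "tensor_map k (HS A) (HS A) E E (tensor_map k H H (\<lambda>y. y) (\<lambda>z. z) Z) = Z"
    if Z: "Z \<in> carrier (tensor_group k (HS A) (HS A))" for Z
  proof -
    have "tensor_map k (HS A) (HS A) E E (tensor_map k H H (\<lambda>y. y) (\<lambda>z. z) Z) =
        tensor_map k (HS A) (HS A) (\<lambda>x. x) (\<lambda>x. x) Z"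
      by (rule tensor_map_comp[OF cA cA cH cH cA cA i i kE kE kid kid _ _ Z]) (simp_all add: E(3))
    also have "\<dots> = Z" by (rule tensor_map_id[OF cA cA Z]) auto
    finally show ?thesis .
  qed
  then show ?thesis using X eq by metis
qed

text \<open>Any presentation of \<open>\<Delta> x\<close> with legs in \<open>A\<close>, read in the
  tensor square of \<open>A\<close>, is a preimage of \<open>\<Delta> x\<close>; by injectivity it
  is the one selected by the definition.\<close>

lemma HS_comult_eq:
  assumes A: "subsp A" and zs: "set zs \<subseteq> A \<times> A"
    and x: "comult H x = lprod (tensor_group k H H) (\<lambda>(x, y). pure_tensor k H H x y) zs"
  shows "comult (HS A) x = lprod (tensor_group k (HS A) (HS A)) (\<lambda>(x, y). pure_tensor k (HS A) (HS A) x y) zs"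
proof -
  let ?X = "lprod (tensor_group k (HS A) (HS A)) (\<lambda>(x, y). pure_tensor k (HS A) (HS A) x y) zs"
  note cA = HS_closed[OF A] and cH = add_smult_closed_H and i = klinear_incl[OF A]
  interpret T: comm_group "tensor_group k (HS A) (HS A)" by (rule comm_group_tensor_group[OF cA cA])
  have X: "?X \<in> carrier (tensor_group k (HS A) (HS A))"
    by (rule T.lprod_closed) (use zs in \<open>auto intro!: pure_tensor_closed\<close>)
  have "tensor_map k H H (\<lambda>y. y) (\<lambda>z. z) ?X = comult H x"
    unfolding x by (rule tensor_map_lprod[OF cA cA cH cH i i]) (use zs in simp)
  then have "(THE X. X \<in> carrier (tensor_group k (HS A) (HS A)) \<and>
      tensor_map k H H (\<lambda>y. y) (\<lambda>z. z) X = comult H x) = ?X"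
    using X by (intro the_equality conjI tensor_incl_inj[OF A _ X]) auto
  moreover have "comult (HS A) x = (THE X. X \<in> carrier (tensor k (HC A) (HC A)) \<and>
      tensor_map k H H (\<lambda>y. y) (\<lambda>z. z) X = comult H x)"
    unfolding hopf_sub_def by simp
  ultimately show ?thesis unfolding HS_tensor(3) by simp
qed

lemma HS_comult_rep:
  assumes A: "hs A" and x: "x \<in> A"
  obtains zs where "set zs \<subseteq> A \<times> A"
    "comult H x = lprod (tensor_group k H H) (\<lambda>(x, y). pure_tensor k H H x y) zs"
    "comult (HS A) x = lprod (tensor_group k (HS A) (HS A)) (\<lambda>(x, y). pure_tensor k (HS A) (HS A) x y) zs"
proof -
  obtain zs where "set zs \<subseteq> A \<times> A"
    "comult H x = lprod (tensor_group k H H) (\<lambda>(x, y). pure_tensor k H H x y) zs"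
    using hs_comult_list[OF A x] by blast
  then show ?thesis using that HS_comult_eq[OF hs_subsp[OF A]] by blast
qed

lemma HS_comult_closed:
  assumes A: "hs A" and x: "x \<in> A"
  shows "comult (HS A) x \<in> carrier (tensor_group k (HS A) (HS A))"
proof -
  note cA = HS_closed[OF hs_subsp[OF A]]
  interpret T: comm_group "tensor_group k (HS A) (HS A)" by (rule comm_group_tensor_group[OF cA cA])
  obtain zs where zs: "set zs \<subseteq> A \<times> A"
    "comult (HS A) x = lprod (tensor_group k (HS A) (HS A)) (\<lambda>(x, y). pure_tensor k (HS A) (HS A) x y) zs"
    by (rule HS_comult_rep[OF A x])
  show ?thesis unfolding zs(2)
    by (rule T.lprod_closed) (use zs(1) in \<open>auto intro!: pure_tensor_closed\<close>)
qed

text \<open>Sweedler sums formed in the Hopf algebra \<open>A\<close> agree with those formed in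
  \<open>H\<close>, so that normality inside \<open>A\<close> can be read off in
  \<open>H\<close>.\<close>

lemma HS_tensor_lift:
  assumes A: "hs A" and h: "h \<in> A" and \<beta>: "bil \<beta>" and cl: "\<And>x y. x \<in> A \<Longrightarrow> y \<in> A \<Longrightarrow> \<beta> x y \<in> A"
  shows "tensor_lift (add_monoid (HS A)) \<beta> (comult (HS A) h) = sw \<beta> h"
proof -
  note s = hs_subsp[OF A] and Ac = hs_carrier[OF A]
  note cA = HS_closed[OF s] and cH = add_smult_closed_H
  obtain zs where zs: "set zs \<subseteq> A \<times> A"
    "comult H h = lprod (tensor_group k H H) (\<lambda>(x, y). pure_tensor k H H x y) zs"
    "comult (HS A) h = lprod (tensor_group k (HS A) (HS A)) (\<lambda>(x, y). pure_tensor k (HS A) (HS A) x y) zs"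
    by (rule HS_comult_rep[OF A h])
  have b: "balanced (add_monoid (HS A)) k (HS A) (HS A) \<beta>"
    using bil_balanced[OF \<beta>] Ac cl by (simp add: balanced_def)
  have "tensor_lift (add_monoid (HS A)) \<beta> (comult (HS A) h) = lprod (add_monoid (HS A)) (\<lambda>(x, y). \<beta> x y) zs"
    unfolding zs(3) by (rule comm_group.tensor_lift_lprod[OF comm_group_HS[OF s] cA cA b]) (use zs(1) in simp)
  also have "\<dots> = lsum (\<lambda>(x, y). \<beta> x y) zs" by (rule lprod_cong_monoid) simp_all
  also have "\<dots> = tensor_lift (add_monoid H) \<beta> (comult H h)"
    unfolding zs(2)
    by (rule comm_group.tensor_lift_lprod[OF comm_group_H cH cH bil_balanced[OF \<beta>], symmetric])
       (use zs(1) Ac in auto)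
  also have "\<dots> = sw \<beta> h" using sw_eq_tensor_lift[OF \<beta> Ac[OF h]] by simp
  finally show ?thesis .
qed

lemma ring_HS:
  assumes A: "hs A" shows "ring (HS A)"
proof (intro ringI abelian_groupI monoidI)
  note Ac = hs_carrier[OF A]
  show "\<exists>y\<in>carrier (HS A). y \<oplus>\<^bsub>HS A\<^esub> x = \<zero>\<^bsub>HS A\<^esub>" if "x \<in> carrier (HS A)" for x
    using that subsp_minus[OF hs_subsp[OF A]] Ac by (intro bexI[of _ "\<ominus>\<^bsub>H\<^esub> x"]) (auto simp: M.l_neg)
qed (use hs_carrier[OF A] hs_add[OF A] hs_mult[OF A] hs_one[OF A] subsp_zero[OF hs_subsp[OF A]]
     in \<open>simp_all add: M.a_ac M.m_assoc M.l_distr M.r_distr\<close>)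

text \<open>The coproduct conditions on the two sides live in different tensor squares. One
  direction pushes generators forward along the inclusion; the other reads a presentation with legs
  in \<open>N\<close> inside the tensor square of \<open>A\<close>.\<close>

lemma hs_HS_iff:
  assumes A: "hs A"
  shows "hopf_subalgebra k (HS A) N \<longleftrightarrow> hs N \<and> N \<subseteq> A"
proof
  note s = hs_subsp[OF A]
  note cA = HS_closed[OF s] and cH = add_smult_closed_H and i = klinear_incl[OF s]
  assume L: "hopf_subalgebra k (HS A) N"
  have NA: "N \<subseteq> A" using L by (auto simp: hopf_subalgebra_def submodule_def subgroup_def)
  have Nc: "N \<subseteq> carrier H" using NA hs_carrier[OF A] by blast
  have sub: "subsp N"
    using L Nc by (intro subspI)
      (auto simp: hopf_subalgebra_def submodule_def submodule_axioms_def subgroup_def)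
  have mult: "x \<star> y \<in> N" if "x \<in> N" "y \<in> N" for x y
    using L that subringE(6)[of N "HS A"] by (auto simp: hopf_subalgebra_def)
  have one: "\<e> \<in> N" using L subringE(3)[of N "HS A"] by (auto simp: hopf_subalgebra_def)
  have sr: "subring N H"
    by (rule M.subringI) (use Nc subsp_minus[OF sub] subsp_add[OF sub] one mult in auto)
  let ?TA = "tensor_group k (HS A) (HS A)" and ?T = "tensor_group k H H"
  let ?i = "tensor_map k H H (\<lambda>y. y) (\<lambda>z. z)"
  interpret TA: comm_group ?TA by (rule comm_group_tensor_group[OF cA cA])
  interpret T: comm_group ?T by (rule comm_group_tensor_group[OF cH cH])
  interpret i: group_hom ?TA ?T ?i
    using tensor_map_hom[OF cA cA cH cH i i] by (simp add: group_hom_def group_hom_axioms_def)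
  have "comult H x \<in> generate ?T {pure_tensor k H H y z | y z. y \<in> N \<and> z \<in> N}" if x: "x \<in> N" for x
  proof -
    let ?S = "{pure_tensor k (HS A) (HS A) y z | y z. y \<in> N \<and> z \<in> N}"
    have "comult (HS A) x \<in> generate ?TA ?S" using L x by (simp add: hopf_subalgebra_def)
    moreover have "?S \<subseteq> carrier ?TA" using NA by (auto intro!: pure_tensor_closed)
    ultimately have "?i (comult (HS A) x) \<in> generate ?T (?i ` ?S)"
      using i.generate_img by blast
    moreover have "?i ` ?S \<subseteq> {pure_tensor k H H y z | y z. y \<in> N \<and> z \<in> N}"
      using tensor_map_pure[OF cA cA cH cH i i] NA by (auto simp: subset_iff) blast
    moreover have "?i (comult (HS A) x) = comult H x"
    proof -
      obtain zs where zs: "set zs \<subseteq> A \<times> A"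
        "comult H x = lprod (tensor_group k H H) (\<lambda>(x, y). pure_tensor k H H x y) zs"
        "comult (HS A) x = lprod (tensor_group k (HS A) (HS A)) (\<lambda>(x, y). pure_tensor k (HS A) (HS A) x y) zs"
        using x NA by (rule HS_comult_rep[OF A subsetD[rotated]])
      show ?thesis unfolding zs(2,3)
        by (rule tensor_map_lprod[OF cA cA cH cH i i]) (use zs(1) in simp)
    qed
    ultimately show ?thesis using T.mono_generate by (metis (no_types, lifting) subsetD)
  qed
  then show "hs N \<and> N \<subseteq> A"
    using sr sub L NA by (simp add: hopf_subalgebra_def)
next
  assume N: "hs N \<and> N \<subseteq> A"
  then have hN: "hs N" and NA: "N \<subseteq> A" by auto
  note s = hs_subsp[OF A] and sN = hs_subsp[OF hN]
  note cA = HS_closed[OF s]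
  interpret LR: ring "HS A" by (rule ring_HS[OF A])
  interpret TA: comm_group "tensor_group k (HS A) (HS A)" by (rule comm_group_tensor_group[OF cA cA])
  have inv: "\<ominus>\<^bsub>HS A\<^esub> x = \<ominus>\<^bsub>H\<^esub> x" if "x \<in> A" for x
    by (rule LR.minus_equality) (use that hs_carrier[OF A] subsp_minus[OF s] in \<open>auto simp: M.l_neg\<close>)
  have sr: "subring N (HS A)"
  proof (rule LR.subringI)
    show "\<ominus>\<^bsub>HS A\<^esub> h \<in> N" if "h \<in> N" for h
      using inv[of h] that NA subsp_minus[OF sN that] by auto
  qed (use NA hs_one[OF hN] hs_mult[OF hN] hs_add[OF hN] in auto)
  have sm: "submodule N k (HS A)"
  proof -
    have "subgroup N (add_monoid (HS A))" using sr by (simp add: subring_def)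
    then show ?thesis using hs_smult[OF hN] by (simp add: submodule_def submodule_axioms_def)
  qed
  have "comult (HS A) x \<in> generate (tensor_group k (HS A) (HS A)) {pure_tensor k (HS A) (HS A) y z | y z. y \<in> N \<and> z \<in> N}"
    (is "_ \<in> generate ?T ?S") if x: "x \<in> N" for x
  proof -
    obtain zs where zs: "set zs \<subseteq> N \<times> N"
      "comult H x = lprod (tensor_group k H H) (\<lambda>(x, y). pure_tensor k H H x y) zs"
      using hs_comult_list[OF hN x] by blast
    have "lprod ?T (\<lambda>(x, y). pure_tensor k (HS A) (HS A) x y) zs \<in> generate ?T ?S"
      using zs(1)
    proof (induction zs)
      case Nil then show ?case by (simp add: generate.one)
    next
      case (Cons p zs)
      have "fst p \<in> N" "snd p \<in> N" using Cons.prems by auto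
      then have "pure_tensor k (HS A) (HS A) (fst p) (snd p) \<in> ?S" by blast
      then have "pure_tensor k (HS A) (HS A) (fst p) (snd p) \<in> generate ?T ?S" by (rule generate.incl)
      then show ?case using Cons by (simp add: generate.eng case_prod_unfold)
    qed
    moreover have "comult (HS A) x = lprod ?T (\<lambda>(x, y). pure_tensor k (HS A) (HS A) x y) zs"
      by (rule HS_comult_eq[OF s _ zs(2)]) (use zs(1) NA in auto)
    ultimately show ?thesis by simp
  qed
  then show "hopf_subalgebra k (HS A) N"
    using sr sm hs_antipode[OF hN] by (simp add: hopf_subalgebra_def)
qed

lemma normal_HS_iff:
  assumes A: "hs A"
  shows "normal_hopf_subalgebra k (HS A) N \<longleftrightarrow> nrm A N"
proof -
  note Ac = hs_carrier[OF A]
  have eq: "tensor_lift (add_monoid (HS A)) (\<lambda>x y. x \<star> a \<star> \<S> y) (comult (HS A) h) = sw (\<lambda>x y. x \<star> a \<star> \<S> y) h"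
    "tensor_lift (add_monoid (HS A)) (\<lambda>x y. \<S> x \<star> a \<star> y) (comult (HS A) h) = sw (\<lambda>x y. \<S> x \<star> a \<star> y) h"
    if a: "a \<in> A" and h: "h \<in> A" for a h
  proof -
    have b: "bil (\<lambda>x y. x \<star> a \<star> \<S> y)" "bil (\<lambda>x y. \<S> x \<star> a \<star> y)"
      using Ac[OF a] by (intro lin_intros; simp)+
    show "tensor_lift (add_monoid (HS A)) (\<lambda>x y. x \<star> a \<star> \<S> y) (comult (HS A) h) = sw (\<lambda>x y. x \<star> a \<star> \<S> y) h"
      by (rule HS_tensor_lift[OF A h b(1)]) (intro hs_mult[OF A] hs_antipode[OF A] a)
    show "tensor_lift (add_monoid (HS A)) (\<lambda>x y. \<S> x \<star> a \<star> y) (comult (HS A) h) = sw (\<lambda>x y. \<S> x \<star> a \<star> y) h"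
      by (rule HS_tensor_lift[OF A h b(2)]) (intro hs_mult[OF A] hs_antipode[OF A] a)
  qed
  show ?thesis
  proof (cases "hs N \<and> N \<subseteq> A")
    case True
    then have "a \<in> A" if "a \<in> N" for a using that by blast
    then have "(\<forall>h\<in>A. \<forall>a\<in>N.
        tensor_lift (add_monoid (HS A)) (\<lambda>x y. x \<star> a \<star> \<S> y) (comult (HS A) h) \<in> N \<and>
        tensor_lift (add_monoid (HS A)) (\<lambda>x y. \<S> x \<star> a \<star> y) (comult (HS A) h) \<in> N) \<longleftrightarrow>
      (\<forall>h\<in>A. \<forall>a\<in>N. sw (\<lambda>x y. x \<star> a \<star> \<S> y) h \<in> N \<and> sw (\<lambda>x y. \<S> x \<star> a \<star> y) h \<in> N)"
      by (intro ball_cong refl) (simp only: eq)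
    then show ?thesis
      unfolding normal_hopf_subalgebra_def hs_HS_iff[OF A] nrm_def HS_simps using A True by blast
  next
    case False
    then show ?thesis unfolding normal_hopf_subalgebra_def hs_HS_iff[OF A] nrm_def by blast
  qed
qed

lemma maximal_normal_HS_iff:
  assumes A: "hs A"
  shows "maximal_normal_hopf_subalgebra k (HS A) N \<longleftrightarrow> maxn A N"
  by (simp add: maximal_normal_hopf_subalgebra_def maxn_def normal_HS_iff[OF A])

lemma normal_quotient_HS:
  "normal_quotient k (HS A) N = quotient_hopf k (HS A) (hidl A N)"
  using ideal_prod_cong[of "HS A" H A "aug N"]
  by (simp add: normal_quotient_def hidl_def augmentation_def aug_def)

end

section \<open>Isomorphisms of quotients\<close>

lemma the_elem_image_const:
  "X \<noteq> {} \<Longrightarrow> (\<And>x. x \<in> X \<Longrightarrow> f x = c) \<Longrightarrow> the_elem (f ` X) = c"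
  by (metis (no_types, lifting) image_cong image_constant_conv the_elem_eq)

lemma (in monoid) lprod_product:
  assumes "\<And>z w. z \<in> set zs \<Longrightarrow> w \<in> set ws \<Longrightarrow> F z w \<in> carrier G"
  shows "lprod G (\<lambda>z. lprod G (F z) ws) zs = lprod G (\<lambda>p. F (fst p) (snd p)) (List.product zs ws)"
  using assms
proof (induction zs)
  case Nil then show ?case by simp
next
  case (Cons z zs)
  have "lprod G (\<lambda>p. F (fst p) (snd p)) (map (Pair z) ws @ List.product zs ws) =
      lprod G (\<lambda>p. F (fst p) (snd p)) (map (Pair z) ws) \<otimes> lprod G (\<lambda>p. F (fst p) (snd p)) (List.product zs ws)"
    by (rule lprod_append) (use Cons.prems in auto)
  then show ?case using Cons by (simp add: lprod_map)
qed

text \<open>Closure under the operations, without the Hopf axioms, already makes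
  \<open>hopf_isomorphic\<close> reflexive, symmetric and transitive. The factors of a series need
  only be shown closed in this sense.\<close>

definition hopf_closed :: "('k, 'm) ring_scheme \<Rightarrow> ('k, 'a) hopf \<Rightarrow> bool" where
  "hopf_closed k A \<longleftrightarrow> add_smult_closed k A \<and>
     (\<forall>x\<in>carrier A. \<forall>y\<in>carrier A. x \<otimes>\<^bsub>A\<^esub> y \<in> carrier A) \<and> \<one>\<^bsub>A\<^esub> \<in> carrier A \<and>
     (\<forall>x\<in>carrier A. comult A x \<in> carrier (tensor_group k A A)) \<and>
     (\<forall>x\<in>carrier A. antipode A x \<in> carrier A)"

lemma hopf_iso_klinear: "\<phi> \<in> hopf_iso k A B \<Longrightarrow> klinear k A B \<phi>"
  by (auto simp: hopf_iso_def klinear_def ring_hom_def)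

lemma hopf_isomorphic_refl:
  assumes "hopf_closed k A" shows "hopf_isomorphic k A A"
proof -
  have "(\<lambda>x. x) \<in> hopf_iso k A A"
    using assms tensor_map_id[of k A A]
    by (auto simp: hopf_iso_def hopf_closed_def ring_hom_def bij_betw_def)
  then show ?thesis by (auto simp: hopf_isomorphic_def)
qed

lemma hopf_isomorphic_trans:
  assumes A: "hopf_closed k A" and B: "hopf_closed k B" and C: "hopf_closed k C"
    and AB: "hopf_isomorphic k A B" and BC: "hopf_isomorphic k B C"
  shows "hopf_isomorphic k A C"
proof -
  obtain f g where f: "f \<in> hopf_iso k A B" and g: "g \<in> hopf_iso k B C"
    using AB BC by (auto simp: hopf_isomorphic_def)
  note F = f[unfolded hopf_iso_def mem_Collect_eq] and G = g[unfolded hopf_iso_def mem_Collect_eq]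
  have fc: "f x \<in> carrier B" if "x \<in> carrier A" for x using F that ring_hom_closed[of f A B] by blast
  have asc: "add_smult_closed k A" "add_smult_closed k B" "add_smult_closed k C"
    using A B C by (auto simp: hopf_closed_def)
  have hom: "g \<circ> f \<in> ring_hom A C" using F G ring_hom_trans by blast
  have lin: "klinear k A C (g \<circ> f)"
    using hopf_iso_klinear[OF f] hopf_iso_klinear[OF g] by (simp add: klinear_def)
  have "comult C ((g \<circ> f) x) = tensor_map k C C (g \<circ> f) (g \<circ> f) (comult A x)" if x: "x \<in> carrier A" for x
  proof -
    have "comult C ((g \<circ> f) x) = tensor_map k C C g g (tensor_map k B B f f (comult A x))"
      using F G fc x by simp
    also have "\<dots> = tensor_map k C C (g \<circ> f) (g \<circ> f) (comult A x)"
      by (rule tensor_map_comp[OF asc(1,1,2,2,3,3)])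
         (use hopf_iso_klinear[OF f] hopf_iso_klinear[OF g] lin x A in \<open>auto simp: hopf_closed_def\<close>)
    finally show ?thesis .
  qed
  then have "g \<circ> f \<in> hopf_iso k A C"
    using hom bij_betw_trans[of f "carrier A" "carrier B" g "carrier C"] F G fc A
    unfolding hopf_iso_def by (auto simp: hopf_closed_def)
  then show ?thesis by (auto simp: hopf_isomorphic_def)
qed

lemma hopf_isomorphic_sym:
  assumes A: "hopf_closed k A" and B: "hopf_closed k B" and AB: "hopf_isomorphic k A B"
  shows "hopf_isomorphic k B A"
proof -
  obtain f where f: "f \<in> hopf_iso k A B" using AB by (auto simp: hopf_isomorphic_def)
  note F = f[unfolded hopf_iso_def mem_Collect_eq]
  have bij: "bij_betw f (carrier A) (carrier B)" and fh: "f \<in> ring_hom A B" using F by auto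
  define g where "g = inv_into (carrier A) f"
  have gf: "g (f x) = x" if "x \<in> carrier A" for x
    using bij that by (simp add: g_def bij_betw_def)
  have ex: "\<exists>x\<in>carrier A. y = f x" if "y \<in> carrier B" for y using bij that by (auto simp: bij_betw_def)
  have bg: "bij_betw g (carrier B) (carrier A)" unfolding g_def by (rule bij_betw_inv_into[OF bij])
  have asc: "add_smult_closed k A" "add_smult_closed k B"
    using A B by (auto simp: hopf_closed_def)
  have gm: "g (y \<otimes>\<^bsub>B\<^esub> z) = g y \<otimes>\<^bsub>A\<^esub> g z" "g (y \<oplus>\<^bsub>B\<^esub> z) = g y \<oplus>\<^bsub>A\<^esub> g z"
    if yz: "y \<in> carrier B" "z \<in> carrier B" for y z
  proof -
    obtain u v where uv: "u \<in> carrier A" "y = f u" "v \<in> carrier A" "z = f v" using ex[OF yz(1)] ex[OF yz(2)] by auto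
    have "u \<otimes>\<^bsub>A\<^esub> v \<in> carrier A" "u \<oplus>\<^bsub>A\<^esub> v \<in> carrier A" using A uv by (auto simp: hopf_closed_def add_smult_closed_def)
    then show "g (y \<otimes>\<^bsub>B\<^esub> z) = g y \<otimes>\<^bsub>A\<^esub> g z" "g (y \<oplus>\<^bsub>B\<^esub> z) = g y \<oplus>\<^bsub>A\<^esub> g z"
      using uv gf ring_hom_mult[OF fh] ring_hom_add[OF fh] by metis+
  qed
  have gs: "g (c \<odot>\<^bsub>B\<^esub> y) = c \<odot>\<^bsub>A\<^esub> g y" if cy: "c \<in> carrier k" "y \<in> carrier B" for c y
  proof -
    obtain u where u: "u \<in> carrier A" "y = f u" using ex[OF cy(2)] by auto
    have "c \<odot>\<^bsub>A\<^esub> u \<in> carrier A" using A u cy by (auto simp: hopf_closed_def add_smult_closed_def)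
    then show ?thesis using u gf F cy by metis
  qed
  have hom: "g \<in> ring_hom B A"
  proof (rule ring_hom_memI)
    show "g x \<in> carrier A" if "x \<in> carrier B" for x using bg that by (auto simp: bij_betw_def)
    have "\<one>\<^bsub>A\<^esub> \<in> carrier A" using A by (simp add: hopf_closed_def)
    then show "g \<one>\<^bsub>B\<^esub> = \<one>\<^bsub>A\<^esub>" using gf ring_hom_one[OF fh] by metis
  qed (use gm in auto)
  have kg: "klinear k B A g" using hom gs by (auto simp: klinear_def ring_hom_def)
  have kid: "klinear k A A (\<lambda>x. x)" using asc by (auto simp: klinear_def add_smult_closed_def)
  have com: "comult A (g y) = tensor_map k A A g g (comult B y)" if y: "y \<in> carrier B" for y
  proof -
    obtain u where u: "u \<in> carrier A" "y = f u" using ex[OF y] by auto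
    have cu: "comult A u \<in> carrier (tensor_group k A A)" using A u by (simp add: hopf_closed_def)
    have "tensor_map k A A g g (comult B y) = tensor_map k A A g g (tensor_map k B B f f (comult A u))"
      using F u by simp
    also have "\<dots> = tensor_map k A A (\<lambda>x. x) (\<lambda>x. x) (comult A u)"
      by (rule tensor_map_comp[OF asc(1,1,2,2,1,1) hopf_iso_klinear[OF f] hopf_iso_klinear[OF f] kg kg kid kid _ _ cu])
         (simp_all add: gf)
    also have "\<dots> = comult A u" by (rule tensor_map_id[OF asc(1,1) cu]) auto
    finally show ?thesis using u gf by simp
  qed
  have rest: "counit A (g y) = counit B y" "antipode A (g y) = g (antipode B y)" if y: "y \<in> carrier B" for y
  proof -
    obtain u where u: "u \<in> carrier A" "y = f u" using ex[OF y] by auto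
    have "antipode A u \<in> carrier A" using A u by (simp add: hopf_closed_def)
    then show "counit A (g y) = counit B y" "antipode A (g y) = g (antipode B y)"
      using F u gf by simp_all
  qed
  have "g \<in> hopf_iso k B A"
    unfolding hopf_iso_def using hom bg gs com rest by simp
  then show ?thesis by (auto simp: hopf_isomorphic_def)
qed

section \<open>The quotients \<open>D / D B\<^sup>+\<close>\<close>

context fd_hopf_algebra
begin

abbreviation FQ :: "'a set \<Rightarrow> 'a set \<Rightarrow> ('k, 'a set) hopf" where
  "FQ D B \<equiv> quotient_hopf k (HS D) (hidl D B)"

definition cls :: "'a set \<Rightarrow> 'a set \<Rightarrow> 'a \<Rightarrow> 'a set" where
  "cls D B x = hidl D B +>\<^bsub>HS D\<^esub> x"

lemma FQ_simps:
  "carrier (FQ D B) = carrier (HS D Quot hidl D B)"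
  "monoid.mult (FQ D B) = monoid.mult (HS D Quot hidl D B)"
  "one (FQ D B) = one (HS D Quot hidl D B)"
  "add (FQ D B) = add (HS D Quot hidl D B)"
  "smult (FQ D B) c X = the_elem ((\<lambda>x. cls D B (c \<bullet> x)) ` X)"
  "counit (FQ D B) X = the_elem (\<epsilon> ` X)"
  "antipode (FQ D B) X = the_elem ((\<lambda>x. cls D B (\<S> x)) ` X)"
  "comult (FQ D B) X = the_elem ((\<lambda>x. tensor_map k (FQ D B) (FQ D B) (cls D B) (cls D B) (comult (HS D) x)) ` X)"
proof -
  note defs = quotient_hopf_def module.defs hopf.defs quotient_algebra_def
  show "carrier (FQ D B) = carrier (HS D Quot hidl D B)"
    "monoid.mult (FQ D B) = monoid.mult (HS D Quot hidl D B)"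
    "one (FQ D B) = one (HS D Quot hidl D B)"
    "add (FQ D B) = add (HS D Quot hidl D B)"
    "smult (FQ D B) c X = the_elem ((\<lambda>x. cls D B (c \<bullet> x)) ` X)"
    "counit (FQ D B) X = the_elem (\<epsilon> ` X)"
    "antipode (FQ D B) X = the_elem ((\<lambda>x. cls D B (\<S> x)) ` X)"
    by (simp_all add: defs cls_def)
  let ?Q = "quotient_algebra (HS D) (hidl D B)"
  \<comment> \<open>The quotient comultiplication is stated over the bare quotient algebra; its
    additive and scalar structure is that of the full quotient, so the tensor maps agree.\<close>
  have t: "tensor_map k ?Q ?Q = tensor_map k (FQ D B) (FQ D B)"
    by (rule tensor_group_cong) (simp_all add: defs)
  have "comult (FQ D B) X = the_elem ((\<lambda>x. tensor_map k ?Q ?Q (cls D B) (cls D B) (comult (HS D) x)) ` X)"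
    by (simp add: quotient_hopf_def module.defs hopf.defs cls_def[abs_def])
  then show "comult (FQ D B) X = the_elem ((\<lambda>x. tensor_map k (FQ D B) (FQ D B) (cls D B) (cls D B) (comult (HS D) x)) ` X)"
    unfolding t .
qed

lemma a_inv_HS:
  assumes A: "hs A" and x: "x \<in> A" shows "\<ominus>\<^bsub>HS A\<^esub> x = \<ominus>\<^bsub>H\<^esub> x"
proof -
  interpret LR: ring "HS A" by (rule ring_HS[OF A])
  show ?thesis
    by (rule LR.minus_equality)
       (use x hs_carrier[OF A] subsp_minus[OF hs_subsp[OF A]] in \<open>auto simp: M.l_neg\<close>)
qed

text \<open>Concatenating presentations of the two coproducts gives one of the coproduct of the sum,
  with all legs still in \<open>D\<close>.\<close>

lemma HS_comult_add:
  assumes D: "hs D" and s: "s1 \<in> D" "s2 \<in> D"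
  shows "comult (HS D) (s1 \<boxplus> s2) = comult (HS D) s1 \<otimes>\<^bsub>tensor_group k (HS D) (HS D)\<^esub> comult (HS D) s2"
proof -
  note Dc = hs_carrier[OF D] and cD = HS_closed[OF hs_subsp[OF D]]
  let ?T = "tensor_group k H H" and ?TD = "tensor_group k (HS D) (HS D)"
  interpret T: comm_group ?T by (rule comm_group_tensor_group[OF add_smult_closed_H add_smult_closed_H])
  interpret TD: comm_group ?TD by (rule comm_group_tensor_group[OF cD cD])
  obtain zs where zs: "set zs \<subseteq> D \<times> D" "comult H s1 = lprod ?T (\<lambda>(x, y). pure_tensor k H H x y) zs"
    "comult (HS D) s1 = lprod ?TD (\<lambda>(x, y). pure_tensor k (HS D) (HS D) x y) zs"
    by (rule HS_comult_rep[OF D s(1)])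
  obtain ws where ws: "set ws \<subseteq> D \<times> D" "comult H s2 = lprod ?T (\<lambda>(x, y). pure_tensor k H H x y) ws"
    "comult (HS D) s2 = lprod ?TD (\<lambda>(x, y). pure_tensor k (HS D) (HS D) x y) ws"
    by (rule HS_comult_rep[OF D s(2)])
  have zw: "set (zs @ ws) \<subseteq> D \<times> D" using zs(1) ws(1) by simp
  have "comult H (s1 \<boxplus> s2) = comult H s1 \<otimes>\<^bsub>?T\<^esub> comult H s2"
    using ring_hom_add[OF comult_hom, of s1 s2] s Dc by (simp add: tensor_simps)
  also have "\<dots> = lprod ?T (\<lambda>(x, y). pure_tensor k H H x y) (zs @ ws)"
    unfolding zs(2) ws(2)
    by (rule T.lprod_append[symmetric]) (use zw Dc in \<open>auto intro!: pure_tensor_closed\<close>)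
  finally have "comult (HS D) (s1 \<boxplus> s2) = lprod ?TD (\<lambda>(x, y). pure_tensor k (HS D) (HS D) x y) (zs @ ws)"
    by (rule HS_comult_eq[OF hs_subsp[OF D] zw])
  also have "\<dots> = comult (HS D) s1 \<otimes>\<^bsub>?TD\<^esub> comult (HS D) s2"
    unfolding zs(3) ws(3)
    by (rule TD.lprod_append) (use zw in \<open>auto intro!: pure_tensor_closed\<close>)
  finally show ?thesis .
qed

context
  fixes D B :: "'a set"
  assumes DB: "nrm D B"
begin

lemma ideal_hidl: "ideal (hidl D B) (HS D)"
proof (rule idealI)
  note hsD = nrmD(1)[OF DB]
  show "ring (HS D)" by (rule ring_HS[OF hsD])
  have i: "inv\<^bsub>add_monoid (HS D)\<^esub> x = \<ominus>\<^bsub>H\<^esub> x" if "x \<in> hidl D B" for x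
    using a_inv_HS[OF hsD] hidl_subset[OF DB] that by (auto simp: a_inv_def)
  show "subgroup (hidl D B) (add_monoid (HS D))"
    by (rule subgroup.intro)
       (use hidl_subset[OF DB] subsp_add[OF hidl_subsp[OF DB]] subsp_zero[OF hidl_subsp[OF DB]]
         subsp_minus[OF hidl_subsp[OF DB]] i in auto)
qed (use hidl_mult_left[OF DB] hidl_mult_right[OF DB] in auto)

lemma cls_hom: "cls D B \<in> ring_hom (HS D) (HS D Quot hidl D B)"
  unfolding cls_def[abs_def] by (rule ideal.rcos_ring_hom[OF ideal_hidl])

lemma cls_mem: "y \<in> cls D B x \<longleftrightarrow> (\<exists>i\<in>hidl D B. y = i \<boxplus> x)"
  by (auto simp: cls_def a_r_coset_def')

lemma cls_self: "x \<in> D \<Longrightarrow> x \<in> cls D B x"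
  unfolding cls_mem using subsp_zero[OF hidl_subsp[OF DB]] hs_carrier[OF nrmD(1)[OF DB]]
  by (intro bexI[of _ "\<zero>\<^bsub>H\<^esub>"]) auto

lemma cls_sub: "x \<in> D \<Longrightarrow> y \<in> cls D B x \<Longrightarrow> y \<in> D \<and> y \<ominus>\<^bsub>H\<^esub> x \<in> hidl D B"
proof -
  assume x: "x \<in> D" and "y \<in> cls D B x"
  then obtain i where i: "i \<in> hidl D B" "y = i \<boxplus> x" unfolding cls_mem by auto
  note c = hs_carrier[OF nrmD(1)[OF DB] x] hidl_closed[OF DB i(1)]
  have "y \<ominus>\<^bsub>H\<^esub> x = i" using i(2) c by (simp add: M.minus_eq M.a_assoc M.r_neg)
  moreover have "y \<in> D" using i x hidl_subset[OF DB] hs_add[OF nrmD(1)[OF DB]] by auto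
  ultimately show ?thesis using i by simp
qed

lemma cls_eq: "x \<in> D \<Longrightarrow> y \<in> D \<Longrightarrow> x \<ominus>\<^bsub>H\<^esub> y \<in> hidl D B \<Longrightarrow> cls D B x = cls D B y"
proof -
  assume x: "x \<in> D" and y: "y \<in> D" and d: "x \<ominus>\<^bsub>H\<^esub> y \<in> hidl D B"
  note c = hs_carrier[OF nrmD(1)[OF DB]]
  have "x = (x \<ominus>\<^bsub>H\<^esub> y) \<boxplus> y" using c x y by (simp add: M.minus_eq M.a_assoc M.l_neg)
  then have "x \<in> cls D B y" unfolding cls_mem using d by blast
  then have "x \<in> hidl D B +>\<^bsub>HS D\<^esub> y" by (simp add: cls_def)
  interpret LI: ideal "hidl D B" "HS D" by (rule ideal_hidl)
  show ?thesis
    unfolding cls_def by (rule LI.a_repr_independence'[symmetric]) (use \<open>x \<in> hidl D B +>\<^bsub>HS D\<^esub> y\<close> y in simp_all)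
qed

lemma cls_eqD: "x \<in> D \<Longrightarrow> y \<in> D \<Longrightarrow> cls D B x = cls D B y \<Longrightarrow> x \<ominus>\<^bsub>H\<^esub> y \<in> hidl D B"
  using cls_sub cls_self by blast

lemma FQ_carrier: "carrier (FQ D B) = cls D B ` D"
  unfolding FQ_simps by (auto simp: FactRing_def A_RCOSETS_def' cls_def)

lemma FQ_cls:
  assumes x: "x \<in> D"
  shows "cls D B x \<in> carrier (FQ D B)"
    "y \<in> D \<Longrightarrow> cls D B x \<otimes>\<^bsub>FQ D B\<^esub> cls D B y = cls D B (x \<star> y)"
    "y \<in> D \<Longrightarrow> cls D B x \<oplus>\<^bsub>FQ D B\<^esub> cls D B y = cls D B (x \<boxplus> y)"
    "\<one>\<^bsub>FQ D B\<^esub> = cls D B \<e>"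
    "c \<in> carrier k \<Longrightarrow> c \<odot>\<^bsub>FQ D B\<^esub> cls D B x = cls D B (c \<bullet> x)"
    "counit (FQ D B) (cls D B x) = \<epsilon> x"
    "antipode (FQ D B) (cls D B x) = cls D B (\<S> x)"
proof -
  note hsD = nrmD(1)[OF DB]
  note Dc = hs_carrier[OF hsD] and I = hidl_subsp[OF DB]
  show "cls D B x \<in> carrier (FQ D B)" using x by (simp add: FQ_carrier)
  show "y \<in> D \<Longrightarrow> cls D B x \<otimes>\<^bsub>FQ D B\<^esub> cls D B y = cls D B (x \<star> y)"
    "y \<in> D \<Longrightarrow> cls D B x \<oplus>\<^bsub>FQ D B\<^esub> cls D B y = cls D B (x \<boxplus> y)"
    "\<one>\<^bsub>FQ D B\<^esub> = cls D B \<e>"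
    using ring_hom_mult[OF cls_hom] ring_hom_add[OF cls_hom] ring_hom_one[OF cls_hom] x
    by (simp_all add: FQ_simps)
  have ne: "cls D B x \<noteq> {}" using cls_self[OF x] by blast
  show "c \<in> carrier k \<Longrightarrow> c \<odot>\<^bsub>FQ D B\<^esub> cls D B x = cls D B (c \<bullet> x)"
    unfolding FQ_simps
  proof (rule the_elem_image_const[OF ne])
    fix y assume c: "c \<in> carrier k" and "y \<in> cls D B x"
    then have y: "y \<in> D" "y \<ominus>\<^bsub>H\<^esub> x \<in> hidl D B" using cls_sub[OF x] by auto
    have "c \<bullet> y \<ominus>\<^bsub>H\<^esub> c \<bullet> x = c \<bullet> (y \<ominus>\<^bsub>H\<^esub> x)"
      using lin_diff[OF lin_smult_lin[OF c lin_id] Dc[OF y(1)] Dc[OF x]] by simp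
    then show "cls D B (c \<bullet> y) = cls D B (c \<bullet> x)"
      using subsp_smult[OF I c y(2)] hs_smult[OF hsD c] x y by (intro cls_eq) simp_all
  qed
  show "counit (FQ D B) (cls D B x) = \<epsilon> x"
    unfolding FQ_simps
  proof (rule the_elem_image_const[OF ne])
    fix y assume "y \<in> cls D B x"
    then have y: "y \<in> D" "y \<ominus>\<^bsub>H\<^esub> x \<in> hidl D B" using cls_sub[OF x] by auto
    have "\<epsilon> y \<ominus>\<^bsub>k\<^esub> \<epsilon> x = \<zero>\<^bsub>k\<^esub>"
      using hidl_counit[OF DB y(2)] lfun_diff[OF lfun_counit Dc[OF y(1)] Dc[OF x]] by simp
    then show "\<epsilon> y = \<epsilon> x" using R.r_right_minus_eq[of "\<epsilon> y" "\<epsilon> x"] Dc x y by simp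
  qed
  show "antipode (FQ D B) (cls D B x) = cls D B (\<S> x)"
    unfolding FQ_simps
  proof (rule the_elem_image_const[OF ne])
    fix y assume "y \<in> cls D B x"
    then have y: "y \<in> D" "y \<ominus>\<^bsub>H\<^esub> x \<in> hidl D B" using cls_sub[OF x] by auto
    have "\<S> y \<ominus>\<^bsub>H\<^esub> \<S> x = \<S> (y \<ominus>\<^bsub>H\<^esub> x)"
      using lin_diff[OF lin_antipode[OF lin_id] Dc[OF y(1)] Dc[OF x]] by simp
    then show "cls D B (\<S> y) = cls D B (\<S> x)"
      using hidl_antipode[OF DB y(2)] hs_antipode[OF hsD] x y by (intro cls_eq) simp_all
  qed
qed

lemma FQ_closed: "add_smult_closed k (FQ D B)"
  unfolding add_smult_closed_def FQ_carrier
  using FQ_cls(3,5) hs_add[OF nrmD(1)[OF DB]] hs_smult[OF nrmD(1)[OF DB]] by auto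

lemma klinear_cls: "klinear k (HS D) (FQ D B) (cls D B)"
  unfolding klinear_def using FQ_cls(1,3,5) by simp

text \<open>The computation of \<open>sw_hidl\<close> once more, with values in the tensor square of
  the quotient, since \<open>sw\<close> takes values in \<open>H\<close> only. It makes the
  comultiplication of the quotient well defined.\<close>

lemma comult_hidl:
  assumes i: "i \<in> hidl D B"
  shows "tensor_map k (FQ D B) (FQ D B) (cls D B) (cls D B) (comult (HS D) i) = \<one>\<^bsub>tensor_group k (FQ D B) (FQ D B)\<^esub>"
proof -
  note hsD = nrmD(1)[OF DB] and hsB = nrmD(2)[OF DB] and BD = nrmD(3)[OF DB]
  note Ds = hs_subsp[OF hsD]
  note Dc = hs_carrier[OF hsD] and Bc = hs_carrier[OF hsB]
  note cD = HS_closed[OF Ds] and cH = add_smult_closed_H and cQ = FQ_closed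
  let ?G = "tensor_group k (FQ D B) (FQ D B)" and ?T = "tensor_group k H H" and ?TD = "tensor_group k (HS D) (HS D)"
  let ?\<beta> = "\<lambda>x y. pure_tensor k (FQ D B) (FQ D B) (cls D B x) (cls D B y)"
  let ?\<pi> = "tensor_map k (FQ D B) (FQ D B) (cls D B) (cls D B)"
  interpret G: comm_group ?G by (rule comm_group_tensor_group[OF cQ cQ])
  interpret T: comm_group ?T by (rule comm_group_tensor_group[OF cH cH])
  interpret TD: comm_group ?TD by (rule comm_group_tensor_group[OF cD cD])
  interpret p: group_hom ?TD ?G ?\<pi>
    using tensor_map_hom[OF cD cD cQ cQ klinear_cls klinear_cls] by (simp add: group_hom_def group_hom_axioms_def)
  have \<beta>: "balanced ?G k (HS D) (HS D) ?\<beta>"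
    by (rule tensor_map_balanced[OF cQ cQ klinear_cls klinear_cls])
  have \<beta>c: "?\<beta> x y \<in> carrier ?G" if "x \<in> D" "y \<in> D" for x y
    using balancedD(1)[OF \<beta>] that by simp
  have \<beta>hom: "(\<lambda>y. ?\<beta> x y) \<in> hom ((add_monoid H)\<lparr>carrier := D\<rparr>) ?G" if "x \<in> D" for x
    using that balancedD[OF \<beta>] by (intro homI) auto
  have \<beta>sum: "?\<beta> x (lsum F zs) = lprod ?G (\<lambda>z. ?\<beta> x (F z)) zs"
    if x: "x \<in> D" and F: "\<And>z. z \<in> set zs \<Longrightarrow> F z \<in> D" for x F and zs :: "'z list"
  proof -
    interpret h: group_hom "add_monoid (HS D)" ?G "\<lambda>y. ?\<beta> x y"
      using \<beta>hom[OF x] comm_group_HS[OF Ds] by (simp add: group_hom_def group_hom_axioms_def comm_group_def)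
    have "?\<beta> x (lprod (add_monoid (HS D)) F zs) = lprod ?G (\<lambda>z. ?\<beta> x (F z)) zs"
      by (rule h.hom_lprod) (use F in simp)
    moreover have "lprod (add_monoid (HS D)) F zs = lsum F zs" by (rule lprod_cong_monoid) simp_all
    ultimately show ?thesis by simp
  qed
  have zeroc: "\<zero>\<^bsub>H\<^esub> \<in> D" by (rule subsp_zero[OF Ds])
  have \<beta>zero: "?\<beta> x i = \<one>\<^bsub>?G\<^esub>" if x: "x \<in> D" and i: "i \<in> hidl D B" for x i
  proof -
    have "cls D B i = cls D B \<zero>\<^bsub>H\<^esub>"
      using i hidl_subset[OF DB] zeroc hidl_closed[OF DB i] by (intro cls_eq) (auto simp: M.minus_eq)
    then show ?thesis using \<beta>sum[OF x, of "[]" "\<lambda>_. \<zero>\<^bsub>H\<^esub>"] by simp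
  qed
  from i have "i \<in> prd D (aug B)" by (simp add: hidl_def)
  then show ?thesis
  proof (induction rule: ideal_prod.induct)
    case (prod d b)
    note d = prod(1) and b = augD(1)[OF prod(2)]
    obtain zs where zs: "set zs \<subseteq> D \<times> D" "comult H d = lprod ?T (\<lambda>(x, y). pure_tensor k H H x y) zs"
      using hs_comult_list[OF hsD d] by blast
    obtain ws where ws: "set ws \<subseteq> B \<times> B" "comult H b = lprod ?T (\<lambda>(x, y). pure_tensor k H H x y) ws"
      using hs_comult_list[OF hsB b] by blast
    have wsD: "set ws \<subseteq> D \<times> D" using ws(1) BD by blast
    have zc: "set zs \<subseteq> carrier H \<times> carrier H" "set ws \<subseteq> carrier H \<times> carrier H"
      using zs(1) wsD Dc by auto
    define ps where "ps = map (\<lambda>p. (fst (fst p) \<star> fst (snd p), snd (fst p) \<star> snd (snd p))) (List.product zs ws)"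
    have psD: "set ps \<subseteq> D \<times> D"
      using zs(1) wsD by (auto simp: ps_def intro!: hs_mult[OF hsD])
    have "comult H (d \<star> b) = monoid.mult (tensor k H H) (comult H d) (comult H b)"
      by (rule ring_hom_mult[OF comult_hom]) (use d b Dc Bc in auto)
    also have "\<dots> = lprod ?T (\<lambda>(x, y). lprod ?T (\<lambda>(u, v). pure_tensor k H H (x \<star> u) (y \<star> v)) ws) zs"
      unfolding zs(2) ws(2) by (rule tensor_mult_lprod[OF zc])
    also have "\<dots> = lprod ?T (\<lambda>z. lprod ?T (\<lambda>w. pure_tensor k H H (fst z \<star> fst w) (snd z \<star> snd w)) ws) zs"
      by (simp add: case_prod_unfold)
    also have "\<dots> = lprod ?T (\<lambda>p. pure_tensor k H H (fst (fst p) \<star> fst (snd p)) (snd (fst p) \<star> snd (snd p))) (List.product zs ws)"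
      by (rule T.lprod_product) (use zc in \<open>auto intro!: pure_tensor_closed M.m_closed\<close>)
    also have "\<dots> = lprod ?T (\<lambda>(x, y). pure_tensor k H H x y) ps"
      by (simp add: ps_def lprod_map)
    finally have "comult (HS D) (d \<star> b) = lprod ?TD (\<lambda>(x, y). pure_tensor k (HS D) (HS D) x y) ps"
      by (rule HS_comult_eq[OF Ds psD])
    then have "?\<pi> (comult (HS D) (d \<star> b)) = lprod ?G (\<lambda>(x, y). ?\<beta> x y) ps"
      using tensor_map_lprod[OF cD cD cQ cQ klinear_cls klinear_cls, of ps] psD by simp
    also have "\<dots> = lprod ?G (\<lambda>p. ?\<beta> (fst (fst p) \<star> fst (snd p)) (snd (fst p) \<star> snd (snd p))) (List.product zs ws)"
      by (simp add: ps_def lprod_map)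
    also have "\<dots> = lprod ?G (\<lambda>z. lprod ?G (\<lambda>w. ?\<beta> (fst z \<star> fst w) (snd z \<star> snd w)) ws) zs"
      by (rule G.lprod_product[symmetric]) (use zs(1) wsD in \<open>auto intro!: \<beta>c hs_mult[OF hsD]\<close>)
    also have "\<dots> = lprod ?G (\<lambda>z. \<one>\<^bsub>?G\<^esub>) zs"
    proof (rule lprod_cong)
      fix z assume "z \<in> set zs"
      then have z: "fst z \<in> D" "snd z \<in> D" using zs(1) by auto
      have w: "fst w \<in> B" "snd w \<in> B" "fst w \<in> D" "snd w \<in> D" if "w \<in> set ws" for w
        using that ws(1) wsD by auto
      \<comment> \<open>Modulo \<open>D B\<^sup>+\<close> the leg \<open>b1\<close> becomes the
        scalar \<open>\<epsilon> b1\<close>. It crosses the tensor sign, and the counit axiom then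
        assembles the second leg to \<open>d2 b\<close>, whose class is zero.\<close>
      have "lprod ?G (\<lambda>w. ?\<beta> (fst z \<star> fst w) (snd z \<star> snd w)) ws =
          lprod ?G (\<lambda>w. ?\<beta> (fst z) (\<epsilon> (fst w) \<bullet> (snd z \<star> snd w))) ws"
      proof (rule lprod_cong)
        fix x assume x: "x \<in> set ws"
        note w = w[OF x]
        have "fst z \<star> fst x \<ominus>\<^bsub>H\<^esub> \<epsilon> (fst x) \<bullet> fst z = fst z \<star> (fst x \<ominus>\<^bsub>H\<^esub> \<epsilon> (fst x) \<bullet> \<e>)"
          using lin_diff[OF lin_mult_right[OF lin_id Dc[OF z(1)]] Bc[OF w(1)], of "\<epsilon> (fst x) \<bullet> \<e>"] Dc[OF z(1)] Bc[OF w(1)]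
          by (simp add: smult_mult_right)
        moreover have "fst z \<star> (fst x \<ominus>\<^bsub>H\<^esub> \<epsilon> (fst x) \<bullet> \<e>) \<in> hidl D B"
          unfolding hidl_def by (intro ideal_prod.prod z aug_diff hsB w)
        ultimately have "cls D B (fst z \<star> fst x) = cls D B (\<epsilon> (fst x) \<bullet> fst z)"
          using z w Bc by (intro cls_eq hs_mult[OF hsD] hs_smult[OF hsD]) auto
        then have "?\<beta> (fst z \<star> fst x) (snd z \<star> snd x) = ?\<beta> (\<epsilon> (fst x) \<bullet> fst z) (snd z \<star> snd x)" by simp
        also have "\<dots> = ?\<beta> (fst z) (\<epsilon> (fst x) \<bullet> (snd z \<star> snd x))"
          using balancedD(4)[OF \<beta>, of "\<epsilon> (fst x)" "fst z" "snd z \<star> snd x"] z w Bc hs_mult[OF hsD] by simp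
        finally show "?\<beta> (fst z \<star> fst x) (snd z \<star> snd x) = ?\<beta> (fst z) (\<epsilon> (fst x) \<bullet> (snd z \<star> snd x))" .
      qed
      also have "\<dots> = ?\<beta> (fst z) (lsum (\<lambda>w. \<epsilon> (fst w) \<bullet> (snd z \<star> snd w)) ws)"
        by (rule \<beta>sum[symmetric, OF z(1)]) (use z w Bc in \<open>auto intro!: hs_smult[OF hsD] hs_mult[OF hsD]\<close>)
      also have "lsum (\<lambda>w. \<epsilon> (fst w) \<bullet> (snd z \<star> snd w)) ws = snd z \<star> b"
      proof -
        have bb: "bil (\<lambda>x y. \<epsilon> x \<bullet> (snd z \<star> y))" using Dc[OF z(2)] by (intro lin_intros; simp)
        have "sw (\<lambda>x y. \<epsilon> x \<bullet> (snd z \<star> y)) b = lsum (\<lambda>(x, y). \<epsilon> x \<bullet> (snd z \<star> y)) ws"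
          unfolding sw_eq_tensor_lift[OF bb Bc[OF b]] ws(2)
          by (rule comm_group.tensor_lift_lprod[OF comm_group_H cH cH bil_balanced[OF bb] zc(2)])
        moreover have "sw (\<lambda>x y. \<epsilon> x \<bullet> (snd z \<star> y)) b = snd z \<star> b"
          by (rule sw_counit_left[OF _ Bc[OF b]]) (use Dc[OF z(2)] in \<open>intro lin_intros\<close>)
        ultimately show ?thesis by (simp add: case_prod_unfold)
      qed
      also have "?\<beta> (fst z) (snd z \<star> b) = \<one>\<^bsub>?G\<^esub>"
        by (rule \<beta>zero[OF z(1)]) (unfold hidl_def, intro ideal_prod.prod z prod(2))
      finally show "lprod ?G (\<lambda>w. ?\<beta> (fst z \<star> fst w) (snd z \<star> snd w)) ws = \<one>\<^bsub>?G\<^esub>" .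
    qed
    also have "\<dots> = \<one>\<^bsub>?G\<^esub>" by (induction zs) auto
    finally show ?case .
  next
    case (sum s1 s2)
    have sD: "s1 \<in> D" "s2 \<in> D" using sum(1,2) hidl_subset[OF DB] unfolding hidl_def by auto
    have "comult (HS D) (s1 \<boxplus> s2) = comult (HS D) s1 \<otimes>\<^bsub>?TD\<^esub> comult (HS D) s2"
      by (rule HS_comult_add[OF hsD sD])
    then show ?case using sum HS_comult_closed[OF hsD] sD by simp
  qed
qed

end

lemma FQ_comult:
  assumes DB: "nrm D B" and x: "x \<in> D"
  shows "comult (FQ D B) (cls D B x) =
    tensor_map k (FQ D B) (FQ D B) (cls D B) (cls D B) (comult (HS D) x)"
  unfolding FQ_simps
proof (rule the_elem_image_const)
  note hsD = nrmD(1)[OF DB]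
  note cD = HS_closed[OF hs_subsp[OF hsD]] and cQ = FQ_closed[OF DB]
  let ?G = "tensor_group k (FQ D B) (FQ D B)" and ?TD = "tensor_group k (HS D) (HS D)"
  let ?\<pi> = "tensor_map k (FQ D B) (FQ D B) (cls D B) (cls D B)"
  interpret G: comm_group ?G by (rule comm_group_tensor_group[OF cQ cQ])
  interpret TD: comm_group ?TD by (rule comm_group_tensor_group[OF cD cD])
  interpret p: group_hom ?TD ?G ?\<pi>
    using tensor_map_hom[OF cD cD cQ cQ klinear_cls[OF DB] klinear_cls[OF DB]]
    by (simp add: group_hom_def group_hom_axioms_def)
  show "cls D B x \<noteq> {}" using cls_self[OF DB x] by blast
  fix y assume "y \<in> cls D B x"
  then obtain i where i: "i \<in> hidl D B" "y = i \<boxplus> x" using cls_mem[OF DB] by blast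
  have iD: "i \<in> D" using i hidl_subset[OF DB] by blast
  show "?\<pi> (comult (HS D) y) = ?\<pi> (comult (HS D) x)"
    using comult_hidl[OF DB i(1)] HS_comult_closed[OF hsD] iD x
    by (simp add: i(2) HS_comult_add[OF hsD iD x])
qed

lemma FQ_hopf_closed:
  assumes DB: "nrm D B" shows "hopf_closed k (FQ D B)"
proof -
  note hsD = nrmD(1)[OF DB] and cD = HS_closed[OF hs_subsp[OF nrmD(1)[OF DB]]] and cQ = FQ_closed[OF DB]
  note c = FQ_cls[OF DB]
  have "comult (FQ D B) (cls D B x) \<in> carrier (tensor_group k (FQ D B) (FQ D B))" if x: "x \<in> D" for x
    unfolding FQ_comult[OF DB x]
    by (rule hom_in_carrier[OF tensor_map_hom[OF cD cD cQ cQ klinear_cls[OF DB] klinear_cls[OF DB]]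
          HS_comult_closed[OF hsD x]])
  then show ?thesis
    unfolding hopf_closed_def
    using cQ c(2,7) c(4)[OF hs_one[OF hsD]] hs_one[OF hsD] hs_mult[OF hsD] hs_antipode[OF hsD]
    by (auto simp: FQ_carrier[OF DB])
qed

text \<open>The inclusion of \<open>A\<close> in \<open>D\<close> induces the isomorphism:
  \<open>ker\<close> makes it well defined and injective, \<open>surj\<close> makes it onto. All
  structure maps are compared on classes of elements of \<open>A\<close>.\<close>

lemma FQ_iso:
  assumes DB: "nrm D B" and AC: "nrm A C" and AD: "A \<subseteq> D"
    and ker: "A \<inter> hidl D B = hidl A C"
    and surj: "\<And>d. d \<in> D \<Longrightarrow> \<exists>a\<in>A. d \<ominus>\<^bsub>H\<^esub> a \<in> hidl D B"
  shows "hopf_isomorphic k (FQ A C) (FQ D B)"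
proof -
  note hsD = nrmD(1)[OF DB] and hsA = nrmD(1)[OF AC]
  note a = FQ_cls[OF AC] and d = FQ_cls[OF DB]
  note cA = HS_closed[OF hs_subsp[OF hsA]] and cD = HS_closed[OF hs_subsp[OF hsD]]
  note qA = FQ_closed[OF AC] and qD = FQ_closed[OF DB]
  \<comment> \<open>The larger cosets of the members of one small coset all coincide, so their union
    is that coset; no representative has to be chosen.\<close>
  define \<phi> where "\<phi> X = (\<Union>x\<in>X. cls D B x)" for X
  have \<phi>: "\<phi> (cls A C x) = cls D B x" if x: "x \<in> A" for x
  proof -
    have "cls D B y = cls D B x" if y: "y \<in> cls A C x" for y
    proof -
      have yA: "y \<in> A" and d: "y \<ominus>\<^bsub>H\<^esub> x \<in> hidl A C" using cls_sub[OF AC x y] by auto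
      have "y \<ominus>\<^bsub>H\<^esub> x \<in> hidl D B" using d unfolding ker[symmetric] by (rule IntD2)
      then show ?thesis by (rule cls_eq[OF DB subsetD[OF AD yA] subsetD[OF AD x]])
    qed
    then have "\<phi> (cls A C x) = (\<Union>y\<in>cls A C x. cls D B x)"
      unfolding \<phi>_def by (rule SUP_cong[OF refl])
    moreover have "cls A C x \<noteq> {}" using cls_self[OF AC x] by blast
    ultimately show ?thesis by simp
  qed
  have AD': "x \<in> D" if "x \<in> A" for x using AD that by blast
  have carA: "X \<in> carrier (FQ A C) \<longleftrightarrow> (\<exists>x\<in>A. X = cls A C x)" for X
    using FQ_carrier[OF AC] by auto
  have hom: "\<phi> \<in> ring_hom (FQ A C) (FQ D B)"
  proof (rule ring_hom_memI)
    fix X Y assume "X \<in> carrier (FQ A C)" "Y \<in> carrier (FQ A C)"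
    then obtain x y where xy: "x \<in> A" "X = cls A C x" "y \<in> A" "Y = cls A C y" using carA by auto
    show "\<phi> (X \<otimes>\<^bsub>FQ A C\<^esub> Y) = \<phi> X \<otimes>\<^bsub>FQ D B\<^esub> \<phi> Y"
      using xy by (simp add: a(2) d(2) \<phi> AD' hs_mult[OF hsA])
    show "\<phi> (X \<oplus>\<^bsub>FQ A C\<^esub> Y) = \<phi> X \<oplus>\<^bsub>FQ D B\<^esub> \<phi> Y"
      using xy by (simp add: a(3) d(3) \<phi> AD' hs_add[OF hsA])
  next
    show "\<phi> X \<in> carrier (FQ D B)" if "X \<in> carrier (FQ A C)" for X
      using that carA d(1) \<phi> AD' by auto
    show "\<phi> \<one>\<^bsub>FQ A C\<^esub> = \<one>\<^bsub>FQ D B\<^esub>"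
      using a(4)[OF hs_one[OF hsA]] d(4)[OF hs_one[OF hsD]] \<phi>[OF hs_one[OF hsA]] by simp
  qed
  have smul: "\<phi> (c \<odot>\<^bsub>FQ A C\<^esub> X) = c \<odot>\<^bsub>FQ D B\<^esub> \<phi> X"
    if c: "c \<in> carrier k" and X: "X \<in> carrier (FQ A C)" for c X
  proof -
    obtain x where x: "x \<in> A" "X = cls A C x" using carA X by auto
    show ?thesis using x c by (simp add: a(5) d(5) \<phi> AD' hs_smult[OF hsA])
  qed
  have kphi: "klinear k (FQ A C) (FQ D B) \<phi>"
    using hom smul by (auto simp: klinear_def ring_hom_def)
  have inj: "inj_on \<phi> (carrier (FQ A C))"
  proof (rule inj_onI)
    fix X Y assume "X \<in> carrier (FQ A C)" "Y \<in> carrier (FQ A C)" and eq: "\<phi> X = \<phi> Y"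
    then obtain x y where xy: "x \<in> A" "X = cls A C x" "y \<in> A" "Y = cls A C y" using carA by auto
    have "x \<ominus>\<^bsub>H\<^esub> y \<in> hidl D B" using eq xy AD' by (intro cls_eqD[OF DB]) (simp_all add: \<phi>)
    then have "x \<ominus>\<^bsub>H\<^esub> y \<in> hidl A C" using ker subsp_diff[OF hs_subsp[OF hsA] xy(1,3)] by blast
    then show "X = Y" using xy cls_eq[OF AC] by simp
  qed
  have "carrier (FQ D B) \<subseteq> \<phi> ` carrier (FQ A C)"
  proof
    fix Y assume "Y \<in> carrier (FQ D B)"
    then obtain y where y: "y \<in> D" "Y = cls D B y" using FQ_carrier[OF DB] by auto
    obtain x where x: "x \<in> A" "y \<ominus>\<^bsub>H\<^esub> x \<in> hidl D B" using surj[OF y(1)] by blast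
    have "Y = \<phi> (cls A C x)" using y x cls_eq[OF DB y(1) AD'[OF x(1)] x(2)] by (simp add: \<phi>)
    then show "Y \<in> \<phi> ` carrier (FQ A C)" using a(1)[OF x(1)] by blast
  qed
  moreover have "\<phi> ` carrier (FQ A C) \<subseteq> carrier (FQ D B)"
    using hom by (auto simp: ring_hom_def)
  ultimately have bij: "bij_betw \<phi> (carrier (FQ A C)) (carrier (FQ D B))"
    using inj by (auto simp: bij_betw_def)
  have com: "comult (FQ D B) (\<phi> X) = tensor_map k (FQ D B) (FQ D B) \<phi> \<phi> (comult (FQ A C) X)"
    if X: "X \<in> carrier (FQ A C)" for X
  proof -
    obtain x where x: "x \<in> A" "X = cls A C x" using carA X by auto
    obtain zs where zs: "set zs \<subseteq> A \<times> A"
      "comult H x = lprod (tensor_group k H H) (\<lambda>(x, y). pure_tensor k H H x y) zs"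
      "comult (HS A) x = lprod (tensor_group k (HS A) (HS A)) (\<lambda>(x, y). pure_tensor k (HS A) (HS A) x y) zs"
      by (rule HS_comult_rep[OF hsA x(1)])
    have zD: "set zs \<subseteq> D \<times> D" using zs(1) AD by blast
    let ?zs = "map (\<lambda>(x, y). (cls A C x, cls A C y)) zs"
    have mz: "set ?zs \<subseteq> carrier (FQ A C) \<times> carrier (FQ A C)" using zs(1) a(1) by auto
    have "comult (FQ A C) X = lprod (tensor_group k (FQ A C) (FQ A C))
        (\<lambda>(x, y). pure_tensor k (FQ A C) (FQ A C) (cls A C x) (cls A C y)) zs"
      unfolding x(2) FQ_comult[OF AC x(1)] zs(3)
      by (rule tensor_map_lprod[OF cA cA qA qA klinear_cls[OF AC] klinear_cls[OF AC]]) (use zs(1) in simp)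
    also have "\<dots> = lprod (tensor_group k (FQ A C) (FQ A C)) (\<lambda>(x, y). pure_tensor k (FQ A C) (FQ A C) x y) ?zs"
      by (simp add: lprod_map case_prod_unfold)
    finally have "tensor_map k (FQ D B) (FQ D B) \<phi> \<phi> (comult (FQ A C) X) =
        lprod (tensor_group k (FQ D B) (FQ D B)) (\<lambda>(x, y). pure_tensor k (FQ D B) (FQ D B) (\<phi> x) (\<phi> y)) ?zs"
      using tensor_map_lprod[OF qA qA qD qD kphi kphi mz] by simp
    also have "\<dots> = lprod (tensor_group k (FQ D B) (FQ D B))
        (\<lambda>(x, y). pure_tensor k (FQ D B) (FQ D B) (cls D B x) (cls D B y)) zs"
      unfolding lprod_map by (rule lprod_cong) (use zs(1) \<phi> in auto)
    also have "\<dots> = tensor_map k (FQ D B) (FQ D B) (cls D B) (cls D B) (comult (HS D) x)"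
      unfolding HS_comult_eq[OF hs_subsp[OF hsD] zD zs(2)]
      by (rule tensor_map_lprod[OF cD cD qD qD klinear_cls[OF DB] klinear_cls[OF DB], symmetric]) (use zD in simp)
    also have "\<dots> = comult (FQ D B) (\<phi> X)"
      using FQ_comult[OF DB AD'[OF x(1)]] \<phi>[OF x(1)] x(2) by simp
    finally show ?thesis by simp
  qed
  have rest: "counit (FQ D B) (\<phi> X) = counit (FQ A C) X" "antipode (FQ D B) (\<phi> X) = \<phi> (antipode (FQ A C) X)"
    if X: "X \<in> carrier (FQ A C)" for X
  proof -
    obtain x where x: "x \<in> A" "X = cls A C x" using carA X by auto
    show "counit (FQ D B) (\<phi> X) = counit (FQ A C) X" "antipode (FQ D B) (\<phi> X) = \<phi> (antipode (FQ A C) X)"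
      using x by (simp_all add: a(6,7) d(6,7) \<phi> AD' hs_antipode[OF hsA])
  qed
  have "\<phi> \<in> hopf_iso k (FQ A C) (FQ D B)"
    unfolding hopf_iso_def using hom bij smul com rest by simp
  then show ?thesis by (auto simp: hopf_isomorphic_def)
qed

lemma maxn_iso:
  assumes A: "maxn D A" and B: "maxn D B" and ne: "A \<noteq> B"
  shows "hopf_isomorphic k (FQ A (A \<inter> B)) (FQ D B)"
proof -
  have nA: "nrm D A" "A \<subset> D" and nB: "nrm D B" using A B by (auto simp: maxn_def)
  have C: "nrm A (A \<inter> B)" using maxn_inter[OF A B ne] by (simp add: maxn_def)
  note hA = nrmD(2)[OF nA(1)]
  have AD: "A \<subseteq> D" and D: "D \<subseteq> prd A B" using nA(2) maxn_prd[OF A B ne] by auto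
  show ?thesis
    by (rule FQ_iso[OF nB C AD inter_hidl[OF nB hA AD D C] mod_hidl_rep[OF nB hA AD D]])
qed

section \<open>Composition series\<close>

text \<open>Normality is part of the relation so that it is symmetric and transitive without side
  conditions: it ensures that the quotients are closed.\<close>

definition same_factor :: "'a set \<times> 'a set \<Rightarrow> 'a set \<times> 'a set \<Rightarrow> bool" where
  "same_factor p q \<longleftrightarrow> nrm (fst p) (snd p) \<and> nrm (fst q) (snd q) \<and>
     hopf_isomorphic k (FQ (fst p) (snd p)) (FQ (fst q) (snd q))"

lemma same_factor_refl: "nrm A N \<Longrightarrow> same_factor (A, N) (A, N)"
  by (simp add: same_factor_def hopf_isomorphic_refl FQ_hopf_closed)

lemma same_factor_sym: "same_factor p q \<Longrightarrow> same_factor q p"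
  unfolding same_factor_def
  using hopf_isomorphic_sym[OF FQ_hopf_closed FQ_hopf_closed, of "fst p" "snd p" "fst q" "snd q"] by blast

lemma same_factor_trans: "same_factor p q \<Longrightarrow> same_factor q r \<Longrightarrow> same_factor p r"
  unfolding same_factor_def
  using hopf_isomorphic_trans[OF FQ_hopf_closed FQ_hopf_closed FQ_hopf_closed,
      of "fst p" "snd p" "fst q" "snd q" "fst r" "snd r"] by blast

abbreviation same_factors :: "('a set \<times> 'a set) list \<Rightarrow> ('a set \<times> 'a set) list \<Rightarrow> bool" where
  "same_factors fs gs \<equiv> rel_mset same_factor (mset fs) (mset gs)"

lemma same_factors_trans: "same_factors fs gs \<Longrightarrow> same_factors gs hs' \<Longrightarrow> same_factors fs hs'"
proof -
  have "transp same_factor" by (rule transpI) (rule same_factor_trans)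
  then have "transp (rel_mset same_factor)" by (rule multiset.rel_transp)
  then show "same_factors fs gs \<Longrightarrow> same_factors gs hs' \<Longrightarrow> same_factors fs hs'" by (rule transpD)
qed

lemma same_factors_refl: "(\<And>p. p \<in> set fs \<Longrightarrow> nrm (fst p) (snd p)) \<Longrightarrow> same_factors fs fs"
proof (rule multiset.rel_refl_strong)
  fix p assume "\<And>p. p \<in> set fs \<Longrightarrow> nrm (fst p) (snd p)" "p \<in> set_mset (mset fs)"
  then have "nrm (fst p) (snd p)" by simp
  then show "same_factor p p" using same_factor_refl[of "fst p" "snd p"] by simp
qed

lemma same_factors_Cons: "same_factor p q \<Longrightarrow> same_factors fs gs \<Longrightarrow> same_factors (p # fs) (q # gs)"
  by (simp add: rel_mset_Plus)

abbreviation scalars :: "'a set" where "scalars \<equiv> {c \<bullet> \<e> | c. c \<in> carrier k}"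

text \<open>The list records the pairs whose quotients are the factors, so that equivalence of
  series becomes a relation between multisets of pairs.\<close>

inductive comp_series :: "'a set \<Rightarrow> ('a set \<times> 'a set) list \<Rightarrow> bool" where
  Nil: "comp_series scalars []"
| Cons: "maxn A N \<Longrightarrow> comp_series N fs \<Longrightarrow> comp_series A ((A, N) # fs)"

text \<open>A Hopf subalgebra contains the unit and hence all scalars, so none is properly contained
  in them. A series starting at the scalars is therefore empty.\<close>

lemma not_maxn_scalars: "\<not> maxn scalars B"
proof
  assume "maxn scalars B"
  then have "nrm scalars B" "B \<subset> scalars" by (auto simp: maxn_def)
  then show False
    using hs_smult[OF nrmD(2) _ hs_one[OF nrmD(2)], of scalars B] by blast
qed

lemma comp_series_nrm: "comp_series A fs \<Longrightarrow> p \<in> set fs \<Longrightarrow> nrm (fst p) (snd p)"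
  by (induction rule: comp_series.induct) (auto simp: maxn_def)

text \<open>The exchange step. If the series begins with \<open>N \<noteq> B\<close>, its tail is
  rerouted through \<open>N \<inter> B\<close> by induction, and \<open>B\<close> is continued by
  \<open>N \<inter> B\<close> instead. The top factors are interchanged: \<open>A / N\<close>
  matches \<open>B / (N \<inter> B)\<close>, and \<open>A / B\<close> matches
  \<open>N / (N \<inter> B)\<close>.\<close>

lemma comp_series_through:
  assumes "comp_series A fs" "maxn A B"
  shows "\<exists>gs. comp_series B gs \<and> same_factors fs ((A, B) # gs)"
  using assms
proof (induction arbitrary: B rule: comp_series.induct)
  case Nil
  then show ?case using not_maxn_scalars by blast
next
  case (Cons A N fs)
  show ?case
  proof (cases "N = B")
    case True
    then show ?thesis
      using Cons.hyps same_factors_refl[OF comp_series_nrm[OF comp_series.Cons[OF Cons.hyps]]] by blast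
  next
    case False
    let ?C = "N \<inter> B"
    have B: "maxn A B" by (rule Cons.prems)
    have C: "maxn N ?C" "maxn B ?C"
      using maxn_inter[OF Cons.hyps(1) B False] maxn_inter[OF B Cons.hyps(1)] False
      by (auto simp: Int_commute)
    obtain gs where gs: "comp_series ?C gs" "same_factors fs ((N, ?C) # gs)"
      using Cons.IH[OF C(1)] by blast
    have n: "nrm A N" "nrm A B" "nrm N ?C" "nrm B ?C" using Cons.hyps(1) B C by (auto simp: maxn_def)
    have i: "same_factor (N, ?C) (A, B)" "same_factor (B, ?C) (A, N)"
      using maxn_iso[OF Cons.hyps(1) B False] maxn_iso[OF B Cons.hyps(1)] False n
      by (auto simp: same_factor_def Int_commute)
    have gg: "same_factors gs gs" by (rule same_factors_refl) (rule comp_series_nrm[OF gs(1)])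
    have "same_factors ((A, N) # fs) ((B, ?C) # (N, ?C) # gs)"
      by (rule same_factors_Cons[OF same_factor_sym[OF i(2)] gs(2)])
    moreover have "same_factors ((B, ?C) # (N, ?C) # gs) ((B, ?C) # (A, B) # gs)"
      by (intro same_factors_Cons i(1) gg same_factor_refl n)
    ultimately have "same_factors ((A, N) # fs) ((B, ?C) # (A, B) # gs)"
      by (rule same_factors_trans)
    then have "same_factors ((A, N) # fs) ((A, B) # (B, ?C) # gs)"
      by (simp add: add_mset_commute)
    then show ?thesis using comp_series.Cons[OF C(2) gs(1)] by blast
  qed
qed

text \<open>The first series is rerouted through the first proper term \<open>B\<close> of the
  second. The two series of \<open>B\<close> are then compared by induction, since equivalence of
  multisets preserves the length.\<close>

lemma jordan_hoelder:
  assumes "comp_series A fs" "comp_series A gs"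
  shows "same_factors fs gs"
  using assms
proof (induction "length fs" arbitrary: A fs gs)
  case 0
  then have "A = scalars" by (auto elim: comp_series.cases)
  then have "gs = []" using 0 not_maxn_scalars by (auto elim: comp_series.cases)
  then show ?case using 0 by simp
next
  case (Suc n)
  from Suc.prems(1) Suc.hyps(2) obtain N where "maxn A N"
    by (auto elim: comp_series.cases)
  then have "A \<noteq> scalars" using not_maxn_scalars by blast
  with Suc.prems(2) obtain B gs' where gs: "gs = (A, B) # gs'" "maxn A B" "comp_series B gs'"
    by (auto elim: comp_series.cases)
  obtain hs' where h: "comp_series B hs'" "same_factors fs ((A, B) # hs')"
    using comp_series_through[OF Suc.prems(1) gs(2)] by blast
  have "length fs = Suc (length hs')" using rel_mset_size[OF h(2)] by simp
  then have "same_factors hs' gs'" using Suc.hyps(1)[OF _ h(1) gs(3)] Suc.hyps(2) by simp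
  then have "same_factors ((A, B) # hs') gs"
    unfolding gs(1) using gs(2) by (intro same_factors_Cons same_factor_refl) (simp add: maxn_def)
  then show ?case by (rule same_factors_trans[OF h(2)])
qed

lemma comp_series_of_lower:
  assumes K: "lower_composition_series k H n K"
  shows "comp_series (K 0) (map (\<lambda>i. (K i, K (Suc i))) [0..<n])"
proof -
  have hK: "hs (K i)" if "i \<le> n" for i
    using K that by (simp add: lower_composition_series_def lower_subnormal_series_def)
  have m: "maxn (K i) (K (Suc i))" if "i < n" for i
    using K that maximal_normal_HS_iff[OF hK[OF less_imp_le[OF that]], of "K (Suc i)"]
    unfolding lower_composition_series_def by blast
  have "comp_series (K j) (map (\<lambda>i. (K i, K (Suc i))) [j..<n])" if "j \<le> n" for j
    using that
  proof (induction rule: inc_induct)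
    case base
    have "K n = scalars" using K by (simp add: lower_composition_series_def lower_subnormal_series_def)
    then show ?case using comp_series.Nil by simp
  next
    case (step j)
    then show ?case using comp_series.Cons[OF m step.IH] by (simp add: upt_conv_Cons)
  qed
  then show ?thesis by simp
qed

end

text \<open>Reordering one list leaves a pointwise relation with a permutation of the other; that
  permutation is the required bijection of indices.\<close>

lemma rel_mset_bij:
  assumes "rel_mset R (mset xs) (mset ys)"
  obtains f where "bij_betw f {..<length xs} {..<length ys}"
    "\<And>i. i < length xs \<Longrightarrow> R (xs ! i) (ys ! f i)"
proof -
  obtain xs' ys' where "mset xs' = mset xs" "mset ys' = mset ys" "list_all2 R xs' ys'"
    using assms unfolding rel_mset_def by blast
  then obtain zs where zs: "list_all2 R xs zs" "mset zs = mset ys"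
    using list_all2_reorder_left_invariance[of R xs' ys' xs] by auto
  obtain p where p: "p permutes {..<length ys}" "permute_list p ys = zs"
    using mset_eq_permutation[OF zs(2)] by blast
  have l: "length xs = length ys" using zs by (metis list_all2_lengthD size_mset)
  have "R (xs ! i) (ys ! p i)" if "i < length xs" for i
    using list_all2_nthD[OF zs(1) that] permute_list_nth[OF p(1), of i] p(2) that l by simp
  moreover have "bij_betw p {..<length xs} {..<length ys}"
    using permutes_imp_bij[OF p(1)] l by simp
  ultimately show ?thesis using that by blast
qed

theorem theorem5p9:
  fixes k :: "('k, 'm) ring_scheme" and H :: "('k, 'a) hopf"
    and n m :: nat and K K' :: "nat \<Rightarrow> 'a set"
  assumes "field k"
    and "hopf_algebra k H"
    and "finite_dimensional k H"
    and "lower_composition_series k H n K"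
    and "lower_composition_series k H m K'"
  shows "equivalent_series k H n K m K'"
proof -
  interpret fd_hopf_algebra k H
    using assms(2,3) by (simp add: fd_hopf_algebra_def fd_hopf_algebra_axioms_def)
  let ?f = "map (\<lambda>i. (K i, K (Suc i))) [0..<n]" and ?g = "map (\<lambda>i. (K' i, K' (Suc i))) [0..<m]"
  have "K 0 = carrier H" "K' 0 = carrier H"
    using assms(4,5) by (simp_all add: lower_composition_series_def lower_subnormal_series_def)
  then have "comp_series (carrier H) ?f" "comp_series (carrier H) ?g"
    using comp_series_of_lower[OF assms(4)] comp_series_of_lower[OF assms(5)] by (simp_all only:)
  then have R: "rel_mset same_factor (mset ?f) (mset ?g)"
    by (rule jordan_hoelder)
  obtain f where f: "bij_betw f {..<length ?f} {..<length ?g}"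
    "\<And>i. i < length ?f \<Longrightarrow> same_factor (?f ! i) (?g ! f i)"
    by (rule rel_mset_bij[OF R]) (rule that)
  have "hopf_isomorphic k (series_factor k H K i) (series_factor k H K' (f i))" if i: "i < n" for i
  proof -
    have "f i < m" using f(1) i by (auto simp: bij_betw_def)
    then show ?thesis
      using f(2)[of i] i by (simp add: same_factor_def series_factor_def normal_quotient_HS)
  qed
  then show ?thesis
    using f(1) unfolding equivalent_series_def by auto
qed

end
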